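(* Let $\mathcal G$ be an étale second countable locally compact Hausdorff groupoid, let $c_0:\mathcal G\to\mathbb R$ and $c:\mathcal G\to\mathbb R$ be continuous homomorphisms, and let $\beta\in\mathbb R$. Assume that a) $\ker c_0=\{g\in\mathcal G: c_0(g)=0\}$ is an equivalence relation, i.e. $\mathcal G^x_x\cap\ker c_0=\{x\}$ for all $x\in\mathcal G^{(0)}$, and b) $\ker c_0$ is open in $\mathcal G$. Let $\psi$ be a $\beta$-KMS weight for the action $\sigma^c$ on $C^*_r(\mathcal G)$. Assume that $\psi$ is invariant under $\sigma^{c_0}$ in the sense that $\psi\circ\sigma^{c_0}_t=\psi$ for all $t\in\mathbb R$. Then there is a regular Borel measure $m$ on $\mathcal G^{(0)}$ such that $\psi=\varphi_m$.
   Context: **KMS weights.** A weight on a $C^*$-algebra $A$ is a map $\psi:A_+\to[0,\infty]$ with $\psi(a+b)=\psi(a)+\psi(b)$, $\psi(\lambda a)=\lambda\psi(a)$ for $\lambda>0$. It is proper when it is non-zero, densely defined ($\{a\in A_+:\psi(a)<\infty\}$ is dense in $A_+$) and lower semi-continuous ($\{a\in A_+:\psi(a)\le\alpha\}$ is closed for all $\alpha\ge0$). For proper $\psi$ put $\mathcal N_\psi=\{a\in A:\psi(a^*a)<\infty\}$; $\psi$ extends uniquely to a linear functional, also denoted $\psi$, on $\mathrm{Span}\{a^*b:a,b\in\mathcal N_\psi\}$. For a point-wise norm-continuous one-parameter group $\alpha$ of automorphisms of $A$ and $\beta\in\mathbb R$, a proper weight $\psi$ is a $\beta$-KMS weight for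 $\alpha$ when (i) $\psi\circ\alpha_t=\psi$ for all $t\in\mathbb R$, and (ii) for all $a,b\in\mathcal N_\psi\cap\mathcal N_\psi^*$ there is a continuous bounded function $F$ on the closed strip $D_\beta$ of complex numbers with imaginary part between $0$ and $\beta$, holomorphic in its interior, with $F(t)=\psi(a\alpha_t(b))$ and $F(t+i\beta)=\psi(\alpha_t(b)a)$ for all $t\in\mathbb R$. **Groupoid algebras.** $\mathcal G^{(0)}$ is the unit space, $r,s$ the range and source maps, $\mathcal G^x=r^{-1}(x)$, $\mathcal G_x=s^{-1}(x)$, $\mathcal G^x_x=r^{-1}(x)\cap s^{-1}(x)$ (isotropy group). $C_c(\mathcal G)$ is a $*$-algebra with $(f_1*f_2)(g)=\sum_{h\in\mathcal G^{r(g)}}f_1(h)f_2(h^{-1}g)$, $f^*(g)=\overline{f(g^{-1})}$. For $x\in\mathcal G^{(0)}$, $\pi_x(f)\psi(g)=\sum_{h\in\mathcal G^{r(g)}}f(h)\psi(h^{-1}g)$ defines a representation on $l^2(\mathcal G_x)$, and $C^*_r(\mathcal G)$ is the completion of $C_c(\mathcal G)$ in the norm $\sup_x\|\pi_x(f)\|$. Restriction of functions to $\mathcal G^{(0)}$ extends from $C_c(\mathcal G)$ to a conditional expectation $P:C^*_r(\mathcal G)\to C_0(\mathcal G^{(0)})$. Measures are always non-zero, and a regular Borel measure is finite on compact sets. For a regular Borel measure $m$ on $\mathcal G^{(0)}$, $\varphi_m$ is the proper weight on $C^*_r(\mathcal G)$ given by $\varphi_m(a)=\int_{\mathcal G^{(0)}}P(a)\,dm$,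 $a\ge0$. A continuous homomorphism $c:\mathcal G\to\mathbb R$ is a continuous map with $c(gh)=c(g)+c(h)$ when $s(g)=r(h)$. It gives a continuous one-parameter group $\sigma^c=(\sigma^c_t)_{t\in\mathbb R}$ of automorphisms of $C^*_r(\mathcal G)$ determined by $\sigma^c_t(f)(g)=e^{itc(g)}f(g)$ for $f\in C_c(\mathcal G)$. *)

theory Defs
  imports "HOL-Analysis.Analysis"
begin

section \<open>C*-algebras\<close>

text \<open>Not assumed unital. The complex scalar multiplication extends the real one of
  the superclass.\<close>

class cstar_algebra = banach + real_normed_algebra +
  fixes scaleC :: "complex \<Rightarrow> 'a \<Rightarrow> 'a"  (infixr \<open>*\<^sub>C\<close> 75)
    and star :: "'a \<Rightarrow> 'a"
  assumes scaleC_add_right: "z *\<^sub>C (a + b) = z *\<^sub>C a + z *\<^sub>C b"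
    and scaleC_add_left: "(z + w) *\<^sub>C a = z *\<^sub>C a + w *\<^sub>C a"
    and scaleC_scaleC: "z *\<^sub>C w *\<^sub>C a = (z * w) *\<^sub>C a"
    and scaleC_of_real: "complex_of_real q *\<^sub>C a = q *\<^sub>R a"
    and norm_scaleC: "norm (z *\<^sub>C a) = cmod z * norm a"
    and mult_scaleC_left: "(z *\<^sub>C a) * b = z *\<^sub>C (a * b)"
    and mult_scaleC_right: "a * (z *\<^sub>C b) = z *\<^sub>C (a * b)"
    and star_star: "star (star a) = a"
    and star_add: "star (a + b) = star a + star b"
    and star_scaleC: "star (z *\<^sub>C a) = cnj z *\<^sub>C star a"
    and star_mult: "star (a * b) = star b * star a"
    and norm_star_mult_self: "norm (star a * a) = (norm a)\<^sup>2"

lemma scaleC_one: "1 *\<^sub>C (a :: 'a :: cstar_algebra) = a"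
  using scaleC_of_real[of 1 a] by simp

interpretation complex_vector: vector_space "scaleC :: complex \<Rightarrow> 'a \<Rightarrow> 'a :: cstar_algebra"
  by unfold_locales
    (simp_all add: scaleC_add_right scaleC_add_left scaleC_scaleC scaleC_one)

definition pos_cone :: "'a :: cstar_algebra set" where
  "pos_cone = {star a * a | a. True}"

text \<open>A *-automorphism of a C*-algebra is automatically isometric, so the last clause is
  redundant.\<close>

definition star_automorphism :: "('a :: cstar_algebra \<Rightarrow> 'a) \<Rightarrow> bool" where
  "star_automorphism \<Phi> \<longleftrightarrow>
     bij \<Phi> \<and>
     (\<forall>a b. \<Phi> (a + b) = \<Phi> a + \<Phi> b) \<and>
     (\<forall>z a. \<Phi> (z *\<^sub>C a) = z *\<^sub>C \<Phi> a) \<and>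
     (\<forall>a b. \<Phi> (a * b) = \<Phi> a * \<Phi> b) \<and>
     (\<forall>a. \<Phi> (star a) = star (\<Phi> a)) \<and>
     (\<forall>a. norm (\<Phi> a) = norm a)"

definition one_parameter_group :: "(real \<Rightarrow> 'a :: cstar_algebra \<Rightarrow> 'a) \<Rightarrow> bool" where
  "one_parameter_group \<alpha> \<longleftrightarrow>
     (\<forall>t. star_automorphism (\<alpha> t)) \<and>
     \<alpha> 0 = id \<and>
     (\<forall>t u. \<alpha> (t + u) = \<alpha> t \<circ> \<alpha> u) \<and>
     (\<forall>a. continuous_on UNIV (\<lambda>t. \<alpha> t a))"


section \<open>Weights and the KMS condition\<close>

text \<open>A weight is a function on the positive cone; it is represented by a total function
  of which only the values on \<^const>\<open>pos_cone\<close> are ever used.\<close>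

definition weight :: "('a :: cstar_algebra \<Rightarrow> ennreal) \<Rightarrow> bool" where
  "weight \<psi> \<longleftrightarrow>
     (\<forall>a\<in>pos_cone. \<forall>b\<in>pos_cone. \<psi> (a + b) = \<psi> a + \<psi> b) \<and>
     (\<forall>a\<in>pos_cone. \<forall>l>0. \<psi> (l *\<^sub>R a) = ennreal l * \<psi> a)"

definition proper_weight :: "('a :: cstar_algebra \<Rightarrow> ennreal) \<Rightarrow> bool" where
  "proper_weight \<psi> \<longleftrightarrow>
     weight \<psi> \<and>
     (\<exists>a\<in>pos_cone. \<psi> a \<noteq> 0) \<and>
     pos_cone \<subseteq> closure {a \<in> pos_cone. \<psi> a < \<infinity>} \<and>
     (\<forall>l\<ge>0. closed {a \<in> pos_cone. \<psi> a \<le> ennreal l})"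

definition weight_invariant ::
  "('a :: cstar_algebra \<Rightarrow> ennreal) \<Rightarrow> (real \<Rightarrow> 'a \<Rightarrow> 'a) \<Rightarrow> bool" where
  "weight_invariant \<psi> \<alpha> \<longleftrightarrow> (\<forall>t. \<forall>a\<in>pos_cone. \<psi> (\<alpha> t a) = \<psi> a)"

definition weight_null :: "('a :: cstar_algebra \<Rightarrow> ennreal) \<Rightarrow> 'a set"  (\<open>\<N>\<close>) where
  "\<N> \<psi> = {a. \<psi> (star a * a) < \<infinity>}"

definition weight_dom :: "('a :: cstar_algebra \<Rightarrow> ennreal) \<Rightarrow> 'a set" where
  "weight_dom \<psi> = complex_vector.span {star a * b | a b. a \<in> \<N> \<psi> \<and> b \<in> \<N> \<psi>}"

text \<open>The linear extension of a proper weight to \<^const>\<open>weight_dom\<close>; the value \<open>0\<close> outside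
  that subspace is a convention that makes the description unique. The positive elements
  of finite weight lie in \<^const>\<open>weight_dom\<close> and span it.\<close>

definition weight_ext :: "('a :: cstar_algebra \<Rightarrow> ennreal) \<Rightarrow> 'a \<Rightarrow> complex" where
  "weight_ext \<psi> = (THE L.
     (\<forall>a\<in>weight_dom \<psi>. \<forall>b\<in>weight_dom \<psi>. L (a + b) = L a + L b) \<and>
     (\<forall>z. \<forall>a\<in>weight_dom \<psi>. L (z *\<^sub>C a) = z * L a) \<and>
     (\<forall>a\<in>pos_cone. \<psi> a < \<infinity> \<longrightarrow> L a = complex_of_real (enn2real (\<psi> a))) \<and>
     (\<forall>a. a \<notin> weight_dom \<psi> \<longrightarrow> L a = 0))"

text \<open>The parameter \<open>\<beta>\<close> may have either sign; for \<open>\<beta> = 0\<close> the strip is the real line.\<close>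

definition strip :: "real \<Rightarrow> complex set" where
  "strip \<beta> = {z. min 0 \<beta> \<le> Im z \<and> Im z \<le> max 0 \<beta>}"

definition KMS_weight ::
  "(real \<Rightarrow> 'a \<Rightarrow> 'a) \<Rightarrow> real \<Rightarrow> ('a :: cstar_algebra \<Rightarrow> ennreal) \<Rightarrow> bool" where
  "KMS_weight \<alpha> \<beta> \<psi> \<longleftrightarrow>
     proper_weight \<psi> \<and>
     weight_invariant \<psi> \<alpha> \<and>
     (\<forall>a \<in> \<N> \<psi> \<inter> star ` \<N> \<psi>. \<forall>b \<in> \<N> \<psi> \<inter> star ` \<N> \<psi>.
        \<exists>F. continuous_on (strip \<beta>) F \<and>
            bounded (F ` strip \<beta>) \<and>
            F holomorphic_on interior (strip \<beta>) \<and>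
            (\<forall>t. F (of_real t) = weight_ext \<psi> (a * \<alpha> t b)) \<and>
            (\<forall>t. F (of_real t + \<i> * of_real \<beta>) = weight_ext \<psi> (\<alpha> t b * a)))"


section \<open>Etale groupoids\<close>

text \<open>Units are identified with the corresponding elements of the groupoid. The composition
  is only meaningful on pairs \<open>(g, h)\<close> with \<open>src G g = rng G h\<close>.\<close>

record 'g groupoid =
  rng :: "'g \<Rightarrow> 'g"
  src :: "'g \<Rightarrow> 'g"
  gmult :: "'g \<Rightarrow> 'g \<Rightarrow> 'g"  (infixl \<open>\<cdot>\<index>\<close> 70)
  ginv :: "'g \<Rightarrow> 'g"

definition units :: "'g groupoid \<Rightarrow> 'g set" where
  "units G = range (rng G)"

locale groupoid =
  fixes G :: "'g groupoid" (structure)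
  assumes rng_rng: "rng G (rng G g) = rng G g"
    and src_rng: "src G (rng G g) = rng G g"
    and rng_src: "rng G (src G g) = src G g"
    and src_src: "src G (src G g) = src G g"
    and rng_mult: "src G g = rng G h \<Longrightarrow> rng G (g \<cdot> h) = rng G g"
    and src_mult: "src G g = rng G h \<Longrightarrow> src G (g \<cdot> h) = src G h"
    and mult_assoc: "\<lbrakk>src G g = rng G h; src G h = rng G k\<rbrakk> \<Longrightarrow> g \<cdot> h \<cdot> k = g \<cdot> (h \<cdot> k)"
    and rng_mult_id: "rng G g \<cdot> g = g"
    and mult_src_id: "g \<cdot> src G g = g"
    and rng_inv: "rng G (ginv G g) = src G g"
    and src_inv: "src G (ginv G g) = rng G g"
    and mult_inv: "g \<cdot> ginv G g = rng G g"
    and inv_mult: "ginv G g \<cdot> g = src G g"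

definition local_homeomorphism_onto ::
  "('a :: topological_space \<Rightarrow> 'b :: topological_space) \<Rightarrow> 'b set \<Rightarrow> bool" where
  "local_homeomorphism_onto f T \<longleftrightarrow>
     range f = T \<and>
     (\<forall>x. \<exists>U k. open U \<and> x \<in> U \<and> openin (top_of_set T) (f ` U) \<and> homeomorphism U (f ` U) f k)"

locale etale_groupoid = groupoid G
  for G :: "'g :: {second_countable_topology, t2_space} groupoid" (structure) +
  assumes locally_compact: "locally_compact_space (euclidean :: 'g topology)"
    and continuous_mult:
      "continuous_on {(g, h). src G g = rng G h} (\<lambda>(g, h). g \<cdot> h)"
    and continuous_inv: "continuous_on UNIV (ginv G)"
    and etale_rng: "local_homeomorphism_onto (rng G) (units G)"
    and etale_src: "local_homeomorphism_onto (src G) (units G)"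

definition cont_hom :: "'g :: topological_space groupoid \<Rightarrow> ('g \<Rightarrow> real) \<Rightarrow> bool" where
  "cont_hom G c \<longleftrightarrow>
     continuous_on UNIV c \<and>
     (\<forall>g h. src G g = rng G h \<longrightarrow> c (gmult G g h) = c g + c h)"


section \<open>The reduced groupoid C*-algebra\<close>

definition Cc :: "('g :: topological_space \<Rightarrow> complex) set" where
  "Cc = {f. continuous_on UNIV f \<and> compact (closure {g. f g \<noteq> 0})}"

definition conv :: "'g groupoid \<Rightarrow> ('g \<Rightarrow> complex) \<Rightarrow> ('g \<Rightarrow> complex) \<Rightarrow> 'g \<Rightarrow> complex" where
  "conv G f1 f2 g = (\<Sum>\<^sub>\<infinity>h | rng G h = rng G g. f1 h * f2 (gmult G (ginv G h) g))"

definition adj :: "'g groupoid \<Rightarrow> ('g \<Rightarrow> complex) \<Rightarrow> 'g \<Rightarrow> complex" where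
  "adj G f g = cnj (f (ginv G g))"

definition ell2 :: "'g set \<Rightarrow> ('g \<Rightarrow> complex) set" where
  "ell2 S = {\<xi>. (\<forall>g. g \<notin> S \<longrightarrow> \<xi> g = 0) \<and> (\<lambda>g. (cmod (\<xi> g))\<^sup>2) summable_on S}"

definition ell2_norm :: "'g set \<Rightarrow> ('g \<Rightarrow> complex) \<Rightarrow> real" where
  "ell2_norm S \<xi> = sqrt (\<Sum>\<^sub>\<infinity>g\<in>S. (cmod (\<xi> g))\<^sup>2)"

definition ell2_opnorm :: "'g set \<Rightarrow> (('g \<Rightarrow> complex) \<Rightarrow> 'g \<Rightarrow> complex) \<Rightarrow> real" where
  "ell2_opnorm S T = (SUP \<xi> \<in> {\<xi> \<in> ell2 S. ell2_norm S \<xi> \<le> 1}. ell2_norm S (T \<xi>))"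

definition regular_rep ::
  "'g groupoid \<Rightarrow> 'g \<Rightarrow> ('g \<Rightarrow> complex) \<Rightarrow> ('g \<Rightarrow> complex) \<Rightarrow> 'g \<Rightarrow> complex" where
  "regular_rep G x f \<xi> g =
     (if src G g = x
      then \<Sum>\<^sub>\<infinity>h | rng G h = rng G g. f h * \<xi> (gmult G (ginv G h) g)
      else 0)"

definition reduced_norm :: "'g groupoid \<Rightarrow> ('g \<Rightarrow> complex) \<Rightarrow> real" where
  "reduced_norm G f = (SUP x \<in> units G. ell2_opnorm {g. src G g = x} (regular_rep G x f))"

text \<open>\<open>reduced_cstar G \<iota>\<close> says that the C*-algebra \<open>'a\<close>, together with the canonical map \<open>\<iota>\<close>
  from \<^const>\<open>Cc\<close>, is the completion of the *-algebra \<^const>\<open>Cc\<close> in the reduced norm; this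
  determines \<open>'a\<close> up to a unique isomorphism compatible with \<open>\<iota>\<close>. The values of \<open>\<iota>\<close>
  outside \<^const>\<open>Cc\<close> are irrelevant.\<close>

definition reduced_cstar ::
  "'g :: topological_space groupoid \<Rightarrow> (('g \<Rightarrow> complex) \<Rightarrow> 'a :: cstar_algebra) \<Rightarrow> bool" where
  "reduced_cstar G \<iota> \<longleftrightarrow>
     (\<forall>f1\<in>Cc. \<forall>f2\<in>Cc. \<iota> (\<lambda>g. f1 g + f2 g) = \<iota> f1 + \<iota> f2) \<and>
     (\<forall>z. \<forall>f\<in>Cc. \<iota> (\<lambda>g. z * f g) = z *\<^sub>C \<iota> f) \<and>
     (\<forall>f1\<in>Cc. \<forall>f2\<in>Cc. \<iota> (conv G f1 f2) = \<iota> f1 * \<iota> f2) \<and>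
     (\<forall>f\<in>Cc. \<iota> (adj G f) = star (\<iota> f)) \<and>
     (\<forall>f\<in>Cc. norm (\<iota> f) = reduced_norm G f) \<and>
     closure (\<iota> ` Cc) = UNIV"

definition gauge_action ::
  "(('g :: topological_space \<Rightarrow> complex) \<Rightarrow> 'a :: cstar_algebra) \<Rightarrow> ('g \<Rightarrow> real) \<Rightarrow> real \<Rightarrow> 'a \<Rightarrow> 'a"
  where
  "gauge_action \<iota> c = (THE \<sigma>.
     one_parameter_group \<sigma> \<and>
     (\<forall>t. \<forall>f\<in>Cc. \<sigma> t (\<iota> f) = \<iota> (\<lambda>g. exp (\<i> * of_real t * of_real (c g)) * f g)))"

text \<open>Functions on the unit space, extended by zero to the groupoid.\<close>

definition C0_units :: "'g :: topological_space groupoid \<Rightarrow> ('g \<Rightarrow> complex) set" where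
  "C0_units G = {f. continuous_on (units G) f \<and>
     (\<forall>e>0. compact {x \<in> units G. e \<le> cmod (f x)}) \<and>
     (\<forall>x. x \<notin> units G \<longrightarrow> f x = 0)}"

text \<open>The extension by continuity, for the supremum norm on \<^const>\<open>C0_units\<close>, of the
  restriction of functions to the unit space.\<close>

definition cond_exp ::
  "'g :: topological_space groupoid \<Rightarrow> (('g \<Rightarrow> complex) \<Rightarrow> 'a :: cstar_algebra)
     \<Rightarrow> 'a \<Rightarrow> 'g \<Rightarrow> complex" where
  "cond_exp G \<iota> = (THE P.
     (\<forall>a. P a \<in> C0_units G) \<and>
     (\<forall>a. uniform_limit (units G) P (P a) (at a)) \<and>
     (\<forall>f\<in>Cc. \<forall>x\<in>units G. P (\<iota> f) x = f x))"

definition regular_borel_measure :: "'g :: topological_space groupoid \<Rightarrow> 'g measure \<Rightarrow> bool" where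
  "regular_borel_measure G m \<longleftrightarrow>
     sets m = sets (restrict_space borel (units G)) \<and>
     emeasure m (units G) \<noteq> 0 \<and>
     (\<forall>K. K \<subseteq> units G \<and> compact K \<longrightarrow> emeasure m K < \<infinity>) \<and>
     (\<forall>B\<in>sets m.
        emeasure m B = (INF U\<in>{U. openin (top_of_set (units G)) U \<and> B \<subseteq> U}. emeasure m U)) \<and>
     (\<forall>B\<in>sets m.
        emeasure m B = (SUP K\<in>{K. compact K \<and> K \<subseteq> B}. emeasure m K))"

text \<open>To be used at positive \<open>a\<close>, where \<open>cond_exp G \<iota> a\<close> takes values in \<open>[0, \<infinity>)\<close>.\<close>

definition measure_weight ::
  "'g :: topological_space groupoid \<Rightarrow> (('g \<Rightarrow> complex) \<Rightarrow> 'a :: cstar_algebra)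
     \<Rightarrow> 'g measure \<Rightarrow> 'a \<Rightarrow> ennreal" where
  "measure_weight G \<iota> m a = (\<integral>\<^sup>+ x. ennreal (Re (cond_exp G \<iota> a x)) \<partial>m)"

end

theory Submission
  imports Defs "HOL-Complex_Analysis.Complex_Analysis"
begin

text \<open>A KMS weight makes right multiplication by smeared elements, and hence by elements fixed under
  the action, bounded in the \<open>L\<^sup>2\<close>-seminorm, and fixed elements of finite weight lie in the centralizer.
  Since \<open>\<psi>\<close> is densely defined, it follows that every compactly supported function on the unit
  space has finite weight and is central for \<open>\<psi>\<close>. Cut down \<open>\<psi>\<close> by such a function to a functional on
  \<open>C\<^sub>c(G)\<close>. It vanishes off the kernel of \<open>c\<^sub>0\<close> by invariance, because functions supported there are
  coboundaries of the gauge action, and on the kernel off the units by centrality, because the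
  isotropy is trivial. So \<open>\<psi>\<close> factors through the conditional expectation on the cut-downs; the
  Riesz measure of its restriction to the unit space gives one inequality between the weights by lower
  semicontinuity along an exhaustion, and the other by the norm bound on right multiplication.\<close>

section \<open>Positive elements of a C*-algebra\<close>

text \<open>The weight may be infinite on most elements, and no functional calculus, GNS space or
  modular theory is set up. Finite quantities are reached through the seminorm \<open>q\<close>, the
  square root of the weight of star a * a, and lower semicontinuity keeps limits inside its domain.
  The decisive obstacle is that a diagonal element h has no evident reason to have finite weight:
  density gives only a nearby p of finite weight, and compressing it to h p h requires that right
  multiplication by h preserve finiteness, whereas a weight by itself controls left multiplication
  only. The KMS condition supplies the bound on the right: exp (- z^2) is entire and decays along
  the strip, so moving a contour by i \<beta> exchanges right multiplication by one smeared element
  with left multiplication by another, and iterated squaring turns this exchange into a norm bound.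
  Openness of the kernel of \<open>c\<^sub>0\<close> makes it clopen, so that a compactly supported
  function can be cut along it without losing continuity.\<close>

lemma star_zero [simp]: "star (0 :: 'a :: cstar_algebra) = 0"
proof -
  have "star (0 :: 'a) + star 0 = star 0 + 0"
    by (simp flip: star_add)
  then show ?thesis by (simp only: add_left_cancel)
qed

lemma star_minus: "star (- a) = - star (a :: 'a :: cstar_algebra)"
  using star_add[of a "- a"] by (simp add: eq_neg_iff_add_eq_0 add.commute)

lemma star_diff: "star (a - b) = star a - star (b :: 'a :: cstar_algebra)"
  using star_add[of a "- b"] by (simp add: star_minus)

lemma star_scaleR: "star (r *\<^sub>R a) = r *\<^sub>R star (a :: 'a :: cstar_algebra)"
  by (simp flip: scaleC_of_real add: star_scaleC)

lemma star_sum: "star (sum f I) = (\<Sum>i\<in>I. star (f i :: 'a :: cstar_algebra))"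
  by (induction I rule: infinite_finite_induct) (auto simp: star_add)

lemma norm_star [simp]: "norm (star a) = norm (a :: 'a :: cstar_algebra)"
proof -
  have *: "norm b \<le> norm (star b)" for b :: 'a
  proof (cases "norm b = 0")
    case False
    have "norm b * norm b = norm (star b * b)"
      by (simp add: norm_star_mult_self power2_eq_square)
    also have "\<dots> \<le> norm (star b) * norm b"
      by (rule norm_mult_ineq)
    finally show ?thesis using False by (simp add: mult_le_cancel_right)
  qed auto
  show ?thesis using *[of a] *[of "star a"] by (simp add: star_star)
qed

lemma bounded_linear_star: "bounded_linear (star :: 'a :: cstar_algebra \<Rightarrow> 'a)"
  by (rule bounded_linear_intro[where K = 1]) (auto simp: star_add star_scaleR)

lemmas tendsto_star [tendsto_intros] = bounded_linear.tendsto[OF bounded_linear_star]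
lemmas continuous_on_star [continuous_intros] =
  bounded_linear.continuous_on[OF bounded_linear_star]

lemma scaleR_scaleC: "r *\<^sub>R z *\<^sub>C (a :: 'a :: cstar_algebra) = (r *\<^sub>R z) *\<^sub>C a"
  by (simp flip: scaleC_of_real add: scaleC_scaleC scaleR_conv_of_real)

lemma scaleC_scaleR: "z *\<^sub>C r *\<^sub>R (a :: 'a :: cstar_algebra) = (r *\<^sub>R z) *\<^sub>C a"
  by (simp flip: scaleC_of_real add: scaleC_scaleC scaleR_conv_of_real mult.commute)

lemma bounded_bilinear_scaleC: "bounded_bilinear (scaleC :: complex \<Rightarrow> 'a :: cstar_algebra \<Rightarrow> 'a)"
  by (rule bounded_bilinear.intro)
    (auto simp: scaleC_add_left scaleC_add_right scaleR_scaleC scaleC_scaleR norm_scaleC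
      intro!: exI[of _ 1])

lemmas tendsto_scaleC [tendsto_intros] = bounded_bilinear.tendsto[OF bounded_bilinear_scaleC]
lemmas continuous_on_scaleC [continuous_intros] =
  bounded_bilinear.continuous_on[OF bounded_bilinear_scaleC]

lemma scaleC_minus_one: "(- 1) *\<^sub>C (a :: 'a :: cstar_algebra) = - a"
  using complex_vector.scale_minus_left[of 1 a] by simp

lemma pos_cone_star_mult [simp]: "star a * a \<in> pos_cone"
  by (auto simp: pos_cone_def)

lemma pos_cone_selfadjoint: "a \<in> pos_cone \<Longrightarrow> star a = a"
  by (auto simp: pos_cone_def star_mult star_star)

lemma pos_cone_zero [simp]: "0 \<in> pos_cone"
  using pos_cone_star_mult[of 0] by simp

lemma pos_cone_scaleR:
  assumes "a \<in> pos_cone" "0 \<le> r"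
  shows "r *\<^sub>R a \<in> pos_cone"
proof -
  obtain b where b: "a = star b * b" using assms(1) by (auto simp: pos_cone_def)
  have "r *\<^sub>R a = star (sqrt r *\<^sub>R b) * (sqrt r *\<^sub>R b)"
    using assms(2) by (simp add: b star_scaleR)
  then show ?thesis by (metis pos_cone_star_mult)
qed

lemma pos_cone_conj:
  assumes "a \<in> pos_cone"
  shows "star x * a * x \<in> pos_cone"
proof -
  obtain b where b: "a = star b * b" using assms by (auto simp: pos_cone_def)
  have "star x * a * x = star (b * x) * (b * x)"
    by (simp add: b star_mult mult.assoc)
  then show ?thesis by (metis pos_cone_star_mult)
qed

text \<open>The solution \<open>e = 1 - sqrt (1 - z)\<close> lies in the algebra although its unit may be missing.\<close>

lemma exists_one_minus_sqrt:
  fixes z :: "'a :: cstar_algebra"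
  assumes z: "star z = z" "norm z < 1"
  obtains e where "star e = e" "e + e - e * e = z"
proof -
  define S where "S = {e :: 'a. norm e \<le> norm z \<and> star e = e}"
  \<comment> \<open>A fixed point of \<open>f\<close> solves e + e = z + e * e. Since x x - y y = x
    (x - y) + (x - y) y also without commutativity, \<open>f\<close> contracts the ball of radius
    norm z with ratio norm z < 1.\<close>
  define f where "f = (\<lambda>e. (1/2) *\<^sub>R (z + e * e))"
  have "closed S"
    unfolding S_def Collect_conj_eq
    by (intro closed_Int closed_Collect_le closed_Collect_eq continuous_intros)
  then have "complete S" by (simp add: complete_eq_closed)
  moreover have "S \<noteq> {}" using z by (auto simp: S_def)
  moreover have "f ` S \<subseteq> S"
  proof safe
    fix e assume "e \<in> S"
    then have e: "norm e \<le> norm z" "star e = e" by (auto simp: S_def)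
    have "norm (z + e * e) \<le> norm z + norm e * norm e"
      by (meson norm_mult_ineq norm_triangle_mono order_refl)
    also have "norm e * norm e \<le> norm z * 1"
      using e z by (intro mult_mono) auto
    finally show "f e \<in> S" using e z
      by (auto simp: S_def f_def star_scaleR star_add star_mult)
  qed
  moreover have "\<forall>x\<in>S. \<forall>y\<in>S. dist (f x) (f y) \<le> norm z * dist x y"
  proof safe
    fix x y assume "x \<in> S" "y \<in> S"
    then have xy: "norm x \<le> norm z" "norm y \<le> norm z" by (auto simp: S_def)
    have "f x - f y = (1/2) *\<^sub>R (x * (x - y) + (x - y) * y)"
      by (simp add: f_def algebra_simps)
    then have "dist (f x) (f y) = (1/2) * norm (x * (x - y) + (x - y) * y)"
      by (simp add: dist_norm)
    also have "norm (x * (x - y) + (x - y) * y) \<le> norm x * norm (x - y) + norm (x - y) * norm y"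
      by (meson norm_mult_ineq norm_triangle_mono)
    also have "\<dots> \<le> norm z * norm (x - y) + norm (x - y) * norm z"
      using xy by (intro add_mono mult_mono) auto
    finally show "dist (f x) (f y) \<le> norm z * dist x y"
      by (simp add: dist_norm)
  qed
  ultimately obtain e where e: "e \<in> S" "f e = e"
    using Banach_fix[of S "norm z" f] z by auto
  have "e + e = 2 *\<^sub>R e" by (simp add: scaleR_2)
  also have "\<dots> = z + e * e" by (subst e(2)[symmetric]) (simp add: f_def)
  finally have "e + e - e * e = z" by simp
  with e(1) show thesis by (intro that[of e]) (auto simp: S_def)
qed

text \<open>Formally the element is x* (1 - z) x with 1 - z = (1 - e)^2. Writing (1 - e) x as x - e
  x makes this a square inside the algebra, without adjoining a unit.\<close>

lemma pos_cone_diff_conj: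
  fixes x z :: "'a :: cstar_algebra"
  assumes "star z = z" "norm z < 1"
  shows "star x * x - star x * z * x \<in> pos_cone"
proof -
  obtain e where e: "star e = e" "e + e - e * e = z"
    using exists_one_minus_sqrt assms by blast
  have "star x * x - star x * z * x = star (x - e * x) * (x - e * x)"
    by (simp add: e(2)[symmetric] star_diff star_mult e(1) algebra_simps)
  then show ?thesis by (metis pos_cone_star_mult)
qed

text \<open>The coefficients of \<open>1 - sqrt (1 - t)\<close>; the convolution identity expresses
  \<open>(1 - sqrt (1 - t))\<^sup>2 = 2 (1 - sqrt (1 - t)) - t\<close>.\<close>

fun sqrt_coeff :: "nat \<Rightarrow> real" where
  "sqrt_coeff 0 = 0"
| "sqrt_coeff (Suc n) =
     (if n = 0 then 1/2 else (\<Sum>i\<in>{1..n}. sqrt_coeff i * sqrt_coeff (Suc n - i)) / 2)"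

declare sqrt_coeff.simps [simp del]

lemma sqrt_coeff_nonneg: "0 \<le> sqrt_coeff n"
proof (induction n rule: less_induct)
  case (less n)
  show ?case
    by (cases n) (auto simp: sqrt_coeff.simps intro!: divide_nonneg_pos sum_nonneg mult_nonneg_nonneg less)
qed

lemma sqrt_coeff_conv:
  "(\<Sum>i\<le>k. sqrt_coeff i * sqrt_coeff (k - i)) = 2 * sqrt_coeff k - (if k = 1 then 1 else 0)"
proof (cases k)
  case (Suc n)
  have "(\<Sum>i\<le>k. sqrt_coeff i * sqrt_coeff (k - i)) = (\<Sum>i\<in>{1..n}. sqrt_coeff i * sqrt_coeff (k - i))"
    using Suc by (intro sum.mono_neutral_right) (auto simp: sqrt_coeff.simps(1) not_le le_Suc_eq)
  also have "\<dots> = 2 * sqrt_coeff k - (if k = 1 then 1 else 0)"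
    using Suc by (auto simp: sqrt_coeff.simps)
  finally show ?thesis .
qed (auto simp: sqrt_coeff.simps)

text \<open>As the coefficient of index 0 vanishes, the triangle i + j <= N + 1 contributes nothing
  outside the square with sides N. The convolution identity summed over the triangle therefore gives
  2 C(N+1) - 1 <= C(N)^2, which propagates the bound 1.\<close>

lemma sqrt_coeff_partial_sums:
  defines "C \<equiv> \<lambda>N. \<Sum>i\<le>N. sqrt_coeff i"
  shows "C N \<le> 1"
    and "(\<Sum>(i, j) | i + j \<le> N. sqrt_coeff i * sqrt_coeff j) = 2 * C N - (if N = 0 then 0 else 1)"
proof -
  have tri: "(\<Sum>(i, j) | i + j \<le> N. sqrt_coeff i * sqrt_coeff j) = 2 * C N - (if N = 0 then 0 else 1)" for N
  proof -
    have "(\<Sum>(i, j) | i + j \<le> N. sqrt_coeff i * sqrt_coeff j)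
        = (\<Sum>k\<le>N. 2 * sqrt_coeff k - (if k = 1 then 1 else 0))"
      by (subst sum.triangle_reindex_eq) (simp add: sqrt_coeff_conv)
    also have "\<dots> = 2 * C N - (if N = 0 then 0 else 1)"
      by (auto simp: C_def sum_subtractf sum_distrib_left)
    finally show ?thesis .
  qed
  then show "(\<Sum>(i, j) | i + j \<le> N. sqrt_coeff i * sqrt_coeff j) = 2 * C N - (if N = 0 then 0 else 1)" .
  show "C N \<le> 1"
  proof (induction N)
    case (Suc N)
    have "2 * C (Suc N) - 1 = (\<Sum>(i, j) | i + j \<le> Suc N. sqrt_coeff i * sqrt_coeff j)"
      using tri[of "Suc N"] by simp
    also have "\<dots> \<le> (\<Sum>(i, j)\<in>{..N} \<times> {..N}. sqrt_coeff i * sqrt_coeff j)"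
    proof -
      have "(\<Sum>(i, j) | i + j \<le> Suc N. sqrt_coeff i * sqrt_coeff j)
          = (\<Sum>(i, j)\<in>{(i, j). i + j \<le> Suc N} \<inter> {..N} \<times> {..N}. sqrt_coeff i * sqrt_coeff j)"
      proof (rule sum.mono_neutral_right)
        show "finite {(i, j). i + j \<le> Suc N}"
          by (rule finite_subset[of _ "{..Suc N} \<times> {..Suc N}"]) auto
        show "\<forall>p\<in>{(i, j). i + j \<le> Suc N} - {(i, j). i + j \<le> Suc N} \<inter> {..N} \<times> {..N}.
            (case p of (i, j) \<Rightarrow> sqrt_coeff i * sqrt_coeff j) = 0"
        proof
          fix p assume "p \<in> {(i, j). i + j \<le> Suc N} - {(i, j). i + j \<le> Suc N} \<inter> {..N} \<times> {..N}"
          then obtain i j where p: "p = (i, j)" and "i = 0 \<or> j = 0" by (cases p) force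
          then show "(case p of (i, j) \<Rightarrow> sqrt_coeff i * sqrt_coeff j) = 0"
            by (auto simp: sqrt_coeff.simps(1))
        qed
      qed auto
      also have "\<dots> \<le> (\<Sum>(i, j)\<in>{..N} \<times> {..N}. sqrt_coeff i * sqrt_coeff j)"
        by (intro sum_mono2) (auto simp: sqrt_coeff_nonneg)
      finally show ?thesis .
    qed
    also have "\<dots> = C N * C N"
      by (simp add: C_def sum_product sum.cartesian_product)
    also have "\<dots> \<le> 1 * 1"
      using Suc by (intro mult_mono) (auto simp: C_def sum_nonneg sqrt_coeff_nonneg)
    finally show ?case by simp
  qed (simp add: C_def sqrt_coeff.simps)
qed

text \<open>The Cauchy product turns the convolution identity into C^2 = 2 C - 1 for the total sum
  C, whose only solution is 1.\<close>

lemma sqrt_coeff_sums: "sqrt_coeff sums 1"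
proof -
  have s: "summable sqrt_coeff"
    by (rule summableI_nonneg_bounded[where x = 1])
      (use sqrt_coeff_partial_sums(1) in \<open>auto simp: sqrt_coeff_nonneg lessThan_Suc_atMost[symmetric]\<close>,
       metis (no_types, lifting) Suc_pred atMost_iff lessThan_Suc_atMost less_one neq0_conv
         sqrt_coeff_partial_sums(1) sum.empty lessThan_0 zero_le_one)
  define C where "C = suminf sqrt_coeff"
  have "(\<lambda>k. \<Sum>i\<le>k. sqrt_coeff i * sqrt_coeff (k - i)) sums (C * C)"
    unfolding C_def using s by (intro Cauchy_product_sums) (auto simp: sqrt_coeff_nonneg)
  then have "(\<lambda>k. 2 * sqrt_coeff k - (if k = 1 then 1 else 0)) sums (C * C)"
    by (simp add: sqrt_coeff_conv)
  moreover have "(\<lambda>k. 2 * sqrt_coeff k - (if k = 1 then 1 else 0)) sums (2 * C - 1)"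
    using s unfolding C_def by (intro sums_diff sums_mult summable_sums sums_single) auto
  ultimately have "C * C = 2 * C - 1"
    using sums_unique2 by blast
  then have "(C - 1)\<^sup>2 = 0" by (simp add: power2_eq_square algebra_simps)
  then have "C = 1" by simp
  then show ?thesis using s by (simp add: C_def sums_iff)
qed

text \<open>In the unitization \<open>u n = 1 - (1 - x)\<^sup>n\<close>, and the square root of \<open>x\<close> is
  \<open>\<Sum>n. sqrt_coeff n (1 - (1 - x)\<^sup>n)\<close>.\<close>

lemma exists_sqrt_contraction:
  fixes x :: "'a :: cstar_algebra"
  assumes x: "star x = x" and contr: "\<And>b. norm (b - x * b) \<le> norm b"
  obtains s where "star s = s" "s * s = x"
proof -
  define u where "u = rec_nat 0 (\<lambda>_ v. x + v - x * v)"
  have u0: "u 0 = 0" and uS: "u (Suc n) = x + u n - x * u n" for n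
    by (simp_all add: u_def)
  define c where "c = sqrt_coeff"
  have c_nonneg: "0 \<le> c n" for n by (simp add: c_def sqrt_coeff_nonneg)
  have u1: "u 1 = x" by (simp add: uS u0)
  have u_contr: "norm (b - u n * b) \<le> norm b" for n b
  proof (induction n)
    case (Suc n)
    have "b - u (Suc n) * b = (b - u n * b) - x * (b - u n * b)"
      by (simp add: uS algebra_simps)
    then show ?case using contr[of "b - u n * b"] Suc by (metis order_trans)
  qed (simp add: u0)
  have u_comm: "u n * x = x * u n" for n
    by (induction n) (simp_all add: u0 uS algebra_simps)
  have u_sa: "star (u n) = u n" for n
    by (induction n) (simp_all add: u0 uS star_add star_diff star_mult x u_comm)
  have u_mult: "u m * u n = u m + u n - u (m + n)" for m n
  proof (induction m)
    case (Suc m)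
    have "u (Suc m) * u n = x * u n + u m * u n - x * (u m * u n)"
      by (simp add: uS algebra_simps)
    then show ?case unfolding Suc by (simp add: uS algebra_simps)
  qed (simp add: u0)
  \<comment> \<open>Self-adjointness turns the bound on u * u, which follows from the contraction
    property with b = u n, into norm u ^ 2 <= 2 norm u.\<close>
  have u_bound: "norm (u n) \<le> 2" for n
  proof -
    have "norm (u n * u n) \<le> norm (u n - u n * u n) + norm (u n)"
      by (metis norm_minus_commute norm_triangle_sub add.commute)
    also have "\<dots> \<le> 2 * norm (u n)" using u_contr[of "u n" n] by simp
    finally have "norm (u n) * norm (u n) \<le> 2 * norm (u n)"
      using norm_star_mult_self[of "u n"] by (simp add: u_sa power2_eq_square)
    then show ?thesis by (cases "norm (u n) = 0") (auto simp: mult_le_cancel_right)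
  qed
  define S where "S = (\<lambda>N. \<Sum>n\<le>N. c n *\<^sub>R u n)"
  define C where "C = (\<lambda>N. \<Sum>n\<le>N. c n)"
  have C_lim: "C \<longlonglongrightarrow> 1"
    using sqrt_coeff_sums by (simp add: C_def c_def sums_def_le)
  have "summable (\<lambda>n. c n *\<^sub>R u n)"
  proof (rule summable_comparison_test, intro exI allI impI)
    show "norm (c n *\<^sub>R u n) \<le> 2 * c n" for n
      using u_bound[of n] c_nonneg[of n] by (simp add: mult.commute mult_left_mono)
    show "summable (\<lambda>n. 2 * c n)"
      using sqrt_coeff_sums by (simp add: c_def sums_iff)
  qed
  then obtain s where S_lim: "S \<longlonglongrightarrow> s"
    unfolding S_def summable_def sums_def_le by blast
  have S_sa: "star (S N) = S N" for N
    by (simp add: S_def star_sum star_scaleR u_sa)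
  \<comment> \<open>The difference is a sum over the part \<open>Q - T\<close> of the square that
    lies outside the triangle. There all u are bounded by 2, and the coefficients add up to C^2 - (2
    C - 1) = (C - 1)^2, which tends to 0.\<close>
  have "norm (S N * S N - (2 * C N) *\<^sub>R S N + (2 *\<^sub>R S N - x)) \<le> 2 * (C N - 1)\<^sup>2" if "N \<ge> 1" for N
  proof -
    define Q T where "Q = {..N} \<times> {..N}" and "T = {(m, n). m + n \<le> N}"
    have T: "T \<subseteq> Q" "finite Q" by (auto simp: T_def Q_def)
    define d where "d = (\<lambda>(m, n). (c m * c n) *\<^sub>R u (m + n))"
    have "S N * S N = (\<Sum>m\<le>N. \<Sum>n\<le>N. (c m * c n) *\<^sub>R (u m * u n))"
      by (simp add: S_def sum_product mult.commute[of "c _" "c _"])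
    also have "\<dots> = (\<Sum>m\<le>N. \<Sum>n\<le>N. c n *\<^sub>R (c m *\<^sub>R u m)) + (\<Sum>m\<le>N. \<Sum>n\<le>N. c m *\<^sub>R (c n *\<^sub>R u n))
        - (\<Sum>m\<le>N. \<Sum>n\<le>N. (c m * c n) *\<^sub>R u (m + n))"
      by (simp add: u_mult sum.distrib[symmetric] sum_subtractf[symmetric] algebra_simps)
    also have "(\<Sum>m\<le>N. \<Sum>n\<le>N. c n *\<^sub>R (c m *\<^sub>R u m)) = C N *\<^sub>R S N"
      by (simp add: C_def S_def scaleR_sum_right flip: scaleR_sum_left sum_distrib_right)
    also have "(\<Sum>m\<le>N. \<Sum>n\<le>N. c m *\<^sub>R (c n *\<^sub>R u n)) = C N *\<^sub>R S N"
      by (subst sum.swap) (simp add: C_def S_def scaleR_sum_right flip: scaleR_sum_left sum_distrib_right)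
    also have "(\<Sum>m\<le>N. \<Sum>n\<le>N. (c m * c n) *\<^sub>R u (m + n)) = sum d Q"
      by (simp add: Q_def d_def sum.cartesian_product)
    finally have 1: "S N * S N = (2 * C N) *\<^sub>R S N - sum d Q"
      by (simp add: scaleR_2 flip: scaleR_scaleR)
    have "sum d T = (\<Sum>k\<le>N. (\<Sum>i\<le>k. c i * c (k - i)) *\<^sub>R u k)"
      unfolding d_def T_def
      by (subst sum.triangle_reindex_eq) (auto simp: scaleR_sum_left intro!: sum.cong)
    also have "\<dots> = (\<Sum>k\<le>N. (2 * c k) *\<^sub>R u k - (if k = 1 then u k else 0))"
      by (intro sum.cong refl) (simp add: c_def sqrt_coeff_conv scaleR_diff_left)
    also have "\<dots> = 2 *\<^sub>R S N - x"
      using that u1 by (simp add: sum_subtractf S_def scaleR_sum_right)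
    finally have 2: "sum d T = 2 *\<^sub>R S N - x" .
    have "sum d Q - sum d T = sum d (Q - T)"
      using T by (simp add: sum_diff)
    then have "norm (sum d Q - sum d T) \<le> (\<Sum>(m, n)\<in>Q - T. 2 * (c m * c n))"
      using mult_left_mono[OF u_bound mult_nonneg_nonneg[OF c_nonneg c_nonneg]]
      by (auto intro!: sum_norm_le simp: d_def c_nonneg mult.commute[of 2])
    also have "\<dots> = 2 * ((\<Sum>(m, n)\<in>Q. c m * c n) - (\<Sum>(m, n)\<in>T. c m * c n))"
      using T by (subst sum_diff[symmetric]) (auto simp: sum_distrib_left intro!: sum.cong)
    also have "(\<Sum>(m, n)\<in>Q. c m * c n) = C N * C N"
      by (simp add: C_def Q_def sum_product sum.cartesian_product)
    also have "(\<Sum>(m, n)\<in>T. c m * c n) = 2 * C N - 1"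
      using sqrt_coeff_partial_sums(2)[of N] that by (simp add: c_def C_def T_def)
    finally have "norm (sum d Q - sum d T) \<le> 2 * (C N - 1)\<^sup>2"
      by (simp add: power2_eq_square algebra_simps)
    then show ?thesis unfolding 1 2 by (simp add: norm_minus_commute)
  qed
  then have ev: "\<forall>\<^sub>F N in sequentially.
      norm (S N * S N - (2 * C N) *\<^sub>R S N + (2 *\<^sub>R S N - x)) \<le> 2 * (C N - 1)\<^sup>2"
    by (auto simp: eventually_at_top_linorder)
  have lim1: "(\<lambda>N. norm (S N * S N - (2 * C N) *\<^sub>R S N + (2 *\<^sub>R S N - x)))
      \<longlonglongrightarrow> norm (s * s - (2 * 1) *\<^sub>R s + (2 *\<^sub>R s - x))"
    by (intro tendsto_intros S_lim C_lim)
  have lim2: "(\<lambda>N. 2 * (C N - 1)\<^sup>2) \<longlonglongrightarrow> 2 * (1 - 1)\<^sup>2"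
    by (intro tendsto_intros C_lim)
  have "norm (s * s - (2 * 1) *\<^sub>R s + (2 *\<^sub>R s - x)) \<le> 2 * (1 - 1)\<^sup>2"
    by (rule tendsto_le[OF trivial_limit_sequentially lim2 lim1 ev])
  then have "s * s = x" by simp
  moreover have "star s = s"
  proof -
    have "(\<lambda>N. star (S N)) \<longlonglongrightarrow> star s" by (intro tendsto_intros S_lim)
    then show ?thesis using S_lim S_sa LIMSEQ_unique by simp
  qed
  ultimately show thesis using that by blast
qed

text \<open>The hypothesis says that left multiplication by r - x has norm at most r, which for
  self-adjoint x places the spectrum in the interval from 0 to 2 r. In this form positivity is
  additive in the pair of x and r, by the triangle inequality alone.\<close>

lemma pos_coneI:
  fixes x :: "'a :: cstar_algebra"
  assumes x: "star x = x" and r: "r > 0" and le: "\<And>b. norm (r *\<^sub>R b - x * b) \<le> r * norm b"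
  shows "x \<in> pos_cone"
proof -
  have "norm (b - (x /\<^sub>R r) * b) \<le> norm b" for b
  proof -
    have "b - (x /\<^sub>R r) * b = (r *\<^sub>R b - x * b) /\<^sub>R r"
      using r by (simp add: algebra_simps)
    then have "norm (b - (x /\<^sub>R r) * b) = norm (r *\<^sub>R b - x * b) / r"
      using r by (simp add: divide_inverse mult.commute)
    also have "\<dots> \<le> norm b"
      using le[of b] r by (simp add: field_simps)
    finally show ?thesis .
  qed
  then obtain s where s: "star s = s" "s * s = x /\<^sub>R r"
    using exists_sqrt_contraction[of "x /\<^sub>R r"] x by (auto simp: star_scaleR)
  have "x = r *\<^sub>R (star s * s)" using s r by simp
  then show ?thesis using r by (metis pos_cone_scaleR pos_cone_star_mult less_imp_le)
qed

text \<open>The hypothesis holds in every C*-algebra, but only its validity in reduced groupoid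
  C*-algebras is needed; there it is read off from the regular representations.\<close>

lemma pos_cone_add:
  fixes x y :: "'a :: cstar_algebra"
  assumes pos: "\<And>a b :: 'a. norm ((norm a)\<^sup>2 *\<^sub>R b - star a * a * b) \<le> (norm a)\<^sup>2 * norm b"
    and "x \<in> pos_cone" "y \<in> pos_cone"
  shows "x + y \<in> pos_cone"
proof -
  obtain a c where a: "x = star a * a" and c: "y = star c * c"
    using assms by (auto simp: pos_cone_def)
  define r where "r = (norm a)\<^sup>2 + (norm c)\<^sup>2"
  show ?thesis
  proof (cases "r = 0")
    case True
    then have "a = 0" "c = 0" by (auto simp: r_def add_nonneg_eq_0_iff)
    then show ?thesis by (simp add: a c)
  next
    case False
    then have "r > 0" by (auto simp: r_def add_nonneg_eq_0_iff intro: add_pos_nonneg add_nonneg_pos)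
    moreover have "norm (r *\<^sub>R b - (x + y) * b) \<le> r * norm b" for b
    proof -
      have "r *\<^sub>R b - (x + y) * b = ((norm a)\<^sup>2 *\<^sub>R b - star a * a * b) + ((norm c)\<^sup>2 *\<^sub>R b - star c * c * b)"
        by (simp add: r_def a c algebra_simps)
      then show ?thesis using pos[of a b] pos[of c b]
        by (simp only: r_def distrib_right) (metis norm_triangle_mono)
    qed
    ultimately show ?thesis
      by (intro pos_coneI) (auto simp: a c star_add star_mult star_star)
  qed
qed

section \<open>The sesquilinear form of a proper weight\<close>

lemma polarization_star:
  fixes a b :: "'a :: cstar_algebra"
  shows "4 *\<^sub>C (star a * b) = star (a + b) * (a + b) - star (a - b) * (a - b)
    + \<i> *\<^sub>C (star (a - \<i> *\<^sub>C b) * (a - \<i> *\<^sub>C b) - star (a + \<i> *\<^sub>C b) * (a + \<i> *\<^sub>C b))"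
proof -
  have 1: "star (a + b) * (a + b) - star (a - b) * (a - b) = 2 *\<^sub>C (star a * b) + 2 *\<^sub>C (star b * a)"
    using scaleC_add_left[of 1 1 "star a * b"] scaleC_add_left[of 1 1 "star b * a"]
    by (simp add: star_add star_diff algebra_simps)
  have 2: "star (a - \<i> *\<^sub>C b) * (a - \<i> *\<^sub>C b) - star (a + \<i> *\<^sub>C b) * (a + \<i> *\<^sub>C b)
      = (- (2 * \<i>)) *\<^sub>C (star a * b) + (2 * \<i>) *\<^sub>C (star b * a)"
  proof -
    have "star (a - \<i> *\<^sub>C b) * (a - \<i> *\<^sub>C b) - star (a + \<i> *\<^sub>C b) * (a + \<i> *\<^sub>C b)
      = - (\<i> *\<^sub>C (star a * b)) - (\<i> *\<^sub>C (star a * b)) + \<i> *\<^sub>C (star b * a) + \<i> *\<^sub>C (star b * a)"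
      by (simp add: star_add star_diff star_scaleC mult_scaleC_left mult_scaleC_right algebra_simps)
    then show ?thesis
      using scaleC_add_left[of \<i> \<i> "star a * b"] scaleC_add_left[of \<i> \<i> "star b * a"]
      by (simp add: mult_2 algebra_simps)
  qed
  have "2 *\<^sub>C (star a * b) + 2 *\<^sub>C (star a * b) = 4 *\<^sub>C (star a * b)"
    using scaleC_add_left[of 2 2 "star a * b"] by simp
  moreover have "\<i> *\<^sub>C ((- (2 * \<i>)) *\<^sub>C (star a * b) + (2 * \<i>) *\<^sub>C (star b * a))
      = 2 *\<^sub>C (star a * b) - 2 *\<^sub>C (star b * a)"
  proof -
    have i: "\<i> * (2 * \<i>) = - 2" by (simp add: complex_eq_iff)
    show ?thesis
      by (simp add: i scaleC_add_right complex_vector.scale_right_diff_distrib scaleC_scaleC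
          complex_vector.scale_minus_left)
  qed
  ultimately show ?thesis
    unfolding 1 2 by (simp add: algebra_simps)
qed

lemma star_mult_self_scaleC:
  "star (z *\<^sub>C a) * (z *\<^sub>C a) = (cmod z)\<^sup>2 *\<^sub>R (star a * (a :: 'a :: cstar_algebra))"
proof -
  have "cnj z * z = of_real ((cmod z)\<^sup>2)"
    using complex_norm_square[of z] by (simp add: mult.commute)
  then show ?thesis
    by (simp add: star_scaleC mult_scaleC_left mult_scaleC_right scaleC_scaleC
        mult.commute[of z] flip: scaleC_of_real)
qed

lemma selfadjoint_parts_unique:
  fixes x y x' y' :: "'a :: cstar_algebra"
  assumes "x + \<i> *\<^sub>C y = x' + \<i> *\<^sub>C y'" "star x = x" "star y = y" "star x' = x'" "star y' = y'"
  shows "x = x'" "y = y'"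
proof -
  have *: "x - \<i> *\<^sub>C y = x' - \<i> *\<^sub>C y'"
    using arg_cong[OF assms(1), of star] by (simp add: star_add star_scaleC assms(2-))
  have "x + x = x' + x'"
    using assms(1) * by (metis (no_types, lifting) add_diff_cancel diff_add_cancel add.assoc add.commute)
  then have "2 *\<^sub>R x = 2 *\<^sub>R x'" by (simp add: scaleR_2)
  then show x: "x = x'" by simp
  have "\<i> *\<^sub>C y = \<i> *\<^sub>C y'" using assms(1) x by simp
  then show "y = y'"
    by simp
qed

text \<open>Closure of the positive cone under addition enters as an assumption here; for reduced
  groupoid algebras it is discharged by \<open>pos_cone_add'\<close>.\<close>

locale cstar_weight =
  fixes \<psi> :: "'a :: cstar_algebra \<Rightarrow> ennreal"
  assumes proper: "proper_weight \<psi>"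
    and pos_add: "(x :: 'a) \<in> pos_cone \<Longrightarrow> y \<in> pos_cone \<Longrightarrow> x + y \<in> pos_cone"
begin

lemma weight: "weight \<psi>"
  using proper by (simp add: proper_weight_def)

lemma psi_add: "a \<in> pos_cone \<Longrightarrow> b \<in> pos_cone \<Longrightarrow> \<psi> (a + b) = \<psi> a + \<psi> b"
  using weight by (simp add: weight_def)

text \<open>Scaling is postulated for positive factors only, so the value at 0 has to be cancelled
  from psi a = psi a + psi 0 at some a of finite weight, which dense definedness provides.\<close>

lemma psi_zero: "\<psi> 0 = 0"
proof -
  obtain a where "a \<in> pos_cone" "\<psi> a < \<infinity>"
    using proper unfolding proper_weight_def by (metis (no_types, lifting) closure_empty
      empty_Collect_eq empty_iff subset_empty pos_cone_zero)
  then show ?thesis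
    using psi_add[of a 0] by (cases "\<psi> a"; cases "\<psi> 0") (auto simp flip: ennreal_plus)
qed

lemma psi_scaleR:
  assumes "a \<in> pos_cone" "0 \<le> r"
  shows "\<psi> (r *\<^sub>R a) = ennreal r * \<psi> a"
  using weight assms by (cases "r = 0") (auto simp: weight_def psi_zero)

lemma psi_le_add: "a \<in> pos_cone \<Longrightarrow> b - a \<in> pos_cone \<Longrightarrow> \<psi> a \<le> \<psi> b"
  using psi_add[of a "b - a"] by (simp add: add_increasing2)

lemma psi_closed: "0 \<le> l \<Longrightarrow> closed {a \<in> pos_cone. \<psi> a \<le> ennreal l}"
  using proper by (simp add: proper_weight_def)

text \<open>The seminorm of the GNS representation. Since \<open>enn2real\<close> sends infinity to
  0, it is meaningful only on elements of finite weight.\<close>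

definition q :: "'a \<Rightarrow> real" where
  "q a = sqrt (enn2real (\<psi> (star a * a)))"

lemma q_nonneg [simp]: "0 \<le> q a"
  by (simp add: q_def)

lemma psi_eq_q: "a \<in> \<N> \<psi> \<Longrightarrow> \<psi> (star a * a) = ennreal ((q a)\<^sup>2)"
  by (auto simp: q_def weight_null_def)

lemma mem_N_I: "\<psi> (star a * a) \<le> ennreal B \<Longrightarrow> a \<in> \<N> \<psi>"
  by (auto simp: weight_null_def intro: order.strict_trans1)

lemma N_zero [simp]: "0 \<in> \<N> \<psi>"
  by (simp add: weight_null_def psi_zero)

text \<open>The parallelogram law avoids the mixed products star a * b, on which the weight is not
  yet defined.\<close>

lemma N_add:
  assumes "a \<in> \<N> \<psi>" "b \<in> \<N> \<psi>"
  shows "a + b \<in> \<N> \<psi>"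
proof -
  have "star (a + b) * (a + b) + star (a - b) * (a - b) = 2 *\<^sub>R (star a * a + star b * b)"
    by (simp add: star_add star_diff scaleR_2 algebra_simps)
  then have "\<psi> (star (a + b) * (a + b)) + \<psi> (star (a - b) * (a - b))
      = ennreal 2 * (\<psi> (star a * a) + \<psi> (star b * b))"
    by (metis psi_add psi_scaleR pos_add pos_cone_star_mult zero_le_numeral)
  also have "\<dots> < \<infinity>" using assms by (auto simp: weight_null_def ennreal_mult_less_top)
  finally show ?thesis by (auto simp: weight_null_def)
qed

lemma N_scaleC:
  assumes "a \<in> \<N> \<psi>"
  shows "z *\<^sub>C a \<in> \<N> \<psi>"
  using assms
  by (auto simp: weight_null_def star_mult_self_scaleC psi_scaleR ennreal_mult_less_top)

lemma N_minus: "a \<in> \<N> \<psi> \<Longrightarrow> - a \<in> \<N> \<psi>"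
  using N_scaleC[of a "- 1"] by (simp add: scaleC_minus_one)

lemma N_diff: "a \<in> \<N> \<psi> \<Longrightarrow> b \<in> \<N> \<psi> \<Longrightarrow> a - b \<in> \<N> \<psi>"
  using N_add[of a "- b"] by (simp add: N_minus)

lemma N_scaleR: "a \<in> \<N> \<psi> \<Longrightarrow> r *\<^sub>R a \<in> \<N> \<psi>"
  using N_scaleC[of a "of_real r"] by (simp add: scaleC_of_real)

lemma N_sum: "(\<And>i. i \<in> I \<Longrightarrow> f i \<in> \<N> \<psi>) \<Longrightarrow> sum f I \<in> \<N> \<psi>"
  by (induction I rule: infinite_finite_induct) (auto intro: N_add)

text \<open>Conjugating the inequality a* a <= r by x. The strict hypothesis makes z = a* a / r have
  norm below 1, as \<open>pos_cone_diff_conj\<close> requires; \<open>q_left_mult\<close> then lets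
  r decrease to the square of norm a.\<close>

lemma psi_left_mult_le:
  assumes "(norm a)\<^sup>2 < r"
  shows "\<psi> (star (a * x) * (a * x)) \<le> ennreal r * \<psi> (star x * x)"
proof -
  have r: "r > 0" using assms by (meson le_less_trans zero_le_power2)
  define z where "z = (1 / r) *\<^sub>R (star a * a)"
  have z: "star z = z" "norm z < 1"
    using assms r by (auto simp: z_def star_scaleR star_mult star_star norm_star_mult_self)
  define y where "y = star (a * x) * (a * x)"
  have y: "y = r *\<^sub>R (star x * z * x)"
    using r by (simp add: y_def z_def star_mult mult.assoc)
  have "star x * z * x \<in> pos_cone"
    using pos_cone_scaleR[of y "1 / r"] r by (simp add: y) (simp add: y_def flip: y)
  then have "\<psi> y = ennreal r * \<psi> (star x * z * x)" and "\<psi> (star x * z * x) \<le> \<psi> (star x * x)"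
    using r pos_cone_diff_conj[OF z, of x] by (auto simp: y psi_scaleR intro: psi_le_add)
  then show ?thesis unfolding y_def by (simp add: mult_left_mono)
qed

lemma N_left_mult: "x \<in> \<N> \<psi> \<Longrightarrow> a * x \<in> \<N> \<psi>"
  using psi_left_mult_le[of a "(norm a)\<^sup>2 + 1" x]
  by (auto simp: weight_null_def ennreal_mult_less_top elim: order.strict_trans1)

lemma q_left_mult:
  assumes "x \<in> \<N> \<psi>"
  shows "q (a * x) \<le> norm a * q x"
proof -
  have *: "(q (a * x))\<^sup>2 \<le> r * (q x)\<^sup>2" if "(norm a)\<^sup>2 < r" for r
  proof -
    have "r \<ge> 0" using that by (meson le_less_trans less_imp_le zero_le_power2)
    then show ?thesis
      using psi_left_mult_le[OF that, of x] assms
      by (simp add: psi_eq_q N_left_mult flip: ennreal_mult)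
  qed
  have "(q (a * x))\<^sup>2 \<le> (norm a)\<^sup>2 * (q x)\<^sup>2"
  proof (cases "q x = 0")
    case True
    then show ?thesis using * [of "(norm a)\<^sup>2 + 1"] by simp
  next
    case False
    then have "(q (a * x))\<^sup>2 / (q x)\<^sup>2 \<le> r" if "(norm a)\<^sup>2 < r" for r
      using *[OF that] by (simp add: pos_divide_le_eq)
    then have "(q (a * x))\<^sup>2 / (q x)\<^sup>2 \<le> (norm a)\<^sup>2" by (rule dense_ge)
    then show ?thesis using False by (simp add: pos_divide_le_eq)
  qed
  then have "(q (a * x))\<^sup>2 \<le> (norm a * q x)\<^sup>2" by (simp add: power_mult_distrib)
  then show ?thesis by (rule power2_le_imp_le) simp
qed

section \<open>The linear extension of the weight\<close>

definition Mpos :: "'a set" where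
  "Mpos = {p \<in> pos_cone. \<psi> p < \<infinity>}"

lemma Mpos_N:
  assumes "p \<in> Mpos"
  shows "p \<in> \<N> \<psi>"
proof -
  obtain b where b: "p = star b * b" using assms by (auto simp: Mpos_def pos_cone_def)
  then have "b \<in> \<N> \<psi>" using assms by (auto simp: Mpos_def weight_null_def)
  then show ?thesis unfolding b by (rule N_left_mult)
qed

lemma Mpos_star_mult: "a \<in> \<N> \<psi> \<Longrightarrow> star a * a \<in> Mpos"
  by (auto simp: Mpos_def weight_null_def)

lemma Mpos_zero: "0 \<in> Mpos"
  by (simp add: Mpos_def psi_zero)

lemma Mpos_add: "a \<in> Mpos \<Longrightarrow> b \<in> Mpos \<Longrightarrow> a + b \<in> Mpos"
  by (auto simp: Mpos_def psi_add pos_add)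

lemma Mpos_scaleR: "a \<in> Mpos \<Longrightarrow> 0 \<le> r \<Longrightarrow> r *\<^sub>R a \<in> Mpos"
  by (auto simp: Mpos_def psi_scaleR pos_cone_scaleR ennreal_mult_less_top)

text \<open>The extension is first built as a relation: \<open>rep z v\<close> says that v is the
  value computed from some decomposition of z into four elements of \<open>Mpos\<close>. Once the
  relation is known to be single-valued and linear, it yields the function that the description in
  \<open>weight_ext\<close> selects.\<close>

definition real_rep :: "'a \<Rightarrow> real \<Rightarrow> bool" where
  "real_rep x r \<longleftrightarrow>
     (\<exists>p\<in>Mpos. \<exists>p'\<in>Mpos. x = p - p' \<and> r = enn2real (\<psi> p) - enn2real (\<psi> p'))"

definition rep :: "'a \<Rightarrow> complex \<Rightarrow> bool" where
  "rep z v \<longleftrightarrow> (\<exists>x y. real_rep x (Re v) \<and> real_rep y (Im v) \<and> z = x + \<i> *\<^sub>C y)"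

lemma enn2real_psi_add:
  "p \<in> Mpos \<Longrightarrow> p' \<in> Mpos \<Longrightarrow> enn2real (\<psi> (p + p')) = enn2real (\<psi> p) + enn2real (\<psi> p')"
  by (auto simp: Mpos_def psi_add enn2real_plus)

lemma enn2real_psi_scaleR:
  "p \<in> Mpos \<Longrightarrow> 0 \<le> r \<Longrightarrow> enn2real (\<psi> (r *\<^sub>R p)) = r * enn2real (\<psi> p)"
  by (auto simp: Mpos_def psi_scaleR enn2real_mult)

lemma real_rep_selfadjoint: "real_rep x r \<Longrightarrow> star x = x"
  by (auto simp: real_rep_def Mpos_def star_diff pos_cone_selfadjoint)

lemma real_rep_unique:
  assumes "real_rep x r" "real_rep x s"
  shows "r = s"
proof -
  obtain p p' where p: "p \<in> Mpos" "p' \<in> Mpos" "x = p - p'" "r = enn2real (\<psi> p) - enn2real (\<psi> p')"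
    using assms(1) by (auto simp: real_rep_def)
  obtain k k' where k: "k \<in> Mpos" "k' \<in> Mpos" "x = k - k'" "s = enn2real (\<psi> k) - enn2real (\<psi> k')"
    using assms(2) by (auto simp: real_rep_def)
  have "p + k' = k + p'" using p(3) k(3) by (simp add: algebra_simps)
  then show ?thesis
    using enn2real_psi_add[OF p(1) k(2)] enn2real_psi_add[OF k(1) p(2)] p(4) k(4) by simp
qed

lemma real_rep_add: "real_rep x r \<Longrightarrow> real_rep y s \<Longrightarrow> real_rep (x + y) (r + s)"
  unfolding real_rep_def
  apply clarify
  subgoal for p k p' k'
    by (rule bexI[of _ "p + k"], rule bexI[of _ "p' + k'"]) (auto simp: Mpos_add enn2real_psi_add)
  done

lemma real_rep_minus: "real_rep x r \<Longrightarrow> real_rep (- x) (- r)"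
  unfolding real_rep_def by (metis minus_diff_eq)

lemma real_rep_scaleR: "real_rep x r \<Longrightarrow> real_rep (s *\<^sub>R x) (s * r)"
proof -
  have *: "real_rep (s *\<^sub>R x) (s * r)" if "real_rep x r" "s \<ge> 0" for x r s
    using that unfolding real_rep_def
    by (metis Mpos_scaleR enn2real_psi_scaleR right_diff_distrib scaleR_right_diff_distrib)
  assume "real_rep x r"
  then show ?thesis
    using *[of x r s] real_rep_minus[OF *[of x r "- s"]] by (cases "s \<ge> 0") auto
qed

lemma real_rep_Mpos: "p \<in> Mpos \<Longrightarrow> real_rep p (enn2real (\<psi> p))"
  unfolding real_rep_def by (intro bexI[of _ p] bexI[of _ 0]) (auto simp: Mpos_zero psi_zero)

lemma rep_unique:
  assumes "rep z v" "rep z v'"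
  shows "v = v'"
proof -
  obtain x y where 1: "real_rep x (Re v)" "real_rep y (Im v)" "z = x + \<i> *\<^sub>C y"
    using assms(1) by (auto simp: rep_def)
  obtain x' y' where 2: "real_rep x' (Re v')" "real_rep y' (Im v')" "z = x' + \<i> *\<^sub>C y'"
    using assms(2) by (auto simp: rep_def)
  have "x = x'" "y = y'"
    using selfadjoint_parts_unique[of x y x' y'] 1 2 real_rep_selfadjoint by metis+
  then show ?thesis using 1 2 real_rep_unique by (auto simp: complex_eq_iff)
qed

lemma rep_add: "rep z v \<Longrightarrow> rep z' v' \<Longrightarrow> rep (z + z') (v + v')"
  unfolding rep_def
  apply clarify
  subgoal for x x' y y'
    by (rule exI[of _ "x + x'"], rule exI[of _ "y + y'"])
      (auto intro: real_rep_add simp: scaleC_add_right)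
  done

lemma scaleC_cartesian:
  "c *\<^sub>C (x + \<i> *\<^sub>C y) = (Re c *\<^sub>R x - Im c *\<^sub>R y) + \<i> *\<^sub>C (Im c *\<^sub>R x + Re c *\<^sub>R (y :: 'a))"
proof -
  have "c *\<^sub>C (x + \<i> *\<^sub>C y) = (of_real (Re c) + \<i> * of_real (Im c)) *\<^sub>C x
      + (\<i> * of_real (Re c) + (- of_real (Im c))) *\<^sub>C y"
    by (subst (1) complex_eq[of c]) (simp add: scaleC_add_right scaleC_scaleC algebra_simps)
  also have "\<dots> = of_real (Re c) *\<^sub>C x + \<i> *\<^sub>C of_real (Im c) *\<^sub>C x
      + (\<i> *\<^sub>C of_real (Re c) *\<^sub>C y - of_real (Im c) *\<^sub>C y)"
    unfolding scaleC_scaleC by (simp only: scaleC_add_left complex_vector.scale_minus_left) simp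
  finally show ?thesis
    unfolding scaleC_of_real scaleC_add_right by (simp add: algebra_simps)
qed

lemma rep_scaleC:
  assumes "rep z v"
  shows "rep (c *\<^sub>C z) (c * v)"
proof -
  obtain x y where xy: "real_rep x (Re v)" "real_rep y (Im v)" "z = x + \<i> *\<^sub>C y"
    using assms by (auto simp: rep_def)
  have "real_rep (Re c *\<^sub>R x - Im c *\<^sub>R y) (Re c * Re v - Im c * Im v)"
    using real_rep_add[OF real_rep_scaleR[OF xy(1)] real_rep_minus[OF real_rep_scaleR[OF xy(2)]]] by simp
  moreover have "real_rep (Im c *\<^sub>R x + Re c *\<^sub>R y) (Im c * Re v + Re c * Im v)"
    using real_rep_add[OF real_rep_scaleR[OF xy(1)] real_rep_scaleR[OF xy(2)]] .
  ultimately show ?thesis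
    unfolding rep_def xy(3) scaleC_cartesian
    by (intro exI[of _ "Re c *\<^sub>R x - Im c *\<^sub>R y"] exI[of _ "Im c *\<^sub>R x + Re c *\<^sub>R y"]) (simp add: add.commute)
qed

lemma rep_Mpos: "p \<in> Mpos \<Longrightarrow> rep p (of_real (enn2real (\<psi> p)))"
  unfolding rep_def using real_rep_Mpos[of p] real_rep_Mpos[OF Mpos_zero]
  by (intro exI[of _ p] exI[of _ 0]) (auto simp: psi_zero)

lemma rep_star: "rep z v \<Longrightarrow> rep (star z) (cnj v)"
  unfolding rep_def
  apply clarify
  subgoal for x y
    by (rule exI[of _ x], rule exI[of _ "- y"])
      (auto simp: star_add star_scaleC real_rep_selfadjoint intro: real_rep_minus)
  done

lemma rep_star_mult:
  assumes "a \<in> \<N> \<psi>" "b \<in> \<N> \<psi>"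
  shows "\<exists>v. rep (star a * b) v"
proof -
  \<comment> \<open>The right-hand side of the polarization identity, with differences written as
    multiples by - 1 so that the rules for sums and scalar multiples apply verbatim.\<close>
  define X where "X = star (a + b) * (a + b) + (- 1) *\<^sub>C (star (a - b) * (a - b))
    + \<i> *\<^sub>C (star (a - \<i> *\<^sub>C b) * (a - \<i> *\<^sub>C b) + (- 1) *\<^sub>C (star (a + \<i> *\<^sub>C b) * (a + \<i> *\<^sub>C b)))"
  note m = rep_Mpos[OF Mpos_star_mult]
  note ib = assms(1) N_scaleC[OF assms(2), of \<i>]
  have "\<exists>v. rep X v"
    unfolding X_def
    using rep_add[OF rep_add[OF m[OF N_add[OF assms]] rep_scaleC[OF m[OF N_diff[OF assms]], of "- 1"]]
        rep_scaleC[OF rep_add[OF m[OF N_diff[OF ib]] rep_scaleC[OF m[OF N_add[OF ib]], of "- 1"]], of \<i>]]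
    by blast
  then have "\<exists>v. rep ((1/4) *\<^sub>C X) v"
    using rep_scaleC by blast
  moreover have "X = 4 *\<^sub>C (star a * b)"
    unfolding polarization_star X_def by (simp only: scaleC_minus_one) simp
  ultimately show ?thesis by (simp add: scaleC_scaleC)
qed

text \<open>Polarization decomposes the generators star a * b into elements of \<open>Mpos\<close>;
  conversely each p in \<open>Mpos\<close> is star b * b with b of finite weight, hence itself a
  generator.\<close>

lemma weight_dom_iff: "z \<in> weight_dom \<psi> \<longleftrightarrow> (\<exists>v. rep z v)"
proof
  assume "z \<in> weight_dom \<psi>"
  then show "\<exists>v. rep z v"
    unfolding weight_dom_def
  proof (induction rule: complex_vector.span_induct_alt)
    case base
    then show ?case using rep_Mpos[OF Mpos_zero] by blast
  next
    case (step c x y)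
    then obtain a b where "x = star a * b" "a \<in> \<N> \<psi>" "b \<in> \<N> \<psi>" by blast
    then show ?case using rep_star_mult rep_scaleC rep_add step by metis
  qed
next
  have M: "p \<in> weight_dom \<psi>" if p: "p \<in> Mpos" for p
  proof -
    obtain b where b: "p = star b * b" using p by (auto simp: Mpos_def pos_cone_def)
    then have "b \<in> \<N> \<psi>" using p by (auto simp: Mpos_def weight_null_def)
    then show ?thesis unfolding weight_dom_def b by (intro complex_vector.span_base) auto
  qed
  assume "\<exists>v. rep z v"
  then show "z \<in> weight_dom \<psi>"
    unfolding rep_def real_rep_def
    using M unfolding weight_dom_def
    by (auto intro!: complex_vector.span_add complex_vector.span_diff complex_vector.span_scale)
qed

text \<open>The clauses of the description force the value of any candidate on a representable
  element, and the function read off from \<open>rep\<close> satisfies them. So the description is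
  met exactly once and \<open>THE\<close> returns that function.\<close>

lemma weight_ext_rep: "rep z v \<Longrightarrow> weight_ext \<psi> z = v"
proof -
  define P where "P = (\<lambda>L. (\<forall>a\<in>weight_dom \<psi>. \<forall>b\<in>weight_dom \<psi>. L (a + b) = L a + L b) \<and>
     (\<forall>z. \<forall>a\<in>weight_dom \<psi>. L (z *\<^sub>C a) = z * L a) \<and>
     (\<forall>a\<in>pos_cone. \<psi> a < \<infinity> \<longrightarrow> L a = complex_of_real (enn2real (\<psi> a))) \<and>
     (\<forall>a. a \<notin> weight_dom \<psi> \<longrightarrow> L a = (0 :: complex)))"
  have val: "L z = v" if L: "P L" and "rep z v" for L z v
  proof -
    have M: "p \<in> weight_dom \<psi>" "L p = of_real (enn2real (\<psi> p))" if "p \<in> Mpos" for p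
      using L that rep_Mpos[OF that] weight_dom_iff unfolding P_def Mpos_def by auto
    have neg: "- p \<in> weight_dom \<psi>" "L (- p) = - L p" if "p \<in> weight_dom \<psi>" for p
    proof -
      have "L ((- 1) *\<^sub>C p) = (- 1) * L p"
        using L that unfolding P_def by blast
      then show "L (- p) = - L p" unfolding scaleC_minus_one by simp
      show "- p \<in> weight_dom \<psi>"
        using that unfolding weight_dom_def by (rule complex_vector.span_neg)
    qed
    have rr: "x \<in> weight_dom \<psi> \<and> L x = of_real r" if "real_rep x r" for x r
    proof -
      obtain p p' where p: "p \<in> Mpos" "p' \<in> Mpos" "x = p + - p'" "r = enn2real (\<psi> p) - enn2real (\<psi> p')"
        using \<open>real_rep x r\<close> by (auto simp: real_rep_def)
      have "L x = L p + L (- p')" unfolding p(3)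
        using L p M neg unfolding P_def by blast
      moreover have "x \<in> weight_dom \<psi>" unfolding p(3)
        using p M(1) neg(1) complex_vector.span_add unfolding weight_dom_def by blast
      ultimately show ?thesis using p M neg by simp
    qed
    obtain x y where xy: "real_rep x (Re v)" "real_rep y (Im v)" "z = x + \<i> *\<^sub>C y"
      using \<open>rep z v\<close> by (auto simp: rep_def)
    have "\<i> *\<^sub>C y \<in> weight_dom \<psi>" "L (\<i> *\<^sub>C y) = \<i> * of_real (Im v)"
      using rr[OF xy(2)] L complex_vector.span_scale unfolding weight_dom_def P_def by auto
    then have "L z = of_real (Re v) + \<i> * of_real (Im v)"
      using L rr[OF xy(1)] unfolding xy(3) P_def by auto
    then show ?thesis by (simp flip: complex_eq)
  qed
  define L where "L = (\<lambda>z. if z \<in> weight_dom \<psi> then THE v. rep z v else 0)"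
  have L: "L z = v" if "rep z v" for z v
    using that rep_unique weight_dom_iff by (auto simp: L_def intro!: the_equality)
  have "P L"
    unfolding P_def
  proof (intro conjI allI ballI impI)
    show "L (a + b) = L a + L b" if "a \<in> weight_dom \<psi>" "b \<in> weight_dom \<psi>" for a b
      using that L rep_add unfolding weight_dom_iff by metis
    show "L (z *\<^sub>C a) = z * L a" if "a \<in> weight_dom \<psi>" for z a
      using that L rep_scaleC unfolding weight_dom_iff by metis
    show "L a = of_real (enn2real (\<psi> a))" if "a \<in> pos_cone" "\<psi> a < \<infinity>" for a
      using that by (intro L rep_Mpos) (auto simp: Mpos_def)
    show "L a = 0" if "a \<notin> weight_dom \<psi>" for a using that by (simp add: L_def)
  qed
  moreover have "L' = L" if "P L'" for L'
  proof
    show "L' z = L z" for z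
    proof (cases "z \<in> weight_dom \<psi>")
      case True
      then obtain v where "rep z v" using weight_dom_iff by blast
      then show ?thesis using val[OF that] L by simp
    next
      case False
      then show ?thesis using that \<open>P L\<close> by (simp add: P_def)
    qed
  qed
  ultimately have "weight_ext \<psi> = L"
    unfolding weight_ext_def P_def[symmetric] by (rule the_equality)
  then show "weight_ext \<psi> z = v" if "rep z v" using that L by simp
qed

abbreviation L :: "'a \<Rightarrow> complex" where "L \<equiv> weight_ext \<psi>"

lemma dom_star_mult [intro]: "a \<in> \<N> \<psi> \<Longrightarrow> b \<in> \<N> \<psi> \<Longrightarrow> star a * b \<in> weight_dom \<psi>"
  using rep_star_mult weight_dom_iff by blast

lemma dom_mult: "star a \<in> \<N> \<psi> \<Longrightarrow> b \<in> \<N> \<psi> \<Longrightarrow> a * b \<in> weight_dom \<psi>"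
  using dom_star_mult[of "star a" b] by (simp add: star_star)

lemma dom_add: "a \<in> weight_dom \<psi> \<Longrightarrow> b \<in> weight_dom \<psi> \<Longrightarrow> a + b \<in> weight_dom \<psi>"
  unfolding weight_dom_def by (rule complex_vector.span_add)

lemma dom_scaleC: "a \<in> weight_dom \<psi> \<Longrightarrow> z *\<^sub>C a \<in> weight_dom \<psi>"
  unfolding weight_dom_def by (rule complex_vector.span_scale)

lemma dom_minus: "a \<in> weight_dom \<psi> \<Longrightarrow> - a \<in> weight_dom \<psi>"
  unfolding weight_dom_def by (rule complex_vector.span_neg)

lemma L_add: "a \<in> weight_dom \<psi> \<Longrightarrow> b \<in> weight_dom \<psi> \<Longrightarrow> L (a + b) = L a + L b"
  using weight_ext_rep rep_add weight_dom_iff by metis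

lemma L_scaleC: "a \<in> weight_dom \<psi> \<Longrightarrow> L (z *\<^sub>C a) = z * L a"
  using weight_ext_rep rep_scaleC weight_dom_iff by metis

lemma L_minus: "a \<in> weight_dom \<psi> \<Longrightarrow> L (- a) = - L a"
  using L_scaleC[of a "- 1"] by (simp add: scaleC_minus_one)

lemma L_diff: "a \<in> weight_dom \<psi> \<Longrightarrow> b \<in> weight_dom \<psi> \<Longrightarrow> L (a - b) = L a - L b"
  using L_add[of a "- b"] by (simp add: dom_minus L_minus)

lemma L_star: "a \<in> weight_dom \<psi> \<Longrightarrow> L (star a) = cnj (L a)"
  using weight_ext_rep rep_star weight_dom_iff by metis

lemma L_zero [simp]: "L 0 = 0"
  using weight_ext_rep[OF rep_Mpos[OF Mpos_zero]] by (simp add: psi_zero)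

lemma L_Mpos: "p \<in> Mpos \<Longrightarrow> L p = of_real (enn2real (\<psi> p))"
  by (intro weight_ext_rep rep_Mpos)

lemma L_star_mult_self: "a \<in> \<N> \<psi> \<Longrightarrow> L (star a * a) = of_real ((q a)\<^sup>2)"
  by (simp add: L_Mpos Mpos_star_mult psi_eq_q)

text \<open>A positive linear map that preserves the weight carries decompositions to decompositions
  of the same value. The abstract form serves both the action of the KMS condition and the gauge
  action of \<open>c\<^sub>0\<close>.\<close>

lemma L_invariant:
  assumes \<Phi>: "\<And>a b. \<Phi> (a + b) = \<Phi> a + \<Phi> b" "\<And>z a. \<Phi> (z *\<^sub>C a) = z *\<^sub>C \<Phi> a"
    "\<And>p. p \<in> pos_cone \<Longrightarrow> \<Phi> p \<in> pos_cone" "\<And>p. p \<in> pos_cone \<Longrightarrow> \<psi> (\<Phi> p) = \<psi> p"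
    and z: "z \<in> weight_dom \<psi>"
  shows "L (\<Phi> z) = L z"
proof -
  have diff: "\<Phi> (a - b) = \<Phi> a - \<Phi> b" for a b
    using \<Phi>(1)[of a "(- 1) *\<^sub>C b"] unfolding \<Phi>(2) by (simp add: scaleC_minus_one)
  have M: "\<Phi> p \<in> Mpos" if "p \<in> Mpos" for p using that \<Phi> by (auto simp: Mpos_def)
  have rr: "real_rep (\<Phi> x) r" if rx: "real_rep x r" for x r
  proof -
    obtain p p' where p: "p \<in> Mpos" "p' \<in> Mpos" "x = p - p'" "r = enn2real (\<psi> p) - enn2real (\<psi> p')"
      using rx by (auto simp: real_rep_def)
    then show ?thesis
      unfolding real_rep_def using M[OF p(1)] M[OF p(2)] \<Phi>(4)
      by (intro bexI[of _ "\<Phi> p"] bexI[of _ "\<Phi> p'"]) (auto simp: diff Mpos_def)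
  qed
  obtain v where v: "rep z v" using z weight_dom_iff by blast
  have "rep (\<Phi> z) v"
    using v unfolding rep_def by (metis rr \<Phi>(1,2))
  then show ?thesis using v weight_ext_rep by simp
qed

lemma Cauchy_Schwarz:
  assumes a: "a \<in> \<N> \<psi>" and b: "b \<in> \<N> \<psi>"
  shows "cmod (L (star a * b)) \<le> q a * q b"
proof -
  define l where "l = L (star a * b)"
  have quad: "0 \<le> (q a)\<^sup>2 + 2 * Re (c * l) + (cmod c)\<^sup>2 * (q b)\<^sup>2" for c
  proof -
    define x where "x = a + c *\<^sub>C b"
    have x: "x \<in> \<N> \<psi>" using a b by (simp add: x_def N_add N_scaleC)
    have "star x * x = (star a * a + c *\<^sub>C (star a * b)) + (cnj c *\<^sub>C star (star a * b) + (cnj c * c) *\<^sub>C (star b * b))"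
      by (simp add: x_def star_add star_scaleC star_mult star_star mult_scaleC_left mult_scaleC_right
          algebra_simps scaleC_add_right scaleC_scaleC)
    then have "L (star x * x) = (L (star a * a) + c * l) + (cnj c * cnj l + cnj c * c * L (star b * b))"
      using a b dom_star_mult[OF b a]
      by (simp add: L_add L_scaleC dom_add dom_scaleC dom_star_mult l_def star_mult star_star
          L_star[OF dom_star_mult[OF a b], unfolded star_mult star_star])
    then have "Re (L (star x * x)) = (q a)\<^sup>2 + 2 * Re (c * l) + (cmod c)\<^sup>2 * (q b)\<^sup>2"
      unfolding L_star_mult_self[OF a] L_star_mult_self[OF b]
      by (simp add: cmod_power2 power2_eq_square[of "Re c"] power2_eq_square[of "Im c"] algebra_simps)
    moreover have "0 \<le> Re (L (star x * x))" by (simp add: L_star_mult_self x)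
    ultimately show ?thesis by simp
  qed
  have quad': "0 \<le> (q a)\<^sup>2 - 2 * t * cmod l + t\<^sup>2 * (q b)\<^sup>2" for t
  proof (cases "l = 0")
    case False
    \<comment> \<open>The phase rotates l onto the negative real axis, so that only the modulus of l
      remains in the quadratic inequality.\<close>
    define c where "c = - of_real t * cnj l / of_real (cmod l)"
    have "cnj l * l = of_real ((cmod l)\<^sup>2)" using complex_norm_square[of l] by (simp add: mult.commute)
    then have "c * l = - of_real (t * cmod l)"
      using False by (simp add: c_def power2_eq_square mult.assoc)
    moreover have "(cmod c)\<^sup>2 = t\<^sup>2"
      using False by (simp add: c_def norm_mult norm_divide)
    ultimately show ?thesis using quad[of c] by simp
  qed (use quad[of 0] in simp)
  have "cmod l \<le> q a * q b"
  proof (cases "q b = 0")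
    case True
    then show ?thesis
      \<comment> \<open>With q b = 0 the quadratic is linear in t, and this t would make it equal to
        - 1.\<close>
      using quad'[of "((q a)\<^sup>2 + 1) / (2 * cmod l)"] by (cases "l = 0") auto
  next
    case False
    \<comment> \<open>The substituted t is the minimum of the quadratic.\<close>
    then have "0 \<le> ((q a)\<^sup>2 - 2 * (cmod l / (q b)\<^sup>2) * cmod l + (cmod l / (q b)\<^sup>2)\<^sup>2 * (q b)\<^sup>2) * (q b)\<^sup>2"
      using quad'[of "cmod l / (q b)\<^sup>2"] by simp
    also have "\<dots> = (q a * q b)\<^sup>2 - (cmod l)\<^sup>2"
      using False by (simp add: field_simps power2_eq_square)
    finally have "(cmod l)\<^sup>2 \<le> (q a * q b)\<^sup>2" by simp
    then show ?thesis by (rule power2_le_imp_le) simp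
  qed
  then show ?thesis by (simp add: l_def)
qed

section \<open>Triangle inequality, lower semicontinuity and completeness of the seminorm\<close>

lemma L_mult_bound: "star a \<in> \<N> \<psi> \<Longrightarrow> b \<in> \<N> \<psi> \<Longrightarrow> cmod (L (a * b)) \<le> q (star a) * q b"
  using Cauchy_Schwarz[of "star a" b] by (simp add: star_star)

lemma q_add:
  assumes "a \<in> \<N> \<psi>" "b \<in> \<N> \<psi>"
  shows "q (a + b) \<le> q a + q b"
proof -
  have ab: "a + b \<in> \<N> \<psi>" using assms by (rule N_add)
  have "star (a + b) * (a + b) = (star a * a + star a * b) + (star (star a * b) + star b * b)"
    by (simp add: star_add star_mult star_star algebra_simps)
  then have "L (star (a + b) * (a + b)) = (L (star a * a) + L (star a * b)) + (cnj (L (star a * b)) + L (star b * b))"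
    using assms dom_star_mult[OF assms(2,1)]
    by (simp add: L_add dom_add dom_star_mult star_mult star_star
        L_star[OF dom_star_mult[OF assms], unfolded star_mult star_star])
  from arg_cong[OF this, of Re]
  have "(q (a + b))\<^sup>2 = (q a)\<^sup>2 + 2 * Re (L (star a * b)) + (q b)\<^sup>2"
    unfolding L_star_mult_self[OF assms(1)] L_star_mult_self[OF assms(2)] L_star_mult_self[OF ab]
    by (simp only: plus_complex.sel Re_complex_of_real cnj.simps algebra_simps mult_2)
  also have "Re (L (star a * b)) \<le> q a * q b"
    using Cauchy_Schwarz[OF assms] complex_Re_le_cmod order_trans by blast
  finally have "(q (a + b))\<^sup>2 \<le> (q a + q b)\<^sup>2"
    by (simp add: power2_sum)
  then show ?thesis by (rule power2_le_imp_le) simp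
qed

lemma q_scaleC: "a \<in> \<N> \<psi> \<Longrightarrow> q (z *\<^sub>C a) = cmod z * q a"
  by (simp add: q_def star_mult_self_scaleC psi_scaleR enn2real_mult real_sqrt_mult)

lemma q_scaleR: "a \<in> \<N> \<psi> \<Longrightarrow> q (r *\<^sub>R a) = \<bar>r\<bar> * q a"
  using q_scaleC[of a "of_real r"] by (simp add: scaleC_of_real)

lemma q_minus: "q (- a) = q a"
  by (simp add: q_def star_minus)

lemma q_minus_commute: "q (a - b) = q (b - a)"
  using q_minus[of "a - b"] by simp

lemma q_zero [simp]: "q 0 = 0"
  by (simp add: q_def psi_zero)

lemma q_sum: "(\<And>i. i \<in> I \<Longrightarrow> f i \<in> \<N> \<psi>) \<Longrightarrow> q (sum f I) \<le> (\<Sum>i\<in>I. q (f i))"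
proof (induction I rule: infinite_finite_induct)
  case (insert i I)
  then have "q (f i + sum f I) \<le> q (f i) + q (sum f I)"
    by (intro q_add N_sum) auto
  with insert show ?case by auto
qed auto

text \<open>The sublevel sets of the weight are closed, and a maps continuously to star a * a. A
  uniform bound on the seminorm along a norm convergent sequence thus proves that the limit has
  finite weight.\<close>

lemma q_lower_semicontinuous:
  assumes f: "f \<longlonglongrightarrow> a" and N: "\<And>n. f n \<in> \<N> \<psi>" "\<And>n. q (f n) \<le> B"
  shows "a \<in> \<N> \<psi>" "q a \<le> B"
proof -
  have B: "0 \<le> B" using N(2)[of 0] q_nonneg order_trans by blast
  have "star a * a \<in> {a \<in> pos_cone. \<psi> a \<le> ennreal (B\<^sup>2)}"
  proof (rule closed_sequentially[OF psi_closed])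
    show "(\<lambda>n. star (f n) * f n) \<longlonglongrightarrow> star a * a" by (intro tendsto_intros f)
    show "star (f n) * f n \<in> {a \<in> pos_cone. \<psi> a \<le> ennreal (B\<^sup>2)}" for n
      using N[of n] by (simp add: psi_eq_q power_mono)
  qed (use B in auto)
  then have *: "\<psi> (star a * a) \<le> ennreal (B\<^sup>2)" by simp
  then show a: "a \<in> \<N> \<psi>" by (rule mem_N_I)
  show "q a \<le> B" using * B unfolding psi_eq_q[OF a] by (simp add: abs_le_square_iff[symmetric])
qed

text \<open>Fix n and let m tend to infinity in f n - f m: lower semicontinuity bounds the seminorm
  of f n minus the norm limit. So a norm limit of a sequence that is Cauchy for \<open>q\<close> is
  also its limit for \<open>q\<close>.\<close>

lemma q_complete:
  assumes f: "f \<longlonglongrightarrow> a" and N: "\<And>n. f n \<in> \<N> \<psi>"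
    and Cauchy: "\<And>e. e > 0 \<Longrightarrow> \<exists>M. \<forall>m\<ge>M. \<forall>n\<ge>M. q (f m - f n) \<le> e"
  shows "a \<in> \<N> \<psi>" "(\<lambda>n. q (f n - a)) \<longlonglongrightarrow> 0"
proof -
  have *: "\<exists>M. \<forall>n\<ge>M. f n - a \<in> \<N> \<psi> \<and> q (f n - a) \<le> e" if "e > 0" for e
  proof -
    obtain M where M: "q (f m - f n) \<le> e" if "m \<ge> M" "n \<ge> M" for m n
      using Cauchy[OF \<open>e > 0\<close>] by blast
    have "f n - a \<in> \<N> \<psi> \<and> q (f n - a) \<le> e" if "n \<ge> M" for n
    proof (intro conjI)
      have lim: "(\<lambda>m. f n - f (m + M)) \<longlonglongrightarrow> f n - a"
        by (intro tendsto_intros LIMSEQ_ignore_initial_segment f)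
      show "f n - a \<in> \<N> \<psi>" "q (f n - a) \<le> e"
        by (rule q_lower_semicontinuous[OF lim, of e]; use M that N N_diff in auto)+
    qed
    then show ?thesis by blast
  qed
  obtain n where "f n - a \<in> \<N> \<psi>" using *[of 1] by auto
  then show "a \<in> \<N> \<psi>" using N_diff[OF N[of n], of "f n - a"] by simp
  show "(\<lambda>n. q (f n - a)) \<longlonglongrightarrow> 0"
  proof (rule LIMSEQ_I)
    fix e :: real assume "e > 0"
    then obtain M where "\<forall>n\<ge>M. q (f n - a) \<le> e / 2" using *[of "e / 2"] by auto
    then show "\<exists>M. \<forall>n\<ge>M. norm (q (f n - a) - 0) < e" using \<open>e > 0\<close> by force
  qed
qed

section \<open>Right multiplication and the spectral radius\<close>

definition NN :: "'a set" where
  "NN = \<N> \<psi> \<inter> star ` \<N> \<psi>"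

lemma mem_NN: "a \<in> NN \<longleftrightarrow> a \<in> \<N> \<psi> \<and> star a \<in> \<N> \<psi>"
  unfolding NN_def by (metis (no_types, lifting) IntI IntE imageE image_eqI star_star)

lemma NN_star: "a \<in> NN \<Longrightarrow> star a \<in> NN"
  by (simp add: mem_NN star_star)

lemma NN_mult: "star a \<in> \<N> \<psi> \<Longrightarrow> b \<in> \<N> \<psi> \<Longrightarrow> a * b \<in> NN"
  by (simp add: mem_NN star_mult N_left_mult)

lemma NN_mult': "a \<in> NN \<Longrightarrow> b \<in> NN \<Longrightarrow> a * b \<in> NN"
  by (auto simp: mem_NN star_mult intro: N_left_mult)

text \<open>Right multiplication \<open>T\<close> by \<open>y\<close> satisfies \<open>\<parallel>T \<xi>\<parallel>\<^sup>2 \<le> \<parallel>\<xi>\<parallel> \<parallel>R \<xi>\<parallel>\<close> with the symmetric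
  operator \<open>R\<close> of right multiplication by \<open>y w\<^sup>*\<close>, and iterating \<open>\<parallel>R \<xi>\<parallel>\<^sup>2 \<le> \<parallel>\<xi>\<parallel> \<parallel>R\<^sup>2 \<xi>\<parallel>\<close>
  bounds \<open>R\<close> by the spectral radius of \<open>y w\<^sup>*\<close>.\<close>

lemma right_mult_bound:
  assumes y: "star y = y" "y \<in> \<N> \<psi>" and w: "w \<in> NN"
    and shift: "\<And>x. x \<in> NN \<Longrightarrow> L (x * y) = L (w * x)"
    and a: "a \<in> \<N> \<psi>"
  shows "(q (a * y))\<^sup>2 \<le> (q a)\<^sup>2 * (norm y * norm w)"
proof -
  have yNN: "y \<in> NN" using y by (simp add: mem_NN)
  \<comment> \<open>The adjoint of the hypothesis: \<open>star w\<close> on the right may be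
    exchanged for y on the left.\<close>
  have shift': "L (x * star w) = L (y * x)" if "x \<in> NN" for x
  proof -
    have "L (star (star x * y)) = L (star (w * star x))"
      using shift[OF NN_star[OF that]] that w yNN
      by (subst (1 2) L_star) (auto intro!: dom_mult simp: mem_NN star_star)
    then show ?thesis by (simp add: star_mult star_star y)
  qed
  define v where "v = y * star w"
  have v: "v \<in> NN" "star v = w * y"
    using w yNN by (auto simp: v_def star_mult star_star y intro!: NN_mult' NN_star)
  have v_shift: "L (x * v) = L (star v * x)" if x: "x \<in> NN" for x
  proof -
    have "L (x * v) = L ((x * y) * star w)" by (simp add: v_def mult.assoc)
    also have "\<dots> = L ((y * x) * y)"
      using shift'[of "x * y"] x yNN by (simp add: NN_mult' mult.assoc)
    also have "\<dots> = L (star v * x)"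
      using shift[of "y * x"] x yNN by (simp add: NN_mult' mult.assoc v)
    finally show ?thesis .
  qed
  define V where "V = rec_nat v (\<lambda>_ u. u * u)"
  have V0: "V 0 = v" and VS: "V (Suc n) = V n * V n" for n by (simp_all add: V_def)
  \<comment> \<open>V n is the power of v with exponent 2^n; the symmetry survives squaring, so each
    step of the iteration may use it.\<close>
  have V: "V n \<in> NN \<and> (\<forall>x\<in>NN. L (x * V n) = L (star (V n) * x))" for n
  proof (induction n)
    case 0
    then show ?case using v v_shift by (simp add: V0)
  next
    case (Suc n)
    have "L (x * (V n * V n)) = L (star (V n * V n) * x)" if x: "x \<in> NN" for x
    proof -
      have "L (x * (V n * V n)) = L ((x * V n) * V n)" by (simp add: mult.assoc)
      also have "\<dots> = L ((star (V n) * x) * V n)"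
        using Suc NN_mult'[OF x] by (metis mult.assoc)
      also have "\<dots> = L (star (V n) * (star (V n) * x))"
        using Suc x NN_mult' NN_star by blast
      finally show ?thesis by (simp add: star_mult mult.assoc)
    qed
    then show ?case using Suc by (simp add: VS NN_mult')
  qed
  define K where "K = norm v"
  have V_norm: "norm (V n) \<le> K ^ 2 ^ n" for n
  proof (induction n)
    case (Suc n)
    have "norm (V (Suc n)) \<le> norm (V n) * norm (V n)" by (simp add: VS norm_mult_ineq)
    also have "\<dots> \<le> K ^ 2 ^ n * K ^ 2 ^ n" using Suc by (intro mult_mono) (auto simp: K_def)
    finally show ?case by (simp add: mult_2 power_add)
  qed (simp add: V0 K_def)
  \<comment> \<open>One factor v of V n is kept for the seminorm and the other 2^n - 1 factors are
    estimated in norm. Multiplying by K avoids that exponent.\<close>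
  have V_q: "K * q (V n) \<le> K ^ 2 ^ n * q v" for n
  proof (induction n)
    case (Suc n)
    have "K * q (V (Suc n)) \<le> K * (norm (V n) * q (V n))"
      unfolding VS using V[of n] by (intro mult_left_mono q_left_mult) (auto simp: mem_NN K_def)
    also have "\<dots> = norm (V n) * (K * q (V n))" by simp
    also have "\<dots> \<le> K ^ 2 ^ n * (K ^ 2 ^ n * q v)"
      by (rule mult_mono[OF V_norm Suc]) (auto simp: K_def)
    finally show ?case by (simp add: mult_2 power_add)
  qed (simp add: V0)
  define s where "s = (\<lambda>n. q (a * V n))"
  define A where "A = q a"
  \<comment> \<open>Symmetry moves the left factor star (V n) across to the other side, where it
    squares V n; Cauchy-Schwarz then separates a * V (Suc n) from a.\<close>
  have s_step: "(s n)\<^sup>2 \<le> s (Suc n) * A" for n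
  proof -
    have Vn: "V n \<in> NN" "V n \<in> \<N> \<psi>" "star (V n) \<in> \<N> \<psi>" using V[of n] by (auto simp: mem_NN)
    have "star (V n) * star a * a \<in> NN"
      using Vn a by (intro NN_mult) (auto simp: star_mult star_star intro: N_left_mult)
    then have "L (star (V n) * star a * a * V n) = L (star (V n) * (star (V n) * star a * a))"
      using V by blast
    moreover have "star (a * V n) * (a * V n) = star (V n) * star a * a * V n"
      by (simp add: star_mult mult.assoc)
    ultimately have "of_real ((s n)\<^sup>2) = L (star (a * V (Suc n)) * a)"
      using L_star_mult_self[of "a * V n"] Vn
      by (simp add: s_def VS star_mult mult.assoc N_left_mult)
    then have "(s n)\<^sup>2 = cmod (L (star (a * V (Suc n)) * a))"
      by (metis abs_of_nonneg norm_of_real zero_le_power2)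
    also have "\<dots> \<le> s (Suc n) * A"
      unfolding s_def A_def using a V by (intro Cauchy_Schwarz N_left_mult) (auto simp: mem_NN)
    finally show ?thesis .
  qed
  have "star (y * star a * a) \<in> \<N> \<psi>" "y * star a * a \<in> \<N> \<psi>"
    using y a by (auto simp: star_mult star_star mult.assoc intro: N_left_mult)
  then have "L (y * star a * a * y) = L (w * (y * star a * a))"
    by (intro shift) (simp add: mem_NN)
  moreover have "star (a * y) * (a * y) = y * star a * a * y"
    by (simp add: star_mult y mult.assoc)
  ultimately have "of_real ((q (a * y))\<^sup>2) = L (star (a * v) * a)"
    using L_star_mult_self[of "a * y"] y by (simp add: star_mult v mult.assoc N_left_mult)
  then have "(q (a * y))\<^sup>2 = cmod (L (star (a * v) * a))"
    by (metis abs_of_nonneg norm_of_real zero_le_power2)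
  also have "\<dots> \<le> s 0 * A"
    unfolding s_def A_def V0 using a v by (intro Cauchy_Schwarz N_left_mult) (auto simp: mem_NN)
  finally have qs: "(q (a * y))\<^sup>2 \<le> s 0 * A" .
  have A0: "A \<ge> 0" and s0: "s n \<ge> 0" for n by (auto simp: A_def s_def)
  have "s 0 * A \<le> A * K * A"
  proof (cases "A = 0 \<or> K = 0")
    case True
    then show ?thesis
    proof
      assume "K = 0"
      then have "s 0 = 0" by (simp add: s_def V0 K_def)
      then show ?thesis using A0 by (simp add: K_def)
    qed auto
  next
    case False
    then have pos: "A > 0" "K > 0" using A0 by (auto simp: K_def)
    have pow: "(s 0 / A) ^ 2 ^ n \<le> s n / A" for n
    proof (induction n)
      case (Suc n)
      have "(s 0 / A) ^ 2 ^ Suc n = ((s 0 / A) ^ 2 ^ n)\<^sup>2"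
        by (simp add: power_mult[symmetric] mult.commute)
      also have "\<dots> \<le> (s n / A)\<^sup>2"
        using Suc A0 s0 by (intro power_mono) auto
      also have "\<dots> \<le> s (Suc n) / A"
        using s_step[of n] pos by (simp add: power2_eq_square field_simps)
      finally show ?case .
    qed simp
    \<comment> \<open>The crude estimate s n <= norm a * q (V n) costs a constant independent of n,
      and a number whose powers with exponents 2^n stay bounded is at most 1.\<close>
    define C where "C = norm a * q v / (K * A)"
    have bound: "(s 0 / A / K) ^ 2 ^ n \<le> C" for n
    proof -
      have "s n \<le> norm a * q (V n)"
        unfolding s_def using V[of n] by (intro q_left_mult) (auto simp: mem_NN)
      also have "q (V n) \<le> K ^ 2 ^ n * q v / K"
        using V_q[of n] pos by (simp add: field_simps)
      finally have "s n / A \<le> norm a * (K ^ 2 ^ n * q v / K) / A"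
        using pos by (intro divide_right_mono) (auto simp: mult_left_mono)
      then have "(s 0 / A) ^ 2 ^ n \<le> K ^ 2 ^ n * C"
        using pow[of n] by (simp add: C_def field_simps)
      then show ?thesis using pos by (simp add: power_divide[of _ K] field_simps)
    qed
    have "s 0 / A / K \<le> 1"
    proof (rule ccontr)
      assume *: "\<not> s 0 / A / K \<le> 1"
      then obtain n where "C < (s 0 / A / K) ^ n" using real_arch_pow by (meson not_le)
      also have "\<dots> \<le> (s 0 / A / K) ^ 2 ^ n"
        using * by (intro power_increasing) (auto simp: less_imp_le)
      finally show False using bound[of n] by simp
    qed
    then show ?thesis using pos by (simp add: field_simps)
  qed
  also have "\<dots> \<le> A * (norm y * norm w) * A"
    unfolding K_def v_def using norm_mult_ineq[of y "star w"] A0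
    by (intro mult_right_mono mult_left_mono) auto
  finally show ?thesis using qs by (simp add: A_def power2_eq_square mult_ac)
qed

end

section \<open>Gaussian smearing and the KMS condition\<close>

text \<open>The improper integral becomes a series over unit intervals, whose terms decay
  geometrically for Gaussian integrands. The same decomposition is estimated in norm and in the
  seminorm \<open>q\<close>.\<close>

lemma integral_symmetric_interval_sums:
  fixes f :: "real \<Rightarrow> 'b :: banach"
  assumes f: "continuous_on UNIV f"
  shows "integral {- real n..real n} f
    = (\<Sum>k<n. integral {- real (Suc k)..- real k} f + integral {real k..real (Suc k)} f)"
proof (induction n)
  case (Suc n)
  have int: "f integrable_on {a..b}" for a b
    using f by (intro integrable_continuous_real) (rule continuous_on_subset, auto)
  have "integral {- real (Suc n)..real (Suc n)} f
      = integral {- real (Suc n)..- real n} f + integral {- real n..real (Suc n)} f"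
    by (intro Henstock_Kurzweil_Integration.integral_combine[symmetric] int) auto
  also have "integral {- real n..real (Suc n)} f = integral {- real n..real n} f + integral {real n..real (Suc n)} f"
    by (intro Henstock_Kurzweil_Integration.integral_combine[symmetric] int) auto
  finally show ?case unfolding Suc by (simp add: add_ac)
qed simp

lemma gauss_le_geometric:
  assumes "real k \<le> \<bar>t\<bar>"
  shows "exp (- (t\<^sup>2)) \<le> exp (- 1) ^ k"
proof -
  have "real k \<le> (real k)\<^sup>2" by (cases k) (auto simp: power2_eq_square)
  also have "\<dots> \<le> t\<^sup>2" using power_mono[OF assms, of 2] by simp
  finally have "exp (- (t\<^sup>2)) \<le> exp (real k * (- 1))" by simp
  also have "\<dots> = exp (- 1) ^ k" by (rule exp_of_nat_mult)
  finally show ?thesis .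
qed

lemma summable_geometric_exp: "summable (\<lambda>k. C * exp (- 1 :: real) ^ k)"
  by (intro summable_mult summable_geometric) simp

lemma improper_integral_convergent:
  fixes f :: "real \<Rightarrow> 'b :: banach"
  assumes f: "continuous_on UNIV f" and le: "\<And>t. norm (f t) \<le> K * exp (- (t\<^sup>2))"
  shows "convergent (\<lambda>n. integral {- real n..real n} f)"
proof -
  define d where "d = (\<lambda>k. integral {- real (Suc k)..- real k} f + integral {real k..real (Suc k)} f)"
  have K: "K \<ge> 0" using order_trans[OF norm_ge_zero le[of 0]] by simp
  have b: "norm (integral {a..a + 1} f) \<le> K * exp (- 1) ^ k"
    if "\<And>t. t \<in> {a..a + 1} \<Longrightarrow> real k \<le> \<bar>t\<bar>" for a k
  proof -
    have "norm (integral {a..a + 1} f) \<le> (K * exp (- 1) ^ k) * ((a + 1) - a)"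
    proof (rule integral_bound)
      show "continuous_on {a..a + 1} f" using f by (rule continuous_on_subset) auto
      show "norm (f t) \<le> K * exp (- 1) ^ k" if "t \<in> {a..a + 1}" for t
        using le[of t] mult_left_mono[OF gauss_le_geometric K] \<open>\<And>t. t \<in> {a..a + 1} \<Longrightarrow> real k \<le> \<bar>t\<bar>\<close> that
        by (meson order_trans)
    qed simp
    then show ?thesis by simp
  qed
  have "norm (d k) \<le> 2 * K * exp (- 1) ^ k" for k
  proof -
    have "norm (integral {- real (Suc k)..- real k} f) \<le> K * exp (- 1) ^ k"
      using b[of "- real (Suc k)" k] by (auto simp: algebra_simps)
    moreover have "norm (integral {real k..real (Suc k)} f) \<le> K * exp (- 1) ^ k"
      using b[of "real k" k] by (auto simp: algebra_simps)
    ultimately show ?thesis unfolding d_def by (simp add: norm_triangle_le)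
  qed
  then have "summable d"
    by (intro summable_comparison_test'[OF summable_geometric_exp, where N = 0]) auto
  then have "(\<lambda>n. \<Sum>k<n. d k) \<longlonglongrightarrow> suminf d" by (rule summable_LIMSEQ)
  then show ?thesis
    unfolding convergent_def integral_symmetric_interval_sums[OF f] d_def by blast
qed

text \<open>The entire function exp (- z^2) restricted to the horizontal line of height b, where its
  modulus is still a multiple of the real Gaussian.\<close>

definition gauss :: "real \<Rightarrow> real \<Rightarrow> complex" where
  "gauss b t = exp (- ((of_real t + \<i> * of_real b)\<^sup>2))"

lemma norm_gauss: "cmod (gauss b t) = exp (b\<^sup>2) * exp (- (t\<^sup>2))"
  unfolding gauss_def norm_exp_eq_Re
  by (simp add: power2_eq_square algebra_simps flip: exp_add)

lemma cnj_gauss: "cnj (gauss b t) = gauss (- b) t"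
  by (simp add: gauss_def exp_cnj)

lemma gauss_zero: "gauss 0 t = of_real (exp (- (t\<^sup>2)))"
  by (simp add: gauss_def flip: exp_of_real)

lemma continuous_gauss [continuous_intros]: "continuous_on S (gauss b)"
  unfolding gauss_def by (intro continuous_intros)

section \<open>Contour shifts in the strip\<close>

lemma convex_strip: "convex (strip \<beta>)"
proof -
  have "strip \<beta> = {z. min 0 \<beta> \<le> Im z} \<inter> {z. Im z \<le> max 0 \<beta>}" by (auto simp: strip_def)
  then show ?thesis
    by (metis convex_Int convex_halfspace_Im_ge convex_halfspace_Im_le)
qed

lemma strip_horizontal: "of_real t \<in> strip \<beta>" "of_real t + \<i> * of_real \<beta> \<in> strip \<beta>"
  by (auto simp: strip_def)

text \<open>Cauchy's theorem on the rectangle with horizontal sides from - n to n at heights 0 and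
  \<beta>: F is bounded and the Gaussian decays, so the two vertical sides vanish in the
  limit.\<close>

lemma gaussian_contour_shift:
  assumes F: "continuous_on (strip \<beta>) F" "bounded (F ` strip \<beta>)" "F holomorphic_on interior (strip \<beta>)"
  shows "(\<lambda>n. integral {- real n..real n} (\<lambda>t. gauss 0 t * F (of_real t))
    - integral {- real n..real n} (\<lambda>t. gauss \<beta> t * F (of_real t + \<i> * of_real \<beta>))) \<longlonglongrightarrow> 0"
proof -
  obtain B where B: "\<And>z. z \<in> strip \<beta> \<Longrightarrow> cmod (F z) \<le> B"
    using F(2) by (auto simp: bounded_iff)
  have B0: "B \<ge> 0" using B[OF strip_horizontal(1)] norm_ge_zero order_trans by blast
  define G where "G = (\<lambda>z. exp (- (z\<^sup>2)) * F z)"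
  have G_cont: "continuous_on (strip \<beta>) G"
    unfolding G_def by (intro continuous_intros F)
  have G_hol: "G holomorphic_on interior (strip \<beta>)"
    unfolding G_def by (intro holomorphic_intros F)
  define h where "h = \<i> * of_real \<beta>"
  define D where "D = (\<lambda>n. integral {- real n..real n} (\<lambda>t. gauss 0 t * F (of_real t))
    - integral {- real n..real n} (\<lambda>t. gauss \<beta> t * F (of_real t + \<i> * of_real \<beta>)))"
  have "norm (D n) \<le> 2 * (exp (\<beta>\<^sup>2) * B * \<bar>\<beta>\<bar>) * exp (- 1) ^ n" if "n > 0" for n
  proof -
    define a b :: complex where "a = of_real (- real n)" and "b = of_real (real n)"
    have ab: "a \<in> strip \<beta>" "b \<in> strip \<beta>" "a + h \<in> strip \<beta>" "b + h \<in> strip \<beta>"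
      using strip_horizontal by (auto simp: a_def b_def h_def simp del: of_real_minus of_real_of_nat_eq)
    have seg: "closed_segment u v \<subseteq> strip \<beta>" if "u \<in> strip \<beta>" "v \<in> strip \<beta>" for u v
      using that convex_strip closed_segment_subset by blast
    define P where "P = linepath a b +++ (linepath b (b + h) +++ (linepath (b + h) (a + h) +++ linepath (a + h) a))"
    \<comment> \<open>Cauchy's theorem for a convex set asks for continuity on the strip and
      differentiability in its interior. This covers both signs of \<beta> and also \<beta> = 0,
      where the interior is empty and the rectangle degenerates.\<close>
    have "(G has_contour_integral 0) P"
    proof (rule Cauchy_theorem_convex[where K = "{}"])
      show "G field_differentiable at x" if "x \<in> interior (strip \<beta>) - {}" for x
        using that G_hol by (metis Diff_empty holomorphic_on_imp_differentiable_at open_interior)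
      show "path_image P \<subseteq> strip \<beta>"
        unfolding P_def by (simp add: path_image_join seg ab)
    qed (use G_cont convex_strip in \<open>auto simp: P_def\<close>)
    moreover have int: "G contour_integrable_on (linepath u v)" if "u \<in> strip \<beta>" "v \<in> strip \<beta>" for u v
      using that G_cont seg by (meson contour_integrable_continuous_linepath continuous_on_subset)
    then have hci: "(G has_contour_integral contour_integral (linepath u v) G) (linepath u v)"
      if "u \<in> strip \<beta>" "v \<in> strip \<beta>" for u v
      using that has_contour_integral_integral by blast
    then have "(G has_contour_integral (contour_integral (linepath a b) G
        + (contour_integral (linepath b (b + h)) G + (contour_integral (linepath (b + h) (a + h)) G
        + contour_integral (linepath (a + h) a) G)))) P"
      unfolding P_def using ab by (intro has_contour_integral_join) auto
    ultimately have sum0: "contour_integral (linepath a b) G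
        + (contour_integral (linepath b (b + h)) G + (contour_integral (linepath (b + h) (a + h)) G
        + contour_integral (linepath (a + h) a) G)) = 0"
      using contour_integral_unique by metis
    have lower: "contour_integral (linepath a b) G = integral {- real n..real n} (\<lambda>t. gauss 0 t * F (of_real t))"
      using \<open>n > 0\<close> by (subst contour_integral_linepath_Reals_eq) (auto simp: a_def b_def G_def gauss_def)
    have "contour_integral (linepath (b + h) (a + h)) G = - contour_integral (linepath (a + h) (b + h)) G"
      using contour_integral_reversepath[of "linepath (a + h) (b + h)" G] by simp
    also have "contour_integral (linepath (a + h) (b + h)) G = contour_integral (linepath a b) (\<lambda>z. G (z + h))"
    proof -
      have "(G has_contour_integral I) (linepath (a + h) (b + h)) \<longleftrightarrow>
          ((\<lambda>z. G (z + h)) has_contour_integral I) (linepath a b)" for I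
        unfolding has_contour_integral_linepath by (simp add: linepath_def algebra_simps)
      then show ?thesis
        using hci[OF ab(3,4)] contour_integral_unique by metis
    qed
    also have "\<dots> = integral {- real n..real n} (\<lambda>t. gauss \<beta> t * F (of_real t + \<i> * of_real \<beta>))"
      using \<open>n > 0\<close> by (subst contour_integral_linepath_Reals_eq) (auto simp: a_def b_def G_def gauss_def h_def)
    finally have upper: "contour_integral (linepath (b + h) (a + h)) G
        = - integral {- real n..real n} (\<lambda>t. gauss \<beta> t * F (of_real t + \<i> * of_real \<beta>))" .
    have side: "norm (contour_integral (linepath u v) G) \<le> (exp (\<beta>\<^sup>2) * B * \<bar>\<beta>\<bar>) * exp (- 1) ^ n"
      if u: "u \<in> strip \<beta>" and v: "v \<in> strip \<beta>" and Re: "Re u = r" "Re v = r" and r: "\<bar>r\<bar> = real n"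
        and uv: "norm (v - u) = \<bar>\<beta>\<bar>" for u v r
    proof -
      have "norm (contour_integral (linepath u v) G) \<le> ((exp (\<beta>\<^sup>2) * exp (- 1) ^ n) * B) * norm (v - u)"
      proof (rule contour_integral_bound_linepath[OF int[OF u v]])
        fix z assume z: "z \<in> closed_segment u v"
        then have zs: "z \<in> strip \<beta>" using seg[OF u v] by blast
        have "Re z = r"
        proof -
          obtain l where "z = (1 - l) *\<^sub>R u + l *\<^sub>R v" using z by (auto simp: in_segment)
          then have "Re z = (1 - l) * r + l * r" using Re by simp
          then show ?thesis by (simp add: algebra_simps)
        qed
        moreover have "\<bar>Im z\<bar> \<le> \<bar>\<beta>\<bar>" using zs by (auto simp: strip_def split: if_splits)
        then have "(Im z)\<^sup>2 \<le> \<beta>\<^sup>2" by (rule abs_le_square_iff[THEN iffD1])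
        ultimately have "cmod (exp (- (z\<^sup>2))) \<le> exp (\<beta>\<^sup>2) * exp (- (r\<^sup>2))"
          by (simp add: norm_exp_eq_Re power2_eq_square flip: exp_add)
        also have "exp (- (r\<^sup>2)) \<le> exp (- 1) ^ n" using r by (intro gauss_le_geometric) simp
        finally show "cmod (G z) \<le> exp (\<beta>\<^sup>2) * exp (- 1) ^ n * B"
          unfolding G_def norm_mult using B[OF zs] by (intro mult_mono) auto
      qed (use B0 in auto)
      then show ?thesis using uv by (simp add: mult_ac)
    qed
    have "norm (contour_integral (linepath b (b + h)) G) \<le> (exp (\<beta>\<^sup>2) * B * \<bar>\<beta>\<bar>) * exp (- 1) ^ n"
      by (rule side[where r = "real n"]) (use ab in \<open>auto simp: b_def h_def norm_mult\<close>)
    moreover have "norm (contour_integral (linepath (a + h) a) G) \<le> (exp (\<beta>\<^sup>2) * B * \<bar>\<beta>\<bar>) * exp (- 1) ^ n"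
      by (rule side[where r = "- real n"]) (use ab in \<open>auto simp: a_def h_def norm_mult\<close>)
    moreover have "D n = - (contour_integral (linepath b (b + h)) G + contour_integral (linepath (a + h) a) G)"
      using sum0 unfolding D_def lower[symmetric] using upper by (simp add: algebra_simps eq_neg_iff_add_eq_0)
    ultimately show ?thesis
      by (simp only: norm_minus_cancel) (intro norm_triangle_le, simp)
  qed
  then have "\<forall>\<^sub>F n in sequentially. norm (D n) \<le> 2 * (exp (\<beta>\<^sup>2) * B * \<bar>\<beta>\<bar>) * exp (- 1) ^ n"
    by (intro eventually_sequentiallyI[of 1]) auto
  then show ?thesis
    unfolding D_def[symmetric]
    by (rule Lim_null_comparison) (intro summable_LIMSEQ_zero summable_geometric_exp)
qed

section \<open>Integrals controlled in the seminorm\<close>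

context cstar_weight
begin

text \<open>Riemann sums converge in norm, obey the bound by the triangle inequality because the
  lengths add up to b - a, and lower semicontinuity passes the bound to the integral.\<close>

lemma q_integral_bound:
  assumes ab: "a \<le> b" and f: "continuous_on {a..b} f"
    and N: "\<And>t. t \<in> {a..b} \<Longrightarrow> f t \<in> \<N> \<psi>" "\<And>t. t \<in> {a..b} \<Longrightarrow> q (f t) \<le> B"
  shows "integral {a..b} f \<in> \<N> \<psi>" "q (integral {a..b} f) \<le> B * (b - a)"
proof -
  have "(f has_integral integral {a..b} f) {a..b}"
    using f by (intro integrable_integral integrable_continuous_real)
  then have "\<exists>\<D>. \<D> tagged_division_of {a..b} \<and>
      norm ((\<Sum>(x, k)\<in>\<D>. measure lborel k *\<^sub>R f x) - integral {a..b} f) < 1 / Suc n" for n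
    unfolding has_integral_real using fine_division_exists_real
    by (metis of_nat_0_less_iff zero_less_Suc zero_less_divide_1_iff)
  then obtain \<D> where D: "\<And>n. \<D> n tagged_division_of {a..b}"
    "\<And>n. norm ((\<Sum>(x, k)\<in>\<D> n. measure lborel k *\<^sub>R f x) - integral {a..b} f) < 1 / Suc n"
    by metis
  define S where "S = (\<lambda>n. \<Sum>(x, k)\<in>\<D> n. measure lborel k *\<^sub>R f x)"
  have "S \<longlonglongrightarrow> integral {a..b} f"
  proof (rule LIM_zero_cancel, rule Lim_null_comparison)
    show "\<forall>\<^sub>F n in sequentially. norm (S n - integral {a..b} f) \<le> 1 / Suc n"
      using D(2) unfolding S_def by (intro always_eventually allI) (metis less_imp_le)
    show "(\<lambda>n. 1 / real (Suc n)) \<longlonglongrightarrow> 0"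
      using LIMSEQ_inverse_real_of_nat by (simp add: inverse_eq_divide)
  qed
  moreover have "S n \<in> \<N> \<psi>" "q (S n) \<le> B * (b - a)" for n
  proof -
    have x: "x \<in> {a..b}" if "(x, k) \<in> \<D> n" for x k
      using tag_in_interval[OF D(1) that] .
    have c: "0 \<le> measure lborel k" for k :: "real set" by (rule measure_nonneg)
    have i: "(case p of (x, k) \<Rightarrow> measure lborel k *\<^sub>R f x) \<in> \<N> \<psi>" if "p \<in> \<D> n" for p
      using that x N by (cases p) (auto intro: N_scaleR)
    show "S n \<in> \<N> \<psi>" unfolding S_def using i by (rule N_sum)
    have "q (S n) \<le> (\<Sum>p\<in>\<D> n. q (case p of (x, k) \<Rightarrow> measure lborel k *\<^sub>R f x))"
      unfolding S_def using i by (rule q_sum)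
    also have "\<dots> \<le> (\<Sum>(x, k)\<in>\<D> n. B * measure lborel k)"
      using x N by (intro sum_mono) (auto simp: q_scaleR c mult.commute[of B] intro!: mult_left_mono)
    also have "\<dots> = B * (\<Sum>(x, k)\<in>\<D> n. measure lborel k)"
      by (simp add: sum_distrib_left split_def)
    also have "(\<Sum>(x, k)\<in>\<D> n. measure lborel k) = b - a"
      using additive_content_tagged_division[of "\<D> n" a b] D(1) ab by simp
    finally show "q (S n) \<le> B * (b - a)" .
  qed
  ultimately show "integral {a..b} f \<in> \<N> \<psi>" "q (integral {a..b} f) \<le> B * (b - a)"
    using q_lower_semicontinuous by blast+
qed

text \<open>The functional is not norm continuous, so the integral cannot be pulled out as for a
  bounded linear map. Instead the function s -> L (x * integral from a to s) is differentiated with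
  the help of continuity in the seminorm, and the fundamental theorem of calculus finishes.\<close>

lemma has_integral_L:
  fixes f :: "real \<Rightarrow> 'a"
  assumes ab: "a \<le> b" and f: "continuous_on {a..b} f"
    and N: "\<And>t. t \<in> {a..b} \<Longrightarrow> f t \<in> \<N> \<psi>"
    and qc: "\<And>s e. s \<in> {a..b} \<Longrightarrow> e > 0 \<Longrightarrow> \<exists>d>0. \<forall>t\<in>{a..b}. \<bar>t - s\<bar> < d \<longrightarrow> q (f t - f s) \<le> e"
    and qB: "\<And>t. t \<in> {a..b} \<Longrightarrow> q (f t) \<le> B"
    and x: "star x \<in> \<N> \<psi>"
  shows "((\<lambda>t. L (x * f t)) has_integral L (x * integral {a..b} f)) {a..b}"
proof -
  define \<Phi> where "\<Phi> = (\<lambda>s. L (x * integral {a..s} f))"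
  have f': "continuous_on {s..t} f" if "a \<le> s" "t \<le> b" for s t
    by (rule continuous_on_subset[OF f]) (use that in auto)
  have IN: "integral {s..t} f \<in> \<N> \<psi>" if "a \<le> s" "s \<le> t" "t \<le> b" for s t
    using that by (intro q_integral_bound(1)[where B = B] f' N qB) auto
  have split: "\<Phi> t - \<Phi> s = L (x * integral {s..t} f)" if "a \<le> s" "s \<le> t" "t \<le> b" for s t
  proof -
    have "integral {a..t} f = integral {a..s} f + integral {s..t} f"
      using that by (intro Henstock_Kurzweil_Integration.integral_combine[symmetric]
          integrable_continuous_real f') auto
    then show ?thesis
      using that unfolding \<Phi>_def by (simp add: distrib_left L_add dom_mult x IN)
  qed
  have step: "cmod (L (x * integral {s..t} f) - (t - s) *\<^sub>R L (x * f u)) \<le> q (star x) * (e * (t - s))"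
    if st: "a \<le> s" "s \<le> t" "t \<le> b" and u: "u \<in> {a..b}"
      and e: "\<And>v. v \<in> {s..t} \<Longrightarrow> q (f v - f u) \<le> e" for s t u e
  proof -
    have fu: "f u \<in> \<N> \<psi>" using u N by blast
    have "integral {s..t} (\<lambda>v. f v - f u) = integral {s..t} f - (t - s) *\<^sub>R f u"
      using st by (subst Henstock_Kurzweil_Integration.integral_diff)
        (auto intro!: integrable_continuous_real f')
    moreover have "q (integral {s..t} (\<lambda>v. f v - f u)) \<le> e * (t - s)"
      using st fu N e by (intro q_integral_bound(2) continuous_intros f' N_diff) auto
    ultimately have qd: "q (integral {s..t} f - (t - s) *\<^sub>R f u) \<le> e * (t - s)" by simp
    have "L (x * integral {s..t} f) - (t - s) *\<^sub>R L (x * f u)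
        = L (x * (integral {s..t} f - (t - s) *\<^sub>R f u))"
      using IN[OF st] fu x L_scaleC[of "x * f u" "of_real (t - s)"]
      by (simp add: right_diff_distrib L_diff dom_mult N_scaleR scaleC_of_real scaleR_conv_of_real
          del: of_real_diff mult_scaleR_right flip: mult_scaleR_right)
    also have "cmod \<dots> \<le> q (star x) * q (integral {s..t} f - (t - s) *\<^sub>R f u)"
      using IN[OF st] fu x by (intro L_mult_bound) (auto intro: N_diff N_scaleR)
    also have "\<dots> \<le> q (star x) * (e * (t - s))" using qd by (intro mult_left_mono) auto
    finally show ?thesis .
  qed
  have "((\<lambda>t. L (x * f t)) has_integral \<Phi> b - \<Phi> a) {a..b}"
  proof (rule fundamental_theorem_of_calculus[OF ab])
    fix s assume s: "s \<in> {a..b}"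
    show "(\<Phi> has_vector_derivative L (x * f s)) (at s within {a..b})"
      unfolding has_vector_derivative_def has_derivative_within_alt
    proof (intro conjI allI impI bounded_linear_scaleR_left)
      fix e :: real assume "e > 0"
      \<comment> \<open>The summand 1 keeps the divisor positive when q (star x) = 0.\<close>
      define e' where "e' = e / (q (star x) + 1)"
      have e': "e' > 0" "q (star x) * e' \<le> e"
      proof -
        have "q (star x) + 1 > 0" using q_nonneg[of "star x"] by linarith
        then show "e' > 0" "q (star x) * e' \<le> e"
          using \<open>e > 0\<close> unfolding e'_def by (auto simp: pos_divide_le_eq algebra_simps)
      qed
      obtain d where d: "d > 0" "\<And>t. t \<in> {a..b} \<Longrightarrow> \<bar>t - s\<bar> < d \<Longrightarrow> q (f t - f s) \<le> e'"
        using qc[OF s e'(1)] by blast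
      show "\<exists>d>0. \<forall>t\<in>{a..b}. norm (t - s) < d \<longrightarrow>
          norm (\<Phi> t - \<Phi> s - (t - s) *\<^sub>R L (x * f s)) \<le> e * norm (t - s)"
      proof (intro exI[of _ d] conjI ballI impI d)
        fix t assume t: "t \<in> {a..b}" "norm (t - s) < d"
        have "norm (\<Phi> t - \<Phi> s - (t - s) *\<^sub>R L (x * f s)) \<le> q (star x) * (e' * norm (t - s))"
        proof (cases "s \<le> t")
          case True
          then show ?thesis
            using step[of s t s e'] split[of s t] s t d(2) by auto
        next
          case False
          then have "norm (\<Phi> s - \<Phi> t - (s - t) *\<^sub>R L (x * f s)) \<le> q (star x) * (e' * (s - t))"
            using step[of t s s e'] split[of t s] s t d(2) by auto
          moreover have "\<Phi> t - \<Phi> s - (t - s) *\<^sub>R L (x * f s) = - (\<Phi> s - \<Phi> t - (s - t) *\<^sub>R L (x * f s))"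
            by (simp add: algebra_simps)
          ultimately show ?thesis using False by (simp only: norm_minus_cancel) simp
        qed
        also have "\<dots> \<le> e * norm (t - s)"
          using mult_right_mono[OF e'(2), of "norm (t - s)"] by (simp add: mult_ac)
        finally show "norm (\<Phi> t - \<Phi> s - (t - s) *\<^sub>R L (x * f s)) \<le> e * norm (t - s)" .
      qed
    qed
  qed
  moreover have "\<Phi> a = 0" by (simp add: \<Phi>_def)
  ultimately show ?thesis by (simp add: \<Phi>_def)
qed

text \<open>The pieces over unit intervals are summable both in norm and in the seminorm;
  \<open>q_complete\<close> identifies the two limits.\<close>

lemma improper_integral_q_convergent:
  assumes f: "continuous_on UNIV f" and N: "\<And>t. f t \<in> \<N> \<psi>"
    and le: "\<And>t. norm (f t) \<le> K * exp (- (t\<^sup>2))" "\<And>t. q (f t) \<le> K' * exp (- (t\<^sup>2))"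
  obtains y where "(\<lambda>n. integral {- real n..real n} f) \<longlonglongrightarrow> y" "y \<in> \<N> \<psi>"
    "(\<lambda>n. q (integral {- real n..real n} f - y)) \<longlonglongrightarrow> 0"
proof -
  define Y where "Y = (\<lambda>n. integral {- real n..real n} f)"
  obtain y where y: "Y \<longlonglongrightarrow> y"
    using improper_integral_convergent[OF f le(1)] unfolding Y_def convergent_def by blast
  define d where "d = (\<lambda>k. integral {- real (Suc k)..- real k} f + integral {real k..real (Suc k)} f)"
  have Y: "Y n = (\<Sum>k<n. d k)" for n
    unfolding Y_def d_def by (rule integral_symmetric_interval_sums[OF f])
  have K: "K' \<ge> 0" using order_trans[OF q_nonneg le(2)[of 0]] by simp
  have b: "integral {a..a + 1} f \<in> \<N> \<psi> \<and> q (integral {a..a + 1} f) \<le> K' * exp (- 1) ^ k"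
    if k: "\<And>t. t \<in> {a..a + 1} \<Longrightarrow> real k \<le> \<bar>t\<bar>" for a k
  proof -
    have "q (f t) \<le> K' * exp (- 1) ^ k" if "t \<in> {a..a + 1}" for t
      using le(2)[of t] mult_left_mono[OF gauss_le_geometric K] k that by (meson order_trans)
    moreover have "continuous_on {a..a + 1} f" using f by (rule continuous_on_subset) auto
    ultimately show ?thesis
      using q_integral_bound[of a "a + 1" f "K' * exp (- 1) ^ k"] N by auto
  qed
  have d: "d k \<in> \<N> \<psi> \<and> q (d k) \<le> 2 * K' * exp (- 1) ^ k" for k
  proof -
    have 1: "integral {- real (Suc k)..- real k} f \<in> \<N> \<psi>"
      "q (integral {- real (Suc k)..- real k} f) \<le> K' * exp (- 1) ^ k"
      using b[of "- real (Suc k)" k] by (auto simp: algebra_simps)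
    have 2: "integral {real k..real (Suc k)} f \<in> \<N> \<psi>"
      "q (integral {real k..real (Suc k)} f) \<le> K' * exp (- 1) ^ k"
      using b[of "real k" k] by (auto simp: algebra_simps)
    show ?thesis
      using 1 2 q_add[OF 1(1) 2(1)] unfolding d_def by (auto intro: N_add)
  qed
  have YN: "Y n \<in> \<N> \<psi>" for n unfolding Y using d by (intro N_sum) auto
  have diff: "q (Y m - Y n) \<le> (\<Sum>k\<in>{n..<m}. 2 * K' * exp (- 1) ^ k)" if "n \<le> m" for m n
  proof -
    have "Y m - Y n = (\<Sum>k\<in>{n..<m}. d k)"
      unfolding Y using that by (simp add: sum_diff_nat_ivl lessThan_atLeast0)
    also have "q \<dots> \<le> (\<Sum>k\<in>{n..<m}. q (d k))" using d by (intro q_sum) auto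
    also have "\<dots> \<le> (\<Sum>k\<in>{n..<m}. 2 * K' * exp (- 1) ^ k)" using d by (intro sum_mono) auto
    finally show ?thesis .
  qed
  have "\<exists>M. \<forall>m\<ge>M. \<forall>n\<ge>M. q (Y m - Y n) \<le> e" if "e > 0" for e
  proof -
    obtain M where M: "\<And>m n. m \<ge> M \<Longrightarrow> norm (\<Sum>k\<in>{m..<n}. 2 * K' * exp (- 1 :: real) ^ k) < e"
      using summable_geometric_exp[of "2 * K'"] \<open>e > 0\<close> unfolding summable_Cauchy by blast
    have "q (Y m - Y n) \<le> e" if "m \<ge> M" "n \<ge> M" for m n
      using that diff[of n m] diff[of m n] M[of n m] M[of m n] q_minus_commute[of "Y m" "Y n"]
      by (cases "n \<le> m") force+
    then show ?thesis by blast
  qed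
  then have "y \<in> \<N> \<psi>" "(\<lambda>n. q (Y n - y)) \<longlonglongrightarrow> 0"
    using q_complete[OF y YN] by blast+
  then show thesis using that y unfolding Y_def by blast
qed

lemma L_q_continuous:
  assumes "\<And>n. f n \<in> \<N> \<psi>" "y \<in> \<N> \<psi>" "(\<lambda>n. q (f n - y)) \<longlonglongrightarrow> 0" "star x \<in> \<N> \<psi>"
  shows "(\<lambda>n. L (x * f n)) \<longlonglongrightarrow> L (x * y)"
proof (rule LIM_zero_cancel, rule Lim_null_comparison)
  have "cmod (L (x * f n) - L (x * y)) \<le> q (star x) * q (f n - y)" for n
    using L_mult_bound[OF assms(4) N_diff[OF assms(1,2)], of n] assms
    by (simp add: right_diff_distrib L_diff dom_mult)
  then show "\<forall>\<^sub>F n in sequentially. norm (L (x * f n) - L (x * y)) \<le> q (star x) * q (f n - y)"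
    by simp
  show "(\<lambda>n. q (star x) * q (f n - y)) \<longlonglongrightarrow> 0"
    using tendsto_mult_right_zero[OF assms(3)] .
qed

end

section \<open>The action on elements of finite weight and Gaussian smearing\<close>

locale cstar_KMS = cstar_weight +
  fixes \<alpha> :: "real \<Rightarrow> 'a \<Rightarrow> 'a" and \<beta> :: real
  assumes group: "one_parameter_group \<alpha>" and KMS: "KMS_weight \<alpha> \<beta> \<psi>"
begin

lemma alpha_hom:
  "\<alpha> t (a + b) = \<alpha> t a + \<alpha> t b" "\<alpha> t (z *\<^sub>C a) = z *\<^sub>C \<alpha> t a" "\<alpha> t (a * b) = \<alpha> t a * \<alpha> t b"
  "\<alpha> t (star a) = star (\<alpha> t a)" "norm (\<alpha> t a) = norm a"
  using group by (auto simp: one_parameter_group_def star_automorphism_def)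

lemma alpha_diff: "\<alpha> t (a - b) = \<alpha> t a - \<alpha> t b"
  by (metis alpha_hom(1) add_diff_cancel diff_add_cancel)

lemma alpha_plus: "\<alpha> (s + t) a = \<alpha> s (\<alpha> t a)" and alpha_0: "\<alpha> 0 a = a"
  using group by (auto simp: one_parameter_group_def)

lemma alpha_continuous: "continuous_on S (\<lambda>t. \<alpha> t a)"
  using group by (auto simp: one_parameter_group_def intro: continuous_on_subset[of UNIV])

lemma alpha_pos: "p \<in> pos_cone \<Longrightarrow> \<alpha> t p \<in> pos_cone"
  by (auto simp: pos_cone_def alpha_hom(3,4))

lemma alpha_psi: "p \<in> pos_cone \<Longrightarrow> \<psi> (\<alpha> t p) = \<psi> p"
  using KMS by (auto simp: KMS_weight_def weight_invariant_def)

lemma alpha_L: "z \<in> weight_dom \<psi> \<Longrightarrow> L (\<alpha> t z) = L z"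
  by (rule L_invariant) (auto simp: alpha_hom alpha_pos alpha_psi)

lemma alpha_N: "a \<in> \<N> \<psi> \<Longrightarrow> \<alpha> t a \<in> \<N> \<psi>"
  unfolding weight_null_def by (simp flip: alpha_hom(3,4) add: alpha_psi)

lemma alpha_q: "q (\<alpha> t a) = q a"
  unfolding q_def by (simp flip: alpha_hom(3,4) add: alpha_psi)

lemma KMS_function:
  assumes "a \<in> NN" "b \<in> NN"
  obtains F where "continuous_on (strip \<beta>) F" "bounded (F ` strip \<beta>)" "F holomorphic_on interior (strip \<beta>)"
    "\<And>t. F (of_real t) = L (a * \<alpha> t b)" "\<And>t. F (of_real t + \<i> * of_real \<beta>) = L (\<alpha> t b * a)"
proof -
  have "\<exists>F. continuous_on (strip \<beta>) F \<and> bounded (F ` strip \<beta>) \<and> F holomorphic_on interior (strip \<beta>) \<and>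
      (\<forall>t. F (of_real t) = L (a * \<alpha> t b)) \<and> (\<forall>t. F (of_real t + \<i> * of_real \<beta>) = L (\<alpha> t b * a))"
    using KMS assms unfolding KMS_weight_def NN_def by blast
  then show thesis using that by metis
qed

lemma Mpos_NN: "p \<in> Mpos \<Longrightarrow> p \<in> NN"
  using Mpos_N[of p] pos_cone_selfadjoint[of p] by (auto simp: mem_NN Mpos_def)

text \<open>Norm continuity of the action says nothing about the seminorm. Expanding the square
  leaves the correlation L (p * \<alpha> (t - s) p), which is continuous in t as the real boundary
  value of a KMS function.\<close>

lemma orbit_q_continuous:
  assumes p: "p \<in> Mpos"
  shows "((\<lambda>t. q (\<alpha> t p - \<alpha> s p)) \<longlongrightarrow> 0) (at s)"
proof -
  have pNN: "p \<in> NN" "star p = p"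
    using p Mpos_NN pos_cone_selfadjoint by (auto simp: Mpos_def)
  obtain F where F: "continuous_on (strip \<beta>) F" "\<And>t. F (of_real t) = L (p * \<alpha> t p)"
    using KMS_function[OF pNN(1) pNN(1)] by metis
  have cont: "continuous_on UNIV (\<lambda>t. F (of_real t))"
    using F(1) strip_horizontal(1) by (intro continuous_on_compose2[OF F(1)] continuous_intros) auto
  have eq: "(q (\<alpha> t p - \<alpha> s p))\<^sup>2 = 2 * (q p)\<^sup>2 - 2 * Re (F (of_real (t - s)))" for t
  proof -
    define u v where "u = \<alpha> s p" and "v = \<alpha> t p"
    have uv: "u \<in> \<N> \<psi>" "v \<in> \<N> \<psi>" "star u = u" "star v = v" "q u = q p" "q v = q p"
      using pNN by (auto simp: u_def v_def mem_NN alpha_N alpha_q simp flip: alpha_hom(4))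
    have dom: "u * v \<in> weight_dom \<psi>" "v * u \<in> weight_dom \<psi>" "u * u \<in> weight_dom \<psi>" "v * v \<in> weight_dom \<psi>"
      using uv by (auto intro!: dom_mult)
    have dif: "v - u \<in> \<N> \<psi>" using uv by (intro N_diff)
    have "u * v = \<alpha> s (p * \<alpha> (t - s) p)"
      by (simp add: u_def v_def alpha_hom(3) flip: alpha_plus)
    moreover have "p * \<alpha> (t - s) p \<in> weight_dom \<psi>"
      using pNN by (intro dom_mult) (auto simp: mem_NN alpha_N)
    ultimately have Luv: "L (u * v) = F (of_real (t - s))"
      by (simp only: F(2) alpha_L)
    have Lvu: "L (v * u) = cnj (L (u * v))"
      using L_star[OF dom(1)] by (simp add: star_mult uv)
    have "star (v - u) * (v - u) = (v * v + u * u) - (u * v + v * u)"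
      by (simp add: star_diff uv algebra_simps)
    then have "L (star (v - u) * (v - u)) = (L (v * v) + L (u * u)) - (L (u * v) + L (v * u))"
      by (simp add: dom L_diff L_add dom_add)
    from arg_cong[OF this, of Re]
    have "(q (v - u))\<^sup>2 = 2 * (q p)\<^sup>2 - 2 * Re (F (of_real (t - s)))"
      using L_star_mult_self[OF uv(1)] L_star_mult_self[OF uv(2)]
      by (simp add: L_star_mult_self[OF dif] Luv Lvu uv)
    then show ?thesis by (simp add: u_def v_def)
  qed
  have F0: "Re (F (of_real 0)) = (q p)\<^sup>2"
    using F(2)[of 0] L_star_mult_self[of p] pNN by (simp add: alpha_0 mem_NN)
  have "continuous_on UNIV (\<lambda>t. 2 * (q p)\<^sup>2 - 2 * Re (F (of_real (t - s))))"
    using continuous_on_compose2[OF cont, of UNIV "\<lambda>t. t - s",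
        OF continuous_on_diff[OF continuous_on_id continuous_on_const]]
    by (intro continuous_intros) auto
  then have "((\<lambda>t. 2 * (q p)\<^sup>2 - 2 * Re (F (of_real (t - s)))) \<longlongrightarrow> 2 * (q p)\<^sup>2 - 2 * Re (F (of_real (s - s)))) (at s)"
    unfolding continuous_on_def by (rule bspec) (rule UNIV_I)
  then have "((\<lambda>t. (q (\<alpha> t p - \<alpha> s p))\<^sup>2) \<longlongrightarrow> 0) (at s)"
    unfolding eq using F0 by simp
  then have "((\<lambda>t. sqrt ((q (\<alpha> t p - \<alpha> s p))\<^sup>2)) \<longlongrightarrow> sqrt 0) (at s)"
    by (intro tendsto_intros)
  then show ?thesis by simp
qed

text \<open>The elements \<open>smear b p = \<integral> exp (- (t + ib)\<^sup>2) \<alpha>\<^sub>t(p) dt\<close> are the values at \<open>- ib\<close> of the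
  entire extension of the orbit of \<open>smear 0 p\<close>.\<close>

definition smear_partial :: "real \<Rightarrow> 'a \<Rightarrow> nat \<Rightarrow> 'a" where
  "smear_partial b p n = integral {- real n..real n} (\<lambda>t. gauss b t *\<^sub>C \<alpha> t p)"

definition smear :: "real \<Rightarrow> 'a \<Rightarrow> 'a" where
  "smear b p = lim (smear_partial b p)"

lemma smear_integrand_continuous: "continuous_on S (\<lambda>t. gauss b t *\<^sub>C \<alpha> t p)"
  by (intro continuous_intros alpha_continuous)

lemma smear_integrand_norm: "norm (gauss b t *\<^sub>C \<alpha> t p) \<le> exp (b\<^sup>2) * norm p * exp (- (t\<^sup>2))"
  by (simp add: norm_scaleC norm_gauss alpha_hom(5))

lemma smear_integrand_q:
  "p \<in> \<N> \<psi> \<Longrightarrow> q (gauss b t *\<^sub>C \<alpha> t p) \<le> exp (b\<^sup>2) * q p * exp (- (t\<^sup>2))"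
  by (simp add: q_scaleC norm_gauss alpha_N alpha_q)

lemma smear_partial_LIMSEQ: "smear_partial b p \<longlonglongrightarrow> smear b p"
  using improper_integral_convergent[OF smear_integrand_continuous smear_integrand_norm, of b p]
  unfolding smear_def smear_partial_def[abs_def] by (simp add: convergent_LIMSEQ_iff)

lemma smear_N:
  assumes p: "p \<in> Mpos"
  shows "smear b p \<in> \<N> \<psi>" "(\<lambda>n. q (smear_partial b p n - smear b p)) \<longlonglongrightarrow> 0"
proof -
  have pN: "p \<in> \<N> \<psi>" using p by (rule Mpos_N)
  obtain y where y: "smear_partial b p \<longlonglongrightarrow> y" "y \<in> \<N> \<psi>"
    "(\<lambda>n. q (smear_partial b p n - y)) \<longlonglongrightarrow> 0"
    using improper_integral_q_convergent[OF smear_integrand_continuous _ smear_integrand_norm smear_integrand_q, of b p]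
      N_scaleC[OF alpha_N[OF pN]] pN
    unfolding smear_partial_def[abs_def] by blast
  then have "y = smear b p" using smear_partial_LIMSEQ LIMSEQ_unique by blast
  then show "smear b p \<in> \<N> \<psi>" "(\<lambda>n. q (smear_partial b p n - smear b p)) \<longlonglongrightarrow> 0"
    using y by auto
qed

lemma smear_partial_N:
  assumes p: "p \<in> Mpos"
  shows "smear_partial b p n \<in> \<N> \<psi>"
proof -
  have pN: "p \<in> \<N> \<psi>" using p by (rule Mpos_N)
  have "exp (b\<^sup>2) * q p * exp (- (t\<^sup>2)) \<le> exp (b\<^sup>2) * q p * 1" for t
    by (intro mult_left_mono) auto
  then have "q (gauss b t *\<^sub>C \<alpha> t p) \<le> exp (b\<^sup>2) * q p * 1" for t
    using smear_integrand_q[OF pN] order_trans by blast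
  then show ?thesis
    unfolding smear_partial_def
    by (intro q_integral_bound(1) smear_integrand_continuous N_scaleC alpha_N pN) auto
qed

text \<open>Conjugation reflects the line of height b into that of height - b. In particular
  \<open>smear 0 p\<close> is self-adjoint for self-adjoint p, as \<open>right_mult_bound\<close>
  demands.\<close>

lemma smear_star:
  assumes "star p = p"
  shows "star (smear b p) = smear (- b) p"
proof -
  have "star (smear_partial b p n) = smear_partial (- b) p n" for n
  proof -
    have "integral {- real n..real n} (star \<circ> (\<lambda>t. gauss b t *\<^sub>C \<alpha> t p)) = star (smear_partial b p n)"
      unfolding smear_partial_def
      by (intro integral_linear integrable_continuous_real smear_integrand_continuous bounded_linear_star)
    then show ?thesis
      unfolding smear_partial_def by (simp add: o_def star_scaleC cnj_gauss assms flip: alpha_hom(4))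
  qed
  then have "smear_partial (- b) p \<longlonglongrightarrow> star (smear b p)"
    using tendsto_star[OF smear_partial_LIMSEQ, of b p] by simp
  then show ?thesis using smear_partial_LIMSEQ LIMSEQ_unique by blast
qed

lemma smear_NN: "p \<in> Mpos \<Longrightarrow> smear b p \<in> NN"
  by (auto simp: mem_NN smear_N smear_star Mpos_def pos_cone_selfadjoint)

lemma smear_L_partial:
  assumes p: "p \<in> Mpos" and x: "star x \<in> \<N> \<psi>"
  shows "((\<lambda>t. gauss b t * L (x * \<alpha> t p)) has_integral L (x * smear_partial b p n)) {- real n..real n}"
proof -
  have pN: "p \<in> \<N> \<psi>" using p by (rule Mpos_N)
  define f where "f = (\<lambda>t. gauss b t *\<^sub>C \<alpha> t p)"
  have fN: "f t \<in> \<N> \<psi>" for t unfolding f_def by (intro N_scaleC alpha_N pN)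
  have qlim: "((\<lambda>t. q (f t - f s)) \<longlongrightarrow> 0) (at s)" for s
  proof (rule Lim_null_comparison)
    show "\<forall>\<^sub>F t in at s. norm (q (f t - f s)) \<le> cmod (gauss b t) * q (\<alpha> t p - \<alpha> s p) + cmod (gauss b t - gauss b s) * q p"
    proof (intro always_eventually allI)
      fix t
      \<comment> \<open>The increment splits into the motion of the orbit under a fixed weight
        factor and the motion of the Gaussian factor on a fixed point of the orbit.\<close>
      have "f t - f s = gauss b t *\<^sub>C (\<alpha> t p - \<alpha> s p) + (gauss b t - gauss b s) *\<^sub>C \<alpha> s p"
        by (simp add: f_def complex_vector.scale_right_diff_distrib complex_vector.scale_left_diff_distrib)
      then have "q (f t - f s) \<le> q (gauss b t *\<^sub>C (\<alpha> t p - \<alpha> s p)) + q ((gauss b t - gauss b s) *\<^sub>C \<alpha> s p)"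
        by (simp add: q_add N_scaleC N_diff alpha_N pN)
      then show "norm (q (f t - f s)) \<le> cmod (gauss b t) * q (\<alpha> t p - \<alpha> s p) + cmod (gauss b t - gauss b s) * q p"
        by (simp add: q_scaleC N_diff alpha_N pN alpha_q)
    qed
    have "continuous_on UNIV (gauss b)" by (rule continuous_gauss)
    then have g: "(gauss b \<longlongrightarrow> gauss b s) (at s)" by (simp add: continuous_on_def)
    have "((\<lambda>t. cmod (gauss b t) * q (\<alpha> t p - \<alpha> s p) + cmod (gauss b t - gauss b s) * q p)
        \<longlongrightarrow> cmod (gauss b s) * 0 + cmod (gauss b s - gauss b s) * q p) (at s)"
      by (intro tendsto_intros g orbit_q_continuous p)
    then show "((\<lambda>t. cmod (gauss b t) * q (\<alpha> t p - \<alpha> s p) + cmod (gauss b t - gauss b s) * q p) \<longlongrightarrow> 0) (at s)"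
      by simp
  qed
  have "((\<lambda>t. L (x * f t)) has_integral L (x * integral {- real n..real n} f)) {- real n..real n}"
  proof (rule has_integral_L[where B = "exp (b\<^sup>2) * q p"])
    show "continuous_on {- real n..real n} f" unfolding f_def by (rule smear_integrand_continuous)
    show "\<exists>d>0. \<forall>t\<in>{- real n..real n}. \<bar>t - s\<bar> < d \<longrightarrow> q (f t - f s) \<le> e" if "e > 0" for s e
      using LIM_D[OF qlim \<open>e > 0\<close>, of s] q_zero \<open>e > 0\<close>
      by (metis (no_types, opaque_lifting) abs_of_nonneg diff_zero diff_self less_imp_le q_nonneg real_norm_def)
    show "q (f t) \<le> exp (b\<^sup>2) * q p" for t
    proof -
      have "exp (b\<^sup>2) * q p * exp (- (t\<^sup>2)) \<le> exp (b\<^sup>2) * q p * 1"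
        by (intro mult_left_mono) auto
      also have "\<dots> = exp (b\<^sup>2) * q p" by simp
      finally show ?thesis using smear_integrand_q[OF pN, of b t] unfolding f_def by (rule order_trans[rotated])
    qed
  qed (use fN x in auto)
  moreover have "L (x * f t) = gauss b t * L (x * \<alpha> t p)" for t
    unfolding f_def using x by (simp add: mult_scaleC_right L_scaleC dom_mult alpha_N pN)
  ultimately show ?thesis by (simp add: smear_partial_def f_def)
qed

lemma smear_L_right:
  assumes p: "p \<in> Mpos" and x: "star x \<in> \<N> \<psi>"
  shows "(\<lambda>n. integral {- real n..real n} (\<lambda>t. gauss b t * L (x * \<alpha> t p))) \<longlonglongrightarrow> L (x * smear b p)"
  using L_q_continuous[OF smear_partial_N[OF p] smear_N[OF p] x]
  by (simp add: integral_unique[OF smear_L_partial[OF p x]])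

text \<open>Integration was justified for the right factor only; taking adjoints moves the orbit to
  the left at the price of replacing b by - b twice.\<close>

lemma smear_L_left:
  assumes p: "p \<in> Mpos" and x: "x \<in> \<N> \<psi>"
  shows "(\<lambda>n. integral {- real n..real n} (\<lambda>t. gauss b t * L (\<alpha> t p * x))) \<longlonglongrightarrow> L (smear b p * x)"
proof -
  have sp: "star p = p" "p \<in> \<N> \<psi>" using p by (auto simp: Mpos_def pos_cone_selfadjoint Mpos_N)
  have "(\<lambda>n. cnj (integral {- real n..real n} (\<lambda>t. gauss (- b) t * L (star x * \<alpha> t p))))
      \<longlonglongrightarrow> cnj (L (star x * smear (- b) p))"
    using smear_L_right[OF p, of "star x" "- b"] x by (intro tendsto_cnj) (simp add: star_star)
  also have "cnj (L (star x * smear (- b) p)) = L (smear b p * x)"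
    using L_star[OF dom_star_mult[OF x smear_N(1)[OF p]], of "- b"]
    by (simp add: star_mult smear_star sp star_star)
  also have "(\<lambda>n. cnj (integral {- real n..real n} (\<lambda>t. gauss (- b) t * L (star x * \<alpha> t p))))
      = (\<lambda>n. integral {- real n..real n} (\<lambda>t. gauss b t * L (\<alpha> t p * x)))"
  proof
    fix n
    have "cnj (gauss (- b) t * L (star x * \<alpha> t p)) = gauss b t * L (\<alpha> t p * x)" for t
      using L_star[OF dom_star_mult[OF x alpha_N[OF sp(2)]], of t]
      by (simp add: star_mult star_star cnj_gauss sp flip: alpha_hom(4))
    then show "cnj (integral {- real n..real n} (\<lambda>t. gauss (- b) t * L (star x * \<alpha> t p)))
        = integral {- real n..real n} (\<lambda>t. gauss b t * L (\<alpha> t p * x))"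
      by (simp add: integral_cnj)
  qed
  finally show ?thesis .
qed

text \<open>The KMS function has the two correlations as boundary values, and the contour shift
  equates their Gaussian averages. The outcome is the hypothesis \<open>shift\<close> of
  \<open>right_mult_bound\<close> with y = smear 0 p and w = smear \<beta> p.\<close>

lemma smear_shift:
  assumes p: "p \<in> Mpos" and x: "x \<in> NN"
  shows "L (x * smear 0 p) = L (smear \<beta> p * x)"
proof -
  obtain F where F: "continuous_on (strip \<beta>) F" "bounded (F ` strip \<beta>)" "F holomorphic_on interior (strip \<beta>)"
    "\<And>t. F (of_real t) = L (x * \<alpha> t p)" "\<And>t. F (of_real t + \<i> * of_real \<beta>) = L (\<alpha> t p * x)"
    using KMS_function[OF x Mpos_NN[OF p]] by metis
  have 1: "(\<lambda>n. integral {- real n..real n} (\<lambda>t. gauss 0 t * F (of_real t))) \<longlonglongrightarrow> L (x * smear 0 p)"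
    using smear_L_right[OF p] x by (simp add: F mem_NN)
  have 2: "(\<lambda>n. integral {- real n..real n} (\<lambda>t. gauss \<beta> t * F (of_real t + \<i> * of_real \<beta>))) \<longlonglongrightarrow> L (smear \<beta> p * x)"
    using smear_L_left[OF p] x by (simp add: F mem_NN)
  have "L (x * smear 0 p) - L (smear \<beta> p * x) = 0"
    using tendsto_diff[OF 1 2] gaussian_contour_shift[OF F(1,2,3)] LIMSEQ_unique by blast
  then show ?thesis by simp
qed

text \<open>Numerically the square root of pi. It occurs as a divisor, so its positivity
  matters.\<close>

definition gauss_mass :: real where
  "gauss_mass = lim (\<lambda>n. integral {- real n..real n} (\<lambda>t. exp (- (t\<^sup>2))))"

lemma gauss_mass: "(\<lambda>n. integral {- real n..real n} (\<lambda>t. exp (- (t\<^sup>2)) :: real)) \<longlonglongrightarrow> gauss_mass"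
proof -
  have "convergent (\<lambda>n. integral {- real n..real n} (\<lambda>t. exp (- (t\<^sup>2)) :: real))"
    by (rule improper_integral_convergent[where K = 1]) (auto intro!: continuous_intros)
  then show ?thesis unfolding gauss_mass_def by (simp add: convergent_LIMSEQ_iff)
qed

lemma gauss_mass_pos: "gauss_mass > 0"
proof -
  \<comment> \<open>On the interval from - 1 to 1 the Gaussian is at least exp (- 1).\<close>
  have "2 * exp (- 1) \<le> integral {- real n..real n} (\<lambda>t. exp (- (t\<^sup>2)) :: real)" if "n \<ge> 1" for n
  proof -
    have int: "(\<lambda>t. exp (- (t\<^sup>2)) :: real) integrable_on {a..b}" for a b
      by (intro integrable_continuous_real continuous_intros)
    have "2 * exp (- 1) = integral {- 1..1 :: real} (\<lambda>t. exp (- 1) :: real)" by simp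
    also have "\<dots> \<le> integral {- 1..1} (\<lambda>t. exp (- (t\<^sup>2)))"
      by (intro integral_le int) (auto simp: abs_square_le_1 abs_le_iff)
    also have "\<dots> \<le> integral {- real n..real n} (\<lambda>t. exp (- (t\<^sup>2)))"
      using that by (intro integral_subset_le int) auto
    finally show ?thesis .
  qed
  then have "2 * exp (- 1) \<le> gauss_mass"
    by (intro LIMSEQ_le_const[OF gauss_mass]) blast
  then show ?thesis by (meson exp_gt_zero less_le_trans mult_pos_pos zero_less_numeral)
qed

lemma smear_norm: "norm (smear b p) \<le> exp (b\<^sup>2) * norm p * gauss_mass"
proof (rule tendsto_le[OF _ _ tendsto_norm[OF smear_partial_LIMSEQ]])
  show "(\<lambda>n. exp (b\<^sup>2) * norm p * integral {- real n..real n} (\<lambda>t. exp (- (t\<^sup>2))))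
      \<longlonglongrightarrow> exp (b\<^sup>2) * norm p * gauss_mass"
    by (intro tendsto_intros gauss_mass)
  have "norm (smear_partial b p n) \<le> integral {- real n..real n} (\<lambda>t. exp (b\<^sup>2) * norm p * exp (- (t\<^sup>2)))" for n
    unfolding smear_partial_def
    by (intro integral_norm_bound_integral integrable_continuous_real smear_integrand_continuous
        continuous_intros smear_integrand_norm)
  then show "\<forall>\<^sub>F n in sequentially. norm (smear_partial b p n)
      \<le> exp (b\<^sup>2) * norm p * integral {- real n..real n} (\<lambda>t. exp (- (t\<^sup>2)))"
    by simp
qed simp

lemma smear_diff: "smear b (p - p') = smear b p - smear b p'"
proof -
  have "smear_partial b (p - p') = (\<lambda>n. smear_partial b p n - smear_partial b p' n)"
    unfolding smear_partial_def
    by (intro ext, subst Henstock_Kurzweil_Integration.integral_diff[symmetric])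
      (auto intro!: integrable_continuous_real smear_integrand_continuous
        simp: alpha_diff complex_vector.scale_right_diff_distrib)
  then have "smear_partial b (p - p') \<longlonglongrightarrow> smear b p - smear b p'"
    using tendsto_diff[OF smear_partial_LIMSEQ[of b p] smear_partial_LIMSEQ[of b p']]
    by simp
  then show ?thesis using smear_partial_LIMSEQ LIMSEQ_unique by blast
qed

section \<open>Elements fixed under the action\<close>

lemma smear_fixed_partial:
  assumes "\<And>t. \<alpha> t h = h"
  shows "smear_partial b h n = integral {- real n..real n} (gauss b) *\<^sub>C h"
proof -
  have "integral {- real n..real n} ((\<lambda>z. z *\<^sub>C h) \<circ> gauss b) = integral {- real n..real n} (gauss b) *\<^sub>C h"
    by (intro integral_linear integrable_continuous_real continuous_gauss
        bounded_bilinear.bounded_linear_left[OF bounded_bilinear_scaleC])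
  then show ?thesis unfolding smear_partial_def by (simp add: assms o_def)
qed

text \<open>The contour shift applied to the constant function 1 shows that the mass on the line of
  height \<beta> equals the mass on the real line.\<close>

lemma gauss_integral: "(\<lambda>n. integral {- real n..real n} (gauss 0)) \<longlonglongrightarrow> of_real gauss_mass"
  "(\<lambda>n. integral {- real n..real n} (gauss \<beta>)) \<longlonglongrightarrow> of_real gauss_mass"
proof -
  have "integral {- real n..real n} (gauss 0) = of_real (integral {- real n..real n} (\<lambda>t. exp (- (t\<^sup>2))))" for n
  proof -
    have "integral {- real n..real n} (of_real \<circ> (\<lambda>t. exp (- (t\<^sup>2)) :: real))
        = (of_real (integral {- real n..real n} (\<lambda>t. exp (- (t\<^sup>2)))) :: complex)"
      by (intro integral_linear integrable_continuous_real continuous_intros bounded_linear_of_real)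
    then show ?thesis by (simp add: o_def gauss_zero[abs_def])
  qed
  then show 1: "(\<lambda>n. integral {- real n..real n} (gauss 0)) \<longlonglongrightarrow> of_real gauss_mass"
    using tendsto_of_real[OF gauss_mass, where ?'a = complex] by simp
  have "bounded ((\<lambda>z. 1 :: complex) ` strip \<beta>)"
    by (rule bounded_subset[of "{1}"]) auto
  then have 2: "(\<lambda>n. integral {- real n..real n} (gauss 0) - integral {- real n..real n} (gauss \<beta>)) \<longlonglongrightarrow> 0"
    using gaussian_contour_shift[of \<beta> "\<lambda>z. 1"] by simp
  show "(\<lambda>n. integral {- real n..real n} (gauss \<beta>)) \<longlonglongrightarrow> of_real gauss_mass"
    using tendsto_diff[OF 1 2] by simp
qed

lemma smear_fixed:
  assumes "\<And>t. \<alpha> t h = h"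
  shows "smear 0 h = gauss_mass *\<^sub>R h" "smear \<beta> h = gauss_mass *\<^sub>R h"
proof -
  have "smear_partial b h \<longlonglongrightarrow> of_real gauss_mass *\<^sub>C h"
    if "(\<lambda>n. integral {- real n..real n} (gauss b)) \<longlonglongrightarrow> of_real gauss_mass" for b
    unfolding smear_fixed_partial[OF assms, abs_def] by (intro tendsto_intros that)
  then show "smear 0 h = gauss_mass *\<^sub>R h" "smear \<beta> h = gauss_mass *\<^sub>R h"
    using gauss_integral smear_partial_LIMSEQ LIMSEQ_unique scaleC_of_real by metis+
qed

text \<open>For a fixed element both smearings are the same multiple of it, and the exchange rule
  \<open>smear_shift\<close> becomes a trace property.\<close>

lemma fixed_central:
  assumes h: "h \<in> Mpos" "\<And>t. \<alpha> t h = h" and x: "x \<in> NN"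
  shows "L (x * h) = L (h * x)"
proof -
  have hN: "h \<in> \<N> \<psi>" "star h = h"
    using h(1) by (auto simp: Mpos_N Mpos_def pos_cone_selfadjoint)
  have d: "x * h \<in> weight_dom \<psi>" "h * x \<in> weight_dom \<psi>"
    using x hN by (auto simp: mem_NN intro!: dom_mult)
  have "of_real gauss_mass * L (x * h) = of_real gauss_mass * L (h * x)"
    using smear_shift[OF h(1) x] L_scaleC[OF d(1), of "of_real gauss_mass"]
      L_scaleC[OF d(2), of "of_real gauss_mass"]
    by (simp add: smear_fixed[OF h(2)] scaleC_of_real)
  then show ?thesis using gauss_mass_pos by simp
qed

text \<open>Centrality is the shift hypothesis of \<open>right_mult_bound\<close> with y = w = h,
  which therefore yields the sharp constant norm h.\<close>

lemma fixed_right_mult_le: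
  assumes h: "h \<in> Mpos" "\<And>t. \<alpha> t h = h" and a: "a \<in> \<N> \<psi>"
  shows "q (a * h) \<le> norm h * q a"
proof -
  have "(q (a * h))\<^sup>2 \<le> (q a)\<^sup>2 * (norm h * norm h)"
    using h(1) fixed_central[OF h]
    by (intro right_mult_bound a Mpos_N Mpos_NN) (auto simp: Mpos_def pos_cone_selfadjoint)
  then have "(q (a * h))\<^sup>2 \<le> (norm h * q a)\<^sup>2" by (simp add: power2_eq_square mult_ac)
  then show ?thesis by (rule power2_le_imp_le) simp
qed

text \<open>Here \<open>h\<close> need not have finite weight: it is approximated by smeared elements of finite
  weight, for which right multiplication is controlled by the KMS condition.\<close>

lemma fixed_right_mult_N:
  assumes h: "h \<in> pos_cone" "\<And>t. \<alpha> t h = h" and a: "a \<in> \<N> \<psi>"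
  shows "a * h \<in> \<N> \<psi>"
proof -
  have "h \<in> closure {p \<in> pos_cone. \<psi> p < \<infinity>}"
    using proper h(1) unfolding proper_weight_def by blast
  then obtain p where p: "\<And>n. p n \<in> Mpos" "p \<longlonglongrightarrow> h"
    unfolding Mpos_def[symmetric] closure_sequential by blast
  obtain C where C: "\<And>n. norm (p n) \<le> C"
    using p(2) by (metis convergentI convergent_imp_Bseq BseqE)
  have C0: "C \<ge> 0" using C[of 0] norm_ge_zero order_trans by blast
  define y where "y = (\<lambda>n. smear 0 (p n))"
  have "y \<longlonglongrightarrow> gauss_mass *\<^sub>R h"
  proof (rule LIM_zero_cancel, rule Lim_null_comparison)
    show "\<forall>\<^sub>F n in sequentially. norm (y n - gauss_mass *\<^sub>R h) \<le> norm (p n - h) * gauss_mass"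
      using smear_norm[of 0 "p _ - h"]
      by (intro always_eventually) (simp add: y_def smear_diff smear_fixed[OF h(2)])
    show "(\<lambda>n. norm (p n - h) * gauss_mass) \<longlonglongrightarrow> 0"
      by (intro tendsto_mult_left_zero tendsto_norm_zero LIM_zero p)
  qed
  then have lim: "(\<lambda>n. a * y n) \<longlonglongrightarrow> a * (gauss_mass *\<^sub>R h)" by (intro tendsto_intros)
  have yN: "y n \<in> \<N> \<psi>" for n unfolding y_def by (intro smear_N p)
  \<comment> \<open>Convergent sequences are bounded, so the norms of both smearings of p n, and
    with them the bound of \<open>right_mult_bound\<close>, are uniform in n. Lower semicontinuity
    then applies along a * y n.\<close>
  have "q (a * y n) \<le> sqrt ((q a)\<^sup>2 * ((C * gauss_mass) * (exp (\<beta>\<^sup>2) * C * gauss_mass)))" for n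
  proof -
    have "star (y n) = y n"
      using p(1)[of n] by (simp add: y_def smear_star Mpos_def pos_cone_selfadjoint)
    then have "(q (a * y n))\<^sup>2 \<le> (q a)\<^sup>2 * (norm (y n) * norm (smear \<beta> (p n)))"
      using p(1)[of n] a yN by (intro right_mult_bound smear_NN) (auto simp: y_def intro: smear_shift)
    also have "\<dots> \<le> (q a)\<^sup>2 * ((C * gauss_mass) * (exp (\<beta>\<^sup>2) * C * gauss_mass))"
    proof (intro mult_left_mono mult_mono)
      have "norm (p n) * gauss_mass \<le> C * gauss_mass"
        using C gauss_mass_pos by (intro mult_right_mono) auto
      then show "norm (y n) \<le> C * gauss_mass"
        using smear_norm[of 0 "p n"] by (simp add: y_def)
      have "exp (\<beta>\<^sup>2) * norm (p n) * gauss_mass \<le> exp (\<beta>\<^sup>2) * C * gauss_mass"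
        using C gauss_mass_pos by (intro mult_right_mono mult_left_mono) auto
      then show "norm (smear \<beta> (p n)) \<le> exp (\<beta>\<^sup>2) * C * gauss_mass"
        using smear_norm[of \<beta> "p n"] order_trans by blast
    qed (use C0 gauss_mass_pos in auto)
    finally show ?thesis by (simp add: real_le_rsqrt)
  qed
  then have "a * (gauss_mass *\<^sub>R h) \<in> \<N> \<psi>"
    using q_lower_semicontinuous(1)[OF lim N_left_mult[OF yN]] by blast
  then have "(1 / gauss_mass) *\<^sub>R (a * (gauss_mass *\<^sub>R h)) \<in> \<N> \<psi>" by (rule N_scaleR)
  then show ?thesis using gauss_mass_pos by simp
qed

end

section \<open>Compactly supported functions\<close>

text \<open>\<open>Cc\<close> for an arbitrary normed target: complex values occur in the
  convolution algebra, real values in Urysohn functions and in the Riesz theorem.\<close>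

definition compactly_supported :: "('x :: topological_space \<Rightarrow> 'b :: real_normed_vector) \<Rightarrow> bool" where
  "compactly_supported f \<longleftrightarrow> continuous_on UNIV f \<and> compact (closure {x. f x \<noteq> 0})"

lemma Cc_iff: "f \<in> Cc \<longleftrightarrow> compactly_supported f"
  by (simp add: Cc_def compactly_supported_def)

lemma compactly_supportedI:
  fixes f :: "'x :: t2_space \<Rightarrow> 'b :: real_normed_vector"
  assumes "continuous_on UNIV f" "compact K" "\<And>x. x \<notin> K \<Longrightarrow> f x = 0"
  shows "compactly_supported f"
proof -
  have "closure {x. f x \<noteq> 0} \<subseteq> K"
    using assms by (intro closure_minimal compact_imp_closed) auto
  then have "closure {x. f x \<noteq> 0} = K \<inter> closure {x. f x \<noteq> 0}" by blast
  moreover have "compact (K \<inter> closure {x. f x \<noteq> 0})"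
    using assms(2) by (intro compact_Int_closed) auto
  ultimately show ?thesis using assms(1) by (simp add: compactly_supported_def)
qed

lemma zero_outside_closure_support:
  assumes "x \<notin> closure {x. f x \<noteq> 0}"
  shows "f x = 0"
proof (rule ccontr)
  assume "f x \<noteq> 0"
  then have "x \<in> {x. f x \<noteq> 0}" by simp
  then have "x \<in> closure {x. f x \<noteq> 0}" by (rule subsetD[OF closure_subset])
  with assms show False by contradiction
qed

lemma compactly_supportedE:
  assumes "compactly_supported f"
  obtains K where "continuous_on UNIV f" "compact K" "closed K" "\<And>x. x \<notin> K \<Longrightarrow> f x = 0"
  using assms zero_outside_closure_support[of _ f] unfolding compactly_supported_def
  by (elim conjE) (rule that[OF _ _ closed_closure])

lemma compactly_supported_bounded:
  assumes "compactly_supported f"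
  obtains B where "B > 0" "\<And>x. norm (f x) \<le> B"
proof -
  obtain K where K: "continuous_on UNIV f" "compact K" "\<And>x. x \<notin> K \<Longrightarrow> f x = 0"
    using assms compactly_supportedE by metis
  then have "bounded (f ` K)"
    by (meson compact_continuous_image compact_imp_bounded continuous_on_subset subset_UNIV)
  then obtain B where B: "B > 0" "\<And>x. x \<in> K \<Longrightarrow> norm (f x) \<le> B"
    unfolding bounded_pos by auto
  then have "norm (f x) \<le> B" for x using K(3)[of x] by (cases "x \<in> K") auto
  then show thesis using that B by blast
qed

lemma compactly_supported_zero: "compactly_supported (\<lambda>x. 0)"
  by (simp add: compactly_supported_def)

lemma compactly_supported_compose:
  fixes f :: "'x :: t2_space \<Rightarrow> 'b :: real_normed_vector" and \<phi> :: "'b \<Rightarrow> 'c :: real_normed_vector"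
  assumes "compactly_supported f" "continuous_on UNIV \<phi>" "\<phi> 0 = 0"
  shows "compactly_supported (\<lambda>x. \<phi> (f x))"
proof -
  obtain K where K: "continuous_on UNIV f" "compact K" "\<And>x. x \<notin> K \<Longrightarrow> f x = 0"
    using assms compactly_supportedE by metis
  then show ?thesis
    using assms by (intro compactly_supportedI[OF _ K(2)] continuous_on_compose2[OF assms(2)]) auto
qed

lemma compactly_supported_compose2:
  fixes f :: "'x :: t2_space \<Rightarrow> 'b :: real_normed_vector" and g :: "'x \<Rightarrow> 'c :: real_normed_vector"
    and \<phi> :: "'b \<Rightarrow> 'c \<Rightarrow> 'd :: real_normed_vector"
  assumes "compactly_supported f" "compactly_supported g"
    and "continuous_on UNIV (\<lambda>x. \<phi> (f x) (g x))" "\<phi> 0 0 = 0"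
  shows "compactly_supported (\<lambda>x. \<phi> (f x) (g x))"
proof -
  obtain K where K: "continuous_on UNIV f" "compact K" "\<And>x. x \<notin> K \<Longrightarrow> f x = 0"
    using assms compactly_supportedE by metis
  obtain K' where K': "continuous_on UNIV g" "compact K'" "\<And>x. x \<notin> K' \<Longrightarrow> g x = 0"
    using assms compactly_supportedE by metis
  show ?thesis
    by (rule compactly_supportedI[of _ "K \<union> K'"]) (use K K' assms in auto)
qed

lemma compactly_supported_continuous: "compactly_supported f \<Longrightarrow> continuous_on S f"
  unfolding compactly_supported_def using continuous_on_subset by blast

lemma compactly_supported_add:
  fixes f :: "'x :: t2_space \<Rightarrow> 'b :: real_normed_vector"
  assumes "compactly_supported f" "compactly_supported g"
  shows "compactly_supported (\<lambda>x. f x + g x)"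
  using compactly_supported_compose2[of f g "(+)"] assms
  by (simp add: continuous_on_add compactly_supported_continuous)

lemma compactly_supported_diff:
  fixes f :: "'x :: t2_space \<Rightarrow> 'b :: real_normed_vector"
  assumes "compactly_supported f" "compactly_supported g"
  shows "compactly_supported (\<lambda>x. f x - g x)"
  using compactly_supported_compose2[of f g "(-)"] assms
  by (simp add: continuous_on_diff compactly_supported_continuous)

lemma compactly_supported_sum:
  fixes f :: "'i \<Rightarrow> 'x :: t2_space \<Rightarrow> 'b :: real_normed_vector"
  shows "(\<And>i. i \<in> I \<Longrightarrow> compactly_supported (f i)) \<Longrightarrow> compactly_supported (\<lambda>x. \<Sum>i\<in>I. f i x)"
  by (induction I rule: infinite_finite_induct) (auto intro: compactly_supported_zero compactly_supported_add)

text \<open>Only continuity near the support of \<open>f\<close> is needed, because \<open>u * f\<close> vanishes elsewhere.\<close>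

lemma compactly_supported_mult:
  fixes f u :: "'x :: t2_space \<Rightarrow> 'b :: real_normed_algebra"
  assumes f: "compactly_supported f" and V: "open V" "continuous_on V u" "closure {x. f x \<noteq> 0} \<subseteq> V"
  shows "compactly_supported (\<lambda>x. u x * f x)"
proof (rule compactly_supportedI)
  have "continuous_on (V \<union> - closure {x. f x \<noteq> 0}) (\<lambda>x. u x * f x)"
  proof (rule continuous_on_open_Un)
    show "continuous_on V (\<lambda>x. u x * f x)"
      by (rule continuous_on_mult[OF V(2) compactly_supported_continuous[OF f]])
    have "u x * f x = 0" if "x \<in> - closure {x. f x \<noteq> 0}" for x
      using zero_outside_closure_support[of x f] that by simp
    then show "continuous_on (- closure {x. f x \<noteq> 0}) (\<lambda>x. u x * f x)"
      by (subst continuous_on_cong[OF refl, where g = "\<lambda>_. 0"]) auto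
  qed (use V in auto)
  moreover have "V \<union> - closure {x. f x \<noteq> 0} = UNIV" using V by blast
  ultimately show "continuous_on UNIV (\<lambda>x. u x * f x)" by simp
  show "compact (closure {x. f x \<noteq> 0})" using f by (simp add: compactly_supported_def)
  show "u x * f x = 0" if "x \<notin> closure {x. f x \<noteq> 0}" for x
    using zero_outside_closure_support[of x f] that by simp
qed

lemma compactly_supported_mult_cont:
  fixes f u :: "'x :: t2_space \<Rightarrow> 'b :: real_normed_algebra"
  assumes "compactly_supported f" "continuous_on UNIV u"
  shows "compactly_supported (\<lambda>x. u x * f x)"
  using compactly_supported_mult[of f UNIV u] assms by simp

lemma compactly_supported_mult_clopen:
  fixes f :: "'x :: t2_space \<Rightarrow> 'b :: real_normed_vector"
  assumes f: "compactly_supported f" and S: "open S" "closed S"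
  shows "compactly_supported (\<lambda>x. if x \<in> S then f x else 0)"
proof -
  obtain K where K: "continuous_on UNIV f" "compact K" "\<And>x. x \<notin> K \<Longrightarrow> f x = 0"
    using f compactly_supportedE by metis
  have "continuous_on (S \<union> - S) (\<lambda>x. if x \<in> S then f x else 0)"
  proof (rule continuous_on_open_Un)
    show "continuous_on S (\<lambda>x. if x \<in> S then f x else 0)"
      using compactly_supported_continuous[OF f] by (subst continuous_on_cong[OF refl, where g = f]) auto
    show "continuous_on (- S) (\<lambda>x. if x \<in> S then f x else 0)"
      by (subst continuous_on_cong[OF refl, where g = "\<lambda>_. 0"]) auto
  qed (use S in auto)
  then show ?thesis using K by (intro compactly_supportedI[of _ K]) (auto simp: Compl_partition)
qed

section \<open>Separation and exhaustion in second countable locally compact spaces\<close>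

locale lc_space =
  fixes dummy :: "'x :: {second_countable_topology, t2_space} itself"
  assumes locally_compact: "locally_compact_space (euclidean :: 'x topology)"
begin

lemma Hausdorff_euclidean: "Hausdorff_space (euclidean :: 'x topology)"
  unfolding Hausdorff_space_def by (auto simp: disjnt_def) (metis hausdorff)

text \<open>Locally compact Hausdorff spaces are regular, and second countability gives the Lindelof
  property that upgrades regular to normal.\<close>

lemma normal_euclidean: "normal_space (euclidean :: 'x topology)"
proof (rule regular_Lindelof_imp_normal_space)
  show "regular_space (euclidean :: 'x topology)"
    using locally_compact_Hausdorff_imp_regular_space[OF locally_compact Hausdorff_euclidean] .
  show "Lindelof_space (euclidean :: 'x topology)"
    unfolding Lindelof_space_def using Lindelof by (metis open_openin topspace_euclidean)
qed

lemma compact_neighbourhood: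
  assumes "compact (K :: 'x set)"
  obtains W L where "open W" "compact L" "K \<subseteq> W" "W \<subseteq> L"
  using assms locally_compact Hausdorff_euclidean
    locally_compact_space_compact_closed_compact[of "euclidean :: 'x topology"]
  by (metis compactin_euclidean_iff open_openin)

lemma Urysohn_compact:
  assumes K: "compact (K :: 'x set)" "open U" "K \<subseteq> U"
  obtains f :: "'x \<Rightarrow> real" where "compactly_supported f" "\<And>x. 0 \<le> f x" "\<And>x. f x \<le> 1"
    "\<And>x. x \<in> K \<Longrightarrow> f x = 1" "closure {x. f x \<noteq> 0} \<subseteq> U"
proof -
  obtain W L where W: "open W" "compact L" "K \<subseteq> W" "W \<subseteq> L"
    using compact_neighbourhood[OF K(1)] by blast
  have "closed K" using K by (intro compact_imp_closed)
  \<comment> \<open>The closure of V lies in both W and U: containment in W bounds the support by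
    the compact set L, containment in U places its closure inside U.\<close>
  obtain V where V: "open V" "K \<subseteq> V" "closure V \<subseteq> W \<inter> U"
  proof -
    have "\<exists>V. openin euclidean V \<and> K \<subseteq> V \<and> euclidean closure_of V \<subseteq> W \<inter> U"
      using normal_euclidean \<open>closed K\<close> K W unfolding normal_space_alt
      by (metis Int_subset_iff closed_closedin open_Int open_openin)
    then show thesis using that by (auto simp flip: open_openin euclidean_closure_of)
  qed
  obtain f :: "'x \<Rightarrow> real" where f: "continuous_map euclidean (top_of_set {0..1}) f" "f ` (- V) \<subseteq> {0}" "f ` K \<subseteq> {1}"
    using Urysohn_lemma[OF normal_euclidean, of "- V" K 0 1] V \<open>closed K\<close>
    by (auto simp: disjnt_def closed_Compl)
  have f': "continuous_on UNIV f" "\<And>x. 0 \<le> f x \<and> f x \<le> 1"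
    using f(1) by (auto simp: continuous_map_in_subtopology image_subset_iff)
  have nz: "{x. f x \<noteq> 0} \<subseteq> V" using f(2) by force
  show thesis
  proof (rule that)
    show "compactly_supported f"
    proof (rule compactly_supportedI[OF f'(1) W(2)])
      show "f x = 0" if "x \<notin> L" for x
        using that nz V(3) W(4) closure_subset[of V] by blast
    qed
    show "f x = 1" if "x \<in> K" for x using f(3) that by blast
    show "closure {x. f x \<noteq> 0} \<subseteq> U" using closure_mono[OF nz] V by blast
  qed (use f' in auto)
qed

text \<open>Countably many bump functions suffice by the Lindelof property, and truncated partial
  sums of them increase to the indicator of U. Such sequences split covers in the outer measure,
  give an exhaustion by compact sets for inner regularity, and produce the approximate unit of the
  algebra.\<close>

lemma open_exhaustion:
  assumes U: "open (U :: 'x set)"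
  obtains g :: "nat \<Rightarrow> 'x \<Rightarrow> real" where "\<And>k. compactly_supported (g k)" "\<And>k x. 0 \<le> g k x"
    "\<And>k x. g k x \<le> 1" "\<And>x. incseq (\<lambda>k. g k x)" "\<And>k x. x \<notin> U \<Longrightarrow> g k x = 0"
    "\<And>K. compact K \<Longrightarrow> K \<subseteq> U \<Longrightarrow> \<exists>k. \<forall>x\<in>K. g k x = 1"
proof -
  have "\<exists>f :: 'x \<Rightarrow> real. compactly_supported f \<and> (\<forall>y. 0 \<le> f y) \<and> f x = 1 \<and> (\<forall>y. y \<notin> U \<longrightarrow> f y = 0)"
    if x: "x \<in> U" for x
  proof -
    obtain f :: "'x \<Rightarrow> real" where "compactly_supported f" "\<And>y. 0 \<le> f y" "f x = 1" "closure {x. f x \<noteq> 0} \<subseteq> U"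
      by (rule Urysohn_compact[of "{x}" U]) (use U x in auto)
    then show ?thesis using closure_subset[of "{x. f x \<noteq> 0}"] by blast
  qed
  then obtain F where F: "\<And>x. x \<in> U \<Longrightarrow> compactly_supported (F x) \<and> (\<forall>y. 0 \<le> F x y) \<and> F x x = (1 :: real)
      \<and> (\<forall>y. y \<notin> U \<longrightarrow> F x y = 0)"
    by metis
  define W where "W = (\<lambda>x. {y. 1/2 < F x y})"
  have W: "open (W x)" if "x \<in> U" for x
    unfolding W_def using F[OF that] by (intro open_Collect_less continuous_intros compactly_supported_continuous) auto
  then obtain \<W> where \<W>: "\<W> \<subseteq> W ` U" "countable \<W>" "\<Union>\<W> = \<Union>(W ` U)"
    using Lindelof[of "W ` U"] by (metis imageE)
  then obtain I where I: "I \<subseteq> U" "countable I" "\<W> = W ` I"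
    by (metis countable_subset_image)
  \<comment> \<open>The default 0 concerns the empty set U, where there is nothing to
    enumerate.\<close>
  define f where "f = (\<lambda>n. if I = {} then (\<lambda>_. 0) else F (from_nat_into I n))"
  have f: "compactly_supported (f n)" "0 \<le> f n y" "y \<notin> U \<Longrightarrow> f n y = 0" for n y
    using F I from_nat_into[of I n] by (auto simp: f_def compactly_supported_zero subset_iff)
  have cover: "\<exists>n. 1/2 < f n x" if x: "x \<in> U" for x
  proof -
    have "x \<in> W x" using F[OF x] by (simp add: W_def)
    then obtain i where i: "i \<in> I" "x \<in> W i" using x \<W>(3) I(3) by blast
    obtain n where "i = from_nat_into I n"
      using from_nat_into_surj[OF I(2) i(1)] by metis
    then show ?thesis using i by (auto simp: f_def W_def intro!: exI[of _ n])
  qed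
  \<comment> \<open>Each point of U has a bump exceeding 1/2, so the factor 2 makes the partial sums
    eventually exceed 1 there; by compactness one index then serves all of K.\<close>
  define s where "s = (\<lambda>k x. \<Sum>n<k. 2 * f n x)"
  have s: "compactly_supported (s k)" "0 \<le> s k x" "incseq (\<lambda>k. s k x)" "x \<notin> U \<Longrightarrow> s k x = 0" for k x
  proof -
    have "compactly_supported (\<lambda>x. 2 * f n x)" for n
      using compactly_supported_mult_cont[OF f(1)] by fastforce
    then show "compactly_supported (s k)" unfolding s_def by (intro compactly_supported_sum)
    show "0 \<le> s k x" unfolding s_def using f by (intro sum_nonneg) auto
    show "incseq (\<lambda>k. s k x)" unfolding s_def using f by (intro incseq_SucI) auto
    show "x \<notin> U \<Longrightarrow> s k x = 0" unfolding s_def using f by (intro sum.neutral) auto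
  qed
  show thesis
  proof (rule that[of "\<lambda>k x. min 1 (s k x)"])
    show "compactly_supported (\<lambda>x. min 1 (s k x))" for k
      using compactly_supported_compose[OF s(1), of "min 1"] by (simp add: continuous_on_min)
    show "incseq (\<lambda>k. min 1 (s k x))" for x
      using s(3)[of x] unfolding incseq_def by (metis min.mono order_refl)
    show "\<exists>k. \<forall>x\<in>K. min 1 (s k x) = 1" if K: "compact K" "K \<subseteq> U" for K
    proof -
      define O' where "O' = (\<lambda>k. {x. 1 < s k x})"
      have "open (O' k)" for k
        unfolding O'_def using s by (intro open_Collect_less continuous_intros compactly_supported_continuous) auto
      moreover have "K \<subseteq> (\<Union>k\<in>UNIV. O' k)"
      proof
        fix x assume "x \<in> K"
        then obtain n where n: "1/2 < f n x" using cover K by blast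
        have "2 * f n x \<le> s (Suc n) x" using s(2)[of n x] by (simp add: s_def)
        then show "x \<in> (\<Union>k\<in>UNIV. O' k)" using n by (auto simp: O'_def intro!: exI[of _ "Suc n"])
      qed
      ultimately obtain D where D: "finite D" "K \<subseteq> (\<Union>k\<in>D. O' k)"
        by (rule compactE_image[OF K(1)])
      then obtain m where m: "\<And>k. k \<in> D \<Longrightarrow> k \<le> m" by (meson finite_nat_set_iff_bounded_le)
      have "1 \<le> s m x" if x: "x \<in> K" for x
      proof -
        obtain k where "k \<in> D" "1 < s k x" using D x by (auto simp: O'_def)
        then show ?thesis using incseqD[OF s(3)[of x] m[of k]] by simp
      qed
      then show ?thesis by (intro exI[of _ m]) auto
    qed
  qed (use s in auto)
qed

end

section \<open>The Riesz representation theorem\<close>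

locale positive_functional = lc_space dummy
  for dummy :: "'x :: {second_countable_topology, t2_space} itself" +
  fixes I :: "('x \<Rightarrow> real) \<Rightarrow> real"
  assumes I_add: "compactly_supported f \<Longrightarrow> compactly_supported g \<Longrightarrow> I (\<lambda>x. f x + g x) = I f + I g"
    and I_scale: "compactly_supported f \<Longrightarrow> I (\<lambda>x. r * f x) = r * I f"
    and I_nonneg: "compactly_supported f \<Longrightarrow> (\<And>x. 0 \<le> f x) \<Longrightarrow> 0 \<le> I f"
begin

definition Cp :: "('x \<Rightarrow> real) set" where
  "Cp = {f. compactly_supported f \<and> (\<forall>x. 0 \<le> f x)}"

lemma CpD: "f \<in> Cp \<Longrightarrow> compactly_supported f" "f \<in> Cp \<Longrightarrow> 0 \<le> f x"
  by (auto simp: Cp_def)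

lemma Cp_zero: "(\<lambda>x. 0) \<in> Cp"
  by (simp add: Cp_def compactly_supported_zero)

lemma I_zero: "I (\<lambda>x. 0) = 0"
  using I_scale[OF compactly_supported_zero, of 0] by simp

lemma Cp_add: "f \<in> Cp \<Longrightarrow> g \<in> Cp \<Longrightarrow> (\<lambda>x. f x + g x) \<in> Cp"
  by (simp add: Cp_def compactly_supported_add)

lemma Cp_mult: "f \<in> Cp \<Longrightarrow> continuous_on UNIV u \<Longrightarrow> (\<And>x. 0 \<le> u x) \<Longrightarrow> (\<lambda>x. u x * f x) \<in> Cp"
  by (simp add: Cp_def compactly_supported_mult_cont)

lemma Cp_scale: "f \<in> Cp \<Longrightarrow> 0 \<le> r \<Longrightarrow> (\<lambda>x. r * f x) \<in> Cp"
  by (rule Cp_mult) auto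

lemma Cp_sum: "(\<And>i. i \<in> A \<Longrightarrow> f i \<in> Cp) \<Longrightarrow> (\<lambda>x. \<Sum>i\<in>A. f i x) \<in> Cp"
  by (simp add: Cp_def compactly_supported_sum sum_nonneg)

lemma I_Cp_nonneg: "f \<in> Cp \<Longrightarrow> 0 \<le> I f"
  by (simp add: Cp_def I_nonneg)

lemma I_diff:
  assumes "compactly_supported f" "compactly_supported g"
  shows "I (\<lambda>x. f x - g x) = I f - I g"
  using I_add[OF compactly_supported_diff[OF assms] assms(2)] by simp

lemma I_mono: "compactly_supported f \<Longrightarrow> compactly_supported g \<Longrightarrow> (\<And>x. f x \<le> g x) \<Longrightarrow> I f \<le> I g"
  using I_nonneg[OF compactly_supported_diff, of g f] I_diff[of g f] by simp

lemma I_sum: "(\<And>i. i \<in> A \<Longrightarrow> compactly_supported (f i)) \<Longrightarrow> I (\<lambda>x. \<Sum>i\<in>A. f i x) = (\<Sum>i\<in>A. I (f i))"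
  by (induction A rule: infinite_finite_induct) (auto simp: I_zero I_add compactly_supported_sum)

lemma partial_sum_less_suminf:
  fixes F :: "nat \<Rightarrow> real"
  assumes "\<And>n. 0 \<le> F n" "ennreal a \<le> (\<Sum>n. ennreal (F n))" "e > 0"
  shows "\<exists>N. a < (\<Sum>n<N. F n) + e"
proof (rule ccontr)
  assume "\<nexists>N. a < (\<Sum>n<N. F n) + e"
  then have le: "(\<Sum>n<N. F n) \<le> a - e" for N by (meson not_le add_le_imp_le_diff)
  have "a - e \<ge> 0" using le[of 0] by simp
  have "(\<Sum>n. ennreal (F n)) \<le> ennreal (a - e)"
  proof (rule suminf_le_const)
    show "summable (\<lambda>n. ennreal (F n))" by simp
    show "(\<Sum>n<N. ennreal (F n)) \<le> ennreal (a - e)" for N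
      using le[of N] assms(1) by (simp add: sum_ennreal ennreal_leI)
  qed
  then have "ennreal a \<le> ennreal (a - e)" using assms(2) by order
  then show False using \<open>a - e \<ge> 0\<close> \<open>e > 0\<close> by simp
qed

text \<open>Dini's theorem on the support of \<open>f\<close> makes the functional countably subadditive.\<close>

lemma I_le_suminf:
  assumes f: "f \<in> Cp" and F: "\<And>n :: nat. F n \<in> Cp"
    and le: "\<And>x. ennreal (f x) \<le> (\<Sum>n. ennreal (F n x))"
  shows "ennreal (I f) \<le> (\<Sum>n. ennreal (I (F n)))"
proof -
  obtain K where K: "compact K" "\<And>x. x \<notin> K \<Longrightarrow> f x = 0"
    using CpD(1)[OF f] compactly_supportedE by metis
  \<comment> \<open>A cutoff that equals 1 on the support of f turns the error e into the compactly
    supported function e * k, to which the functional applies.\<close>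
  obtain k :: "'x \<Rightarrow> real" where k: "compactly_supported k" "\<And>x. 0 \<le> k x" "\<And>x. x \<in> K \<Longrightarrow> k x = 1"
    using Urysohn_compact[OF K(1) open_UNIV subset_UNIV] by metis
  have kC: "k \<in> Cp" using k by (simp add: Cp_def)
  have main: "ennreal (I f) \<le> (\<Sum>n. ennreal (I (F n))) + ennreal (e * I k)" if "e > 0" for e
  proof -
    define V where "V = (\<lambda>N. {x. f x < (\<Sum>n<N. F n x) + e})"
    have "open (V N)" for N
      unfolding V_def using f F
      by (intro open_Collect_less continuous_intros compactly_supported_continuous CpD(1)) auto
    moreover have "K \<subseteq> (\<Union>N\<in>UNIV. V N)"
      using partial_sum_less_suminf[OF CpD(2)[OF F] le that] by (auto simp: V_def)
    ultimately obtain D where D: "finite D" "K \<subseteq> (\<Union>N\<in>D. V N)"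
      by (rule compactE_image[OF K(1)])
    then obtain m where m: "\<And>N. N \<in> D \<Longrightarrow> N \<le> m" by (meson finite_nat_set_iff_bounded_le)
    have "f x \<le> (\<Sum>n<m. F n x) + e * k x" for x
    proof (cases "x \<in> K")
      case True
      then obtain N where N: "N \<in> D" "f x < (\<Sum>n<N. F n x) + e" using D by (auto simp: V_def)
      have "(\<Sum>n<N. F n x) \<le> (\<Sum>n<m. F n x)"
        using m[OF N(1)] CpD(2)[OF F] by (intro sum_mono2) auto
      then show ?thesis using N k(3)[OF True] by simp
    next
      case False
      then show ?thesis
        using K(2) k(2) that CpD(2)[OF F] by (simp add: sum_nonneg)
    qed
    then have "I f \<le> I (\<lambda>x. (\<Sum>n<m. F n x) + e * k x)"
      using f F kC that
      by (intro I_mono CpD(1) Cp_add Cp_sum Cp_scale) auto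
    also have "\<dots> = (\<Sum>n<m. I (F n)) + e * I k"
      using F kC that by (subst I_add) (auto intro!: CpD(1) Cp_sum Cp_scale simp: I_sum I_scale CpD)
    finally have "ennreal (I f) \<le> ennreal ((\<Sum>n<m. I (F n)) + e * I k)" by (rule ennreal_leI)
    also have "\<dots> = (\<Sum>n<m. ennreal (I (F n))) + ennreal (e * I k)"
      using F kC that by (simp add: sum_ennreal I_Cp_nonneg sum_nonneg)
    also have "(\<Sum>n<m. ennreal (I (F n))) \<le> (\<Sum>n. ennreal (I (F n)))"
      by (intro sum_le_suminf) auto
    finally show ?thesis by (simp add: add_right_mono)
  qed
  show ?thesis
  proof (rule ennreal_le_epsilon)
    fix e :: real assume e: "0 < e"
    define d where "d = e / (I k + 1)"
    have Ik: "0 \<le> I k" using kC by (rule I_Cp_nonneg)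
    then have d: "d > 0" "d * I k \<le> e" using e by (auto simp: d_def field_simps)
    have "ennreal (I f) \<le> (\<Sum>n. ennreal (I (F n))) + ennreal (d * I k)" by (rule main[OF d(1)])
    also have "\<dots> \<le> (\<Sum>n. ennreal (I (F n))) + ennreal e"
      using d by (intro add_left_mono ennreal_leI)
    finally show "ennreal (I f) \<le> (\<Sum>n. ennreal (I (F n))) + ennreal e" .
  qed
qed

section \<open>The outer measure of a positive functional\<close>

definition cover :: "'x set \<Rightarrow> (nat \<Rightarrow> 'x \<Rightarrow> real) set" where
  "cover E = {F. (\<forall>n. F n \<in> Cp) \<and> (\<forall>x\<in>E. 1 \<le> (\<Sum>n. ennreal (F n x)))}"

text \<open>Arbitrary sets are covered directly by series of functions instead of passing through
  open sets. Countable subadditivity is then a reindexing of double series, while outer regularity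
  becomes a theorem.\<close>

definition outer :: "'x set \<Rightarrow> ennreal" where
  "outer E = (INF F\<in>cover E. \<Sum>n. ennreal (I (F n)))"

lemma outer_le: "F \<in> cover E \<Longrightarrow> outer E \<le> (\<Sum>n. ennreal (I (F n)))"
  unfolding outer_def by (rule INF_lower)

lemma outer_mono: "A \<subseteq> B \<Longrightarrow> outer A \<le> outer B"
  unfolding outer_def cover_def by (rule INF_superset_mono) auto

lemma outer_le_2dim:
  assumes F: "\<And>n k :: nat. F n k \<in> Cp" and E: "\<And>x. x \<in> E \<Longrightarrow> 1 \<le> (\<Sum>n. \<Sum>k. ennreal (F n k x))"
  shows "outer E \<le> (\<Sum>n. \<Sum>k. ennreal (I (F n k)))"
proof -
  define G where "G = (\<lambda>i. case prod_decode i of (n, k) \<Rightarrow> F n k)"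
  have "(\<Sum>i. ennreal (G i x)) = (\<Sum>n. \<Sum>k. ennreal (F n k x))" for x
    using suminf_ennreal_2dimen[of "\<lambda>n. \<Sum>k. ennreal (F n k x)" "\<lambda>(n, k). ennreal (F n k x)"]
    by (simp add: G_def split_def)
  then have "G \<in> cover E" using F E by (auto simp: cover_def G_def split: prod.split)
  then have "outer E \<le> (\<Sum>i. ennreal (I (G i)))" by (rule outer_le)
  also have "\<dots> = (\<Sum>n. \<Sum>k. ennreal (I (F n k)))"
    using suminf_ennreal_2dimen[of "\<lambda>n. \<Sum>k. ennreal (I (F n k))" "\<lambda>(n, k). ennreal (I (F n k))"]
    by (simp add: G_def split_def)
  finally show ?thesis .
qed

lemma single_suminf: "(\<Sum>n. ennreal (if n = 0 then a else 0)) = ennreal a"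
  using suminf_finite[of "{0 :: nat}" "\<lambda>n. ennreal (if n = 0 then a else 0)"] by simp

lemma outer_le_I:
  assumes "f \<in> Cp" "\<And>x. x \<in> E \<Longrightarrow> 1 \<le> f x"
  shows "outer E \<le> ennreal (I f)"
proof -
  define F where "F = (\<lambda>n x. if n = (0 :: nat) then f x else 0)"
  have F: "F n = (if n = 0 then f else (\<lambda>x. 0))" for n by (auto simp: F_def)
  have "1 \<le> (\<Sum>n. ennreal (F n x))" if "x \<in> E" for x
    using assms(2)[OF that] by (simp add: F_def single_suminf)
  then have "F \<in> cover E" using assms(1) Cp_zero by (simp add: cover_def F)
  then have "outer E \<le> (\<Sum>n. ennreal (I (F n)))" by (rule outer_le)
  also have "\<dots> = (\<Sum>n. ennreal (if n = 0 then I f else 0))"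
    by (intro suminf_cong) (simp add: F I_zero)
  finally show ?thesis by (simp add: single_suminf)
qed

lemma I_le_outer:
  assumes "f \<in> Cp" "\<And>x. f x \<le> indicator E x"
  shows "ennreal (I f) \<le> outer E"
  unfolding outer_def
proof (rule INF_greatest)
  fix F assume F: "F \<in> cover E"
  show "ennreal (I f) \<le> (\<Sum>n. ennreal (I (F n)))"
  proof (rule I_le_suminf[OF assms(1)])
    show "ennreal (f x) \<le> (\<Sum>n. ennreal (F n x))" for x
    proof (cases "x \<in> E")
      case True
      then have "ennreal (f x) \<le> 1" using assms(2)[of x] by simp
      also have "1 \<le> (\<Sum>n. ennreal (F n x))" using F True by (simp add: cover_def)
      finally show ?thesis .
    next
      case False
      then show ?thesis using assms(2)[of x] by (simp add: ennreal_neg)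
    qed
  qed (use F in \<open>auto simp: cover_def\<close>)
qed

lemma outer_empty: "outer {} = 0"
  using outer_le_I[OF Cp_zero, of "{}"] by (simp add: I_zero)

lemma outer_approx:
  assumes "outer E < \<infinity>" "e > 0"
  obtains F where "F \<in> cover E" "(\<Sum>n. ennreal (I (F n))) \<le> outer E + ennreal e"
proof -
  have "outer E < outer E + ennreal e"
    using assms by (simp add: ennreal_add_left_cancel_less[of _ 0, simplified] less_top)
  then obtain F where "F \<in> cover E" "(\<Sum>n. ennreal (I (F n))) < outer E + ennreal e"
    by (subst (asm) outer_def) (auto simp: INF_less_iff)
  then show thesis using that by (auto intro: less_imp_le)
qed

lemma outer_UN: "outer (\<Union>i. A i) \<le> (\<Sum>i :: nat. outer (A i))"
proof (cases "\<exists>i. outer (A i) = \<infinity>")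
  case True
  then obtain i where "outer (A i) = \<infinity>" by blast
  moreover have "outer (A i) \<le> (\<Sum>i. outer (A i))"
    using sum_le_suminf[of "\<lambda>i. outer (A i)" "{i}"] by simp
  ultimately show ?thesis by (simp add: top_unique)
next
  case False
  then have fin: "outer (A i) < \<infinity>" for i by (simp add: less_top)
  show ?thesis
  proof (rule ennreal_le_epsilon)
    fix e :: real assume e: "0 < e"
    have "\<exists>F\<in>cover (A i). (\<Sum>n. ennreal (I (F n))) \<le> outer (A i) + ennreal (e * (1 / 2) ^ Suc i)" for i
      using outer_approx[OF fin[of i], of "e * (1 / 2) ^ Suc i"] e by auto
    then obtain F where F: "\<And>i. F i \<in> cover (A i)"
      "\<And>i. (\<Sum>n. ennreal (I (F i n))) \<le> outer (A i) + ennreal (e * (1 / 2) ^ Suc i)"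
      by metis
    have "outer (\<Union>i. A i) \<le> (\<Sum>i. \<Sum>n. ennreal (I (F i n)))"
    proof (rule outer_le_2dim)
      show "F i n \<in> Cp" for i n using F(1)[of i] by (simp add: cover_def)
      fix x assume "x \<in> (\<Union>i. A i)"
      then obtain i where "x \<in> A i" by blast
      then have "1 \<le> (\<Sum>n. ennreal (F i n x))" using F(1)[of i] by (simp add: cover_def)
      also have "\<dots> \<le> (\<Sum>i. \<Sum>n. ennreal (F i n x))"
        using sum_le_suminf[of "\<lambda>i. \<Sum>n. ennreal (F i n x)" "{i}"] by simp
      finally show "1 \<le> (\<Sum>i. \<Sum>n. ennreal (F i n x))" .
    qed
    also have "\<dots> \<le> (\<Sum>i. outer (A i) + ennreal (e * (1 / 2) ^ Suc i))"
      by (intro suminf_le F(2)) auto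
    also have "\<dots> = (\<Sum>i. outer (A i)) + (\<Sum>i. ennreal (e * (1 / 2) ^ Suc i))"
      by (intro suminf_add[symmetric]) auto
    also have "(\<Sum>i. ennreal (e * (1 / 2) ^ Suc i)) = ennreal e"
    proof -
      have "(\<lambda>i. e * (1 / 2) ^ Suc i) sums (e * 1)"
        by (intro sums_mult power_half_series)
      then have "(\<lambda>i. ennreal (e * (1 / 2) ^ Suc i)) sums ennreal e"
        using e by (subst sums_ennreal) auto
      then show ?thesis by (rule sums_unique[symmetric])
    qed
    finally show "outer (\<Union>i. A i) \<le> (\<Sum>i. outer (A i)) + ennreal e" .
  qed
qed

lemma outer_Un: "outer (A \<union> B) \<le> outer A + outer B"
proof -
  have "outer (\<Union>i. if i = 0 then A else if i = Suc 0 then B else {})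
      \<le> (\<Sum>i. outer (if i = 0 then A else if i = Suc 0 then B else {}))"
    by (rule outer_UN)
  also have "\<dots> = (\<Sum>i\<in>{0, Suc 0}. outer (if i = 0 then A else if i = Suc 0 then B else {}))"
    by (rule suminf_finite) (auto simp: outer_empty)
  also have "(\<Union>i. if i = 0 then A else if i = Suc 0 then B else {}) = A \<union> B"
    by (auto split: if_splits)
  finally show ?thesis by simp
qed

text \<open>Caratheodory's condition for an open set. Multiplying a cover F of E by functions g K
  that increase to the indicator of U divides it: (1 - g K) F covers E - U at every stage because g
  K vanishes off U, and g K F covers the rest of E in the limit.\<close>

lemma outer_open_split:
  assumes U: "open U"
  shows "outer (U \<inter> E) + outer (E - U) \<le> outer E"
  unfolding outer_def[of E]
proof (rule INF_greatest)
  fix F assume F: "F \<in> cover E"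
  have FC: "F n \<in> Cp" for n using F by (simp add: cover_def)
  obtain g :: "nat \<Rightarrow> 'x \<Rightarrow> real" where g: "\<And>k. compactly_supported (g k)" "\<And>k x. 0 \<le> g k x"
    "\<And>k x. g k x \<le> 1" "\<And>x. incseq (\<lambda>k. g k x)" "\<And>k x. x \<notin> U \<Longrightarrow> g k x = 0"
    "\<And>K. compact K \<Longrightarrow> K \<subseteq> U \<Longrightarrow> \<exists>k. \<forall>x\<in>K. g k x = 1"
    by (rule open_exhaustion[OF U]) (rule that, blast+)
  \<comment> \<open>The increments of g telescope, so the limit of g K * F n becomes a series of
    nonnegative functions d k * F n, which is an admissible cover.\<close>
  define d where "d = (\<lambda>k x. if k = 0 then g 0 x else g k x - g (k - 1) x)"
  have d0: "0 \<le> d k x" for k x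
    using g(2) incseqD[OF g(4), of "k - 1" k x] by (simp add: d_def)
  have dc: "continuous_on UNIV (d k)" for k
    unfolding d_def using g(1)
    by (cases "k = 0") (auto intro!: compactly_supported_continuous compactly_supported_diff)
  have dsum: "(\<Sum>k<Suc K. d k x) = g K x" for K x
    by (induction K) (simp_all add: d_def)
  have FdC: "(\<lambda>x. d k x * F n x) \<in> Cp" for n k
    by (rule Cp_mult[OF FC dc d0])
  have a: "outer (U \<inter> E) \<le> (\<Sum>n. \<Sum>k. ennreal (I (\<lambda>x. d k x * F n x)))"
  proof (rule outer_le_2dim[OF FdC])
    fix x assume x: "x \<in> U \<inter> E"
    have sum1: "1 \<le> (\<Sum>k. ennreal (d k x))"
    proof -
      obtain K where "g K x = 1" using g(6)[of "{x}"] x by auto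
      then have "1 = (\<Sum>k<Suc K. ennreal (d k x))"
        using dsum[of x K] d0 by (subst sum_ennreal) auto
      also have "\<dots> \<le> (\<Sum>k. ennreal (d k x))" by (intro sum_le_suminf) auto
      finally show ?thesis .
    qed
    have "1 \<le> (\<Sum>n. ennreal (F n x))" using F x by (simp add: cover_def)
    also have "\<dots> \<le> (\<Sum>n. (\<Sum>k. ennreal (d k x)) * ennreal (F n x))"
      using mult_right_mono[OF sum1] by (intro suminf_le) auto
    also have "\<dots> = (\<Sum>n. \<Sum>k. ennreal (d k x * F n x))"
      using d0 by (simp add: ennreal_mult' CpD(2)[OF FC] ennreal_suminf_multc)
    finally show "1 \<le> (\<Sum>n. \<Sum>k. ennreal (d k x * F n x))" .
  qed
  have b: "(\<Sum>n. \<Sum>k<Suc K. ennreal (I (\<lambda>x. d k x * F n x))) + outer (E - U) \<le> (\<Sum>n. ennreal (I (F n)))" for K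
  proof -
    have gC: "(\<lambda>x. g K x * F n x) \<in> Cp" "(\<lambda>x. (1 - g K x) * F n x) \<in> Cp" for n
      using g(2,3) compactly_supported_continuous[OF g(1)]
      by (auto intro!: Cp_mult FC continuous_on_diff)
    have "(\<lambda>n x. (1 - g K x) * F n x) \<in> cover (E - U)"
      using F gC(2) g(5) by (auto simp: cover_def)
    then have "outer (E - U) \<le> (\<Sum>n. ennreal (I (\<lambda>x. (1 - g K x) * F n x)))"
      by (rule outer_le)
    moreover have "(\<Sum>k<Suc K. ennreal (I (\<lambda>x. d k x * F n x))) = ennreal (I (\<lambda>x. g K x * F n x))" for n
    proof -
      have "(\<Sum>k<Suc K. ennreal (I (\<lambda>x. d k x * F n x))) = ennreal (\<Sum>k<Suc K. I (\<lambda>x. d k x * F n x))"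
        by (intro sum_ennreal I_Cp_nonneg FdC)
      also have "(\<Sum>k<Suc K. I (\<lambda>x. d k x * F n x)) = I (\<lambda>x. \<Sum>k<Suc K. d k x * F n x)"
        by (intro I_sum[symmetric] CpD FdC)
      also have "(\<lambda>x. \<Sum>k<Suc K. d k x * F n x) = (\<lambda>x. g K x * F n x)"
        by (simp only: sum_distrib_right[symmetric] dsum)
      finally show ?thesis .
    qed
    ultimately have "(\<Sum>n. \<Sum>k<Suc K. ennreal (I (\<lambda>x. d k x * F n x))) + outer (E - U)
        \<le> (\<Sum>n. ennreal (I (\<lambda>x. g K x * F n x))) + (\<Sum>n. ennreal (I (\<lambda>x. (1 - g K x) * F n x)))"
      by (simp add: add_left_mono)
    also have "\<dots> = (\<Sum>n. ennreal (I (\<lambda>x. g K x * F n x)) + ennreal (I (\<lambda>x. (1 - g K x) * F n x)))"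
      by (intro suminf_add) auto
    also have "\<dots> = (\<Sum>n. ennreal (I (F n)))"
    proof (intro suminf_cong)
      fix n
      have "I (F n) = I (\<lambda>x. g K x * F n x + (1 - g K x) * F n x)" by (simp add: algebra_simps)
      also have "\<dots> = I (\<lambda>x. g K x * F n x) + I (\<lambda>x. (1 - g K x) * F n x)"
        by (intro I_add CpD gC)
      finally show "ennreal (I (\<lambda>x. g K x * F n x)) + ennreal (I (\<lambda>x. (1 - g K x) * F n x)) = ennreal (I (F n))"
        using I_Cp_nonneg[OF gC(1)] I_Cp_nonneg[OF gC(2)] by simp
    qed
    finally show ?thesis .
  qed
  have "(\<Sum>k. ennreal (I (\<lambda>x. d k x * F n x))) = (SUP K. \<Sum>k<K. ennreal (I (\<lambda>x. d k x * F n x)))" for n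
    by (rule suminf_eq_SUP)
  then have "(\<Sum>n. \<Sum>k. ennreal (I (\<lambda>x. d k x * F n x)))
      = (SUP K. \<Sum>n. \<Sum>k<K. ennreal (I (\<lambda>x. d k x * F n x)))"
    by (simp only:) (intro ennreal_suminf_SUP_eq incseq_SucI sum_mono2, auto)
  then have "outer (U \<inter> E) + outer (E - U)
      \<le> (SUP K. \<Sum>n. \<Sum>k<K. ennreal (I (\<lambda>x. d k x * F n x))) + outer (E - U)"
    using a by (simp add: add_right_mono)
  also have "\<dots> = (SUP K. (\<Sum>n. \<Sum>k<K. ennreal (I (\<lambda>x. d k x * F n x))) + outer (E - U))"
    by (rule ennreal_SUP_add_left[symmetric]) auto
  also have "\<dots> \<le> (\<Sum>n. ennreal (I (F n)))"
  proof (rule SUP_least)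
    fix K
    have "(\<Sum>n. \<Sum>k<K. ennreal (I (\<lambda>x. d k x * F n x))) \<le> (\<Sum>n. \<Sum>k<Suc K. ennreal (I (\<lambda>x. d k x * F n x)))"
      by (intro suminf_le sum_mono2) auto
    then show "(\<Sum>n. \<Sum>k<K. ennreal (I (\<lambda>x. d k x * F n x))) + outer (E - U) \<le> (\<Sum>n. ennreal (I (F n)))"
      using b[of K] by (meson add_right_mono order_trans)
  qed
  finally show "outer (U \<inter> E) + outer (E - U) \<le> (\<Sum>n. ennreal (I (F n)))" .
qed

section \<open>The Riesz measure and its regularity\<close>

definition riesz :: "'x measure" where
  "riesz = measure_of UNIV (sets borel) outer"

lemma sets_riesz [simp]: "sets riesz = sets borel" and space_riesz [simp]: "space riesz = UNIV"
  using sets.sigma_sets_eq[of "borel :: 'x measure"] sets.space_closed[of "borel :: 'x measure"]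
  by (simp_all add: riesz_def space_measure_of_conv sets_measure_of_conv)

lemma emeasure_riesz:
  assumes "A \<in> sets borel"
  shows "emeasure riesz A = outer A"
proof -
  have oms: "outer_measure_space (Pow UNIV) outer"
    unfolding outer_measure_space_def positive_def increasing_def countably_subadditive_def
    using outer_empty outer_mono outer_UN by auto
  define LS where "LS = lambda_system UNIV (Pow UNIV) outer"
  have ms: "measure_space UNIV LS outer"
    unfolding LS_def by (rule sigma_algebra.caratheodory_lemma[OF sigma_algebra_Pow oms])
  have "{S. open S} \<subseteq> LS"
  proof safe
    fix U :: "'x set" assume U: "open U"
    have "outer (U \<inter> E) + outer ((UNIV - U) \<inter> E) = outer E" for E
    proof (rule antisym)
      have eq: "(UNIV - U) \<inter> E = E - U" by blast
      show "outer (U \<inter> E) + outer ((UNIV - U) \<inter> E) \<le> outer E"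
        unfolding eq by (rule outer_open_split[OF U])
      have "(U \<inter> E) \<union> ((UNIV - U) \<inter> E) = E" by blast
      then show "outer E \<le> outer (U \<inter> E) + outer ((UNIV - U) \<inter> E)"
        using outer_Un[of "U \<inter> E" "(UNIV - U) \<inter> E"] by simp
    qed
    then show "U \<in> LS" by (simp add: LS_def lambda_system_def)
  qed
  moreover have "sigma_algebra UNIV LS" using ms by (simp add: measure_space_def)
  ultimately have sub: "sets borel \<subseteq> LS"
    unfolding borel_def by (simp add: sigma_algebra.sigma_sets_subset)
  have "measure_space UNIV (sets borel) outer"
    using measure_down[OF ms _ sub] sets.sigma_algebra_axioms[of "borel :: 'x measure"] by simp
  then show ?thesis
    unfolding riesz_def using assms sets.sigma_algebra_axioms[of "borel :: 'x measure"]
    by (intro emeasure_measure_of_sigma) (auto simp: measure_space_def)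
qed

lemma riesz_compact_finite:
  assumes "compact K"
  shows "emeasure riesz K < \<infinity>"
proof -
  obtain k :: "'x \<Rightarrow> real" where k: "compactly_supported k" "\<And>x. 0 \<le> k x" "\<And>x. x \<in> K \<Longrightarrow> k x = 1"
    using Urysohn_compact[OF assms open_UNIV subset_UNIV] by metis
  then have "outer K \<le> ennreal (I k)" by (intro outer_le_I) (auto simp: Cp_def)
  moreover have "K \<in> sets borel" using assms by (intro borel_closed compact_imp_closed)
  ultimately show ?thesis by (simp add: emeasure_riesz order.strict_trans1)
qed

text \<open>Scaling a cover of E by r > 1 leaves room: the set where some partial sum of the
  original cover exceeds 1 / r is open, contains E, and is covered by the scaled functions at r
  times the cost.\<close>

lemma outer_regular: "outer E = (INF U\<in>{U. open U \<and> E \<subseteq> U}. outer U)"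
proof (rule antisym)
  show "outer E \<le> (INF U\<in>{U. open U \<and> E \<subseteq> U}. outer U)"
    by (intro INF_greatest outer_mono) auto
  show "(INF U\<in>{U. open U \<and> E \<subseteq> U}. outer U) \<le> outer E"
    unfolding outer_def[of E]
  proof (rule INF_greatest)
    fix F assume F: "F \<in> cover E"
    define S where "S = (\<Sum>n. ennreal (I (F n)))"
    have le: "(INF U\<in>{U. open U \<and> E \<subseteq> U}. outer U) \<le> ennreal r * S" if r: "r > 1" for r
    proof -
      define U where "U = (\<Union>N. {x. 1 / r < (\<Sum>n<N. F n x)})"
      have FC: "F n \<in> Cp" for n using F by (simp add: cover_def)
      have "open U"
        unfolding U_def using FC
        by (intro open_UN ballI open_Collect_less continuous_intros compactly_supported_continuous CpD)
      moreover have "E \<subseteq> U"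
      proof
        fix x assume "x \<in> E"
        then have "ennreal 1 \<le> (\<Sum>n. ennreal (F n x))" using F by (simp add: cover_def)
        then have "\<exists>N. 1 < (\<Sum>n<N. F n x) + (1 - 1 / r)"
          using r by (intro partial_sum_less_suminf CpD(2)[OF FC]) auto
        then obtain N where "1 < (\<Sum>n<N. F n x) + (1 - 1 / r)" ..
        then show "x \<in> U" by (auto simp: U_def intro!: exI[of _ N])
      qed
      moreover have "outer U \<le> ennreal r * S"
      proof -
        have "(\<lambda>n x. r * F n x) \<in> cover U"
          unfolding cover_def
        proof (intro CollectI conjI allI ballI)
          show "(\<lambda>x. r * F n x) \<in> Cp" for n using FC r by (intro Cp_scale) auto
          fix x assume "x \<in> U"
          then obtain N where "1 / r < (\<Sum>n<N. F n x)" by (auto simp: U_def)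
          then have "1 \<le> (\<Sum>n<N. r * F n x)"
            using r by (simp add: sum_distrib_left[symmetric] field_simps)
          then have "ennreal 1 \<le> ennreal (\<Sum>n<N. r * F n x)" by (rule ennreal_leI)
          also have "\<dots> = (\<Sum>n<N. ennreal (r * F n x))"
            using CpD(2)[OF FC] r by (intro sum_ennreal[symmetric]) auto
          also have "\<dots> \<le> (\<Sum>n. ennreal (r * F n x))" by (intro sum_le_suminf) auto
          finally show "1 \<le> (\<Sum>n. ennreal (r * F n x))" by simp
        qed
        then have "outer U \<le> (\<Sum>n. ennreal (I (\<lambda>x. r * F n x)))" by (rule outer_le)
        also have "\<dots> = ennreal r * S"
          using r CpD(1)[OF FC] by (simp add: I_scale ennreal_mult'' I_Cp_nonneg FC S_def ennreal_mult)
        finally show ?thesis .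
      qed
      ultimately show ?thesis by (intro INF_lower2[of U]) auto
    qed
    show "(INF U\<in>{U. open U \<and> E \<subseteq> U}. outer U) \<le> (\<Sum>n. ennreal (I (F n)))"
      unfolding S_def[symmetric]
    proof (rule ennreal_le_epsilon)
      fix e :: real assume "S < top" "0 < e"
      then obtain s where s: "S = ennreal s" "s \<ge> 0" by (cases S) auto
      \<comment> \<open>The scale is chosen so that the cost grows by e s / (s + 1), at most e, also
        when s = 0.\<close>
      have "ennreal (1 + e / (s + 1)) * S = ennreal (s + e * s / (s + 1))"
        using s \<open>0 < e\<close> by (simp flip: ennreal_mult add: field_simps)
      also have "\<dots> \<le> ennreal (s + e)"
        using s \<open>0 < e\<close> by (intro ennreal_leI) (simp add: field_simps)
      also have "\<dots> = S + ennreal e" using s \<open>0 < e\<close> by simp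
      finally show "(INF U\<in>{U. open U \<and> E \<subseteq> U}. outer U) \<le> S + ennreal e"
        using le[of "1 + e / (s + 1)"] s \<open>0 < e\<close> by (auto intro: order_trans)
    qed
  qed
qed

lemma riesz_outer_regular:
  assumes "B \<in> sets borel"
  shows "emeasure riesz B = (INF U\<in>{U. open U \<and> B \<subseteq> U}. emeasure riesz U)"
  using outer_regular[of B] assms by (simp add: emeasure_riesz)

text \<open>Inside a compact set Q of finite measure, outer approximation of Q - B by an open V is
  inner approximation of B by the compact set Q - V. An increasing exhaustion by such Q extends this
  to sets of infinite measure.\<close>

lemma riesz_inner_regular:
  assumes B: "B \<in> sets borel"
  shows "emeasure riesz B = (SUP K\<in>{K. compact K \<and> K \<subseteq> B}. emeasure riesz K)"
proof (rule antisym)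
  show "(SUP K\<in>{K. compact K \<and> K \<subseteq> B}. emeasure riesz K) \<le> emeasure riesz B"
    using B by (intro SUP_least emeasure_mono) auto
  obtain g :: "nat \<Rightarrow> 'x \<Rightarrow> real" where g: "\<And>k. compactly_supported (g k)" "\<And>x. incseq (\<lambda>k. g k x)"
    "\<And>K. compact K \<Longrightarrow> \<exists>k. \<forall>x\<in>K. g k x = 1"
    using open_exhaustion[of UNIV] by (metis open_UNIV subset_UNIV)
  define Q where "Q = (\<lambda>n. {x. 1 \<le> g n x})"
  have Q_closed: "closed (Q n)" for n
    unfolding Q_def using g(1) by (intro closed_Collect_le continuous_intros compactly_supported_continuous)
  have Q_compact: "compact (Q n)" for n
  proof -
    obtain K where K: "compact K" "\<And>x. x \<notin> K \<Longrightarrow> g n x = 0"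
      using g(1) compactly_supportedE by metis
    then have "Q n = K \<inter> Q n" by (force simp: Q_def)
    then show ?thesis using compact_Int_closed[OF K(1) Q_closed] by metis
  qed
  have Q_borel: "Q n \<in> sets borel" for n using Q_closed by (rule borel_closed)
  have "Q n \<subseteq> Q (Suc n)" for n
  proof
    fix x assume "x \<in> Q n"
    then show "x \<in> Q (Suc n)" using incseqD[OF g(2), of n "Suc n" x] by (simp add: Q_def)
  qed
  then have "incseq (\<lambda>n. B \<inter> Q n)"
    by (intro incseq_SucI) blast
  moreover have "(\<Union>n. B \<inter> Q n) = B"
  proof -
    have "\<exists>n. x \<in> Q n" for x
    proof -
      obtain k where "g k x = 1" using g(3)[of "{x}"] by auto
      then show ?thesis by (intro exI[of _ k]) (simp add: Q_def)
    qed
    then show ?thesis by blast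
  qed
  ultimately have "emeasure riesz B = (SUP n. emeasure riesz (B \<inter> Q n))"
    using B Q_borel by (subst SUP_emeasure_incseq) auto
  also have "\<dots> \<le> (SUP K\<in>{K. compact K \<and> K \<subseteq> B}. emeasure riesz K)"
  proof (rule SUP_least)
    fix n
    define C D where "C = B \<inter> Q n" and "D = Q n - C"
    have CD: "C \<in> sets borel" "D \<in> sets borel" using B Q_borel by (auto simp: C_def D_def)
    have finD: "emeasure riesz D < \<infinity>"
      using emeasure_mono[of D "Q n" riesz] riesz_compact_finite[OF Q_compact[of n]] Q_borel
      by (auto simp: D_def intro: order.strict_trans1)
    show "emeasure riesz (B \<inter> Q n) \<le> (SUP K\<in>{K. compact K \<and> K \<subseteq> B}. emeasure riesz K)"
      unfolding C_def[symmetric]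
    proof (rule ennreal_le_epsilon)
      fix e :: real assume e: "0 < e"
      have "emeasure riesz D < emeasure riesz D + ennreal e"
        using finD e by (simp add: ennreal_add_left_cancel_less[of _ 0, simplified] less_top)
      then obtain V where V: "open V" "D \<subseteq> V" "emeasure riesz V < emeasure riesz D + ennreal e"
        by (subst (asm) riesz_outer_regular[OF CD(2)]) (auto simp: INF_less_iff)
      have Vb: "V \<in> sets borel" using V by auto
      have "emeasure riesz (V - D) + emeasure riesz D = emeasure riesz V"
        using V CD Vb by (subst plus_emeasure) (auto intro!: arg_cong[of _ _ "emeasure riesz"])
      then have VD: "emeasure riesz (V - D) \<le> ennreal e"
        using V(3) finD by (metis add.commute ennreal_add_left_cancel_le less_imp_le not_less top.not_eq_extremum infinity_ennreal_def)
      define K where "K = Q n - V"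
      have "compact K"
        unfolding K_def using Q_compact V by (intro compact_diff)
      moreover have "K \<subseteq> B" using V by (auto simp: K_def D_def C_def)
      moreover have "emeasure riesz C \<le> emeasure riesz K + ennreal e"
      proof -
        have "emeasure riesz C \<le> emeasure riesz (K \<union> (V - D))"
          using Vb CD Q_borel by (intro emeasure_mono) (auto simp: K_def C_def D_def)
        also have "\<dots> \<le> emeasure riesz K + emeasure riesz (V - D)"
          using Vb CD Q_borel by (intro emeasure_subadditive) (auto simp: K_def)
        finally show ?thesis using VD by (meson add_left_mono order_trans)
      qed
      ultimately show "emeasure riesz C \<le> (SUP K\<in>{K. compact K \<and> K \<subseteq> B}. emeasure riesz K) + ennreal e"
        by (smt (verit, best) SUP_upper add_right_mono mem_Collect_eq order_trans)
    qed
  qed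
  finally show "emeasure riesz B \<le> (SUP K\<in>{K. compact K \<and> K \<subseteq> B}. emeasure riesz K)" .
qed

text \<open>Both sides are squeezed between the lower and upper sums over the levels \<open>{f > i}\<close>; applied
  to multiples of \<open>f\<close> this gives equality.\<close>

lemma riesz_nn_integral_levels:
  assumes f: "f \<in> Cp"
  shows "ennreal (I f) \<le> (\<integral>\<^sup>+ x. ennreal (f x) \<partial>riesz) + emeasure riesz {x. 0 < f x}"
    and "(\<integral>\<^sup>+ x. ennreal (f x) \<partial>riesz) \<le> ennreal (I f) + emeasure riesz {x. 0 < f x}"
proof -
  obtain B where "\<And>x. norm (f x) \<le> B" using compactly_supported_bounded[OF CpD(1)[OF f]] by metis
  then obtain m :: nat where m: "\<And>x. f x \<le> real m"
    by (metis abs_ge_self order_trans real_arch_simple real_norm_def)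
  have f_cont: "continuous_on S f" for S using f by (intro compactly_supported_continuous CpD)
  have f_meas [measurable]: "f \<in> borel_measurable borel"
    using f_cont by (rule borel_measurable_continuous_onI)
  \<comment> \<open>The slice of f between the heights i and i + 1. The slices add up to f, and each
    lies between the indicators of {f > i + 1} and {f > i}.\<close>
  define h where "h = (\<lambda>i x. min (max (f x - real i) 0) 1)"
  have hC: "h i \<in> Cp" for i
  proof -
    have "compactly_supported (\<lambda>x. min (max (f x - real i) 0) 1)"
      by (rule compactly_supported_compose[OF CpD(1)[OF f], of "\<lambda>t. min (max (t - real i) 0) 1"])
        (auto intro!: continuous_intros)
    then show ?thesis by (simp add: Cp_def h_def)
  qed
  have h_sum: "(\<Sum>i<n. h i x) = min (f x) (real n)" for n x
    using CpD(2)[OF f, of x] by (induction n) (auto simp: h_def min_def max_def)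
  have If: "ennreal (I f) = (\<Sum>i<m. ennreal (I (h i)))"
  proof -
    have "f = (\<lambda>x. \<Sum>i<m. h i x)" using m by (auto simp: h_sum)
    then have "I f = (\<Sum>i<m. I (h i))" using I_sum[of "{..<m}" h] hC CpD(1) by metis
    then show ?thesis using hC by (simp add: sum_ennreal I_Cp_nonneg)
  qed
  have Jf: "(\<integral>\<^sup>+ x. ennreal (f x) \<partial>riesz) = (\<Sum>i<m. \<integral>\<^sup>+ x. ennreal (h i x) \<partial>riesz)"
  proof -
    have "ennreal (f x) = (\<Sum>i<m. ennreal (h i x))" for x
      using m[of x] h_sum[of x m] CpD(2)[OF hC] by (subst sum_ennreal) auto
    moreover have "h i \<in> borel_measurable riesz" for i
      using hC borel_measurable_continuous_onI[of "h i"]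
      by (simp add: compactly_supported_continuous CpD measurable_cong_sets[OF sets_riesz refl])
    ultimately show ?thesis by (simp add: nn_integral_sum)
  qed
  define L where "L = (\<lambda>i. emeasure riesz {x. real i < f x})"
  have Lset: "{x. real i < f x} \<in> sets borel" "{x. real i \<le> f x} \<in> sets borel" for i by measurable
  have L_le: "L (Suc i) \<le> emeasure riesz {x. real (Suc i) \<le> f x}" for i
    unfolding L_def using Lset by (intro emeasure_mono) auto
  have I_upper: "ennreal (I (h i)) \<le> L i" for i
    unfolding L_def emeasure_riesz[OF Lset(1)]
    by (rule I_le_outer[OF hC]) (auto simp: h_def indicator_def)
  have I_lower: "L (Suc i) \<le> ennreal (I (h i))" for i
  proof -
    have "outer {x. real (Suc i) \<le> f x} \<le> ennreal (I (h i))"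
      by (rule outer_le_I[OF hC]) (auto simp: h_def)
    then show ?thesis using L_le[of i] unfolding emeasure_riesz[OF Lset(2)] by (rule order_trans[rotated])
  qed
  have J_upper: "(\<integral>\<^sup>+ x. ennreal (h i x) \<partial>riesz) \<le> L i" for i
  proof -
    have "(\<integral>\<^sup>+ x. ennreal (h i x) \<partial>riesz) \<le> (\<integral>\<^sup>+ x. indicator {x. real i < f x} x \<partial>riesz)"
      by (intro nn_integral_mono) (auto simp: h_def indicator_def)
    then show ?thesis using Lset by (simp add: L_def)
  qed
  have J_lower: "L (Suc i) \<le> (\<integral>\<^sup>+ x. ennreal (h i x) \<partial>riesz)" for i
  proof -
    have "(\<integral>\<^sup>+ x. indicator {x. real (Suc i) < f x} x \<partial>riesz) \<le> (\<integral>\<^sup>+ x. ennreal (h i x) \<partial>riesz)"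
      by (intro nn_integral_mono) (auto simp: h_def indicator_def)
    then show ?thesis using Lset(1)[of "Suc i"] by (simp add: L_def)
  qed
  \<comment> \<open>Lower and upper sums differ by an index shift only, that is by at most the
    measure of {f > 0}.\<close>
  have shift: "(\<Sum>i<m. L i) \<le> (\<Sum>i<m. L (Suc i)) + L 0"
  proof -
    have "(\<Sum>i<m. L i) \<le> (\<Sum>i<Suc m. L i)" by (intro sum_mono2) auto
    also have "\<dots> = (\<Sum>i<m. L (Suc i)) + L 0" by (simp only: sum.lessThan_Suc_shift add.commute)
    finally show ?thesis .
  qed
  have L0: "L 0 = emeasure riesz {x. 0 < f x}" by (simp add: L_def)
  have "ennreal (I f) \<le> (\<Sum>i<m. L i)" unfolding If by (intro sum_mono I_upper)
  also note shift
  also have "(\<Sum>i<m. L (Suc i)) \<le> (\<integral>\<^sup>+ x. ennreal (f x) \<partial>riesz)"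
    unfolding Jf by (intro sum_mono J_lower)
  finally show "ennreal (I f) \<le> (\<integral>\<^sup>+ x. ennreal (f x) \<partial>riesz) + emeasure riesz {x. 0 < f x}"
    by (simp add: L0 add_right_mono)
  have "(\<integral>\<^sup>+ x. ennreal (f x) \<partial>riesz) \<le> (\<Sum>i<m. L i)" unfolding Jf by (intro sum_mono J_upper)
  also note shift
  also have "(\<Sum>i<m. L (Suc i)) \<le> ennreal (I f)"
    unfolding If by (intro sum_mono I_lower)
  finally show "(\<integral>\<^sup>+ x. ennreal (f x) \<partial>riesz) \<le> ennreal (I f) + emeasure riesz {x. 0 < f x}"
    by (simp add: L0 add_right_mono)
qed

text \<open>Dividing by n makes the fixed error c disappear. In its use c is the measure of {f > 0},
  which does not change when f is replaced by n * f.\<close>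

lemma le_of_multiples_le:
  fixes a b c :: ennreal
  assumes "c < \<infinity>" "\<And>n :: nat. n > 0 \<Longrightarrow> of_nat n * a \<le> of_nat n * b + c"
  shows "a \<le> b"
proof (rule ennreal_le_epsilon)
  fix e :: real assume b: "b < top" and e: "0 < e"
  obtain r where r: "c = ennreal r" "r \<ge> 0" using assms(1) by (cases c) auto
  obtain s where s: "b = ennreal s" "s \<ge> 0" using b by (cases b) auto
  obtain n :: nat where n: "r / e < real n" using reals_Archimedean2 by blast
  then have n0: "n > 0" using r e by (metis divide_nonneg_pos gr0I not_less of_nat_0)
  have *: "of_nat n * a \<le> ennreal (real n * s + r)"
    using assms(2)[OF n0] r s by (simp add: ennreal_of_nat_eq_real_of_nat ennreal_mult)
  then have "a < top" using n0 by (metis ennreal_less_top ennreal_mult_eq_top_iff of_nat_eq_0_iff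
        neq0_conv order.strict_trans1 top.not_eq_extremum)
  then obtain t where t: "a = ennreal t" "t \<ge> 0" by (cases a) auto
  have "real n * t \<le> real n * s + r"
    using * t s r
    by (simp add: ennreal_of_nat_eq_real_of_nat del: ennreal_plus flip: ennreal_mult)
  moreover have "r \<le> real n * e" using n e by (simp add: field_simps)
  ultimately have "real n * t \<le> real n * (s + e)" by (simp add: algebra_simps)
  then have "t \<le> s + e" using n0 by simp
  then show "a \<le> b + ennreal e" using t s e by (simp flip: ennreal_plus)
qed

theorem riesz_nn_integral:
  assumes f: "f \<in> Cp"
  shows "(\<integral>\<^sup>+ x. ennreal (f x) \<partial>riesz) = ennreal (I f)"
proof -
  define c where "c = emeasure riesz {x. 0 < f x}"
  obtain K where K: "compact K" "\<And>x. x \<notin> K \<Longrightarrow> f x = 0"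
    using CpD(1)[OF f] compactly_supportedE by metis
  have "{x. 0 < f x} \<subseteq> K"
  proof
    fix x assume "x \<in> {x. 0 < f x}"
    then show "x \<in> K" using K(2)[of x] by (cases "x \<in> K") auto
  qed
  then have "c \<le> emeasure riesz K"
    unfolding c_def using K by (intro emeasure_mono) (auto simp: borel_closed compact_imp_closed)
  then have c: "c < \<infinity>" using riesz_compact_finite[OF K(1)] by order
  have f_meas [measurable]: "f \<in> borel_measurable riesz"
    using f borel_measurable_continuous_onI[of f]
    by (simp add: compactly_supported_continuous CpD measurable_cong_sets[OF sets_riesz refl])
  have scale: "(\<integral>\<^sup>+ x. ennreal (real n * f x) \<partial>riesz) = of_nat n * (\<integral>\<^sup>+ x. ennreal (f x) \<partial>riesz)"
    "ennreal (I (\<lambda>x. real n * f x)) = of_nat n * ennreal (I f)" for n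
    using CpD[OF f] by (simp_all add: ennreal_mult nn_integral_cmult I_scale I_Cp_nonneg f
        ennreal_of_nat_eq_real_of_nat)
  have C: "(\<lambda>x. real n * f x) \<in> Cp" for n by (intro Cp_scale f) auto
  have pos: "{x. 0 < real n * f x} = {x. 0 < f x}" if "n > 0" for n
    using that by (simp add: zero_less_mult_iff)
  show ?thesis
  proof (rule antisym)
    show "(\<integral>\<^sup>+ x. ennreal (f x) \<partial>riesz) \<le> ennreal (I f)"
    proof (rule le_of_multiples_le[OF c])
      show "of_nat n * (\<integral>\<^sup>+ x. ennreal (f x) \<partial>riesz) \<le> of_nat n * ennreal (I f) + c" if "n > 0" for n
        using riesz_nn_integral_levels(2)[OF C[of n]] unfolding scale pos[OF that] c_def .
    qed
    show "ennreal (I f) \<le> (\<integral>\<^sup>+ x. ennreal (f x) \<partial>riesz)"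
    proof (rule le_of_multiples_le[OF c])
      show "of_nat n * ennreal (I f) \<le> of_nat n * (\<integral>\<^sup>+ x. ennreal (f x) \<partial>riesz) + c" if "n > 0" for n
        using riesz_nn_integral_levels(1)[OF C[of n]] unfolding scale pos[OF that] c_def .
    qed
  qed
qed

end

section \<open>Etale groupoids and their convolution algebras\<close>

context groupoid
begin

lemma src_units: "src G g \<in> units G" and rng_units: "rng G g \<in> units G"
  unfolding units_def by (metis rng_src rangeI) (rule rangeI)

lemma unitsD:
  assumes "x \<in> units G"
  shows "rng G x = x" "src G x = x"
  using assms rng_rng src_rng by (auto simp: units_def)

lemma mem_units_iff: "x \<in> units G \<longleftrightarrow> rng G x = x"
  unfolding units_def by (metis rangeE rangeI rng_rng)

lemma units_mult:
  assumes "x \<in> units G"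
  shows "x \<cdot> x = x"
  using rng_mult_id[of x] unitsD[OF assms] by simp

lemma inv_mult_cancel: "src G g = rng G h \<Longrightarrow> ginv G g \<cdot> (g \<cdot> h) = h"
  by (metis inv_mult mult_assoc rng_mult_id src_inv)

lemma mult_inv_cancel: "rng G g = rng G h \<Longrightarrow> g \<cdot> (ginv G g \<cdot> h) = h"
  by (metis mult_inv mult_assoc rng_mult_id rng_inv src_inv)

lemma mult_inv_cancel_right: "src G g = rng G h \<Longrightarrow> (g \<cdot> h) \<cdot> ginv G h = g"
  by (metis mult_inv mult_assoc mult_src_id rng_inv)

lemma inv_mult_cancel_right: "src G g = src G h \<Longrightarrow> (g \<cdot> ginv G h) \<cdot> h = g"
  by (metis inv_mult mult_assoc mult_src_id rng_inv src_inv)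

lemma inv_unique:
  assumes "src G g = rng G h" "g \<cdot> h = rng G g"
  shows "h = ginv G g"
proof -
  have "h = ginv G g \<cdot> (g \<cdot> h)" using inv_mult_cancel[OF assms(1)] by simp
  also have "\<dots> = ginv G g" by (metis assms(2) mult_src_id src_inv)
  finally show ?thesis .
qed

lemma inv_inv [simp]: "ginv G (ginv G g) = g"
  using inv_unique[of "ginv G g" g] by (simp add: src_inv rng_inv inv_mult)

lemma inv_mult_distrib:
  assumes "src G g = rng G h"
  shows "ginv G (g \<cdot> h) = ginv G h \<cdot> ginv G g"
proof (rule inv_unique[symmetric])
  show "src G (g \<cdot> h) = rng G (ginv G h \<cdot> ginv G g)"
    using assms by (simp add: src_mult rng_mult rng_inv src_inv)
  have "g \<cdot> h \<cdot> (ginv G h \<cdot> ginv G g) = ((g \<cdot> h) \<cdot> ginv G h) \<cdot> ginv G g"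
    using assms by (intro mult_assoc[symmetric]) (auto simp: src_mult rng_inv src_inv)
  then show "g \<cdot> h \<cdot> (ginv G h \<cdot> ginv G g) = rng G (g \<cdot> h)"
    using assms by (simp add: mult_inv_cancel_right mult_inv rng_mult)
qed

lemma units_inv: "x \<in> units G \<Longrightarrow> ginv G x = x"
  using inv_unique[of x x] by (simp add: unitsD units_mult)

text \<open>For \<open>g, k\<close> with a common source, \<open>h = g k\<^sup>-\<^sup>1\<close> is equivalent to \<open>k = h\<^sup>-\<^sup>1 g\<close>.\<close>

lemma mult_inv_swap:
  assumes "src G g = src G k"
  shows "rng G (g \<cdot> ginv G k) = rng G g" "src G (g \<cdot> ginv G k) = rng G k"
    "ginv G (g \<cdot> ginv G k) \<cdot> g = k"
proof -
  have s: "src G g = rng G (ginv G k)" using assms by (simp add: rng_inv)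
  show "rng G (g \<cdot> ginv G k) = rng G g" by (rule rng_mult[OF s])
  show "src G (g \<cdot> ginv G k) = rng G k" using src_mult[OF s] by (simp add: src_inv)
  have "ginv G (g \<cdot> ginv G k) \<cdot> g = (k \<cdot> ginv G g) \<cdot> g" using inv_mult_distrib[OF s] by simp
  then show "ginv G (g \<cdot> ginv G k) \<cdot> g = k" using inv_mult_cancel_right assms by simp
qed

lemma inv_mult_swap:
  assumes "rng G h = rng G g"
  shows "rng G (ginv G h \<cdot> g) = src G h" "src G (ginv G h \<cdot> g) = src G g"
    "g \<cdot> ginv G (ginv G h \<cdot> g) = h"
proof -
  have s: "src G (ginv G h) = rng G g" using assms by (simp add: src_inv)
  show "rng G (ginv G h \<cdot> g) = src G h" using rng_mult[OF s] by (simp add: rng_inv)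
  show "src G (ginv G h \<cdot> g) = src G g" by (rule src_mult[OF s])
  have "g \<cdot> ginv G (ginv G h \<cdot> g) = g \<cdot> (ginv G g \<cdot> h)" using inv_mult_distrib[OF s] by simp
  then show "g \<cdot> ginv G (ginv G h \<cdot> g) = h" using mult_inv_cancel assms by simp
qed

end

text \<open>A partition of unity in the form of an induction rule: f is the finite sum of the
  functions (u x / s) * f, each supported in a member of the cover. It reduces continuity of
  convolutions to functions supported where the range map is injective.\<close>

lemma (in lc_space) compactly_supported_local_induct:
  fixes f :: "'x \<Rightarrow> complex"
  assumes cover: "\<And>x. \<exists>U. open U \<and> x \<in> U \<and> Q U"
    and zero: "P (\<lambda>x. 0)"
    and add: "\<And>f g. compactly_supported f \<Longrightarrow> compactly_supported g \<Longrightarrow> P f \<Longrightarrow> P g \<Longrightarrow> P (\<lambda>x. f x + g x)"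
    and loc: "\<And>f U. compactly_supported f \<Longrightarrow> open U \<Longrightarrow> Q U \<Longrightarrow> closure {x. f x \<noteq> 0} \<subseteq> U \<Longrightarrow> P f"
    and f: "compactly_supported f"
  shows "P f"
proof -
  obtain U where U: "\<And>x. open (U x) \<and> x \<in> U x \<and> Q (U x)" using cover by metis
  have "\<exists>u :: 'x \<Rightarrow> real. compactly_supported u \<and> (\<forall>y. 0 \<le> u y) \<and> u x = 1 \<and> closure {y. u y \<noteq> 0} \<subseteq> U x" for x
  proof -
    have "compact {x}" "open (U x)" "{x} \<subseteq> U x" using U by auto
    from Urysohn_compact[OF this] show ?thesis by (metis insertI1)
  qed
  then obtain u :: "'x \<Rightarrow> 'x \<Rightarrow> real" where u: "\<And>x. compactly_supported (u x)" "\<And>x y. 0 \<le> u x y"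
    "\<And>x. u x x = 1" "\<And>x. closure {y. u x y \<noteq> 0} \<subseteq> U x"
    by metis
  define K where "K = closure {x. f x \<noteq> 0}"
  have "compact K" using f by (simp add: K_def compactly_supported_def)
  moreover have "open {y. 0 < u x y}" for x
    using u(1) by (intro open_Collect_less continuous_on_const compactly_supported_continuous)
  moreover have "K \<subseteq> (\<Union>x\<in>K. {y. 0 < u x y})"
  proof
    fix x assume "x \<in> K"
    moreover have "0 < u x x" using u(3)[of x] by simp
    ultimately show "x \<in> (\<Union>x\<in>K. {y. 0 < u x y})" by blast
  qed
  ultimately obtain D where D: "D \<subseteq> K" "finite D" "K \<subseteq> (\<Union>x\<in>D. {y. 0 < u x y})"
    by (rule compactE_image)
  define s where "s = (\<lambda>y. \<Sum>x\<in>D. u x y)"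
  have s_cont: "continuous_on UNIV s"
    unfolding s_def using u(1) by (intro continuous_on_sum compactly_supported_continuous)
  have s_pos: "0 < s y" if y: "y \<in> K" for y
  proof -
    obtain x where "x \<in> D" "0 < u x y" using D(3) y by blast
    then show ?thesis unfolding s_def using u(2) D(2) by (intro sum_pos2) auto
  qed
  \<comment> \<open>The quotient is continuous only where s is positive, which is an open
    neighbourhood of the closed support of f.\<close>
  define F where "F = (\<lambda>x y. complex_of_real (u x y / s y) * f y)"
  have F: "compactly_supported (F x)" for x
    unfolding F_def
  proof (rule compactly_supported_mult[OF f])
    show "open {y. 0 < s y}" using s_cont by (intro open_Collect_less continuous_on_const)
    show "continuous_on {y. 0 < s y} (\<lambda>y. complex_of_real (u x y / s y))"
      by (intro continuous_on_of_real continuous_on_divide compactly_supported_continuous[OF u(1)]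
          continuous_on_subset[OF s_cont]) auto
    show "closure {y. f y \<noteq> 0} \<subseteq> {y. 0 < s y}" using s_pos by (auto simp: K_def)
  qed
  have PF: "P (F x)" for x
  proof (rule loc[OF F])
    have "{y. F x y \<noteq> 0} \<subseteq> {y. u x y \<noteq> 0}" by (auto simp: F_def)
    then show "closure {y. F x y \<noteq> 0} \<subseteq> U x" using closure_mono u(4) by blast
  qed (use U in auto)
  have "P (\<lambda>y. \<Sum>x\<in>E. F x y)" if "finite E" for E
    using that
  proof (induction E)
    case (insert x E)
    have "P (\<lambda>y. F x y + (\<Sum>x\<in>E. F x y))"
      by (rule add[OF F _ PF insert.IH]) (intro compactly_supported_sum F)
    then show ?case using insert by simp
  qed (simp add: zero)
  moreover have F_sum: "(\<Sum>x\<in>D. F x y) = f y" for y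
  proof (cases "f y = 0")
    case False
    then have "y \<in> K" using zero_outside_closure_support[of y f] by (auto simp: K_def)
    then have "s y \<noteq> 0" using s_pos by force
    have "(\<Sum>x\<in>D. F x y) = complex_of_real (\<Sum>x\<in>D. u x y / s y) * f y"
      by (simp add: F_def sum_distrib_right)
    also have "(\<Sum>x\<in>D. u x y / s y) = 1"
      using \<open>s y \<noteq> 0\<close> by (simp add: s_def flip: sum_divide_distrib)
    finally show ?thesis by simp
  qed (simp add: F_def)
  then have "(\<lambda>y. \<Sum>x\<in>D. F x y) = f" by (rule ext)
  ultimately show ?thesis using D(2) by metis
qed

section \<open>Topology of the unit space and of the fibres\<close>

context etale_groupoid
begin

sublocale lc: lc_space "TYPE('g)"
  by unfold_locales (rule locally_compact)

lemma local_homeomorphism_continuous: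
  assumes "local_homeomorphism_onto p T"
  shows "continuous_on UNIV (p :: 'g \<Rightarrow> 'g)"
proof -
  have "isCont p x" for x
  proof -
    obtain U k where "open U" "x \<in> U" "homeomorphism U (p ` U) p k"
      using assms unfolding local_homeomorphism_onto_def by metis
    then show ?thesis
      by (meson homeomorphism_cont1 continuous_on_eq_continuous_at)
  qed
  then show ?thesis by (simp add: continuous_at_imp_continuous_on)
qed

lemma continuous_rng: "continuous_on S (rng G)" and continuous_src: "continuous_on S (src G)"
  using local_homeomorphism_continuous[OF etale_rng] local_homeomorphism_continuous[OF etale_src]
  by (auto intro: continuous_on_subset)

text \<open>Near a unit the range map is injective; if g and its range both lie in such a
  neighbourhood, then they have the same range and hence coincide.\<close>

lemma open_units: "open (units G)"
proof (subst open_subopen, safe)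
  fix x assume x: "x \<in> units G"
  obtain U k where U: "open U" "x \<in> U" "homeomorphism U (rng G ` U) (rng G) k"
    using etale_rng unfolding local_homeomorphism_onto_def by metis
  define V where "V = U \<inter> rng G -` U"
  have "open V" unfolding V_def
    using U continuous_rng by (intro open_Int open_vimage)
  moreover have "x \<in> V" using U x by (simp add: V_def unitsD)
  moreover have "V \<subseteq> units G"
  proof
    fix g assume "g \<in> V"
    then have "k (rng G (rng G g)) = rng G g" "k (rng G g) = g"
      using U(3) by (auto simp: V_def homeomorphism_def)
    then have "rng G g = g" by (simp add: rng_rng)
    then show "g \<in> units G" by (simp add: mem_units_iff)
  qed
  ultimately show "\<exists>T. open T \<and> x \<in> T \<and> T \<subseteq> units G" by blast
qed

lemma closed_units: "closed (units G)"
proof -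
  have "units G = {g. rng G g = g}" by (auto simp: mem_units_iff)
  then show ?thesis by (simp add: closed_Collect_eq continuous_rng)
qed

text \<open>Finitely many open sets on which p is injective cover K, and each meets a fibre at most
  once. This makes convolutions finite sums, with a number of terms bounded uniformly over the unit
  space.\<close>

lemma local_homeomorphism_fibres:
  assumes p: "local_homeomorphism_onto p T" and K: "compact (K :: 'g set)"
  shows "\<exists>N. \<forall>x. finite {h \<in> K. p h = x} \<and> card {h \<in> K. p h = x} \<le> N"
proof -
  obtain U where U: "\<And>x. open (U x)" "\<And>x. x \<in> U x" "\<And>x. inj_on p (U x)"
    using p unfolding local_homeomorphism_onto_def homeomorphism_def inj_on_def by metis
  have "K \<subseteq> (\<Union>x\<in>K. U x)" using U(2) by blast
  with K U(1) obtain D where D: "D \<subseteq> K" "finite D" "K \<subseteq> (\<Union>x\<in>D. U x)"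
    by (rule compactE_image)
  have "finite {h \<in> K. p h = x} \<and> card {h \<in> K. p h = x} \<le> card D" for x
  proof -
    have sub: "{h \<in> K. p h = x} \<subseteq> (\<Union>y\<in>D. {h \<in> U y. p h = x})" using D by blast
    have fin: "finite {h \<in> U y. p h = x} \<and> card {h \<in> U y. p h = x} \<le> 1" for y
    proof (cases "{h \<in> U y. p h = x} = {}")
      case True
      show ?thesis unfolding True by simp
    next
      case False
      then obtain h where "h \<in> U y" "p h = x" by blast
      then have "{h \<in> U y. p h = x} = {h}" using U(3)[of y] by (auto simp: inj_on_def)
      then show ?thesis by simp
    qed
    have fU: "finite (\<Union>y\<in>D. {h \<in> U y. p h = x})" using D fin by blast
    have "card {h \<in> K. p h = x} \<le> card (\<Union>y\<in>D. {h \<in> U y. p h = x})"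
      by (rule card_mono[OF fU sub])
    also have "\<dots> \<le> (\<Sum>y\<in>D. card {h \<in> U y. p h = x})" using D by (intro card_UN_le)
    also have "\<dots> \<le> (\<Sum>y\<in>D. 1)" using fin by (intro sum_mono) blast
    finally show ?thesis using finite_subset[OF sub fU] by simp
  qed
  then show ?thesis by blast
qed

lemma compact_fibres:
  assumes "compact (K :: 'g set)"
  obtains N where "\<And>x. finite {h \<in> K. rng G h = x}" "\<And>x. card {h \<in> K. rng G h = x} \<le> N"
    "\<And>x. finite {h \<in> K. src G h = x}" "\<And>x. card {h \<in> K. src G h = x} \<le> N"
proof -
  obtain N1 N2 where "\<forall>x. finite {h \<in> K. rng G h = x} \<and> card {h \<in> K. rng G h = x} \<le> N1"
    "\<forall>x. finite {h \<in> K. src G h = x} \<and> card {h \<in> K. src G h = x} \<le> N2"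
    using local_homeomorphism_fibres[OF etale_rng assms] local_homeomorphism_fibres[OF etale_src assms] by blast
  then show thesis by (intro that[of "max N1 N2"]) (auto simp: le_max_iff_disj)
qed

section \<open>Convolution of compactly supported functions\<close>

lemma conv_eq_sum:
  assumes "finite {h \<in> K. rng G h = rng G g}" "\<And>h. h \<notin> K \<Longrightarrow> f h = 0"
  shows "conv G f k g = (\<Sum>h\<in>{h \<in> K. rng G h = rng G g}. f h * k (ginv G h \<cdot> g))"
proof -
  have "conv G f k g = infsum (\<lambda>h. f h * k (ginv G h \<cdot> g)) {h \<in> K. rng G h = rng G g}"
    unfolding conv_def using assms(2) by (intro infsum_cong_neutral) auto
  then show ?thesis using infsum_finite[OF assms(1)] by simp
qed

lemma conv_add_left:
  assumes "compactly_supported f" "compactly_supported f'"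
  shows "conv G (\<lambda>x. f x + f' x) k g = conv G f k g + conv G f' k g"
proof -
  obtain K where K: "compact K" "\<And>x. x \<notin> K \<Longrightarrow> f x = 0" using assms(1) compactly_supportedE by metis
  obtain K' where K': "compact K'" "\<And>x. x \<notin> K' \<Longrightarrow> f' x = 0" using assms(2) compactly_supportedE by metis
  obtain N where "\<And>x. finite {h \<in> K \<union> K'. rng G h = x}"
    using compact_fibres[OF compact_Un[OF K(1) K'(1)]] by metis
  then show ?thesis
    using K K' by (subst (1 2 3) conv_eq_sum[where K = "K \<union> K'"]) (auto simp: sum.distrib distrib_right)
qed

text \<open>If f is supported in an open set U on which the range map has a continuous inverse, the
  convolution has a single term wherever the range of g lies in the image of U, and it vanishes
  where that range avoids the image of the support. These two open conditions cover the
  groupoid.\<close>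

lemma conv_continuous:
  assumes f: "compactly_supported f" and k: "compactly_supported k"
  shows "continuous_on UNIV (conv G f k)"
proof (rule lc.compactly_supported_local_induct[where Q = "\<lambda>U. \<exists>\<rho>. open (rng G ` U) \<and> homeomorphism U (rng G ` U) (rng G) \<rho>"
      and P = "\<lambda>f. continuous_on UNIV (conv G f k)", OF _ _ _ _ f])
  fix x
  obtain U \<rho> where U: "open U" "x \<in> U" "openin (top_of_set (units G)) (rng G ` U)"
    "homeomorphism U (rng G ` U) (rng G) \<rho>"
    using etale_rng unfolding local_homeomorphism_onto_def by metis
  then have "open (rng G ` U)" using open_units openin_open_trans by blast
  then show "\<exists>U. open U \<and> x \<in> U \<and> (\<exists>\<rho>. open (rng G ` U) \<and> homeomorphism U (rng G ` U) (rng G) \<rho>)"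
    using U by blast
next
  show "continuous_on UNIV (conv G (\<lambda>x. 0) k)" by (simp add: conv_def)
next
  fix f f' :: "'g \<Rightarrow> complex"
  assume ff': "compactly_supported f" "compactly_supported f'"
    and c: "continuous_on UNIV (conv G f k)" "continuous_on UNIV (conv G f' k)"
  have "conv G (\<lambda>x. f x + f' x) k = (\<lambda>g. conv G f k g + conv G f' k g)"
    by (rule ext, rule conv_add_left[OF ff'])
  then show "continuous_on UNIV (conv G (\<lambda>x. f x + f' x) k)"
    using continuous_on_add[OF c] by simp
next
  fix f :: "'g \<Rightarrow> complex" and U
  assume f: "compactly_supported f" and U: "open U"
    "\<exists>\<rho>. open (rng G ` U) \<and> homeomorphism U (rng G ` U) (rng G) \<rho>" and fU: "closure {x. f x \<noteq> 0} \<subseteq> U"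
  then obtain \<rho> where \<rho>: "open (rng G ` U)" "homeomorphism U (rng G ` U) (rng G) \<rho>" by blast
  define K where "K = closure {x. f x \<noteq> 0}"
  have K: "compact K" "K \<subseteq> U" "\<And>x. x \<notin> K \<Longrightarrow> f x = 0"
  proof -
    show "compact K" "K \<subseteq> U" using f fU by (auto simp: K_def compactly_supported_def)
    show "f x = 0" if "x \<notin> K" for x
      using that unfolding K_def by (rule zero_outside_closure_support)
  qed
  have \<rho>_rng: "\<rho> (rng G h) = h" if "h \<in> U" for h
    using \<rho>(2) that by (simp add: homeomorphism_def)
  have rng_\<rho>: "rng G (\<rho> y) = y" "\<rho> y \<in> U" if "y \<in> rng G ` U" for y
    using \<rho>(2) that by (auto simp: homeomorphism_def)
  have conv_in: "conv G f k g = f (\<rho> (rng G g)) * k (ginv G (\<rho> (rng G g)) \<cdot> g)" if "rng G g \<in> rng G ` U" for g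
  proof -
    have eq: "{h \<in> U. rng G h = rng G g} = {\<rho> (rng G g)}"
      using \<rho>_rng rng_\<rho>[OF that] by force
    show ?thesis using K by (subst conv_eq_sum[where K = U]) (auto simp: eq)
  qed
  have conv_out: "conv G f k g = 0" if "rng G g \<notin> rng G ` K" for g
  proof -
    have eq: "{h \<in> K. rng G h = rng G g} = {}"
      unfolding Collect_empty_eq using that by (metis imageI)
    show ?thesis by (subst conv_eq_sum[where K = K, OF _ K(3)]) (simp_all add: eq)
  qed
  define V where "V = rng G -` (rng G ` U)"
  define W where "W = rng G -` (- (rng G ` K))"
  have V: "open V" unfolding V_def using \<rho>(1) continuous_rng by (intro open_vimage)
  have "closed (rng G ` K)"
    using K(1) continuous_rng by (intro compact_imp_closed compact_continuous_image)
  then have W: "open W" unfolding W_def using continuous_rng by (intro open_vimage) auto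
  have "continuous_on (V \<union> W) (conv G f k)"
  proof (rule continuous_on_open_Un[OF V W])
    have cont1: "continuous_on V (\<lambda>g. \<rho> (rng G g))"
    proof (rule continuous_on_compose2[OF _ continuous_rng])
      show "continuous_on (rng G ` U) \<rho>" using \<rho>(2) by (simp add: homeomorphism_def)
      show "rng G ` V \<subseteq> rng G ` U" unfolding V_def by (rule image_vimage_subset)
    qed
    have cont2: "continuous_on V (\<lambda>g. ginv G (\<rho> (rng G g)))"
      using cont1 by (rule continuous_on_compose2[OF continuous_inv]) auto
    have "continuous_on V ((\<lambda>(g, h). g \<cdot> h) \<circ> (\<lambda>g. (ginv G (\<rho> (rng G g)), g)))"
    proof (rule continuous_on_compose)
      show "continuous_on V (\<lambda>g. (ginv G (\<rho> (rng G g)), g))"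
        by (intro continuous_on_Pair cont2 continuous_on_id)
      show "continuous_on ((\<lambda>g. (ginv G (\<rho> (rng G g)), g)) ` V) (\<lambda>(g, h). g \<cdot> h)"
        by (rule continuous_on_subset[OF continuous_mult]) (auto simp: V_def src_inv rng_\<rho>)
    qed
    then have cont3: "continuous_on V (\<lambda>g. ginv G (\<rho> (rng G g)) \<cdot> g)" by (simp add: o_def)
    have "continuous_on V (\<lambda>g. f (\<rho> (rng G g)) * k (ginv G (\<rho> (rng G g)) \<cdot> g))"
      by (intro continuous_on_mult continuous_on_compose2[OF compactly_supported_continuous[OF f] cont1]
          continuous_on_compose2[OF compactly_supported_continuous[OF k] cont3]) auto
    then show "continuous_on V (conv G f k)"
      by (subst continuous_on_cong[OF refl conv_in]) (auto simp: V_def)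
    show "continuous_on W (conv G f k)"
      by (subst continuous_on_cong[OF refl conv_out]) (auto simp: W_def)
  qed
  moreover have "V \<union> W = UNIV"
  proof (rule UNIV_eq_I[symmetric])
    fix x
    show "x \<in> V \<union> W"
      using subsetD[OF image_mono[OF K(2)], of "rng G x" "rng G"]
      by (cases "rng G x \<in> rng G ` K") (simp_all add: V_def W_def)
  qed
  ultimately show "continuous_on UNIV (conv G f k)" by simp
qed

lemma conv_compactly_supported:
  assumes f: "compactly_supported f" and k: "compactly_supported k"
  shows "compactly_supported (conv G f k)"
proof -
  obtain K where K: "compact K" "\<And>x. x \<notin> K \<Longrightarrow> f x = 0" using f compactly_supportedE by metis
  obtain L where L: "compact L" "\<And>x. x \<notin> L \<Longrightarrow> k x = 0" using k compactly_supportedE by metis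
  define C where "C = {p :: 'g \<times> 'g. src G (fst p) = rng G (snd p)}"
  have "closed C" unfolding C_def
    by (intro closed_Collect_eq continuous_on_compose2[OF continuous_src continuous_on_fst[OF continuous_on_id]]
        continuous_on_compose2[OF continuous_rng continuous_on_snd[OF continuous_on_id]]) auto
  then have "compact ((K \<times> L) \<inter> C)" using K L by (intro compact_Int_closed compact_Times)
  then have comp: "compact ((\<lambda>(g, h). g \<cdot> h) ` ((K \<times> L) \<inter> C))"
    by (intro compact_continuous_image continuous_on_subset[OF continuous_mult]) (auto simp: C_def)
  show ?thesis
  proof (rule compactly_supportedI[OF conv_continuous[OF f k] comp])
    fix g assume g: "g \<notin> (\<lambda>(g, h). g \<cdot> h) ` ((K \<times> L) \<inter> C)"
    have "f h * k (ginv G h \<cdot> g) = 0" if h: "rng G h = rng G g" for h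
    proof (rule ccontr)
      assume "f h * k (ginv G h \<cdot> g) \<noteq> 0"
      then have "h \<in> K" "ginv G h \<cdot> g \<in> L" using K(2)[of h] L(2)[of "ginv G h \<cdot> g"] by auto
      moreover have "src G h = rng G (ginv G h \<cdot> g)" "g = h \<cdot> (ginv G h \<cdot> g)"
        using inv_mult_swap(1)[OF h] mult_inv_cancel[OF h] by auto
      ultimately have "(h, ginv G h \<cdot> g) \<in> (K \<times> L) \<inter> C" by (simp add: C_def)
      then show False using g \<open>g = h \<cdot> (ginv G h \<cdot> g)\<close> by force
    qed
    then show "conv G f k g = 0" unfolding conv_def by (intro infsum_0) auto
  qed
qed

lemma adj_compactly_supported:
  assumes "compactly_supported f"
  shows "compactly_supported (adj G f)"
proof -
  obtain K where K: "compact K" "\<And>x. x \<notin> K \<Longrightarrow> f x = 0" using assms compactly_supportedE by metis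
  have "continuous_on UNIV (\<lambda>g. cnj (f (ginv G g)))"
    by (intro continuous_on_cnj continuous_on_compose2[OF compactly_supported_continuous[OF assms] continuous_inv]) auto
  moreover have "compact (ginv G ` K)"
    using K continuous_inv by (intro compact_continuous_image) (auto intro: continuous_on_subset)
  moreover have "f (ginv G g) = 0" if "g \<notin> ginv G ` K" for g
    using that K(2)[of "ginv G g"] by (metis image_eqI inv_inv)
  ultimately show ?thesis by (intro compactly_supportedI[of _ "ginv G ` K"]) (auto simp: adj_def[abs_def])
qed

end

section \<open>The regular representations on finitely supported vectors\<close>

text \<open>The squared Hilbert space norm of a finitely supported vector. A sum over an infinite
  set is 0 by convention, so the value is meaningful for finite support only.\<close>

definition sqn :: "('g \<Rightarrow> complex) \<Rightarrow> real" where
  "sqn \<xi> = (\<Sum>g | \<xi> g \<noteq> 0. (cmod (\<xi> g))\<^sup>2)"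

lemma sqn_eq_sum:
  assumes "finite A" "\<And>g. g \<notin> A \<Longrightarrow> \<xi> g = 0"
  shows "sqn \<xi> = (\<Sum>g\<in>A. (cmod (\<xi> g))\<^sup>2)"
  unfolding sqn_def using assms by (intro sum.mono_neutral_left) auto

lemma sqn_nonneg [simp]: "0 \<le> sqn \<xi>"
  unfolding sqn_def by (intro sum_nonneg) auto

lemma sqn_scale: "sqn (\<lambda>g. z * \<xi> g) = (cmod z)\<^sup>2 * sqn \<xi>"
proof (cases "z = 0")
  case False
  then show ?thesis by (simp add: sqn_def norm_mult power_mult_distrib sum_distrib_left)
qed (simp add: sqn_def)

lemma ell2_normI:
  assumes "\<And>F. finite F \<Longrightarrow> F \<subseteq> S \<Longrightarrow> (\<Sum>g\<in>F. (cmod (\<xi> g))\<^sup>2) \<le> C\<^sup>2" "0 \<le> C"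
  shows "ell2_norm S \<xi> \<le> C"
proof -
  have "(\<lambda>g. (cmod (\<xi> g))\<^sup>2) summable_on S"
    by (rule nonneg_bdd_above_summable_on) (use assms in \<open>auto intro!: bdd_aboveI[of _ "C\<^sup>2"]\<close>)
  then have "(\<Sum>\<^sub>\<infinity>g\<in>S. (cmod (\<xi> g))\<^sup>2) \<le> C\<^sup>2"
    using assms(1) by (intro infsum_le_finite_sums)
  then show ?thesis
    unfolding ell2_norm_def using assms(2) by (simp add: real_le_lsqrt)
qed

context groupoid
begin

definition fin_vec :: "'g \<Rightarrow> ('g \<Rightarrow> complex) set" where
  "fin_vec x = {\<xi>. finite {g. \<xi> g \<noteq> 0} \<and> (\<forall>g. \<xi> g \<noteq> 0 \<longrightarrow> src G g = x)}"

lemma fin_vecD: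
  assumes "\<xi> \<in> fin_vec x"
  shows "finite {g. \<xi> g \<noteq> 0}" "\<xi> g \<noteq> 0 \<Longrightarrow> src G g = x"
  using assms by (auto simp: fin_vec_def)

lemma fin_vec_scale: "\<xi> \<in> fin_vec x \<Longrightarrow> (\<lambda>g. z * \<xi> g) \<in> fin_vec x"
  by (auto simp: fin_vec_def elim!: finite_subset[rotated])

lemma fin_vec_ell2:
  assumes "\<xi> \<in> fin_vec x"
  shows "\<xi> \<in> ell2 {g. src G g = x}" "ell2_norm {g. src G g = x} \<xi> = sqrt (sqn \<xi>)"
proof -
  have "((\<lambda>g. (cmod (\<xi> g))\<^sup>2) has_sum sqn \<xi>) {g. \<xi> g \<noteq> 0}"
    unfolding sqn_def using fin_vecD(1)[OF assms] by (rule has_sum_finite)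
  then have "((\<lambda>g. (cmod (\<xi> g))\<^sup>2) has_sum sqn \<xi>) {g. src G g = x}"
    by (rule has_sum_cong_neutral[THEN iffD1, rotated -1]) (use fin_vecD[OF assms] in auto)
  then show "\<xi> \<in> ell2 {g. src G g = x}" "ell2_norm {g. src G g = x} \<xi> = sqrt (sqn \<xi>)"
    using fin_vecD[OF assms] by (auto simp: ell2_def ell2_norm_def infsumI has_sum_imp_summable)
qed

lemma regular_rep_conv: "regular_rep G x f \<xi> g = (if src G g = x then conv G f \<xi> g else 0)"
  by (simp add: regular_rep_def conv_def)

lemma regular_rep_scale: "regular_rep G x f (\<lambda>g. z * \<xi> g) = (\<lambda>g. z * regular_rep G x f \<xi> g)"
  by (rule ext) (simp add: regular_rep_def mult.left_commute infsum_cmult_right')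

text \<open>The substitution h = g k^(-1) turns the sum over a range fibre into the action of a
  matrix with entries f (g k^(-1)). Adjoints, products and norm estimates become finite matrix
  computations.\<close>

lemma regular_rep_sum:
  assumes A: "finite A" "\<And>k. k \<in> A \<Longrightarrow> src G k = x" "\<And>k. k \<notin> A \<Longrightarrow> \<xi> k = 0" and g: "src G g = x"
  shows "regular_rep G x f \<xi> g = (\<Sum>k\<in>A. f (g \<cdot> ginv G k) * \<xi> k)"
proof -
  define \<phi> where "\<phi> = (\<lambda>k. g \<cdot> ginv G k)"
  have sw: "rng G (\<phi> k) = rng G g" "ginv G (\<phi> k) \<cdot> g = k" if "k \<in> A" for k
    using mult_inv_swap[of g k] A(2)[OF that] g by (auto simp: \<phi>_def)
  have inj: "inj_on \<phi> A" using sw(2) by (metis inj_onI)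
  have "regular_rep G x f \<xi> g = infsum (\<lambda>h. f h * \<xi> (ginv G h \<cdot> g)) {h. rng G h = rng G g}"
    using g by (simp add: regular_rep_def)
  also have "\<dots> = infsum (\<lambda>h. f h * \<xi> (ginv G h \<cdot> g)) (\<phi> ` A)"
  proof (rule infsum_cong_neutral)
    fix h assume h: "h \<in> {h. rng G h = rng G g} - \<phi> ` A"
    then have "h = \<phi> (ginv G h \<cdot> g)" using inv_mult_swap(3)[of h g] by (simp add: \<phi>_def)
    then have "ginv G h \<cdot> g \<notin> A" using h by blast
    then show "f h * \<xi> (ginv G h \<cdot> g) = 0" using A(3) by simp
  qed (use sw in auto)
  also have "\<dots> = (\<Sum>h\<in>\<phi> ` A. f h * \<xi> (ginv G h \<cdot> g))" using A by (intro infsum_finite) auto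
  also have "\<dots> = (\<Sum>k\<in>A. f (\<phi> k) * \<xi> (ginv G (\<phi> k) \<cdot> g))" by (rule sum.reindex[OF inj, unfolded o_def])
  also have "\<dots> = (\<Sum>k\<in>A. f (\<phi> k) * \<xi> k)" using sw by (intro sum.cong) auto
  finally show ?thesis by (simp add: \<phi>_def)
qed

lemma regular_rep_fin_vec_sum:
  assumes "\<xi> \<in> fin_vec x" "src G g = x"
  shows "regular_rep G x f \<xi> g = (\<Sum>k | \<xi> k \<noteq> 0. f (g \<cdot> ginv G k) * \<xi> k)"
  using fin_vecD[OF assms(1)] assms(2) by (intro regular_rep_sum) auto

lemma regular_rep_adjoint:
  assumes "\<zeta> \<in> fin_vec x" "\<eta> \<in> fin_vec x"
  assumes A: "finite A" "\<And>k. k \<in> A \<Longrightarrow> src G k = x" "\<And>k. k \<notin> A \<Longrightarrow> \<zeta> k = 0" "\<And>k. k \<notin> A \<Longrightarrow> \<eta> k = 0"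
  shows "(\<Sum>g\<in>A. cnj (\<zeta> g) * regular_rep G x f \<eta> g) = (\<Sum>g\<in>A. cnj (regular_rep G x (adj G f) \<zeta> g) * \<eta> g)"
proof -
  have "(\<Sum>g\<in>A. cnj (\<zeta> g) * regular_rep G x f \<eta> g) = (\<Sum>g\<in>A. \<Sum>k\<in>A. cnj (\<zeta> g) * (f (g \<cdot> ginv G k) * \<eta> k))"
    using A by (intro sum.cong) (simp_all add: regular_rep_sum[where A = A] sum_distrib_left)
  also have "\<dots> = (\<Sum>k\<in>A. \<Sum>g\<in>A. cnj (\<zeta> g) * (f (g \<cdot> ginv G k) * \<eta> k))" by (rule sum.swap)
  also have "\<dots> = (\<Sum>k\<in>A. cnj (regular_rep G x (adj G f) \<zeta> k) * \<eta> k)"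
  proof (rule sum.cong[OF refl])
    fix k assume k: "k \<in> A"
    have "adj G f (k \<cdot> ginv G g) = cnj (f (g \<cdot> ginv G k))" if "g \<in> A" for g
      unfolding adj_def using A(2)[OF k] A(2)[OF that] by (subst inv_mult_distrib) (auto simp: rng_inv)
    then have "regular_rep G x (adj G f) \<zeta> k = (\<Sum>g\<in>A. cnj (f (g \<cdot> ginv G k)) * \<zeta> g)"
      using A k by (simp add: regular_rep_sum[where A = A])
    then show "(\<Sum>g\<in>A. cnj (\<zeta> g) * (f (g \<cdot> ginv G k) * \<eta> k)) = cnj (regular_rep G x (adj G f) \<zeta> k) * \<eta> k"
      by (simp add: sum_distrib_right sum_distrib_left mult_ac)
  qed
  finally show ?thesis .
qed

lemma adj_adj: "adj G (adj G f) = f"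
  by (rule ext) (simp add: adj_def)

end

section \<open>Bounds for the regular representations\<close>

context etale_groupoid
begin

lemma regular_rep_fin_vec:
  assumes f: "compactly_supported f" and \<xi>: "\<xi> \<in> fin_vec x"
  shows "regular_rep G x f \<xi> \<in> fin_vec x"
proof -
  obtain K where K: "compact K" "\<And>x. x \<notin> K \<Longrightarrow> f x = 0" using f compactly_supportedE by metis
  obtain N where fib: "\<And>y. finite {h \<in> K. src G h = y}" using compact_fibres[OF K(1)] by metis
  have "{g. regular_rep G x f \<xi> g \<noteq> 0} \<subseteq> (\<Union>k\<in>{k. \<xi> k \<noteq> 0}. (\<lambda>h. h \<cdot> k) ` {h \<in> K. src G h = rng G k})"
  proof
    fix g assume g: "g \<in> {g. regular_rep G x f \<xi> g \<noteq> 0}"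
    then have gx: "src G g = x" by (auto simp: regular_rep_def split: if_splits)
    have "(\<Sum>k | \<xi> k \<noteq> 0. f (g \<cdot> ginv G k) * \<xi> k) \<noteq> 0"
      using g regular_rep_fin_vec_sum[OF \<xi> gx] by auto
    then obtain k where k: "\<xi> k \<noteq> 0" "f (g \<cdot> ginv G k) \<noteq> 0"
      by (metis (mono_tags, lifting) mem_Collect_eq mult_zero_left sum.neutral)
    have kx: "src G k = x" using fin_vecD(2)[OF \<xi> k(1)] .
    have "g \<cdot> ginv G k \<in> {h \<in> K. src G h = rng G k}"
      using K(2)[of "g \<cdot> ginv G k"] k(2) mult_inv_swap(2)[of g k] gx kx by auto
    moreover have "g = (g \<cdot> ginv G k) \<cdot> k" using inv_mult_cancel_right[of g k] gx kx by simp
    ultimately show "g \<in> (\<Union>k\<in>{k. \<xi> k \<noteq> 0}. (\<lambda>h. h \<cdot> k) ` {h \<in> K. src G h = rng G k})"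
      using k(1) by blast
  qed
  moreover have "finite (\<Union>k\<in>{k. \<xi> k \<noteq> 0}. (\<lambda>h. h \<cdot> k) ` {h \<in> K. src G h = rng G k})"
    using fin_vecD(1)[OF \<xi>] fib by blast
  ultimately show ?thesis
    by (auto simp: fin_vec_def regular_rep_def elim: finite_subset split: if_splits)
qed

text \<open>Schur's test: the matrix f (g k^(-1)) has at most N nonzero entries in each row and each
  column, since these are indexed by points of K with prescribed range or source, and every entry is
  at most B in modulus.\<close>

lemma regular_rep_bound:
  assumes f: "compactly_supported f" and K: "\<And>x. x \<notin> K \<Longrightarrow> f x = 0" and B: "\<And>x. cmod (f x) \<le> B"
    and fib: "\<And>y. finite {h \<in> K. rng G h = y}" "\<And>y. card {h \<in> K. rng G h = y} \<le> N"
      "\<And>y. finite {h \<in> K. src G h = y}" "\<And>y. card {h \<in> K. src G h = y} \<le> N"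
    and \<xi>: "\<xi> \<in> fin_vec x"
  shows "sqn (regular_rep G x f \<xi>) \<le> (real N * B)\<^sup>2 * sqn \<xi>"
proof -
  define S where "S = {k. \<xi> k \<noteq> 0}"
  define T where "T = {g. regular_rep G x f \<xi> g \<noteq> 0}"
  have S: "finite S" "\<And>k. k \<in> S \<Longrightarrow> src G k = x" using fin_vecD[OF \<xi>] by (auto simp: S_def)
  have T: "finite T" "\<And>g. g \<in> T \<Longrightarrow> src G g = x"
    using fin_vecD[OF regular_rep_fin_vec[OF f \<xi>]] by (auto simp: T_def)
  have point: "(cmod (regular_rep G x f \<xi> g))\<^sup>2
      \<le> real N * B\<^sup>2 * (\<Sum>k\<in>S. if g \<cdot> ginv G k \<in> K then (cmod (\<xi> k))\<^sup>2 else 0)" if g: "g \<in> T" for g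
  proof -
    define S' where "S' = {k \<in> S. g \<cdot> ginv G k \<in> K}"
    have S': "finite S'" "S' \<subseteq> S" using S by (auto simp: S'_def)
    have "inj_on (\<lambda>k. g \<cdot> ginv G k) S'"
      using mult_inv_swap(3)[of g] S'(2) S(2) T(2)[OF g] by (intro inj_onI) (metis subsetD)
    moreover have "(\<lambda>k. g \<cdot> ginv G k) ` S' \<subseteq> {h \<in> K. rng G h = rng G g}"
      using mult_inv_swap(1)[of g] S(2) T(2)[OF g] by (auto simp: S'_def)
    ultimately have "card S' \<le> card {h \<in> K. rng G h = rng G g}"
      using fib(1) by (meson card_inj_on_le)
    then have card: "card S' \<le> N" using fib(2) le_trans by blast
    have "cmod (regular_rep G x f \<xi> g) = cmod (\<Sum>k\<in>S. f (g \<cdot> ginv G k) * \<xi> k)"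
      using regular_rep_fin_vec_sum[OF \<xi> T(2)[OF g]] by (simp add: S_def)
    also have "(\<Sum>k\<in>S. f (g \<cdot> ginv G k) * \<xi> k) = (\<Sum>k\<in>S'. f (g \<cdot> ginv G k) * \<xi> k)"
      using S S' K by (intro sum.mono_neutral_right) (auto simp: S'_def)
    also have "cmod \<dots> \<le> (\<Sum>k\<in>S'. B * cmod (\<xi> k))"
      using B by (intro sum_norm_le) (simp add: norm_mult mult_right_mono)
    finally have "(cmod (regular_rep G x f \<xi> g))\<^sup>2 \<le> (\<Sum>k\<in>S'. B * cmod (\<xi> k))\<^sup>2"
      by (intro power_mono) auto
    also have "\<dots> \<le> (\<Sum>k\<in>S'. (B * cmod (\<xi> k))\<^sup>2) * real (card S')"
      by (rule sum_squared_le_sum_of_squares)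
    also have "\<dots> \<le> (\<Sum>k\<in>S'. (B * cmod (\<xi> k))\<^sup>2) * real N"
      using card by (intro mult_left_mono sum_nonneg) auto
    also have "(\<Sum>k\<in>S'. (B * cmod (\<xi> k))\<^sup>2) = B\<^sup>2 * (\<Sum>k\<in>S'. (cmod (\<xi> k))\<^sup>2)"
      by (simp add: power_mult_distrib sum_distrib_left)
    also have "(\<Sum>k\<in>S'. (cmod (\<xi> k))\<^sup>2) = (\<Sum>k\<in>S. if g \<cdot> ginv G k \<in> K then (cmod (\<xi> k))\<^sup>2 else 0)"
      using S by (simp add: S'_def sum.inter_filter)
    finally show ?thesis by (simp add: mult_ac)
  qed
  have inner: "(\<Sum>g\<in>T. if g \<cdot> ginv G k \<in> K then (cmod (\<xi> k))\<^sup>2 else 0) \<le> real N * (cmod (\<xi> k))\<^sup>2"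
    if k: "k \<in> S" for k
  proof -
    define T' where "T' = {g \<in> T. g \<cdot> ginv G k \<in> K}"
    have "inj_on (\<lambda>g. g \<cdot> ginv G k) T'"
      using inv_mult_cancel_right[of _ k] S(2)[OF k] T(2) by (intro inj_onI) (metis (mono_tags, lifting) T'_def mem_Collect_eq)
    moreover have "(\<lambda>g. g \<cdot> ginv G k) ` T' \<subseteq> {h \<in> K. src G h = rng G k}"
      using mult_inv_swap(2)[of _ k] S(2)[OF k] T(2) by (auto simp: T'_def)
    ultimately have "card T' \<le> card {h \<in> K. src G h = rng G k}"
      using fib(3) by (meson card_inj_on_le)
    then have "card T' \<le> N" using fib(4) le_trans by blast
    moreover have "(\<Sum>g\<in>T. if g \<cdot> ginv G k \<in> K then (cmod (\<xi> k))\<^sup>2 else 0) = real (card T') * (cmod (\<xi> k))\<^sup>2"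
      using T(1) by (simp add: T'_def sum.inter_filter[symmetric])
    ultimately show ?thesis by (simp add: mult_right_mono)
  qed
  have "sqn (regular_rep G x f \<xi>) = (\<Sum>g\<in>T. (cmod (regular_rep G x f \<xi> g))\<^sup>2)"
    by (simp add: sqn_def T_def)
  also have "\<dots> \<le> (\<Sum>g\<in>T. real N * B\<^sup>2 * (\<Sum>k\<in>S. if g \<cdot> ginv G k \<in> K then (cmod (\<xi> k))\<^sup>2 else 0))"
    by (intro sum_mono point)
  also have "\<dots> = real N * B\<^sup>2 * (\<Sum>k\<in>S. \<Sum>g\<in>T. if g \<cdot> ginv G k \<in> K then (cmod (\<xi> k))\<^sup>2 else 0)"
    by (subst sum.swap) (simp add: sum_distrib_left)
  also have "\<dots> \<le> real N * B\<^sup>2 * (\<Sum>k\<in>S. real N * (cmod (\<xi> k))\<^sup>2)"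
    by (intro mult_left_mono sum_mono inner) auto
  also have "\<dots> = (real N * B)\<^sup>2 * sqn \<xi>"
    by (simp add: sqn_def S_def sum_distrib_left power2_eq_square mult_ac)
  finally show ?thesis .
qed

text \<open>Finitely many values of the image depend on finitely many coordinates of the vector
  only, because f has finite range fibres on its support. So estimates on finitely supported vectors
  pass to the whole Hilbert space.\<close>

lemma regular_rep_ell2_le:
  assumes f: "compactly_supported f" and C: "0 \<le> C"
    and le: "\<And>\<xi>. \<xi> \<in> fin_vec x \<Longrightarrow> sqn (regular_rep G x f \<xi>) \<le> C\<^sup>2 * sqn \<xi>"
    and \<xi>: "\<xi> \<in> ell2 {g. src G g = x}"
  shows "ell2_norm {g. src G g = x} (regular_rep G x f \<xi>) \<le> C * ell2_norm {g. src G g = x} \<xi>"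
proof -
  obtain K where K: "compact K" "\<And>x. x \<notin> K \<Longrightarrow> f x = 0" using f compactly_supportedE by metis
  obtain N where fib: "\<And>y. finite {h \<in> K. rng G h = y}" using compact_fibres[OF K(1)] by metis
  define X where "X = {g. src G g = x}"
  have sm: "(\<lambda>g. (cmod (\<xi> g))\<^sup>2) summable_on X" using \<xi> by (simp add: ell2_def X_def)
  have inf_nonneg: "0 \<le> (\<Sum>\<^sub>\<infinity>g\<in>X. (cmod (\<xi> g))\<^sup>2)" by (intro infsum_nonneg) auto
  have "(\<Sum>g\<in>F. (cmod (regular_rep G x f \<xi> g))\<^sup>2) \<le> (C * ell2_norm X \<xi>)\<^sup>2" if F: "finite F" "F \<subseteq> X" for F
  proof -
    define S where "S = (\<Union>g\<in>F. (\<lambda>h. ginv G h \<cdot> g) ` {h \<in> K. rng G h = rng G g})"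
    have S: "finite S" "S \<subseteq> X"
      using F fib inv_mult_swap(2) by (auto simp: S_def X_def)
    define \<xi>' where "\<xi>' = (\<lambda>g. if g \<in> S then \<xi> g else 0)"
    have \<xi>': "\<xi>' \<in> fin_vec x"
      using S by (auto simp: fin_vec_def \<xi>'_def X_def elim!: finite_subset[rotated] split: if_splits)
    have "regular_rep G x f \<xi> g = regular_rep G x f \<xi>' g" if g: "g \<in> F" for g
    proof -
      have "ginv G h \<cdot> g \<in> S" if "h \<in> {h \<in> K. rng G h = rng G g}" for h
        using that g by (auto simp: S_def)
      then show ?thesis
        using conv_eq_sum[where f = f and K = K and g = g, OF fib K(2)]
        by (auto simp: regular_rep_conv \<xi>'_def intro!: sum.cong)
    qed
    then have "(\<Sum>g\<in>F. (cmod (regular_rep G x f \<xi> g))\<^sup>2) = (\<Sum>g\<in>F. (cmod (regular_rep G x f \<xi>' g))\<^sup>2)"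
      by (intro sum.cong) auto
    also have "\<dots> \<le> (\<Sum>g\<in>F \<union> {g. regular_rep G x f \<xi>' g \<noteq> 0}. (cmod (regular_rep G x f \<xi>' g))\<^sup>2)"
      using F fin_vecD(1)[OF regular_rep_fin_vec[OF f \<xi>']] by (intro sum_mono2) auto
    also have "\<dots> = sqn (regular_rep G x f \<xi>')"
      using F fin_vecD(1)[OF regular_rep_fin_vec[OF f \<xi>']] by (intro sqn_eq_sum[symmetric]) auto
    also have "\<dots> \<le> C\<^sup>2 * sqn \<xi>'" by (rule le[OF \<xi>'])
    also have "sqn \<xi>' = (\<Sum>g\<in>S. (cmod (\<xi> g))\<^sup>2)"
      using S by (subst sqn_eq_sum[of S]) (auto simp: \<xi>'_def)
    also have "\<dots> \<le> (\<Sum>\<^sub>\<infinity>g\<in>X. (cmod (\<xi> g))\<^sup>2)"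
      using S by (intro finite_sum_le_infsum sm) auto
    also have "\<dots> = (ell2_norm X \<xi>)\<^sup>2" using inf_nonneg by (simp add: ell2_norm_def)
    finally show ?thesis by (simp add: power_mult_distrib mult_left_mono)
  qed
  then show ?thesis
    unfolding X_def[symmetric] using C inf_nonneg by (intro ell2_normI) (auto simp: ell2_norm_def)
qed

lemma zero_ell2: "(\<lambda>_. 0) \<in> ell2 S" "ell2_norm S (\<lambda>_. 0) = 0"
  by (auto simp: ell2_def ell2_norm_def)

lemma ell2_opnorm_le:
  assumes f: "compactly_supported f" and C: "0 \<le> C"
    and le: "\<And>\<xi>. \<xi> \<in> fin_vec x \<Longrightarrow> sqn (regular_rep G x f \<xi>) \<le> C\<^sup>2 * sqn \<xi>"
  shows "ell2_opnorm {g. src G g = x} (regular_rep G x f) \<le> C"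
  unfolding ell2_opnorm_def
proof (rule cSUP_least)
  show "{\<xi> \<in> ell2 {g. src G g = x}. ell2_norm {g. src G g = x} \<xi> \<le> 1} \<noteq> {}"
    by (intro ex_in_conv[THEN iffD1] exI[of _ "\<lambda>_. 0"]) (simp add: zero_ell2)
  fix \<xi> assume "\<xi> \<in> {\<xi> \<in> ell2 {g. src G g = x}. ell2_norm {g. src G g = x} \<xi> \<le> 1}"
  then show "ell2_norm {g. src G g = x} (regular_rep G x f \<xi>) \<le> C"
    using regular_rep_ell2_le[OF f C le, of \<xi>] C mult_left_le by force
qed

lemma regular_rep_uniform_bound:
  assumes f: "compactly_supported f"
  obtains C where "0 \<le> C" "\<And>x \<xi>. \<xi> \<in> fin_vec x \<Longrightarrow> sqn (regular_rep G x f \<xi>) \<le> C\<^sup>2 * sqn \<xi>"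
proof -
  obtain K where K: "compact K" "\<And>x. x \<notin> K \<Longrightarrow> f x = 0" using f compactly_supportedE by metis
  obtain N where fib: "\<And>x. finite {h \<in> K. rng G h = x}" "\<And>x. card {h \<in> K. rng G h = x} \<le> N"
    "\<And>x. finite {h \<in> K. src G h = x}" "\<And>x. card {h \<in> K. src G h = x} \<le> N"
    using compact_fibres[OF K(1)] by metis
  obtain B where B: "B > 0" "\<And>x. cmod (f x) \<le> B" using compactly_supported_bounded[OF f] by metis
  have "sqn (regular_rep G x f \<xi>) \<le> (real N * B)\<^sup>2 * sqn \<xi>" if "\<xi> \<in> fin_vec x" for x \<xi>
    using regular_rep_bound[OF f K(2) B(2) fib that] .
  then show thesis using that[of "real N * B"] B(1) by simp
qed

text \<open>The reduced norm consists of real suprema, which dominate their members only when the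
  families are bounded; the uniform bound from Schur's test guarantees that. The vector is
  normalized to reach the unit ball, hence the separate case of norm 0.\<close>

lemma sqn_regular_rep_le:
  assumes f: "compactly_supported f" and x: "x \<in> units G" and \<xi>: "\<xi> \<in> fin_vec x"
  shows "sqn (regular_rep G x f \<xi>) \<le> (reduced_norm G f)\<^sup>2 * sqn \<xi>"
proof (cases "sqn \<xi> = 0")
  case True
  have "\<xi> g = 0" for g
  proof (rule ccontr)
    assume "\<xi> g \<noteq> 0"
    then show False using True fin_vecD(1)[OF \<xi>] unfolding sqn_def
      by (subst (asm) sum_nonneg_eq_0_iff) auto
  qed
  then have "regular_rep G x f \<xi> = (\<lambda>_. 0)" by (auto simp: regular_rep_def)
  then show ?thesis using True by (simp add: sqn_def)
next
  case False
  define s where "s = sqrt (sqn \<xi>)"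
  have "0 < sqn \<xi>" using False sqn_nonneg[of \<xi>] by linarith
  then have s: "s > 0" "s\<^sup>2 = sqn \<xi>" by (auto simp: s_def)
  define X where "X = {g. src G g = x}"
  obtain C where C: "0 \<le> C" "\<And>x \<xi>. \<xi> \<in> fin_vec x \<Longrightarrow> sqn (regular_rep G x f \<xi>) \<le> C\<^sup>2 * sqn \<xi>"
    using regular_rep_uniform_bound[OF f] by metis
  define \<eta> where "\<eta> = (\<lambda>g. of_real (1 / s) * \<xi> g)"
  have \<eta>: "\<eta> \<in> fin_vec x" unfolding \<eta>_def by (rule fin_vec_scale[OF \<xi>])
  have \<eta>_sqn: "sqn \<eta> = 1"
    unfolding \<eta>_def sqn_scale using s False by (simp add: norm_divide power_divide)
  have \<eta>1: "\<eta> \<in> {\<xi> \<in> ell2 X. ell2_norm X \<xi> \<le> 1}"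
    using fin_vec_ell2[OF \<eta>] \<eta>_sqn by (simp add: X_def)
  have "sqrt (sqn (regular_rep G x f \<eta>)) = ell2_norm X (regular_rep G x f \<eta>)"
    using fin_vec_ell2(2)[OF regular_rep_fin_vec[OF f \<eta>]] by (simp add: X_def)
  also have "\<dots> \<le> ell2_opnorm X (regular_rep G x f)"
    unfolding ell2_opnorm_def
  proof (rule cSUP_upper[OF \<eta>1])
    have "ell2_norm X (regular_rep G x f \<xi>) \<le> C" if "\<xi> \<in> ell2 X" "ell2_norm X \<xi> \<le> 1" for \<xi>
      using regular_rep_ell2_le[OF f C(1) C(2), of x \<xi>] that C(1) unfolding X_def
      by (meson mult_left_le order_trans)
    then show "bdd_above ((\<lambda>\<xi>. ell2_norm X (regular_rep G x f \<xi>)) ` {\<xi> \<in> ell2 X. ell2_norm X \<xi> \<le> 1})"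
      by (intro bdd_aboveI[of _ C]) auto
  qed
  also have "\<dots> \<le> reduced_norm G f"
    unfolding reduced_norm_def X_def
  proof (rule cSUP_upper[OF x])
    show "bdd_above ((\<lambda>x. ell2_opnorm {g. src G g = x} (regular_rep G x f)) ` units G)"
      using ell2_opnorm_le[OF f C(1) C(2)] by (intro bdd_aboveI[of _ C]) auto
  qed
  finally have "sqrt (sqn (regular_rep G x f \<eta>)) \<le> reduced_norm G f" .
  then have "(sqrt (sqn (regular_rep G x f \<eta>)))\<^sup>2 \<le> (reduced_norm G f)\<^sup>2"
    by (intro power_mono) auto
  then have "sqn (regular_rep G x f \<eta>) \<le> (reduced_norm G f)\<^sup>2" by simp
  moreover have "sqn (regular_rep G x f \<eta>) = sqn (regular_rep G x f \<xi>) / sqn \<xi>"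
    unfolding \<eta>_def regular_rep_scale sqn_scale using s by (simp add: norm_divide power_divide)
  ultimately show ?thesis using s False sqn_nonneg[of \<xi>] by (simp add: divide_le_eq)
qed

lemma reduced_norm_le:
  assumes f: "compactly_supported f" and C: "0 \<le> C"
    and le: "\<And>x \<xi>. x \<in> units G \<Longrightarrow> \<xi> \<in> fin_vec x \<Longrightarrow> sqn (regular_rep G x f \<xi>) \<le> C\<^sup>2 * sqn \<xi>"
  shows "reduced_norm G f \<le> C"
  unfolding reduced_norm_def
  by (rule cSUP_least) (use rng_units ell2_opnorm_le[OF f C le] in auto)

text \<open>The regular representation at the source x of g maps the delta function at x to a vector
  with coordinate f g at g. Evaluation at a point is therefore contractive and extends to the
  completion.\<close>

lemma cmod_le_reduced_norm:
  assumes f: "compactly_supported f" and nonneg: "0 \<le> reduced_norm G f"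
  shows "cmod (f g) \<le> reduced_norm G f"
proof -
  define x where "x = src G g"
  have x: "x \<in> units G" unfolding x_def by (rule src_units)
  define \<xi> where "\<xi> = (\<lambda>h. if h = x then 1 else 0 :: complex)"
  have \<xi>: "\<xi> \<in> fin_vec x" using x by (auto simp: fin_vec_def \<xi>_def unitsD split: if_splits)
  have supp: "{k. \<xi> k \<noteq> 0} = {x}" by (auto simp: \<xi>_def)
  have "regular_rep G x f \<xi> g = f g"
    using regular_rep_fin_vec_sum[OF \<xi>, of g f] x units_inv[OF x] mult_src_id[of g]
    unfolding supp by (simp add: \<xi>_def x_def)
  then have "(cmod (f g))\<^sup>2 = (\<Sum>h\<in>{g}. (cmod (regular_rep G x f \<xi> h))\<^sup>2)" by simp
  also have "\<dots> \<le> (\<Sum>h\<in>insert g {h. regular_rep G x f \<xi> h \<noteq> 0}. (cmod (regular_rep G x f \<xi> h))\<^sup>2)"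
    using fin_vecD(1)[OF regular_rep_fin_vec[OF f \<xi>]] by (intro sum_mono2) auto
  also have "\<dots> = sqn (regular_rep G x f \<xi>)"
    using fin_vecD(1)[OF regular_rep_fin_vec[OF f \<xi>]] by (intro sqn_eq_sum[symmetric]) auto
  also have "\<dots> \<le> (reduced_norm G f)\<^sup>2 * sqn \<xi>" by (rule sqn_regular_rep_le[OF f x \<xi>])
  also have "sqn \<xi> = 1" by (simp add: sqn_def supp) (simp add: \<xi>_def)
  finally have "(cmod (f g))\<^sup>2 \<le> (reduced_norm G f)\<^sup>2" by simp
  then show ?thesis using nonneg by (rule power2_le_imp_le)
qed

text \<open>On functions supported in a fixed compact set the reduced norm is dominated by the
  supremum norm, which gives continuity of gauge orbits in the algebra.\<close>

lemma reduced_norm_compact_bound: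
  assumes "compact K"
  obtains C where "0 \<le> C"
    "\<And>f B. compactly_supported f \<Longrightarrow> (\<And>x. x \<notin> K \<Longrightarrow> f x = 0) \<Longrightarrow> (\<And>x. cmod (f x) \<le> B) \<Longrightarrow> reduced_norm G f \<le> C * B"
proof -
  obtain N where fib: "\<And>x. finite {h \<in> K. rng G h = x}" "\<And>x. card {h \<in> K. rng G h = x} \<le> N"
    "\<And>x. finite {h \<in> K. src G h = x}" "\<And>x. card {h \<in> K. src G h = x} \<le> N"
    using compact_fibres[OF assms] by metis
  have "reduced_norm G f \<le> real N * B" if f: "compactly_supported f" and K: "\<And>x. x \<notin> K \<Longrightarrow> f x = 0"
    and B: "\<And>x. cmod (f x) \<le> B" for f B
  proof (rule reduced_norm_le[OF f])
    have "0 \<le> B" using B norm_ge_zero order_trans by blast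
    then show "0 \<le> real N * B" by simp
  qed (rule regular_rep_bound[OF f K B fib])
  then show thesis using that[of "real N"] by simp
qed

lemma regular_rep_mult:
  assumes f: "compactly_supported f" and k: "compactly_supported k" and \<xi>: "\<xi> \<in> fin_vec x"
  shows "regular_rep G x (conv G f k) \<xi> = regular_rep G x f (regular_rep G x k \<xi>)"
proof
  fix g
  obtain K where K: "compact K" "\<And>x. x \<notin> K \<Longrightarrow> f x = 0" using f compactly_supportedE by metis
  obtain N where fib: "\<And>y. finite {h \<in> K. rng G h = y}" using compact_fibres[OF K(1)] by metis
  define S where "S = {l. \<xi> l \<noteq> 0}"
  have S: "\<And>l. l \<in> S \<Longrightarrow> src G l = x" using fin_vecD[OF \<xi>] by (auto simp: S_def)
  show "regular_rep G x (conv G f k) \<xi> g = regular_rep G x f (regular_rep G x k \<xi>) g"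
  proof (cases "src G g = x")
    case g: True
    define H where "H = {h \<in> K. rng G h = rng G g}"
    have inner: "regular_rep G x k \<xi> (ginv G h \<cdot> g) = (\<Sum>l\<in>S. k ((ginv G h \<cdot> g) \<cdot> ginv G l) * \<xi> l)"
      if "h \<in> H" for h
      using that inv_mult_swap(2)[of h g] g regular_rep_fin_vec_sum[OF \<xi>] by (simp add: S_def H_def)
    have "regular_rep G x f (regular_rep G x k \<xi>) g = (\<Sum>h\<in>H. f h * regular_rep G x k \<xi> (ginv G h \<cdot> g))"
      using g conv_eq_sum[OF fib K(2)] by (simp add: regular_rep_conv[of x f] H_def)
    also have "\<dots> = (\<Sum>h\<in>H. \<Sum>l\<in>S. f h * (k ((ginv G h \<cdot> g) \<cdot> ginv G l) * \<xi> l))"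
      by (intro sum.cong) (auto simp: inner sum_distrib_left)
    also have "\<dots> = (\<Sum>l\<in>S. \<Sum>h\<in>H. f h * (k ((ginv G h \<cdot> g) \<cdot> ginv G l) * \<xi> l))"
      by (rule sum.swap)
    also have "\<dots> = (\<Sum>l\<in>S. conv G f k (g \<cdot> ginv G l) * \<xi> l)"
    proof (rule sum.cong[OF refl])
      fix l assume l: "l \<in> S"
      have r: "rng G (g \<cdot> ginv G l) = rng G g" using mult_inv_swap(1)[of g l] S[OF l] g by simp
      have "ginv G h \<cdot> (g \<cdot> ginv G l) = (ginv G h \<cdot> g) \<cdot> ginv G l" if "h \<in> H" for h
        using that S[OF l] g by (intro mult_assoc[symmetric]) (auto simp: H_def src_inv rng_inv)
      then have "conv G f k (g \<cdot> ginv G l) = (\<Sum>h\<in>H. f h * k ((ginv G h \<cdot> g) \<cdot> ginv G l))"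
        using conv_eq_sum[where f = f and K = K and g = "g \<cdot> ginv G l" and k = k, OF fib K(2)]
        unfolding r H_def[symmetric] by simp
      then show "(\<Sum>h\<in>H. f h * (k ((ginv G h \<cdot> g) \<cdot> ginv G l) * \<xi> l)) = conv G f k (g \<cdot> ginv G l) * \<xi> l"
        by (simp add: sum_distrib_right mult.assoc)
    qed
    also have "\<dots> = regular_rep G x (conv G f k) \<xi> g"
      using regular_rep_fin_vec_sum[OF \<xi> g] by (simp add: S_def)
    finally show ?thesis by simp
  qed (simp add: regular_rep_def)
qed

text \<open>With T for f, the square expands to r^2 |\<eta>|^2 - 2 r |T \<eta>|^2 + |T* T \<eta>|^2,
  and the last term is at most r |T \<eta>|^2. This is the Hilbert space source of the hypothesis of
  \<open>pos_cone_add\<close>.\<close>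

lemma sqn_diff_adjoint_le:
  assumes f: "compactly_supported f" and r: "0 \<le> r" and \<eta>: "\<eta> \<in> fin_vec x"
    and le: "\<And>\<zeta>. \<zeta> \<in> fin_vec x \<Longrightarrow> sqn (regular_rep G x f \<zeta>) \<le> r * sqn \<zeta>"
      "\<And>\<zeta>. \<zeta> \<in> fin_vec x \<Longrightarrow> sqn (regular_rep G x (adj G f) \<zeta>) \<le> r * sqn \<zeta>"
  shows "sqn (\<lambda>g. of_real r * \<eta> g - regular_rep G x (adj G f) (regular_rep G x f \<eta>) g) \<le> r\<^sup>2 * sqn \<eta>"
proof -
  define \<theta> where "\<theta> = regular_rep G x f \<eta>"
  define \<zeta> where "\<zeta> = regular_rep G x (adj G f) \<theta>"
  have \<theta>: "\<theta> \<in> fin_vec x" unfolding \<theta>_def by (rule regular_rep_fin_vec[OF f \<eta>])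
  have \<zeta>: "\<zeta> \<in> fin_vec x"
    unfolding \<zeta>_def by (rule regular_rep_fin_vec[OF adj_compactly_supported[OF f] \<theta>])
  define A where "A = {g. \<eta> g \<noteq> 0} \<union> {g. \<theta> g \<noteq> 0} \<union> {g. \<zeta> g \<noteq> 0}"
  have A: "finite A" "\<And>g. g \<in> A \<Longrightarrow> src G g = x" "\<And>g. g \<notin> A \<Longrightarrow> \<eta> g = 0" "\<And>g. g \<notin> A \<Longrightarrow> \<theta> g = 0" "\<And>g. g \<notin> A \<Longrightarrow> \<zeta> g = 0"
    using fin_vecD[OF \<eta>] fin_vecD[OF \<theta>] fin_vecD[OF \<zeta>] by (auto simp: A_def)
  have "(\<Sum>g\<in>A. cnj (\<eta> g) * \<zeta> g) = (\<Sum>g\<in>A. cnj (\<theta> g) * \<theta> g)"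
    unfolding \<zeta>_def using regular_rep_adjoint[OF \<eta> \<theta> A(1,2,3,4), of "adj G f"]
    by (simp add: adj_adj \<theta>_def)
  also have "\<dots> = of_real (sqn \<theta>)"
    using A by (simp add: sqn_eq_sum[of A] complex_norm_square[symmetric] mult.commute)
  finally have ip: "Re (\<Sum>g\<in>A. cnj (\<eta> g) * \<zeta> g) = sqn \<theta>" by simp
  have "(cmod (of_real r * \<eta> g - \<zeta> g))\<^sup>2 = r\<^sup>2 * (cmod (\<eta> g))\<^sup>2 - 2 * r * Re (cnj (\<eta> g) * \<zeta> g) + (cmod (\<zeta> g))\<^sup>2" for g
    unfolding cmod_power2 by (simp add: power2_eq_square algebra_simps)
  then have "sqn (\<lambda>g. of_real r * \<eta> g - \<zeta> g)
      = (\<Sum>g\<in>A. r\<^sup>2 * (cmod (\<eta> g))\<^sup>2 - 2 * r * Re (cnj (\<eta> g) * \<zeta> g) + (cmod (\<zeta> g))\<^sup>2)"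
    using A by (subst sqn_eq_sum[of A]) auto
  also have "\<dots> = r\<^sup>2 * sqn \<eta> - 2 * r * Re (\<Sum>g\<in>A. cnj (\<eta> g) * \<zeta> g) + sqn \<zeta>"
  proof -
    have "sqn \<eta> = (\<Sum>g\<in>A. (cmod (\<eta> g))\<^sup>2)" "sqn \<zeta> = (\<Sum>g\<in>A. (cmod (\<zeta> g))\<^sup>2)"
      using A by (auto intro!: sqn_eq_sum)
    then show ?thesis
      by (simp only: sum.distrib sum_subtractf sum_distrib_left[symmetric] Re_sum)
  qed
  also have "\<dots> = r\<^sup>2 * sqn \<eta> - 2 * r * sqn \<theta> + sqn \<zeta>" unfolding ip ..
  also have "\<dots> \<le> r\<^sup>2 * sqn \<eta>"
    using le(2)[OF \<theta>] mult_nonneg_nonneg[OF r sqn_nonneg, of \<theta>] by (simp add: \<zeta>_def)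
  finally show ?thesis by (simp add: \<zeta>_def \<theta>_def)
qed

end

section \<open>The reduced C*-algebra\<close>

lemma exp_i_diff_le: "cmod (exp (\<i> * of_real s) - exp (\<i> * of_real t)) \<le> \<bar>s - t\<bar>"
proof -
  have "exp (\<i> * of_real s) - exp (\<i> * of_real t) = exp (\<i> * of_real t) * (exp (\<i> * of_real (s - t)) - 1)"
    by (simp add: algebra_simps flip: exp_add)
  then have "cmod (exp (\<i> * of_real s) - exp (\<i> * of_real t)) = cmod (exp (\<i> * of_real (s - t)) - 1)"
    by (simp add: norm_mult)
  also have "\<dots> = 2 * \<bar>sin ((s - t) / 2)\<bar>" by (rule dist_exp_i_1)
  also have "\<dots> \<le> 2 * \<bar>(s - t) / 2\<bar>" using abs_sin_x_le_abs_x[of "(s - t) / 2"] by simp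
  finally show ?thesis by simp
qed

context groupoid
begin

lemma conv_units_left:
  assumes "\<And>h. h \<notin> units G \<Longrightarrow> k h = 0"
  shows "conv G k f g = k (rng G g) * f g"
proof -
  have "conv G k f g = infsum (\<lambda>h. k h * f (ginv G h \<cdot> g)) {rng G g}"
    unfolding conv_def
  proof (rule infsum_cong_neutral)
    fix h assume "h \<in> {h. rng G h = rng G g} - {rng G g}"
    then have "h \<notin> units G" using mem_units_iff by auto
    then show "k h * f (ginv G h \<cdot> g) = 0" by (simp add: assms)
  qed (auto simp: rng_rng)
  then show ?thesis using units_inv[OF rng_units[of g]] by (simp add: rng_mult_id)
qed

lemma conv_units_right:
  assumes "\<And>h. h \<notin> units G \<Longrightarrow> k h = 0"
  shows "conv G f k g = f g * k (src G g)"
proof -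
  have "conv G f k g = infsum (\<lambda>h. f h * k (ginv G h \<cdot> g)) {g}"
    unfolding conv_def
  proof (rule infsum_cong_neutral)
    fix h assume h: "h \<in> {h. rng G h = rng G g} - {g}"
    have "ginv G h \<cdot> g \<notin> units G"
    proof
      assume "ginv G h \<cdot> g \<in> units G"
      then have "ginv G h \<cdot> g = src G h"
        using inv_mult_swap(1)[of h g] h by (simp add: mem_units_iff)
      then have "g = h \<cdot> src G h" using mult_inv_cancel[of h g] h by simp
      then show False using h mult_src_id[of h] by simp
    qed
    then show "f h * k (ginv G h \<cdot> g) = 0" by (simp add: assms)
  qed auto
  then show ?thesis by (simp add: inv_mult)
qed

end

context etale_groupoid
begin

lemma cont_hom_mult: "cont_hom G c \<Longrightarrow> src G g = rng G h \<Longrightarrow> c (g \<cdot> h) = c g + c h"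
  by (simp add: cont_hom_def)

lemma cont_hom_units:
  assumes "cont_hom G c" "x \<in> units G"
  shows "c x = 0"
  using cont_hom_mult[OF assms(1), of x x] by (simp add: unitsD[OF assms(2)] units_mult[OF assms(2)])

lemma cont_hom_inv:
  assumes "cont_hom G c"
  shows "c (ginv G g) = - c g"
proof -
  have "c (ginv G g) + c g = c (src G g)"
    using cont_hom_mult[OF assms, of "ginv G g" g] by (simp add: src_inv inv_mult)
  then show ?thesis using cont_hom_units[OF assms src_units, of g] by simp
qed

end

locale reduced_algebra = etale_groupoid G
  for G :: "'g :: {second_countable_topology, t2_space} groupoid" (structure) +
  fixes \<iota> :: "('g \<Rightarrow> complex) \<Rightarrow> 'a :: cstar_algebra"
  assumes reduced: "reduced_cstar G \<iota>"
begin

lemma iota_add: "compactly_supported f \<Longrightarrow> compactly_supported k \<Longrightarrow> \<iota> (\<lambda>g. f g + k g) = \<iota> f + \<iota> k"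
  and iota_scale: "compactly_supported f \<Longrightarrow> \<iota> (\<lambda>g. z * f g) = z *\<^sub>C \<iota> f"
  and iota_conv: "compactly_supported f \<Longrightarrow> compactly_supported k \<Longrightarrow> \<iota> (conv G f k) = \<iota> f * \<iota> k"
  and iota_adj: "compactly_supported f \<Longrightarrow> \<iota> (adj G f) = star (\<iota> f)"
  and iota_norm: "compactly_supported f \<Longrightarrow> norm (\<iota> f) = reduced_norm G f"
  and iota_dense: "closure (\<iota> ` {f. compactly_supported f}) = UNIV"
proof -
  have "Cc = {f :: 'g \<Rightarrow> complex. compactly_supported f}" using Cc_iff by blast
  then show "closure (\<iota> ` {f. compactly_supported f}) = UNIV" using reduced by (simp add: reduced_cstar_def)
qed (use reduced in \<open>auto simp: reduced_cstar_def Cc_iff\<close>)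

lemma compactly_supported_scale: "compactly_supported f \<Longrightarrow> compactly_supported (\<lambda>g. z * f g)"
  for f :: "'g \<Rightarrow> complex"
  by (intro compactly_supported_mult_cont continuous_on_const)

lemma iota_diff:
  assumes "compactly_supported f" "compactly_supported k"
  shows "\<iota> (\<lambda>g. f g - k g) = \<iota> f - \<iota> k"
  using iota_add[OF compactly_supported_diff[OF assms] assms(2)] by simp

lemma cmod_le_norm_iota:
  assumes "compactly_supported f"
  shows "cmod (f g) \<le> norm (\<iota> f)"
  using cmod_le_reduced_norm[OF assms] iota_norm[OF assms] norm_ge_zero by metis

lemma dense_induct:
  assumes "closed {a. P a}" "\<And>f. compactly_supported f \<Longrightarrow> P (\<iota> f)"
  shows "P a"
proof -
  have "closure (\<iota> ` {f. compactly_supported f}) \<subseteq> {a. P a}"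
    using assms by (intro closure_minimal) auto
  then show ?thesis unfolding iota_dense by blast
qed

lemma dense_eq:
  fixes \<Phi> \<Psi> :: "'a \<Rightarrow> 'c :: t2_space"
  assumes "continuous_on UNIV \<Phi>" "continuous_on UNIV \<Psi>" "\<And>f. compactly_supported f \<Longrightarrow> \<Phi> (\<iota> f) = \<Psi> (\<iota> f)"
  shows "\<Phi> a = \<Psi> a"
  by (rule dense_induct) (use assms in \<open>auto intro: closed_Collect_eq\<close>)

text \<open>The extension principle behind both the gauge automorphisms and the conditional
  expectation; completeness of the target lets a nonexpansive map pass from the dense image to the
  algebra.\<close>

lemma dense_extension:
  fixes \<phi> :: "('g \<Rightarrow> complex) \<Rightarrow> 'c :: complete_space"
  assumes le: "\<And>f k. compactly_supported f \<Longrightarrow> compactly_supported k \<Longrightarrow> dist (\<phi> f) (\<phi> k) \<le> norm (\<iota> f - \<iota> k)"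
  shows "\<exists>\<Phi>. (\<forall>f. compactly_supported f \<longrightarrow> \<Phi> (\<iota> f) = \<phi> f) \<and> (\<forall>a b. dist (\<Phi> a) (\<Phi> b) \<le> norm (a - b))"
proof -
  define D where "D = \<iota> ` {f. compactly_supported f}"
  \<comment> \<open>An arbitrary preimage; the estimate for pairs of functions makes the value
    independent of the choice.\<close>
  define pre where "pre = (\<lambda>a. SOME f. compactly_supported f \<and> \<iota> f = a)"
  have pre: "compactly_supported (pre a) \<and> \<iota> (pre a) = a" if "a \<in> D" for a
  proof -
    obtain f where "compactly_supported f" "\<iota> f = a" using \<open>a \<in> D\<close> unfolding D_def by blast
    then have "\<exists>f. compactly_supported f \<and> \<iota> f = a" by blast
    then show ?thesis unfolding pre_def by (rule someI_ex)
  qed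
  have "1-lipschitz_on D (\<phi> \<circ> pre)"
  proof (rule lipschitz_onI)
    fix a b assume ab: "a \<in> D" "b \<in> D"
    show "dist ((\<phi> \<circ> pre) a) ((\<phi> \<circ> pre) b) \<le> 1 * dist a b"
      using le[of "pre a" "pre b"] pre[OF ab(1)] pre[OF ab(2)] by (simp add: dist_norm)
  qed simp
  then obtain \<Phi> where \<Phi>: "1-lipschitz_on (closure D) \<Phi>" "\<And>a. a \<in> D \<Longrightarrow> \<Phi> a = \<phi> (pre a)"
    using lipschitz_extend_closure by (metis o_apply)
  have "\<Phi> (\<iota> f) = \<phi> f" if f: "compactly_supported f" for f
  proof -
    have D: "\<iota> f \<in> D" using f by (auto simp: D_def)
    have "dist (\<phi> (pre (\<iota> f))) (\<phi> f) \<le> 0" using le[OF _ f, of "pre (\<iota> f)"] pre[OF D] by simp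
    then show ?thesis using \<Phi>(2)[OF D] by simp
  qed
  moreover have "dist (\<Phi> a) (\<Phi> b) \<le> norm (a - b)" for a b
    using lipschitz_onD[OF \<Phi>(1), of a b] iota_dense by (simp add: D_def dist_norm)
  ultimately show ?thesis by blast
qed

lemma nonexpansive_continuous:
  assumes "\<And>a b :: 'a. dist (\<Phi> a) (\<Phi> b) \<le> norm (a - b)"
  shows "continuous_on S \<Phi>"
  by (rule lipschitz_on_continuous_on[of 1]) (auto intro!: lipschitz_onI simp: dist_norm[of _ "_ :: 'a"] assms)

text \<open>For elements from \<open>Cc\<close> this is read off in every regular representation by
  \<open>sqn_diff_adjoint_le\<close>; both sides are norm continuous in a and in b, so density gives
  the rest.\<close>

lemma norm_square_diff_le: "norm ((norm a)\<^sup>2 *\<^sub>R b - star a * a * b) \<le> (norm a)\<^sup>2 * norm (b :: 'a)"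
proof -
  have base: "norm ((norm (\<iota> f))\<^sup>2 *\<^sub>R \<iota> k - star (\<iota> f) * \<iota> f * \<iota> k) \<le> (norm (\<iota> f))\<^sup>2 * norm (\<iota> k)"
    if f: "compactly_supported f" and k: "compactly_supported k" for f k
  proof -
    define r where "r = (norm (\<iota> f))\<^sup>2"
    have r0: "0 \<le> r" by (simp add: r_def)
    define h where "h = conv G (adj G f) (conv G f k)"
    have fk: "compactly_supported (conv G f k)" by (rule conv_compactly_supported[OF f k])
    have af: "compactly_supported (adj G f)" by (rule adj_compactly_supported[OF f])
    have h: "compactly_supported h" unfolding h_def by (rule conv_compactly_supported[OF af fk])
    have rk: "compactly_supported (\<lambda>g. of_real r * k g)" by (rule compactly_supported_scale[OF k])
    have d: "compactly_supported (\<lambda>g. of_real r * k g - h g)" by (rule compactly_supported_diff[OF rk h])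
    have "r *\<^sub>R \<iota> k - star (\<iota> f) * \<iota> f * \<iota> k = \<iota> (\<lambda>g. of_real r * k g - h g)"
      using iota_diff[OF rk h] by (simp add: iota_scale k h_def iota_conv af fk f iota_adj scaleC_of_real mult.assoc)
    also have "norm \<dots> = reduced_norm G (\<lambda>g. of_real r * k g - h g)" by (rule iota_norm[OF d])
    also have "\<dots> \<le> r * norm (\<iota> k)"
    proof (rule reduced_norm_le[OF d])
      show "0 \<le> r * norm (\<iota> k)" using r0 by simp
      fix x \<xi> assume x: "x \<in> units G" and \<xi>: "\<xi> \<in> fin_vec x"
      define \<eta> where "\<eta> = regular_rep G x k \<xi>"
      have \<eta>: "\<eta> \<in> fin_vec x" unfolding \<eta>_def by (rule regular_rep_fin_vec[OF k \<xi>])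
      have "regular_rep G x (\<lambda>g. of_real r * k g - h g) \<xi>
          = (\<lambda>g. of_real r * \<eta> g - regular_rep G x (adj G f) (regular_rep G x f \<eta>) g)"
      proof
        fix g
        show "regular_rep G x (\<lambda>g. of_real r * k g - h g) \<xi> g
          = of_real r * \<eta> g - regular_rep G x (adj G f) (regular_rep G x f \<eta>) g"
        proof (cases "src G g = x")
          case True
          have "regular_rep G x (\<lambda>g. of_real r * k g - h g) \<xi> g
              = of_real r * regular_rep G x k \<xi> g - regular_rep G x h \<xi> g"
            using regular_rep_fin_vec_sum[OF \<xi> True]
            by (simp add: left_diff_distrib sum_subtractf sum_distrib_left mult.assoc)
          then show ?thesis
            unfolding h_def \<eta>_def by (simp add: regular_rep_mult[OF af fk \<xi>] regular_rep_mult[OF f k \<xi>])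
        qed (simp add: regular_rep_def \<eta>_def)
      qed
      then have "sqn (regular_rep G x (\<lambda>g. of_real r * k g - h g) \<xi>)
          = sqn (\<lambda>g. of_real r * \<eta> g - regular_rep G x (adj G f) (regular_rep G x f \<eta>) g)" by simp
      also have "\<dots> \<le> r\<^sup>2 * sqn \<eta>"
      proof (rule sqn_diff_adjoint_le[OF f r0 \<eta>])
        show "sqn (regular_rep G x f \<zeta>) \<le> r * sqn \<zeta>" if "\<zeta> \<in> fin_vec x" for \<zeta>
          using sqn_regular_rep_le[OF f x that] by (simp add: r_def iota_norm f)
        show "sqn (regular_rep G x (adj G f) \<zeta>) \<le> r * sqn \<zeta>" if "\<zeta> \<in> fin_vec x" for \<zeta>
          using sqn_regular_rep_le[OF af x that] iota_norm[OF af] by (simp add: r_def iota_adj f)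
      qed
      also have "\<dots> \<le> r\<^sup>2 * ((norm (\<iota> k))\<^sup>2 * sqn \<xi>)"
        using sqn_regular_rep_le[OF k x \<xi>] by (intro mult_left_mono) (auto simp: \<eta>_def iota_norm k)
      finally show "sqn (regular_rep G x (\<lambda>g. of_real r * k g - h g) \<xi>) \<le> (r * norm (\<iota> k))\<^sup>2 * sqn \<xi>"
        by (simp add: power_mult_distrib mult.assoc)
    qed
    finally show ?thesis by (simp add: r_def)
  qed
  have half: "norm ((norm (\<iota> f))\<^sup>2 *\<^sub>R b - star (\<iota> f) * \<iota> f * b) \<le> (norm (\<iota> f))\<^sup>2 * norm b"
    if f: "compactly_supported f" for f b
  proof (rule dense_induct[where a = b])
    show "closed {b. norm ((norm (\<iota> f))\<^sup>2 *\<^sub>R b - star (\<iota> f) * \<iota> f * b) \<le> (norm (\<iota> f))\<^sup>2 * norm b}"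
      by (intro closed_Collect_le continuous_intros)
  qed (rule base[OF f])
  show ?thesis
  proof (rule dense_induct[where a = a])
    show "closed {a. norm ((norm a)\<^sup>2 *\<^sub>R b - star a * a * b) \<le> (norm a)\<^sup>2 * norm b}"
      by (intro closed_Collect_le continuous_intros)
  qed (rule half)
qed

lemma pos_cone_add': "x \<in> pos_cone \<Longrightarrow> y \<in> pos_cone \<Longrightarrow> (x :: 'a) + y \<in> pos_cone"
  by (rule pos_cone_add[OF norm_square_diff_le])

subsection \<open>The gauge actions\<close>

definition twist :: "('g \<Rightarrow> real) \<Rightarrow> real \<Rightarrow> ('g \<Rightarrow> complex) \<Rightarrow> 'g \<Rightarrow> complex" where
  "twist c t f g = exp (\<i> * of_real t * of_real (c g)) * f g"

lemma twist_compactly_supported: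
  assumes "cont_hom G c" "compactly_supported f"
  shows "compactly_supported (twist c t f)"
  unfolding twist_def[abs_def] using assms
  by (intro compactly_supported_mult_cont continuous_intros) (auto simp: cont_hom_def)

lemma twist_adj: "cont_hom G c \<Longrightarrow> adj G (twist c t f) = twist c t (adj G f)"
  by (rule ext) (simp add: adj_def twist_def cont_hom_inv exp_cnj)

lemma twist_conv:
  assumes c: "cont_hom G c"
  shows "conv G (twist c t f) (twist c t k) = twist c t (conv G f k)"
proof
  fix g
  have "twist c t f h * twist c t k (ginv G h \<cdot> g) = exp (\<i> * of_real t * of_real (c g)) * (f h * k (ginv G h \<cdot> g))"
    if "rng G h = rng G g" for h
  proof -
    have "c h + c (ginv G h \<cdot> g) = c g"
      using cont_hom_mult[OF c, of h "ginv G h \<cdot> g"] inv_mult_swap(1)[OF that] mult_inv_cancel[OF that] by simp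
    then have "exp (\<i> * of_real t * of_real (c g))
        = exp (\<i> * of_real t * of_real (c h)) * exp (\<i> * of_real t * of_real (c (ginv G h \<cdot> g)))"
      by (simp flip: exp_add distrib_left of_real_add)
    then show ?thesis by (simp add: twist_def)
  qed
  then have "conv G (twist c t f) (twist c t k) g
      = (\<Sum>\<^sub>\<infinity>h | rng G h = rng G g. exp (\<i> * of_real t * of_real (c g)) * (f h * k (ginv G h \<cdot> g)))"
    unfolding conv_def by (intro infsum_cong) auto
  then show "conv G (twist c t f) (twist c t k) g = twist c t (conv G f k) g"
    by (simp add: infsum_cmult_right' twist_def conv_def)
qed

text \<open>Since c (g k^(-1)) = c g - c k, twisting the function conjugates its matrix by the
  diagonal unitary with entries exp (i t c g), which preserves operator norms.\<close>

lemma twist_reduced_norm_le: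
  assumes c: "cont_hom G c" and f: "compactly_supported f"
  shows "reduced_norm G (twist c t f) \<le> reduced_norm G f"
proof (rule reduced_norm_le[OF twist_compactly_supported[OF c f]])
  show "0 \<le> reduced_norm G f" using iota_norm[OF f] norm_ge_zero by metis
  fix x \<xi> assume x: "x \<in> units G" and \<xi>: "\<xi> \<in> fin_vec x"
  define \<eta> where "\<eta> = twist c (- t) \<xi>"
  have supp: "{g. \<eta> g \<noteq> 0} = {g. \<xi> g \<noteq> 0}" by (auto simp: \<eta>_def twist_def)
  have \<eta>: "\<eta> \<in> fin_vec x" using \<xi> supp by (auto simp: fin_vec_def)
  have phase: "cmod (twist c s \<zeta> g) = cmod (\<zeta> g)" for s \<zeta> g
    by (simp add: twist_def norm_mult)
  have "regular_rep G x (twist c t f) \<xi> g = twist c t (regular_rep G x f \<eta>) g" for g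
  proof (cases "src G g = x")
    case True
    have "twist c t f (g \<cdot> ginv G k) * \<xi> k = exp (\<i> * of_real t * of_real (c g)) * (f (g \<cdot> ginv G k) * \<eta> k)"
      if "\<xi> k \<noteq> 0" for k
    proof -
      have "src G g = rng G (ginv G k)" using True fin_vecD(2)[OF \<xi> that] by (simp add: rng_inv)
      then have ck: "c (g \<cdot> ginv G k) = c g - c k"
        using cont_hom_mult[OF c] cont_hom_inv[OF c] by simp
      have "exp (\<i> * of_real t * of_real (c (g \<cdot> ginv G k)))
          = exp (\<i> * of_real t * of_real (c g)) * exp (\<i> * of_real (- t) * of_real (c k))"
        unfolding ck by (simp add: algebra_simps flip: exp_add)
      then show ?thesis by (simp add: twist_def \<eta>_def)
    qed
    then show ?thesis
      unfolding twist_def[of c t "regular_rep G x f \<eta>"]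
        regular_rep_fin_vec_sum[OF \<xi> True] regular_rep_fin_vec_sum[OF \<eta> True] supp
      by (auto simp: sum_distrib_left intro!: sum.cong)
  qed (simp add: regular_rep_def twist_def)
  then have "regular_rep G x (twist c t f) \<xi> = twist c t (regular_rep G x f \<eta>)" by (rule ext)
  then have "sqn (regular_rep G x (twist c t f) \<xi>) = sqn (twist c t (regular_rep G x f \<eta>))"
    by simp
  also have "\<dots> = sqn (regular_rep G x f \<eta>)" unfolding sqn_def by (simp add: phase) (simp add: twist_def)
  also have "\<dots> \<le> (reduced_norm G f)\<^sup>2 * sqn \<eta>" by (rule sqn_regular_rep_le[OF f x \<eta>])
  also have "sqn \<eta> = sqn \<xi>" unfolding sqn_def supp by (simp add: \<eta>_def phase)
  finally show "sqn (regular_rep G x (twist c t f) \<xi>) \<le> (reduced_norm G f)\<^sup>2 * sqn \<xi>" .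
qed

lemma twist_add: "twist c (s + t) f = twist c s (twist c t f)"
  by (rule ext) (simp add: twist_def distrib_left distrib_right exp_add)

lemma twist_zero: "twist c 0 f = f"
  by (rule ext) (simp add: twist_def)

lemma twist_norm:
  assumes c: "cont_hom G c" and f: "compactly_supported f"
  shows "norm (\<iota> (twist c t f)) = norm (\<iota> f)"
proof -
  have "reduced_norm G (twist c (- t) (twist c t f)) \<le> reduced_norm G (twist c t f)"
    using twist_reduced_norm_le[OF c twist_compactly_supported[OF c f]] .
  then have "reduced_norm G f \<le> reduced_norm G (twist c t f)"
    by (simp add: twist_zero flip: twist_add)
  then show ?thesis
    using twist_reduced_norm_le[OF c f] by (simp add: iota_norm f twist_compactly_supported c antisym)
qed

lemma twist_norm_diff:
  assumes c: "cont_hom G c" and f: "compactly_supported f" and k: "compactly_supported k"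
  shows "norm (\<iota> (twist c t f) - \<iota> (twist c t k)) = norm (\<iota> f - \<iota> k)"
proof -
  have "\<iota> (twist c t f) - \<iota> (twist c t k) = \<iota> (twist c t (\<lambda>g. f g - k g))"
    using iota_diff[OF twist_compactly_supported[OF c f] twist_compactly_supported[OF c k], of t t]
    by (simp add: twist_def[abs_def] right_diff_distrib)
  then show ?thesis
    using twist_norm[OF c compactly_supported_diff[OF f k]] by (simp add: iota_diff f k)
qed

text \<open>On the compact support of f the homomorphism is bounded, so the orbit is Lipschitz in
  the supremum norm with supports in one compact set, hence Lipschitz in the reduced norm.\<close>

lemma twist_orbit_continuous:
  assumes c: "cont_hom G c" and f: "compactly_supported f"
  shows "continuous_on UNIV (\<lambda>t. \<iota> (twist c t f))"
proof -
  obtain K where K: "compact K" "\<And>x. x \<notin> K \<Longrightarrow> f x = 0" using f compactly_supportedE by metis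
  obtain C where C: "0 \<le> C" "\<And>f B. compactly_supported f \<Longrightarrow> (\<And>x. x \<notin> K \<Longrightarrow> f x = 0) \<Longrightarrow> (\<And>x. cmod (f x) \<le> B)
      \<Longrightarrow> reduced_norm G f \<le> C * B"
    using reduced_norm_compact_bound[OF K(1)] by metis
  obtain B where B: "B > 0" "\<And>x. cmod (f x) \<le> B" using compactly_supported_bounded[OF f] by metis
  have "bounded (c ` K)"
    using K(1) c by (intro compact_imp_bounded compact_continuous_image) (auto simp: cont_hom_def intro: continuous_on_subset)
  then obtain M where M: "M > 0" "\<And>x. x \<in> K \<Longrightarrow> \<bar>c x\<bar> \<le> M" unfolding bounded_pos by auto
  have "(C * (M * B))-lipschitz_on UNIV (\<lambda>t. \<iota> (twist c t f))"
  proof (rule lipschitz_onI)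
    show "0 \<le> C * (M * B)" using C M B by simp
    fix s t
    have cs: "compactly_supported (\<lambda>g. twist c s f g - twist c t f g)"
      by (intro compactly_supported_diff twist_compactly_supported c f)
    have "dist (\<iota> (twist c s f)) (\<iota> (twist c t f)) = norm (\<iota> (\<lambda>g. twist c s f g - twist c t f g))"
      by (simp add: dist_norm iota_diff twist_compactly_supported c f)
    also have "\<dots> = reduced_norm G (\<lambda>g. twist c s f g - twist c t f g)" by (rule iota_norm[OF cs])
    also have "\<dots> \<le> C * (\<bar>s - t\<bar> * M * B)"
    proof (rule C(2)[OF cs])
      show "twist c s f x - twist c t f x = 0" if "x \<notin> K" for x using K(2)[OF that] by (simp add: twist_def)
      show "cmod (twist c s f x - twist c t f x) \<le> \<bar>s - t\<bar> * M * B" for x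
      proof (cases "x \<in> K")
        case True
        have "twist c s f x - twist c t f x = (exp (\<i> * of_real (s * c x)) - exp (\<i> * of_real (t * c x))) * f x"
          by (simp add: twist_def left_diff_distrib mult.assoc)
        then have "cmod (twist c s f x - twist c t f x) \<le> \<bar>s * c x - t * c x\<bar> * cmod (f x)"
          using mult_right_mono[OF exp_i_diff_le[of "s * c x" "t * c x"], of "cmod (f x)"] by (simp add: norm_mult)
        also have "\<bar>s * c x - t * c x\<bar> = \<bar>s - t\<bar> * \<bar>c x\<bar>" by (simp add: abs_mult flip: left_diff_distrib)
        also have "\<bar>s - t\<bar> * \<bar>c x\<bar> * cmod (f x) \<le> \<bar>s - t\<bar> * M * B"
          using M(2)[OF True] B M(1) by (intro mult_mono) auto
        finally show ?thesis .
      next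
        case False
        then show ?thesis using K(2) M B by (simp add: twist_def)
      qed
    qed
    finally show "dist (\<iota> (twist c s f)) (\<iota> (twist c t f)) \<le> C * (M * B) * dist s t"
      by (simp add: dist_real_def mult_ac)
  qed
  then show ?thesis by (rule lipschitz_on_continuous_on)
qed

text \<open>Each twist is isometric on the dense image, so it extends, and every algebraic identity
  holds on the whole algebra because it holds on that image and all maps involved are
  continuous.\<close>

lemma gauge_exists:
  assumes c: "cont_hom G c"
  shows "\<exists>\<sigma>. one_parameter_group \<sigma> \<and> (\<forall>t f. compactly_supported f \<longrightarrow> \<sigma> t (\<iota> f) = \<iota> (twist c t f))"
proof -
  have "\<exists>\<Phi>. (\<forall>f. compactly_supported f \<longrightarrow> \<Phi> (\<iota> f) = \<iota> (twist c t f)) \<and> (\<forall>a b. dist (\<Phi> a) (\<Phi> b) \<le> norm (a - b))" for t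
    by (rule dense_extension) (simp add: dist_norm twist_norm_diff c)
  then obtain \<sigma> where \<sigma>: "\<And>t f. compactly_supported f \<Longrightarrow> \<sigma> t (\<iota> f) = \<iota> (twist c t f)"
    "\<And>t a b. dist (\<sigma> t a) (\<sigma> t b) \<le> norm (a - b)" by metis
  have cont: "continuous_on S (\<sigma> t)" for S t by (rule nonexpansive_continuous[OF \<sigma>(2)])
  note comp = continuous_on_compose2[OF cont[of UNIV]]
  note cs = twist_compactly_supported[OF c]
  have add: "\<sigma> t (a + b) = \<sigma> t a + \<sigma> t b" for t a b
  proof (rule dense_eq[where a = a])
    fix f :: "'g \<Rightarrow> complex" assume f: "compactly_supported f"
    show "\<sigma> t (\<iota> f + b) = \<sigma> t (\<iota> f) + \<sigma> t b"
    proof (rule dense_eq[where a = b])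
      fix k :: "'g \<Rightarrow> complex" assume k: "compactly_supported k"
      have "\<sigma> t (\<iota> f + \<iota> k) = \<iota> (twist c t (\<lambda>g. f g + k g))"
        using \<sigma>(1)[OF compactly_supported_add[OF f k]] by (simp add: iota_add f k)
      also have "\<dots> = \<iota> (\<lambda>g. twist c t f g + twist c t k g)" by (simp add: twist_def[abs_def] distrib_left)
      finally show "\<sigma> t (\<iota> f + \<iota> k) = \<sigma> t (\<iota> f) + \<sigma> t (\<iota> k)" by (simp add: iota_add cs f k \<sigma>)
    qed (auto intro!: continuous_intros comp cont)
  qed (auto intro!: continuous_intros comp cont)
  have mult: "\<sigma> t (a * b) = \<sigma> t a * \<sigma> t b" for t a b
  proof (rule dense_eq[where a = a])
    fix f :: "'g \<Rightarrow> complex" assume f: "compactly_supported f"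
    show "\<sigma> t (\<iota> f * b) = \<sigma> t (\<iota> f) * \<sigma> t b"
    proof (rule dense_eq[where a = b])
      fix k :: "'g \<Rightarrow> complex" assume k: "compactly_supported k"
      have "\<sigma> t (\<iota> f * \<iota> k) = \<iota> (twist c t (conv G f k))"
        using \<sigma>(1)[OF conv_compactly_supported[OF f k]] by (simp add: iota_conv f k)
      also have "\<dots> = \<iota> (conv G (twist c t f) (twist c t k))" by (simp add: twist_conv c)
      finally show "\<sigma> t (\<iota> f * \<iota> k) = \<sigma> t (\<iota> f) * \<sigma> t (\<iota> k)" by (simp add: iota_conv cs f k \<sigma>)
    qed (auto intro!: continuous_intros comp cont)
  qed (auto intro!: continuous_intros comp cont)
  have scale: "\<sigma> t (z *\<^sub>C a) = z *\<^sub>C \<sigma> t a" for t z a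
  proof (rule dense_eq[where a = a])
    fix f :: "'g \<Rightarrow> complex" assume f: "compactly_supported f"
    have "\<sigma> t (z *\<^sub>C \<iota> f) = \<iota> (twist c t (\<lambda>g. z * f g))"
      using \<sigma>(1)[OF compactly_supported_scale[OF f]] by (simp add: iota_scale f)
    also have "\<dots> = \<iota> (\<lambda>g. z * twist c t f g)" by (simp add: twist_def[abs_def] mult_ac)
    finally show "\<sigma> t (z *\<^sub>C \<iota> f) = z *\<^sub>C \<sigma> t (\<iota> f)" by (simp add: iota_scale cs f \<sigma>)
  qed (auto intro!: continuous_intros comp cont)
  have st: "\<sigma> t (star a) = star (\<sigma> t a)" for t a
  proof (rule dense_eq[where a = a])
    fix f :: "'g \<Rightarrow> complex" assume f: "compactly_supported f"
    have "\<sigma> t (star (\<iota> f)) = \<iota> (twist c t (adj G f))"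
      using \<sigma>(1)[OF adj_compactly_supported[OF f]] by (simp add: iota_adj f)
    also have "\<dots> = star (\<sigma> t (\<iota> f))" by (simp add: twist_adj[OF c, symmetric] iota_adj cs f \<sigma>)
    finally show "\<sigma> t (star (\<iota> f)) = star (\<sigma> t (\<iota> f))" .
  qed (auto intro!: continuous_intros comp cont)
  have nrm: "norm (\<sigma> t a) = norm a" for t a
    by (rule dense_eq[where a = a]) (auto intro!: continuous_intros comp cont simp: \<sigma> twist_norm c)
  have plus: "\<sigma> (s + t) a = \<sigma> s (\<sigma> t a)" for s t a
    by (rule dense_eq[where a = a]) (auto intro!: comp cont simp: \<sigma> twist_add cs)
  have zero: "\<sigma> 0 a = a" for a
    by (rule dense_eq[where a = a]) (auto intro!: cont simp: \<sigma> twist_zero)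
  have "bij (\<sigma> t)" for t
    by (rule o_bij[of "\<sigma> (- t)"]) (auto simp: fun_eq_iff zero simp flip: plus)
  moreover have "continuous_on UNIV (\<lambda>t. \<sigma> t a)" for a
  proof -
    have "a \<in> closure (\<iota> ` {f. compactly_supported f})" by (simp add: iota_dense)
    then obtain F where F: "\<And>n. F n \<in> \<iota> ` {f. compactly_supported f}" "F \<longlonglongrightarrow> a"
      unfolding closure_sequential by blast
    \<comment> \<open>All automorphisms are nonexpansive, so approximating a approximates its entire
      orbit uniformly in time, and uniform limits of continuous orbits are continuous.\<close>
    have "uniform_limit UNIV (\<lambda>n t. \<sigma> t (F n)) (\<lambda>t. \<sigma> t a) sequentially"
    proof (rule uniform_limitI)
      fix e :: real assume "e > 0"
      then have "\<forall>\<^sub>F n in sequentially. dist (F n) a < e" using F(2) by (simp add: tendsto_iff)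
      then show "\<forall>\<^sub>F n in sequentially. \<forall>t\<in>UNIV. dist (\<sigma> t (F n)) (\<sigma> t a) < e"
        by eventually_elim (use \<sigma>(2) in \<open>auto simp: dist_norm[of _ a] intro: order.strict_trans1\<close>)
    qed
    moreover have "continuous_on UNIV (\<lambda>t. \<sigma> t (F n))" for n
      using F(1)[of n] twist_orbit_continuous[OF c] by (auto simp: \<sigma>)
    ultimately show ?thesis
      by (intro uniform_limit_theorem[where f = "\<lambda>n t. \<sigma> t (F n)"]) auto
  qed
  ultimately have "one_parameter_group \<sigma>"
    unfolding one_parameter_group_def star_automorphism_def
    using add mult scale st nrm plus zero by (auto simp: fun_eq_iff)
  then show ?thesis using \<sigma>(1) by blast
qed

lemma gauge_action:
  assumes c: "cont_hom G c"
  shows "one_parameter_group (gauge_action \<iota> c)"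
    "compactly_supported f \<Longrightarrow> gauge_action \<iota> c t (\<iota> f) = \<iota> (twist c t f)"
proof -
  define P where "P = (\<lambda>\<sigma>. one_parameter_group \<sigma> \<and>
     (\<forall>t. \<forall>f\<in>Cc. \<sigma> t (\<iota> f) = \<iota> (\<lambda>g. exp (\<i> * of_real t * of_real (c g)) * f g)))"
  have cont: "continuous_on UNIV (\<sigma> t)" if "P \<sigma>" for \<sigma> t
  proof (rule nonexpansive_continuous)
    have \<sigma>: "\<sigma> t (a + b) = \<sigma> t a + \<sigma> t b" "norm (\<sigma> t a) = norm a" for a b
      using that by (auto simp: P_def one_parameter_group_def star_automorphism_def)
    have "\<sigma> t (a - b) = \<sigma> t a - \<sigma> t b" for a b
      using \<sigma>(1)[of "a - b" b] by simp
    then show "dist (\<sigma> t a) (\<sigma> t b) \<le> norm (a - b)" for a b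
      using \<sigma>(2)[of "a - b"] by (simp add: dist_norm)
  qed
  obtain \<sigma> where "one_parameter_group \<sigma>" "\<And>t f. compactly_supported f \<Longrightarrow> \<sigma> t (\<iota> f) = \<iota> (twist c t f)"
    using gauge_exists[OF c] by blast
  then have P: "P \<sigma>" unfolding P_def by (simp add: Cc_iff twist_def[abs_def])
  have "\<sigma>' = \<sigma>" if P': "P \<sigma>'" for \<sigma>'
  proof (intro ext)
    fix t a
    show "\<sigma>' t a = \<sigma> t a"
      by (rule dense_eq[where a = a, OF cont[OF P'] cont[OF P]]) (use P P' in \<open>simp add: P_def Cc_iff\<close>)
  qed
  then have "gauge_action \<iota> c = \<sigma>"
    unfolding gauge_action_def P_def[symmetric] using P by (intro the_equality)
  then show "one_parameter_group (gauge_action \<iota> c)"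
    "compactly_supported f \<Longrightarrow> gauge_action \<iota> c t (\<iota> f) = \<iota> (twist c t f)"
    using P by (auto simp: P_def Cc_iff twist_def[abs_def])
qed

lemma gauge_action_unit_supported:
  assumes c: "cont_hom G c" and k: "compactly_supported k" "\<And>g. g \<notin> units G \<Longrightarrow> k g = 0"
  shows "gauge_action \<iota> c t (\<iota> k) = \<iota> k"
proof -
  have "twist c t k g = k g" for g
    using k(2)[of g] cont_hom_units[OF c, of g] by (cases "g \<in> units G") (auto simp: twist_def)
  then have "twist c t k = k" by (rule ext)
  then show ?thesis by (simp add: gauge_action c k)
qed

subsection \<open>The conditional expectation\<close>

lemma cond_exp_exists:
  "\<exists>P. (\<forall>f x. compactly_supported f \<longrightarrow> x \<in> units G \<longrightarrow> P (\<iota> f) x = f x) \<and>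
     (\<forall>a b x. x \<in> units G \<longrightarrow> dist (P a x) (P b x) \<le> norm (a - b)) \<and> (\<forall>a x. x \<notin> units G \<longrightarrow> P a x = 0)"
proof -
  have "\<exists>\<Phi>. (\<forall>f. compactly_supported f \<longrightarrow> \<Phi> (\<iota> f) = f x) \<and> (\<forall>a b. dist (\<Phi> a) (\<Phi> b :: complex) \<le> norm (a - b))" for x
  proof (rule dense_extension)
    fix f k :: "'g \<Rightarrow> complex" assume "compactly_supported f" "compactly_supported k"
    then show "dist (f x) (k x) \<le> norm (\<iota> f - \<iota> k)"
      using cmod_le_norm_iota[OF compactly_supported_diff, of f k x] by (simp add: dist_norm iota_diff)
  qed
  then obtain \<Phi> where "\<And>x f. compactly_supported f \<Longrightarrow> \<Phi> x (\<iota> f) = f x"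
    "\<And>x a b. dist (\<Phi> x a) (\<Phi> x b :: complex) \<le> norm (a - b)" by metis
  then show ?thesis by (intro exI[of _ "\<lambda>a x. if x \<in> units G then \<Phi> x a else 0"]) auto
qed

text \<open>Existence comes from extending the evaluations at units one by one. Uniqueness rests on
  the clause about uniform limits: it makes a candidate continuous at each unit, and values on the
  dense image are prescribed.\<close>

lemma cond_exp:
  "compactly_supported f \<Longrightarrow> x \<in> units G \<Longrightarrow> cond_exp G \<iota> (\<iota> f) x = f x"
  "x \<in> units G \<Longrightarrow> dist (cond_exp G \<iota> a x) (cond_exp G \<iota> b x) \<le> norm (a - b)"
  "cond_exp G \<iota> a \<in> C0_units G"
proof -
  define R where "R = (\<lambda>P. (\<forall>a. P a \<in> C0_units G) \<and>
     (\<forall>a. uniform_limit (units G) P (P a) (at a)) \<and>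
     (\<forall>f\<in>Cc. \<forall>x\<in>units G. P (\<iota> f) x = f x))"
  obtain P where P: "\<And>f x. compactly_supported f \<Longrightarrow> x \<in> units G \<Longrightarrow> P (\<iota> f) x = f x"
    "\<And>a b x. x \<in> units G \<Longrightarrow> dist (P a x) (P b x) \<le> norm (a - b)" "\<And>a x. x \<notin> units G \<Longrightarrow> P a x = 0"
    using cond_exp_exists by metis
  have approx: "\<exists>f. compactly_supported f \<and> (\<forall>x\<in>units G. cmod (P a x - f x) < e)" if e: "e > 0" for a e
  proof -
    have "a \<in> closure (\<iota> ` {f. compactly_supported f})" by (simp add: iota_dense)
    then obtain f where f: "compactly_supported f" "dist (\<iota> f) a < e"
      using e unfolding closure_approachable by blast
    have "cmod (P a x - f x) < e" if "x \<in> units G" for x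
      using P(2)[OF that, of "\<iota> f" a] P(1)[OF f(1) that] f(2) by (simp add: dist_norm norm_minus_commute)
    then show ?thesis using f by blast
  qed
  have C0: "P a \<in> C0_units G" for a
  proof -
    obtain F where F: "\<And>n :: nat. compactly_supported (F n)" "\<And>n x. x \<in> units G \<Longrightarrow> cmod (P a x - F n x) < 1 / Suc n"
      using approx[of "1 / Suc _" a] by (metis of_nat_0_less_iff zero_less_Suc zero_less_divide_1_iff)
    have "uniform_limit (units G) F (P a) sequentially"
    proof (rule uniform_limitI)
      fix e :: real assume "e > 0"
      then obtain N where N: "1 / Suc N < e" using nat_approx_posE by blast
      have "dist (F n x) (P a x) < e" if "n \<ge> N" "x \<in> units G" for n x
      proof -
        have "1 / real (Suc n) \<le> 1 / real (Suc N)" using that by (intro divide_left_mono) auto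
        then show ?thesis using F(2)[OF that(2), of n] N by (simp add: dist_norm norm_minus_commute)
      qed
      then show "\<forall>\<^sub>F n in sequentially. \<forall>x\<in>units G. dist (F n x) (P a x) < e"
        by (auto simp: eventually_sequentially)
    qed
    then have cont: "continuous_on (units G) (P a)"
      by (intro uniform_limit_theorem[where f = F]) (auto intro: always_eventually compactly_supported_continuous F)
    \<comment> \<open>A function f from \<open>Cc\<close> within distance e of P a cannot vanish
      where P a has modulus at least e, so this closed set lies in the compact support of f.\<close>
    have "compact {x \<in> units G. e \<le> cmod (P a x)}" if e: "e > 0" for e
    proof -
      obtain f where f: "compactly_supported f" "\<And>x. x \<in> units G \<Longrightarrow> cmod (P a x - f x) < e"
        using approx[OF e] by metis
      obtain K where K: "compact K" "\<And>x. x \<notin> K \<Longrightarrow> f x = 0" using f compactly_supportedE by metis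
      have "closedin (top_of_set (units G)) (units G \<inter> (\<lambda>x. cmod (P a x)) -` {e..})"
        by (intro continuous_closedin_preimage continuous_on_norm cont) auto
      then have "closed (units G \<inter> (\<lambda>x. cmod (P a x)) -` {e..})"
        using closed_units closedin_closed_trans by blast
      moreover have "{x \<in> units G. e \<le> cmod (P a x)} = K \<inter> (units G \<inter> (\<lambda>x. cmod (P a x)) -` {e..})"
      proof -
        have "x \<in> K" if "x \<in> units G" "e \<le> cmod (P a x)" for x
          using f(2)[OF that(1)] that(2) K(2)[of x] by (cases "x \<in> K") auto
        then show ?thesis by auto
      qed
      ultimately show ?thesis using K(1) by (simp add: compact_Int_closed)
    qed
    then show ?thesis using cont P(3) by (simp add: C0_units_def)
  qed
  have "uniform_limit (units G) P (P a) (at a)" for a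
  proof (rule uniform_limitI)
    fix e :: real assume e: "e > 0"
    have "\<forall>\<^sub>F b in at a. dist b a < e" using e unfolding eventually_at by blast
    then show "\<forall>\<^sub>F b in at a. \<forall>x\<in>units G. dist (P b x) (P a x) < e"
      by eventually_elim (use P(2) in \<open>auto simp: dist_norm[of _ a] intro: order.strict_trans1\<close>)
  qed
  then have R: "R P" unfolding R_def using C0 P(1) by (simp add: Cc_iff)
  have "P' = P" if P': "R P'" for P'
  proof (intro ext)
    fix a x
    show "P' a x = P a x"
    proof (cases "x \<in> units G")
      case True
      have cont: "continuous_on UNIV (\<lambda>b. Q b x)" if "R Q" for Q
      proof -
        have "((\<lambda>b. Q b x) \<longlongrightarrow> Q a x) (at a)" for a
          using that True unfolding R_def by (intro tendsto_uniform_limitI) auto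
        then show ?thesis by (simp add: continuous_on_def)
      qed
      show ?thesis
        by (rule dense_eq[where a = a, OF cont[OF P'] cont[OF R]])
          (use P' R True in \<open>simp add: R_def Cc_iff\<close>)
    next
      case False
      have "P' a \<in> C0_units G" using P' by (simp add: R_def)
      then show ?thesis using False P(3) by (simp add: C0_units_def)
    qed
  qed
  then have "cond_exp G \<iota> = P"
    unfolding cond_exp_def R_def[symmetric] using R by (intro the_equality)
  then show "compactly_supported f \<Longrightarrow> x \<in> units G \<Longrightarrow> cond_exp G \<iota> (\<iota> f) x = f x"
    "x \<in> units G \<Longrightarrow> dist (cond_exp G \<iota> a x) (cond_exp G \<iota> b x) \<le> norm (a - b)"
    "cond_exp G \<iota> a \<in> C0_units G"
    using P C0 by auto
qed

lemma cond_exp_continuous: "x \<in> units G \<Longrightarrow> continuous_on S (\<lambda>a. cond_exp G \<iota> a x)"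
  by (rule nonexpansive_continuous) (rule cond_exp(2))

lemma cond_exp_outside: "x \<notin> units G \<Longrightarrow> cond_exp G \<iota> a x = 0"
  using cond_exp(3)[of a] by (simp add: C0_units_def)

text \<open>At a unit the convolution of adj f with f is a sum of squared moduli; continuity in b
  and density extend the sign to all squares.\<close>

lemma cond_exp_pos:
  assumes "a \<in> pos_cone"
  shows "0 \<le> Re (cond_exp G \<iota> a x)"
proof (cases "x \<in> units G")
  case x: True
  obtain b where b: "a = star b * b" using assms by (auto simp: pos_cone_def)
  have "0 \<le> Re (cond_exp G \<iota> (star b * b) x)"
  proof (rule dense_induct[where a = b])
    have "continuous_on UNIV (\<lambda>b :: 'a. star b * b)" by (intro continuous_intros)
    then show "closed {b. 0 \<le> Re (cond_exp G \<iota> (star b * b) x)}"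
      by (intro closed_Collect_le continuous_intros continuous_on_compose2[OF cond_exp_continuous[OF x, of UNIV]]) auto
    fix f :: "'g \<Rightarrow> complex" assume f: "compactly_supported f"
    have cs: "compactly_supported (conv G (adj G f) f)"
      by (intro conv_compactly_supported adj_compactly_supported f)
    obtain K where K: "compact K" "\<And>x. x \<notin> K \<Longrightarrow> adj G f x = 0"
      using adj_compactly_supported[OF f] compactly_supportedE by metis
    obtain N where fib: "\<And>y. finite {h \<in> K. rng G h = y}" using compact_fibres[OF K(1)] by metis
    have "cond_exp G \<iota> (star (\<iota> f) * \<iota> f) x = conv G (adj G f) f x"
      using cond_exp(1)[OF cs x] by (simp add: iota_conv iota_adj adj_compactly_supported f)
    also have "\<dots> = (\<Sum>h | h \<in> K \<and> rng G h = rng G x. adj G f h * f (ginv G h \<cdot> x))"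
      by (rule conv_eq_sum[OF fib K(2)])
    also have "\<dots> = (\<Sum>h | h \<in> K \<and> rng G h = rng G x. of_real ((cmod (f (ginv G h)))\<^sup>2))"
    proof (rule sum.cong[OF refl])
      fix h assume "h \<in> {h. h \<in> K \<and> rng G h = rng G x}"
      then have "x = src G (ginv G h)" using x by (simp add: unitsD src_inv)
      then have "ginv G h \<cdot> x = ginv G h" by (metis mult_src_id)
      then show "adj G f h * f (ginv G h \<cdot> x) = of_real ((cmod (f (ginv G h)))\<^sup>2)"
        by (simp only: adj_def complex_norm_square mult.commute)
    qed
    finally show "0 \<le> Re (cond_exp G \<iota> (star (\<iota> f) * \<iota> f) x)"
      by (simp add: sum_nonneg)
  qed
  then show ?thesis by (simp add: b)
qed (simp add: cond_exp_outside)

end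

section \<open>Diagonality of invariant KMS weights\<close>

lemma exp_i_neq_1:
  assumes "s \<noteq> 0" "\<bar>s\<bar> \<le> 1"
  shows "exp (\<i> * of_real s) \<noteq> 1"
proof
  assume "exp (\<i> * of_real s) = 1"
  then have "sin (s / 2) = 0" using dist_exp_i_1[of s] by simp
  moreover have "0 < sin (\<bar>s\<bar> / 2)"
    using assms pi_gt3 by (intro sin_gt_zero) auto
  ultimately show False by (auto simp: abs_if split: if_splits)
qed

section \<open>Elements supported on the unit space\<close>

context reduced_algebra
begin

definition unit_supported :: "('g \<Rightarrow> complex) \<Rightarrow> bool" where
  "unit_supported k \<longleftrightarrow> compactly_supported k \<and> (\<forall>g. g \<notin> units G \<longrightarrow> k g = 0)"

lemma unit_supportedD:
  assumes "unit_supported k"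
  shows "compactly_supported k" "g \<notin> units G \<Longrightarrow> k g = 0"
  using assms by (auto simp: unit_supported_def)

lemma unit_supported_mult:
  assumes "unit_supported k" "unit_supported k'"
  shows "unit_supported (\<lambda>g. k g * k' g)" "\<iota> k * \<iota> k' = \<iota> (\<lambda>g. k g * k' g)"
proof -
  have eq: "conv G k k' g = k g * k' g" for g
  proof (cases "g \<in> units G")
    case True
    then show ?thesis using conv_units_left[of k k' g] unit_supportedD(2)[OF assms(1)] by (simp add: unitsD)
  next
    case False
    then show ?thesis
      using conv_units_left[of k k' g] unit_supportedD(2)[OF assms(1)] unit_supportedD(2)[OF assms(2) False] by simp
  qed
  have "compactly_supported (\<lambda>g. k g * k' g)"
    using assms by (intro compactly_supported_mult_cont compactly_supported_continuous) (auto dest: unit_supportedD)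
  then show "unit_supported (\<lambda>g. k g * k' g)" using assms by (auto simp: unit_supported_def)
  have "conv G k k' = (\<lambda>g. k g * k' g)" using eq by (rule ext)
  then show "\<iota> k * \<iota> k' = \<iota> (\<lambda>g. k g * k' g)"
    using iota_conv[OF unit_supportedD(1)[OF assms(1)] unit_supportedD(1)[OF assms(2)]] by simp
qed

lemma unit_supported_commute:
  assumes "unit_supported k" "unit_supported k'"
  shows "\<iota> k * \<iota> k' = \<iota> k' * \<iota> k"
  by (simp add: unit_supported_mult[OF assms] unit_supported_mult[OF assms(2,1)] mult.commute)

lemma unit_supported_star:
  assumes "unit_supported k"
  shows "unit_supported (\<lambda>g. cnj (k g))" "star (\<iota> k) = \<iota> (\<lambda>g. cnj (k g))"
proof -
  show "unit_supported (\<lambda>g. cnj (k g))"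
    using assms compactly_supported_compose[of k cnj] by (auto simp: unit_supported_def intro: continuous_intros)
  have "adj G k g = cnj (k g)" for g
  proof (cases "g \<in> units G")
    case False
    then have "ginv G g \<notin> units G" using units_inv[of "ginv G g"] by auto
    then show ?thesis using assms False by (simp add: adj_def unit_supportedD)
  qed (simp add: adj_def units_inv)
  then have "adj G k = (\<lambda>g. cnj (k g))" by (rule ext)
  then show "star (\<iota> k) = \<iota> (\<lambda>g. cnj (k g))" using iota_adj[OF unit_supportedD(1)[OF assms]] by simp
qed

text \<open>Starting from functions on the whole groupoid keeps Urysohn functions, exhaustions and
  the Riesz functional on a single type. The extension by zero stays continuous because the unit
  space is clopen.\<close>

definition diag :: "('g \<Rightarrow> real) \<Rightarrow> 'g \<Rightarrow> complex" where
  "diag r g = (if g \<in> units G then of_real (r g) else 0)"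

lemma diag_unit_supported:
  assumes "compactly_supported r"
  shows "unit_supported (diag r)"
proof -
  have "compactly_supported (\<lambda>g. complex_of_real (r g))"
    using compactly_supported_compose[OF assms, of complex_of_real] by (simp add: continuous_intros)
  then have "compactly_supported (\<lambda>g. if g \<in> units G then complex_of_real (r g) else 0)"
    using open_units closed_units by (rule compactly_supported_mult_clopen)
  then show ?thesis by (simp add: unit_supported_def diag_def[abs_def])
qed

lemma diag_selfadjoint: "compactly_supported r \<Longrightarrow> star (\<iota> (diag r)) = \<iota> (diag r)"
  using unit_supported_star(2)[OF diag_unit_supported] by (simp add: diag_def[abs_def] if_distrib cong: if_cong)

lemma diag_mult:
  assumes "compactly_supported r" "compactly_supported r'"
  shows "\<iota> (diag r) * \<iota> (diag r') = \<iota> (diag (\<lambda>g. r g * r' g))"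
proof -
  have "(\<lambda>g. diag r g * diag r' g) = diag (\<lambda>g. r g * r' g)" by (auto simp: diag_def)
  then show ?thesis
    using unit_supported_mult(2)[OF diag_unit_supported[OF assms(1)] diag_unit_supported[OF assms(2)]] by simp
qed

lemma diag_square_root:
  assumes "compactly_supported r" "\<And>g. 0 \<le> r g"
  shows "compactly_supported (\<lambda>g. sqrt (r g))"
    "\<iota> (diag r) = star (\<iota> (diag (\<lambda>g. sqrt (r g)))) * \<iota> (diag (\<lambda>g. sqrt (r g)))"
proof -
  show s: "compactly_supported (\<lambda>g. sqrt (r g))"
    using compactly_supported_compose[OF assms(1), of sqrt] by (simp add: continuous_intros)
  show "\<iota> (diag r) = star (\<iota> (diag (\<lambda>g. sqrt (r g)))) * \<iota> (diag (\<lambda>g. sqrt (r g)))"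
    unfolding diag_selfadjoint[OF s] diag_mult[OF s s] using assms(2) by simp
qed

lemma diag_pos:
  assumes "compactly_supported r" "\<And>g. 0 \<le> r g"
  shows "\<iota> (diag r) \<in> pos_cone"
  using diag_square_root(2)[OF assms] by simp

lemma diag_conj:
  assumes r: "compactly_supported r" and f: "compactly_supported f"
  shows "compactly_supported (\<lambda>g. diag r (rng G g) * f g * diag r (src G g))"
    "\<iota> (diag r) * \<iota> f * \<iota> (diag r) = \<iota> (\<lambda>g. diag r (rng G g) * f g * diag r (src G g))"
proof -
  note u = unit_supportedD[OF diag_unit_supported[OF r]]
  have eq: "conv G (conv G (diag r) f) (diag r) = (\<lambda>g. diag r (rng G g) * f g * diag r (src G g))"
    using conv_units_left[of "diag r" f] conv_units_right[of "diag r"] u(2) by auto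
  have cs: "compactly_supported (conv G (diag r) f)" by (rule conv_compactly_supported[OF u(1) f])
  have "compactly_supported (conv G (conv G (diag r) f) (diag r))" by (rule conv_compactly_supported[OF cs u(1)])
  then show "compactly_supported (\<lambda>g. diag r (rng G g) * f g * diag r (src G g))" by (simp only: eq)
  have "\<iota> (conv G (conv G (diag r) f) (diag r)) = \<iota> (diag r) * \<iota> f * \<iota> (diag r)"
    by (simp add: iota_conv cs u(1) f)
  then show "\<iota> (diag r) * \<iota> f * \<iota> (diag r) = \<iota> (\<lambda>g. diag r (rng G g) * f g * diag r (src G g))"
    by (simp only: eq)
qed

lemma diag_norm_le:
  assumes r: "compactly_supported r" and le: "\<And>g. \<bar>r g\<bar> \<le> 1"
  shows "norm (\<iota> (diag r)) \<le> 1"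
proof -
  note u = unit_supportedD[OF diag_unit_supported[OF r]]
  have "reduced_norm G (diag r) \<le> 1"
  proof (rule reduced_norm_le[OF u(1)])
    fix x \<xi> assume \<xi>: "\<xi> \<in> fin_vec x"
    have "cmod (regular_rep G x (diag r) \<xi> g) \<le> cmod (\<xi> g)" for g
    proof (cases "src G g = x")
      case True
      have "cmod (diag r (rng G g)) * cmod (\<xi> g) \<le> 1 * cmod (\<xi> g)"
        using le by (intro mult_right_mono) (auto simp: diag_def)
      then show ?thesis
        using True conv_units_left[of "diag r" \<xi> g] u(2) by (simp add: regular_rep_conv norm_mult)
    qed (simp add: regular_rep_def)
    then have "(\<Sum>g | \<xi> g \<noteq> 0. (cmod (regular_rep G x (diag r) \<xi> g))\<^sup>2) \<le> sqn \<xi>"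
      unfolding sqn_def by (intro sum_mono power_mono) auto
    moreover have "regular_rep G x (diag r) \<xi> g = 0" if "g \<notin> {g. \<xi> g \<noteq> 0}" for g
      using \<open>\<And>g. cmod (regular_rep G x (diag r) \<xi> g) \<le> cmod (\<xi> g)\<close>[of g] that by simp
    ultimately show "sqn (regular_rep G x (diag r) \<xi>) \<le> 1\<^sup>2 * sqn \<xi>"
      using sqn_eq_sum[OF fin_vecD(1)[OF \<xi>]] by simp
  qed simp
  then show ?thesis by (simp add: iota_norm u(1))
qed

lemma diag_approximate_unit:
  assumes r: "\<And>n :: nat. compactly_supported (r n)" "\<And>n g. 0 \<le> r n g" "\<And>n g. r n g \<le> 1" "\<And>g. incseq (\<lambda>n. r n g)"
    and K: "\<And>K. compact K \<Longrightarrow> K \<subseteq> units G \<Longrightarrow> \<exists>n. \<forall>x\<in>K. r n x = 1"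
  shows "(\<lambda>n. \<iota> (diag (r n)) * a * \<iota> (diag (r n))) \<longlonglongrightarrow> a"
proof (rule LIMSEQ_I)
  fix e :: real assume e: "e > 0"
  have "a \<in> closure (\<iota> ` {f. compactly_supported f})" by (simp add: iota_dense)
  then obtain f where f: "compactly_supported f" "norm (\<iota> f - a) < e / 2"
    unfolding closure_approachable dist_norm using e by (metis (no_types, lifting) half_gt_zero imageE mem_Collect_eq)
  obtain K where K': "compact K" "\<And>x. x \<notin> K \<Longrightarrow> f x = 0" using f(1) compactly_supportedE by metis
  have "compact (rng G ` K \<union> src G ` K)"
    using K'(1) by (intro compact_Un compact_continuous_image continuous_rng continuous_src)
  moreover have "rng G ` K \<union> src G ` K \<subseteq> units G" using rng_units src_units by auto
  ultimately obtain N where N: "\<forall>x\<in>rng G ` K \<union> src G ` K. r N x = 1" using K by blast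
  have "norm (\<iota> (diag (r n)) * a * \<iota> (diag (r n)) - a) < e" if n: "n \<ge> N" for n
  proof -
    define d where "d = \<iota> (diag (r n))"
    have d1: "norm d \<le> 1" unfolding d_def using r by (intro diag_norm_le) (auto simp: abs_le_iff intro: order_trans[of _ 0])
    have one: "r n x = 1" if "x \<in> rng G ` K \<union> src G ` K" for x
    proof (rule antisym)
      show "1 \<le> r n x" using N that incseqD[OF r(4) n, of x] by force
    qed (rule r(3))
    have "diag (r n) (rng G g) * f g * diag (r n) (src G g) = f g" for g
    proof (cases "g \<in> K")
      case True
      then show ?thesis using one rng_units src_units by (simp add: diag_def)
    qed (simp add: K'(2))
    then have "(\<lambda>g. diag (r n) (rng G g) * f g * diag (r n) (src G g)) = f" by (rule ext)
    \<comment> \<open>Once r n equals 1 on all ranges and sources of the support of f, compression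
      leaves f untouched; the contraction bound on d transfers the approximation from f to
      a.\<close>
    then have df: "d * \<iota> f * d = \<iota> f" unfolding d_def diag_conj(2)[OF r(1) f(1)] by simp
    have "d * a * d - a = d * (a - \<iota> f) * d + (\<iota> f - a)" by (simp add: algebra_simps df[unfolded mult.assoc])
    then have "norm (d * a * d - a) \<le> norm (d * (a - \<iota> f) * d) + norm (\<iota> f - a)"
      by (simp only: norm_triangle_ineq)
    also have "norm (d * (a - \<iota> f) * d) \<le> norm d * norm (a - \<iota> f) * norm d"
      by (meson norm_mult_ineq order_trans mult_right_mono norm_ge_zero)
    also have "\<dots> \<le> 1 * norm (a - \<iota> f) * 1" using d1 by (intro mult_mono) auto
    finally show ?thesis using f(2) by (simp add: d_def norm_minus_commute)
  qed
  then show "\<exists>N. \<forall>n\<ge>N. norm (\<iota> (diag (r n)) * a * \<iota> (diag (r n)) - a) < e" by blast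
qed

text \<open>A local unit. Through the factorization of k as k times \<open>diag r\<close>,
  membership in a left ideal passes from \<open>diag r\<close> to k.\<close>

lemma diag_Urysohn:
  assumes "unit_supported k"
  obtains r where "compactly_supported r" "\<And>g. 0 \<le> r g" "\<And>g. r g \<le> 1"
    "\<And>g. k g \<noteq> 0 \<Longrightarrow> r g = 1" "\<iota> k * \<iota> (diag r) = \<iota> k"
proof -
  define K where "K = closure {g. k g \<noteq> 0}"
  have "compact K" using assms by (simp add: K_def unit_supported_def compactly_supported_def)
  then obtain r :: "'g \<Rightarrow> real" where r: "compactly_supported r" "\<And>g. 0 \<le> r g" "\<And>g. r g \<le> 1" "\<And>g. g \<in> K \<Longrightarrow> r g = 1"
    using lc.Urysohn_compact[OF _ open_UNIV subset_UNIV] by metis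
  have r1: "r g = 1" if "k g \<noteq> 0" for g
    using zero_outside_closure_support[of g k] that r(4) by (auto simp: K_def)
  have "k g * diag r g = k g" for g
    using r1[of g] unit_supportedD(2)[OF assms, of g] by (cases "k g = 0") (auto simp: diag_def)
  then have "(\<lambda>g. k g * diag r g) = k" by (rule ext)
  then have "\<iota> k * \<iota> (diag r) = \<iota> k"
    using unit_supported_mult(2)[OF assms diag_unit_supported[OF r(1)]] by simp
  then show thesis using that r r1 by blast
qed

end

section \<open>Finite weight of diagonal elements\<close>

locale groupoid_KMS = reduced_algebra G \<iota>
  for G :: "'g :: {second_countable_topology, t2_space} groupoid" (structure)
    and \<iota> :: "('g \<Rightarrow> complex) \<Rightarrow> 'a :: cstar_algebra" +
  fixes c\<^sub>0 c :: "'g \<Rightarrow> real" and \<beta> :: real and \<psi> :: "'a \<Rightarrow> ennreal"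
  assumes c\<^sub>0: "cont_hom G c\<^sub>0" and c: "cont_hom G c"
    and trivial_isotropy: "\<And>x g. x \<in> units G \<Longrightarrow> rng G g = x \<Longrightarrow> src G g = x \<Longrightarrow> c\<^sub>0 g = 0 \<Longrightarrow> g = x"
    and open_kernel: "open {g. c\<^sub>0 g = 0}"
    and KMS_psi: "KMS_weight (gauge_action \<iota> c) \<beta> \<psi>"
    and invariant: "weight_invariant \<psi> (gauge_action \<iota> c\<^sub>0)"
begin

sublocale kms: cstar_KMS \<psi> "gauge_action \<iota> c" \<beta>
proof
  show "proper_weight \<psi>" using KMS_psi by (simp add: KMS_weight_def)
qed (use pos_cone_add' gauge_action(1)[OF c] KMS_psi in auto)

lemma diag_fixed: "compactly_supported r \<Longrightarrow> gauge_action \<iota> c t (\<iota> (diag r)) = \<iota> (diag r)"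
  using diag_unit_supported[of r] by (intro gauge_action_unit_supported c) (auto dest: unit_supportedD)

text \<open>Density yields p of finite weight within 1/2 of a local unit u for h. The compression h
  p h has finite weight because h is fixed by the action, and it dominates half of h u h = h
  h.\<close>

lemma diag_N_nonneg:
  assumes r: "compactly_supported r" "\<And>g. 0 \<le> r g"
  shows "\<iota> (diag r) \<in> \<N> \<psi>"
proof -
  define h where "h = \<iota> (diag r)"
  have h: "star h = h" "h \<in> pos_cone" "\<And>t. gauge_action \<iota> c t h = h"
    using diag_selfadjoint[OF r(1)] diag_pos[OF r] diag_fixed[OF r(1)] by (auto simp: h_def)
  obtain k where k: "compactly_supported k" "\<And>g. 0 \<le> k g" "h * \<iota> (diag k) = h"
    using diag_Urysohn[OF diag_unit_supported[OF r(1)]] unfolding h_def by metis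
  define u where "u = \<iota> (diag k)"
  have u: "star u = u" "u \<in> pos_cone" using diag_selfadjoint[OF k(1)] diag_pos[OF k(1,2)] by (auto simp: u_def)
  have "u \<in> closure {p \<in> pos_cone. \<psi> p < \<infinity>}"
    using kms.proper u(2) unfolding proper_weight_def by blast
  then obtain p where p: "p \<in> pos_cone" "\<psi> p < \<infinity>" "dist p u < 1/2"
    unfolding closure_approachable by (metis (mono_tags, lifting) half_gt_zero mem_Collect_eq zero_less_one)
  obtain b where b: "p = star b * b" using p(1) by (auto simp: pos_cone_def)
  have "b \<in> \<N> \<psi>" using p(2) b by (simp add: weight_null_def)
  then have "b * h \<in> \<N> \<psi>" using kms.fixed_right_mult_N h by blast
  then have fin: "\<psi> (h * p * h) < \<infinity>" by (simp add: weight_null_def star_mult h(1) b mult.assoc)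
  \<comment> \<open>The factor - 2 matches the distance 1/2: then norm z < 1, and h h - h z h = 2 h
    p h - h h is positive by \<open>pos_cone_diff_conj\<close>.\<close>
  define z where "z = (- 2) *\<^sub>R (p - u)"
  have z: "star z = z" "norm z < 1"
    using p(3) u(1) pos_cone_selfadjoint[OF p(1)] by (auto simp: z_def star_minus star_scaleR star_diff dist_norm)
  have "h * p * h - (1/2) *\<^sub>R (h * h) = (1/2) *\<^sub>R (star h * h - star h * z * h)"
  proof -
    have "h * u * h = h * h" using k(3) by (simp add: u_def)
    then have "h * z * h = (- 2) *\<^sub>R (h * p * h) + 2 *\<^sub>R (h * h)"
      by (simp add: z_def algebra_simps)
    then have "h * h - h * z * h = 2 *\<^sub>R (h * p * h) - h * h"
      by (simp only: scaleR_2 scaleR_minus_left) simp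
    then show ?thesis unfolding h(1) by (simp only: scaleR_diff_right scaleR_scaleR) simp
  qed
  then have "h * p * h - (1/2) *\<^sub>R (h * h) \<in> pos_cone"
    using pos_cone_diff_conj[OF z, of h] by (simp add: pos_cone_scaleR)
  moreover have hh: "h * h \<in> pos_cone" using pos_cone_star_mult[of h] by (simp add: h(1))
  ultimately have "\<psi> ((1/2) *\<^sub>R (h * h)) \<le> \<psi> (h * p * h)"
    by (intro kms.psi_le_add pos_cone_scaleR) auto
  then have "ennreal (1/2) * \<psi> (h * h) < \<infinity>"
    using fin hh by (simp add: kms.psi_scaleR order.strict_trans1)
  then have "\<psi> (h * h) < \<infinity>" by (auto simp: ennreal_mult_less_top)
  then show ?thesis by (simp add: weight_null_def h(1) flip: h_def)
qed

lemma unit_supported_NN: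
  assumes "unit_supported k"
  shows "\<iota> k \<in> kms.NN"
proof -
  have "\<iota> k \<in> \<N> \<psi>" if k: "unit_supported k" for k
  proof -
    obtain r where r: "compactly_supported r" "\<And>g. 0 \<le> r g" "\<iota> k * \<iota> (diag r) = \<iota> k"
      using diag_Urysohn[OF k] by metis
    then show ?thesis using kms.N_left_mult[OF diag_N_nonneg[OF r(1,2)]] by metis
  qed
  then show ?thesis using assms unit_supported_star[OF assms] by (simp add: kms.mem_NN)
qed

lemma unit_supported_dom:
  assumes "unit_supported k"
  shows "\<iota> k \<in> weight_dom \<psi>"
proof -
  obtain r where r: "compactly_supported r" "\<And>g. 0 \<le> r g" "\<iota> k * \<iota> (diag r) = \<iota> k"
    using diag_Urysohn[OF assms] by metis
  have "\<iota> k * \<iota> (diag r) \<in> weight_dom \<psi>"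
    using unit_supported_NN[OF assms] diag_N_nonneg[OF r(1,2)] by (intro kms.dom_mult) (auto simp: kms.mem_NN)
  then show ?thesis by (simp add: r(3))
qed

lemma diag_NN: "compactly_supported r \<Longrightarrow> \<iota> (diag r) \<in> kms.NN"
  by (intro unit_supported_NN diag_unit_supported)

lemma diag_N: "compactly_supported r \<Longrightarrow> \<iota> (diag r) \<in> \<N> \<psi>"
  using diag_NN by (simp add: kms.mem_NN)

lemma diag_Mpos:
  assumes "compactly_supported r" "\<And>g. 0 \<le> r g"
  shows "\<iota> (diag r) \<in> kms.Mpos"
  unfolding diag_square_root(2)[OF assms]
  by (intro kms.Mpos_star_mult diag_N diag_square_root(1) assms)

text \<open>Compressing by an element of finite seminorm brings every element of the algebra into
  the domain of the extended weight, so the functional is total.\<close>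

definition \<omega> :: "('g \<Rightarrow> real) \<Rightarrow> ('g \<Rightarrow> complex) \<Rightarrow> complex" where
  "\<omega> r f = kms.L (\<iota> (diag r) * \<iota> f * \<iota> (diag r))"

section \<open>Vanishing of the compressed functional off the unit space\<close>

lemma diag_conj_dom:
  assumes "compactly_supported r"
  shows "\<iota> (diag r) * x * \<iota> (diag r) \<in> weight_dom \<psi>" "\<iota> (diag r) * x * \<iota> (diag r) \<in> kms.NN"
proof -
  show "\<iota> (diag r) * x * \<iota> (diag r) \<in> weight_dom \<psi>"
    using kms.dom_mult[of "\<iota> (diag r)" "x * \<iota> (diag r)"] assms
    by (simp add: diag_N kms.N_left_mult diag_selfadjoint mult.assoc)
  show "\<iota> (diag r) * x * \<iota> (diag r) \<in> kms.NN"
    using assms by (simp add: kms.mem_NN kms.N_left_mult diag_N star_mult diag_selfadjoint)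
qed

lemma omega_add:
  assumes r: "compactly_supported r" and f: "compactly_supported f" "compactly_supported k"
  shows "\<omega> r (\<lambda>g. f g + k g) = \<omega> r f + \<omega> r k"
  unfolding \<omega>_def using r f
  by (simp add: iota_add distrib_left distrib_right kms.L_add diag_conj_dom)

lemma omega_diff:
  assumes r: "compactly_supported r" and f: "compactly_supported f" "compactly_supported k"
  shows "\<omega> r (\<lambda>g. f g - k g) = \<omega> r f - \<omega> r k"
  unfolding \<omega>_def using r f
  by (simp add: iota_diff left_diff_distrib right_diff_distrib kms.L_diff diag_conj_dom)

lemma omega_zero: "\<omega> r (\<lambda>g. 0) = 0"
  using iota_scale[OF compactly_supported_zero, of 0] by (simp add: \<omega>_def)

lemma omega_sum:
  assumes r: "compactly_supported r" and "finite I" "\<And>i. i \<in> I \<Longrightarrow> compactly_supported (f i)"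
  shows "\<omega> r (\<lambda>g. \<Sum>i\<in>I. f i g) = (\<Sum>i\<in>I. \<omega> r (f i))"
  using assms(2,3) by (induction I) (simp_all add: omega_zero omega_add r compactly_supported_sum)

text \<open>Diagonal elements are fixed by the action, hence central for the weight, and they
  commute with the compressing element. So multiplying f by k at the range or at the source gives
  the same value.\<close>

lemma omega_central:
  assumes r: "compactly_supported r" and k: "compactly_supported k" "\<And>g. 0 \<le> k g"
    and f: "compactly_supported f"
  shows "\<omega> r (\<lambda>g. (diag k (rng G g) - diag k (src G g)) * f g) = 0"
proof -
  note u = unit_supportedD[OF diag_unit_supported[OF k(1)]]
  have cs: "compactly_supported (conv G (diag k) f)" "compactly_supported (conv G f (diag k))"
    using conv_compactly_supported u(1) f by auto
  have "(\<lambda>g. (diag k (rng G g) - diag k (src G g)) * f g) = (\<lambda>g. conv G (diag k) f g - conv G f (diag k) g)"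
    using conv_units_left[of "diag k" f] conv_units_right[of "diag k" f] u(2) by (auto simp: algebra_simps)
  then have "\<omega> r (\<lambda>g. (diag k (rng G g) - diag k (src G g)) * f g) = \<omega> r (conv G (diag k) f) - \<omega> r (conv G f (diag k))"
    using omega_diff[OF r cs] by simp
  also have "\<omega> r (conv G (diag k) f) = kms.L (\<iota> (diag k) * (\<iota> (diag r) * \<iota> f * \<iota> (diag r)))"
    using unit_supported_commute[OF diag_unit_supported[OF r] diag_unit_supported[OF k(1)]]
    by (simp add: \<omega>_def iota_conv u(1) f mult.assoc[symmetric])
  also have "\<dots> = kms.L ((\<iota> (diag r) * \<iota> f * \<iota> (diag r)) * \<iota> (diag k))"
    using kms.fixed_central[OF diag_Mpos[OF k] diag_fixed[OF k(1)] diag_conj_dom(2)[OF r]] by simp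
  also have "\<dots> = \<omega> r (conv G f (diag k))"
    using unit_supported_commute[OF diag_unit_supported[OF r] diag_unit_supported[OF k(1)]]
    by (simp add: \<omega>_def iota_conv u(1) f mult.assoc)
  finally show ?thesis by simp
qed

text \<open>\<open>c\<^sub>0\<close> vanishes on units, so the gauge automorphism fixes the
  compressing element and acts on the middle factor alone.\<close>

lemma omega_twist:
  assumes r: "compactly_supported r" and f: "compactly_supported f"
  shows "\<omega> r (twist c\<^sub>0 t f) = \<omega> r f"
proof -
  define \<Phi> where "\<Phi> = gauge_action \<iota> c\<^sub>0 t"
  have hom: "\<Phi> (a + b) = \<Phi> a + \<Phi> b" "\<Phi> (z *\<^sub>C a) = z *\<^sub>C \<Phi> a" "\<Phi> (a * b) = \<Phi> a * \<Phi> b" "\<Phi> (star a) = star (\<Phi> a)" for a b z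
    using gauge_action(1)[OF c\<^sub>0] by (auto simp: \<Phi>_def one_parameter_group_def star_automorphism_def)
  have pos: "\<Phi> p \<in> pos_cone" if "p \<in> pos_cone" for p using that by (auto simp: pos_cone_def hom)
  have psi: "\<psi> (\<Phi> p) = \<psi> p" if "p \<in> pos_cone" for p
    using invariant that by (simp add: weight_invariant_def \<Phi>_def)
  have fixed: "\<Phi> (\<iota> (diag r)) = \<iota> (diag r)"
    unfolding \<Phi>_def using diag_unit_supported[OF r] by (intro gauge_action_unit_supported c\<^sub>0) (auto dest: unit_supportedD)
  have "\<Phi> (\<iota> (diag r) * \<iota> f * \<iota> (diag r)) = \<iota> (diag r) * \<iota> (twist c\<^sub>0 t f) * \<iota> (diag r)"
    by (simp add: hom fixed) (simp add: \<Phi>_def gauge_action(2) c\<^sub>0 f)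
  then show ?thesis
    unfolding \<omega>_def using kms.L_invariant[of \<Phi>, OF hom(1,2) pos psi diag_conj_dom(1)[OF r]] by metis
qed

text \<open>A function vanishing on the kernel of \<open>c\<^sub>0\<close> is a coboundary \<open>exp (i t c\<^sub>0) k - k\<close>.\<close>

lemma omega_off_kernel:
  assumes r: "compactly_supported r" and f: "compactly_supported f" and f0: "\<And>g. c\<^sub>0 g = 0 \<Longrightarrow> f g = 0"
  shows "\<omega> r f = 0"
proof -
  define K where "K = closure {g. f g \<noteq> 0}"
  have K: "compact K" using f by (simp add: K_def compactly_supported_def)
  have c0_cont: "continuous_on S c\<^sub>0" for S using c\<^sub>0 continuous_on_subset by (auto simp: cont_hom_def)
  \<comment> \<open>Openness of the kernel keeps the closure of the support, and not only the set
    where f is nonzero, away from the zeros of \<open>c\<^sub>0\<close>.\<close>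
  have Kc: "K \<subseteq> {g. c\<^sub>0 g \<noteq> 0}"
    unfolding K_def
  proof (rule closure_minimal)
    have "closed (- {g. c\<^sub>0 g = 0})" using open_kernel by (rule closed_Compl)
    moreover have "- {g. c\<^sub>0 g = 0} = {g. c\<^sub>0 g \<noteq> 0}" by blast
    ultimately show "closed {g. c\<^sub>0 g \<noteq> 0}" by simp
  qed (use f0 in auto)
  have "bounded (c\<^sub>0 ` K)" by (intro compact_imp_bounded compact_continuous_image c0_cont K)
  then obtain M where M: "M > 0" "\<And>g. g \<in> K \<Longrightarrow> \<bar>c\<^sub>0 g\<bar> \<le> M" unfolding bounded_pos by auto
  \<comment> \<open>On V this bounds t times \<open>c\<^sub>0\<close> by 1 in modulus while it stays
    nonzero, so the exponential differs from 1 and division by the difference is continuous near the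
    support.\<close>
  define t where "t = 1 / (M + 1)"
  define V where "V = {g. c\<^sub>0 g \<noteq> 0} \<inter> {g. \<bar>c\<^sub>0 g\<bar> < M + 1}"
  have V: "open V" unfolding V_def by (intro open_Int open_Collect_neq open_Collect_less continuous_intros c0_cont)
  have ne: "exp (\<i> * of_real t * of_real (c\<^sub>0 g)) - 1 \<noteq> 0" if "g \<in> V" for g
  proof -
    have "\<bar>t * c\<^sub>0 g\<bar> \<le> 1" "t * c\<^sub>0 g \<noteq> 0" using that M(1) by (auto simp: V_def t_def abs_mult)
    then show ?thesis using exp_i_neq_1[of "t * c\<^sub>0 g"] by (simp add: mult.assoc)
  qed
  define k where "k = (\<lambda>g. inverse (exp (\<i> * of_real t * of_real (c\<^sub>0 g)) - 1) * f g)"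
  have k: "compactly_supported k"
    unfolding k_def
  proof (rule compactly_supported_mult[OF f V])
    show "continuous_on V (\<lambda>g. inverse (exp (\<i> * of_real t * of_real (c\<^sub>0 g)) - 1))"
      using ne by (intro continuous_intros c0_cont) auto
    show "closure {x. f x \<noteq> 0} \<subseteq> V" using Kc M(2) unfolding K_def[symmetric] V_def by force
  qed
  have "twist c\<^sub>0 t k g - k g = f g" for g
  proof (cases "f g = 0")
    case False
    then have "g \<in> K" using zero_outside_closure_support[of g f] by (auto simp: K_def)
    then have "g \<in> V" using Kc M(2)[of g] unfolding V_def by force
    have "twist c\<^sub>0 t k g - k g = (exp (\<i> * of_real t * of_real (c\<^sub>0 g)) - 1) * k g"
      by (simp add: twist_def left_diff_distrib)
    then show ?thesis using ne[OF \<open>g \<in> V\<close>] by (simp add: k_def)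
  qed (simp add: twist_def k_def)
  then have "f = (\<lambda>g. twist c\<^sub>0 t k g - k g)" by auto
  then have "\<omega> r f = \<omega> r (twist c\<^sub>0 t k) - \<omega> r k"
    using omega_diff[OF r twist_compactly_supported[OF c\<^sub>0 k] k] by metis
  then show ?thesis by (simp add: omega_twist[OF r k])
qed

text \<open>Off the units the kernel of \<open>c\<^sub>0\<close> has no isotropy, so \<open>f\<close> is a finite sum of functions of
  the form \<open>(k \<circ> r - k \<circ> s) f'\<close> with \<open>k\<close> supported in the unit space.\<close>

lemma omega_kernel_off_units:
  assumes r: "compactly_supported r" and f: "compactly_supported f"
    and f0: "\<And>g. c\<^sub>0 g \<noteq> 0 \<Longrightarrow> f g = 0" "\<And>g. g \<in> units G \<Longrightarrow> f g = 0"
  shows "\<omega> r f = 0"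
proof -
  define K where "K = closure {g. f g \<noteq> 0}"
  have K: "compact K" using f by (simp add: K_def compactly_supported_def)
  have "K \<subseteq> {g. c\<^sub>0 g = 0} \<inter> - units G"
    unfolding K_def
  proof (rule closure_minimal)
    have "closed {g. c\<^sub>0 g = 0}"
      using c\<^sub>0 by (intro closed_Collect_eq continuous_on_const) (auto simp: cont_hom_def)
    then show "closed ({g. c\<^sub>0 g = 0} \<inter> - units G)" using open_units by (intro closed_Int closed_Compl) auto
  qed (use f0 in auto)
  then have K': "c\<^sub>0 g = 0" "g \<notin> units G" if "g \<in> K" for g using that by auto
  \<comment> \<open>Equal range and source would place g in an isotropy group inside the kernel, and
    trivial isotropy there would make g a unit.\<close>
  have ne: "rng G g \<noteq> src G g" if "g \<in> K" for g
  proof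
    assume "rng G g = src G g"
    then have "g = rng G g" using trivial_isotropy[OF rng_units[of g]] K'(1)[OF that] by simp
    then show False using K'(2)[OF that] rng_units[of g] by simp
  qed
  have "\<exists>k. compactly_supported k \<and> (\<forall>x. 0 \<le> k x) \<and> k (rng G g) = 1 \<and> k (src G g) = (0 :: real)" if "g \<in> K" for g
  proof -
    have "compact {rng G g}" "open (- {src G g})" "{rng G g} \<subseteq> - {src G g}" using ne[OF that] by auto
    then obtain k :: "'g \<Rightarrow> real" where k: "compactly_supported k" "\<And>x. 0 \<le> k x" "\<And>x. x \<in> {rng G g} \<Longrightarrow> k x = 1"
      "closure {x. k x \<noteq> 0} \<subseteq> - {src G g}"
      using lc.Urysohn_compact by metis
    have "src G g \<notin> closure {x. k x \<noteq> 0}" using k(4) by blast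
    then have "k (src G g) = 0" by (rule zero_outside_closure_support)
    then show ?thesis using k(1,2,3) by blast
  qed
  then obtain k where k: "\<And>g. g \<in> K \<Longrightarrow> compactly_supported (k g)" "\<And>g x. g \<in> K \<Longrightarrow> 0 \<le> k g x"
    "\<And>g. g \<in> K \<Longrightarrow> k g (rng G g) = 1" "\<And>g. g \<in> K \<Longrightarrow> k g (src G g) = (0 :: real)"
    by metis
  define d where "d = (\<lambda>g x. k g (rng G x) - k g (src G x))"
  have d_cont: "continuous_on S (d g)" if "g \<in> K" for g S
    unfolding d_def
    by (intro continuous_on_diff continuous_on_compose2[OF compactly_supported_continuous[OF k(1)[OF that], of UNIV] continuous_rng]
        continuous_on_compose2[OF compactly_supported_continuous[OF k(1)[OF that], of UNIV] continuous_src]) auto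
  have "open {x. d g x \<noteq> 0}" if "g \<in> K" for g
    using d_cont[OF that] by (intro open_Collect_neq continuous_on_const)
  moreover have "K \<subseteq> (\<Union>g\<in>K. {x. d g x \<noteq> 0})"
  proof
    fix g assume "g \<in> K"
    then have "d g g \<noteq> 0" using k(3,4) by (simp add: d_def)
    then show "g \<in> (\<Union>g\<in>K. {x. d g x \<noteq> 0})" using \<open>g \<in> K\<close> by blast
  qed
  ultimately obtain D where D: "D \<subseteq> K" "finite D" "K \<subseteq> (\<Union>g\<in>D. {x. d g x \<noteq> 0})"
    using K by (metis (no_types, lifting) compactE_image)
  \<comment> \<open>A sum of squares, positive on the support: with F g = (d g / S) f the products d
    g * F g add up to f, and each of them is annihilated by centrality.\<close>
  define S where "S = (\<lambda>x. \<Sum>g\<in>D. (d g x)\<^sup>2)"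
  have S_cont: "continuous_on T S" for T
    unfolding S_def using D(1) by (intro continuous_on_sum continuous_on_power d_cont) auto
  have S_pos: "0 < S x" if x: "x \<in> K" for x
  proof -
    obtain g where "g \<in> D" "d g x \<noteq> 0" using D(3) x by blast
    then show ?thesis unfolding S_def using D(2) by (intro sum_pos2[of _ g]) auto
  qed
  define F where "F = (\<lambda>g x. complex_of_real (d g x / S x) * f x)"
  have F: "compactly_supported (F g)" if "g \<in> D" for g
    unfolding F_def
  proof (rule compactly_supported_mult[OF f])
    show "open {x. 0 < S x}" using S_cont by (intro open_Collect_less continuous_on_const)
    show "continuous_on {x. 0 < S x} (\<lambda>x. complex_of_real (d g x / S x))"
      using D(1) that by (intro continuous_on_of_real continuous_on_divide d_cont S_cont) auto
    show "closure {x. f x \<noteq> 0} \<subseteq> {x. 0 < S x}" using S_pos by (auto simp: K_def)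
  qed
  have dF: "\<omega> r (\<lambda>x. complex_of_real (d g x) * F g x) = 0" if "g \<in> D" for g
  proof -
    have g: "g \<in> K" using D(1) that by blast
    have "(\<lambda>x. complex_of_real (d g x) * F g x) = (\<lambda>x. (diag (k g) (rng G x) - diag (k g) (src G x)) * F g x)"
      using rng_units src_units by (auto simp: d_def diag_def)
    then show ?thesis using omega_central[OF r k(1)[OF g] k(2)[OF g] F[OF that]] by simp
  qed
  have dF_cs: "compactly_supported (\<lambda>x. complex_of_real (d g x) * F g x)" if "g \<in> D" for g
    using D(1) that by (intro compactly_supported_mult_cont F continuous_on_of_real d_cont) auto
  have F_sum: "(\<Sum>g\<in>D. complex_of_real (d g x) * F g x) = f x" for x
  proof (cases "f x = 0")
    case False
    then have "x \<in> K" using zero_outside_closure_support[of x f] by (auto simp: K_def)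
    then have S0: "S x \<noteq> 0" using S_pos by force
    have "(\<Sum>g\<in>D. complex_of_real (d g x) * F g x) = complex_of_real (\<Sum>g\<in>D. (d g x)\<^sup>2 / S x) * f x"
      by (simp add: F_def sum_distrib_right power2_eq_square mult.assoc)
    also have "(\<Sum>g\<in>D. (d g x)\<^sup>2 / S x) = 1" using S0 by (simp add: S_def flip: sum_divide_distrib)
    finally show ?thesis by simp
  qed (simp add: F_def)
  have "\<omega> r f = \<omega> r (\<lambda>x. \<Sum>g\<in>D. complex_of_real (d g x) * F g x)" by (simp only: F_sum)
  also have "\<dots> = (\<Sum>g\<in>D. \<omega> r (\<lambda>x. complex_of_real (d g x) * F g x))"
    by (rule omega_sum[OF r D(2) dF_cs])
  finally show ?thesis by (simp add: dF)
qed

text \<open>The kernel and the unit space are clopen, so f splits into compactly supported pieces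
  off the kernel, on the kernel off the units, and on the units. The first two pieces contribute
  nothing; the factor r^2 comes from compression on both sides.\<close>

lemma omega_diagonal:
  assumes r: "compactly_supported r" and f: "compactly_supported f"
  shows "\<omega> r f = kms.L (\<iota> (\<lambda>g. if g \<in> units G then of_real ((r g)\<^sup>2) * f g else 0))"
proof -
  define A B where "A = {g. c\<^sub>0 g = 0}" and "B = units G"
  have A: "open A" "closed A"
    using open_kernel c\<^sub>0 by (auto simp: A_def cont_hom_def intro!: closed_Collect_eq)
  have B: "open B" "closed B" using open_units closed_units by (auto simp: B_def)
  have BA: "B \<subseteq> A" using cont_hom_units[OF c\<^sub>0] by (auto simp: A_def B_def)
  define f1 f2 f3 where "f1 = (\<lambda>g. if g \<in> - A then f g else 0)" and "f2 = (\<lambda>g. if g \<in> A \<inter> - B then f g else 0)"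
    and "f3 = (\<lambda>g. if g \<in> B then f g else 0)"
  have cs: "compactly_supported f1" "compactly_supported f2" "compactly_supported f3"
    unfolding f1_def f2_def f3_def using A B
    by (intro compactly_supported_mult_clopen f open_Int closed_Int open_Compl closed_Compl; simp)+
  have "f = (\<lambda>g. f1 g + (f2 g + f3 g))" using BA by (intro ext) (auto simp: f1_def f2_def f3_def)
  then have "\<omega> r f = \<omega> r f1 + (\<omega> r f2 + \<omega> r f3)"
    using omega_add[OF r cs(1) compactly_supported_add[OF cs(2,3)]] omega_add[OF r cs(2,3)] by metis
  also have "\<omega> r f1 = 0" by (rule omega_off_kernel[OF r cs(1)]) (simp add: f1_def A_def)
  also have "\<omega> r f2 = 0" by (rule omega_kernel_off_units[OF r cs(2)]) (auto simp: f2_def A_def B_def)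
  also have "\<omega> r f3 = kms.L (\<iota> (\<lambda>g. if g \<in> units G then of_real ((r g)\<^sup>2) * f g else 0))"
  proof -
    have "diag r (rng G g) * f3 g * diag r (src G g) = (if g \<in> units G then of_real ((r g)\<^sup>2) * f g else 0)" for g
      by (cases "g \<in> units G") (auto simp: f3_def B_def diag_def unitsD power2_eq_square)
    then have "(\<lambda>g. diag r (rng G g) * f3 g * diag r (src G g)) = (\<lambda>g. if g \<in> units G then of_real ((r g)\<^sup>2) * f g else 0)"
      by (rule ext)
    then show ?thesis unfolding \<omega>_def diag_conj(2)[OF r cs(3)] by simp
  qed
  finally show ?thesis by simp
qed

text \<open>Its argument lives on the whole groupoid although only its values on units matter. The
  Riesz theorem can thus be applied to the ambient type, and the measure is restricted to the unit
  space at the end.\<close>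

definition I :: "('g \<Rightarrow> real) \<Rightarrow> real" where
  "I f = Re (kms.L (\<iota> (diag f)))"

sublocale rep: positive_functional "TYPE('g)" I
proof
  fix f k :: "'g \<Rightarrow> real" and s :: real
  assume f: "compactly_supported f"
  note uf = diag_unit_supported[OF f]
  have "diag (\<lambda>x. s * f x) = (\<lambda>g. of_real s * diag f g)" by (auto simp: diag_def)
  then show "I (\<lambda>x. s * f x) = s * I f"
    using uf by (simp add: I_def iota_scale unit_supportedD kms.L_scaleC unit_supported_dom)
  show "0 \<le> I f" if "\<And>x. 0 \<le> f x"
    using kms.L_Mpos[OF diag_Mpos[OF f that]] by (simp add: I_def)
  assume k: "compactly_supported k"
  have "diag (\<lambda>x. f x + k x) = (\<lambda>g. diag f g + diag k g)" by (auto simp: diag_def)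
  then show "I (\<lambda>x. f x + k x) = I f + I k"
    using uf diag_unit_supported[OF k]
    by (simp add: I_def iota_add unit_supportedD kms.L_add unit_supported_dom)
qed

section \<open>Comparison of the weight with the Riesz integral\<close>

abbreviation P :: "'a \<Rightarrow> 'g \<Rightarrow> real" where
  "P a x \<equiv> Re (cond_exp G \<iota> a x)"

lemma P_continuous: "continuous_on UNIV (P a)"
proof -
  have "continuous_on (units G \<union> - units G) (P a)"
  proof (rule continuous_on_open_Un)
    show "continuous_on (units G) (P a)"
      using cond_exp(3)[of a] by (intro continuous_on_Re) (simp add: C0_units_def)
    show "continuous_on (- units G) (P a)"
      by (subst continuous_on_cong[OF refl, where g = "\<lambda>_. 0"]) (auto simp: cond_exp_outside)
  qed (use open_units closed_units in auto)
  then show ?thesis by (simp add: Compl_partition)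
qed

lemma P_measurable: "P a \<in> borel_measurable rep.riesz"
  using borel_measurable_continuous_onI[OF P_continuous] by (simp add: measurable_cong_sets[OF rep.sets_riesz refl])

lemma P_close: "P a x \<le> P b x + norm (a - b)"
proof (cases "x \<in> units G")
  case True
  have "P a x - P b x \<le> cmod (cond_exp G \<iota> a x - cond_exp G \<iota> b x)"
    using complex_Re_le_cmod[of "cond_exp G \<iota> a x - cond_exp G \<iota> b x"] by simp
  then show ?thesis using cond_exp(2)[OF True, of a b] by (simp add: dist_norm)
qed (simp add: cond_exp_outside)

lemma psi_diag_conj:
  assumes r: "compactly_supported r" and a: "a \<in> pos_cone"
  shows "\<psi> (\<iota> (diag r) * a * \<iota> (diag r)) = ennreal (Re (kms.L (\<iota> (diag r) * a * \<iota> (diag r))))"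
proof -
  obtain b where b: "a = star b * b" using a by (auto simp: pos_cone_def)
  have eq: "\<iota> (diag r) * a * \<iota> (diag r) = star (b * \<iota> (diag r)) * (b * \<iota> (diag r))"
    by (simp add: b star_mult diag_selfadjoint[OF r] mult.assoc)
  have "b * \<iota> (diag r) \<in> \<N> \<psi>" by (intro kms.N_left_mult diag_N r)
  then show ?thesis unfolding eq by (simp add: kms.L_star_mult_self kms.psi_eq_q)
qed

lemma L_diag_conj_close:
  assumes r: "compactly_supported r"
  shows "Re (kms.L (\<iota> (diag r) * a * \<iota> (diag r)))
    \<le> Re (kms.L (\<iota> (diag r) * b * \<iota> (diag r))) + (kms.q (\<iota> (diag r)))\<^sup>2 * norm (a - b)"
proof -
  define h where "h = \<iota> (diag r)"
  have h: "h \<in> \<N> \<psi>" "star h = h" using diag_N[OF r] diag_selfadjoint[OF r] by (auto simp: h_def)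
  have dom: "h * x * h \<in> weight_dom \<psi>" for x using diag_conj_dom[OF r] by (simp add: h_def)
  have "Re (kms.L (h * a * h)) - Re (kms.L (h * b * h)) = Re (kms.L (h * (a - b) * h))"
    by (simp add: left_diff_distrib right_diff_distrib kms.L_diff dom)
  also have "\<dots> \<le> cmod (kms.L (h * ((a - b) * h)))" using complex_Re_le_cmod by (simp add: mult.assoc)
  also have "\<dots> \<le> kms.q (star h) * kms.q ((a - b) * h)"
    by (rule kms.L_mult_bound) (auto simp: h kms.N_left_mult)
  also have "\<dots> \<le> kms.q h * (norm (a - b) * kms.q h)"
    using h by (intro mult_mono kms.q_left_mult) auto
  finally show ?thesis by (simp add: h_def power2_eq_square mult_ac)
qed

lemma psi_diag_conj_iota:
  assumes r: "compactly_supported r" and f: "compactly_supported f" and pos: "\<iota> f \<in> pos_cone"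
  shows "\<psi> (\<iota> (diag r) * \<iota> f * \<iota> (diag r)) = (\<integral>\<^sup>+ x. ennreal ((r x)\<^sup>2 * P (\<iota> f) x) \<partial>rep.riesz)"
proof -
  have Pf: "P (\<iota> f) x = (if x \<in> units G then Re (f x) else 0)" for x
    by (simp add: cond_exp(1) f cond_exp_outside)
  define k where "k = (\<lambda>x. (r x)\<^sup>2 * P (\<iota> f) x)"
  have "compactly_supported (\<lambda>x. (r x * P (\<iota> f) x) * r x)"
    using r by (intro compactly_supported_mult_cont continuous_on_mult P_continuous compactly_supported_continuous)
  then have k_cs: "compactly_supported k" by (simp add: k_def power2_eq_square mult_ac)
  have k: "k \<in> rep.Cp"
    using k_cs cond_exp_pos[OF pos] by (simp add: rep.Cp_def k_def)
  define h where "h = (\<lambda>g. if g \<in> units G then of_real ((r g)\<^sup>2) * f g else 0)"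
  have h_cs: "unit_supported h"
  proof -
    have "compactly_supported (\<lambda>g. complex_of_real ((r g)\<^sup>2) * f g)"
      using r by (intro compactly_supported_mult_cont f continuous_on_of_real continuous_on_power compactly_supported_continuous)
    from compactly_supported_mult_clopen[OF this open_units closed_units]
    show ?thesis by (simp add: h_def unit_supported_def)
  qed
  have "Re (kms.L (\<iota> h)) = I k"
  proof -
    have cnj_h: "unit_supported (\<lambda>g. cnj (h g))" by (rule unit_supported_star(1)[OF h_cs])
    \<comment> \<open>The values of f on units enter the extended weight as complex numbers, while
      the Riesz functional takes real functions; averaging with the conjugate passes to real
      parts.\<close>
    have "diag k = (\<lambda>g. (1/2) * (h g + cnj (h g)))"
      by (rule ext) (auto simp: diag_def k_def Pf h_def complex_eq_iff)
    then have "\<iota> (diag k) = (1/2) *\<^sub>C \<iota> (\<lambda>g. h g + cnj (h g))"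
      using iota_scale[OF compactly_supported_add[OF unit_supportedD(1)[OF h_cs] unit_supportedD(1)[OF cnj_h]], of "1/2"]
      by metis
    then have "\<iota> (diag k) = (1/2) *\<^sub>C (\<iota> h + star (\<iota> h))"
      using iota_add[OF unit_supportedD(1)[OF h_cs] unit_supportedD(1)[OF cnj_h]]
      by (simp add: unit_supported_star(2)[OF h_cs])
    moreover have "star (\<iota> h) \<in> weight_dom \<psi>"
      using unit_supported_dom[OF cnj_h] by (simp add: unit_supported_star(2)[OF h_cs])
    ultimately have "kms.L (\<iota> (diag k)) = (1/2) * (kms.L (\<iota> h) + cnj (kms.L (\<iota> h)))"
      using unit_supported_dom[OF h_cs] by (simp add: kms.L_scaleC kms.L_add kms.dom_add kms.L_star)
    then have "kms.L (\<iota> (diag k)) = of_real (Re (kms.L (\<iota> h)))"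
      by (simp add: complex_add_cnj)
    then show ?thesis by (simp add: I_def)
  qed
  moreover have "kms.L (\<iota> (diag r) * \<iota> f * \<iota> (diag r)) = kms.L (\<iota> h)"
    using omega_diagonal[OF r f] by (simp add: \<omega>_def h_def)
  ultimately have "\<psi> (\<iota> (diag r) * \<iota> f * \<iota> (diag r)) = ennreal (I k)"
    using psi_diag_conj[OF r pos] by simp
  also have "\<dots> = (\<integral>\<^sup>+ x. ennreal (k x) \<partial>rep.riesz)" by (rule rep.riesz_nn_integral[OF k, symmetric])
  finally show ?thesis by (simp add: k_def)
qed

lemma pos_cone_approx:
  assumes "a \<in> pos_cone" "e > 0"
  obtains f where "compactly_supported f" "\<iota> f \<in> pos_cone" "norm (a - \<iota> f) < e"
proof -
  obtain b where b: "a = star b * b" using assms by (auto simp: pos_cone_def)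
  have "b \<in> closure (\<iota> ` {f. compactly_supported f})" by (simp add: iota_dense)
  then obtain F where F: "\<And>n. F n \<in> \<iota> ` {f. compactly_supported f}" "F \<longlonglongrightarrow> b"
    unfolding closure_sequential by blast
  have "(\<lambda>n. star (F n) * F n) \<longlonglongrightarrow> star b * b" by (intro tendsto_intros F)
  then obtain n where n: "norm (star (F n) * F n - star b * b) < e"
    using LIMSEQ_D[OF _ assms(2)] by blast
  obtain k where k: "compactly_supported k" "F n = \<iota> k" using F(1)[of n] by auto
  have "\<iota> (conv G (adj G k) k) = star (F n) * F n"
    using k by (simp add: iota_conv iota_adj adj_compactly_supported)
  then show thesis
    using n k(1) by (intro that[of "conv G (adj G k) k"] conv_compactly_supported adj_compactly_supported)
      (auto simp: b norm_minus_commute)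
qed

text \<open>The weight alone is only lower semicontinuous, but after compression both sides are
  Lipschitz on the positive cone, with constants \<open>C\<close> and \<open>Q\<close>. Agreement on
  positive images of functions from \<open>Cc\<close>, which are dense in the cone, therefore
  suffices.\<close>

lemma psi_diag_conj_integral:
  assumes r: "compactly_supported r" and a: "a \<in> pos_cone"
  shows "\<psi> (\<iota> (diag r) * a * \<iota> (diag r)) = (\<integral>\<^sup>+ x. ennreal ((r x)\<^sup>2 * P a x) \<partial>rep.riesz)"
proof -
  define \<mu> where "\<mu> = rep.riesz"
  define J where "J = (\<lambda>a. \<integral>\<^sup>+ x. ennreal ((r x)\<^sup>2 * P a x) \<partial>\<mu>)"
  define Q where "Q = (kms.q (\<iota> (diag r)))\<^sup>2"
  define \<l> where "\<l> = (\<lambda>a. Re (kms.L (\<iota> (diag r) * a * \<iota> (diag r))))"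
  have r_meas: "r \<in> borel_measurable \<mu>"
    unfolding \<mu>_def using borel_measurable_continuous_onI[OF compactly_supported_continuous[OF r]]
    by (simp add: measurable_cong_sets[OF rep.sets_riesz refl])
  have P_meas: "P b \<in> borel_measurable \<mu>" for b unfolding \<mu>_def by (rule P_measurable)
  have "compactly_supported (\<lambda>x. r x * r x)"
    using r by (intro compactly_supported_mult_cont compactly_supported_continuous)
  then have r2: "(\<lambda>x. (r x)\<^sup>2) \<in> rep.Cp" by (simp add: rep.Cp_def power2_eq_square)
  define C where "C = I (\<lambda>x. (r x)\<^sup>2)"
  have C: "(\<integral>\<^sup>+ x. ennreal ((r x)\<^sup>2) \<partial>\<mu>) = ennreal C" "0 \<le> C"
    unfolding C_def \<mu>_def by (rule rep.riesz_nn_integral[OF r2], rule rep.I_Cp_nonneg[OF r2])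
  have J_close: "J b \<le> J b' + ennreal (norm (b - b') * C)" if "b \<in> pos_cone" "b' \<in> pos_cone" for b b'
  proof -
    have "J b \<le> (\<integral>\<^sup>+ x. ennreal ((r x)\<^sup>2 * P b' x) + ennreal (norm (b - b')) * ennreal ((r x)\<^sup>2) \<partial>\<mu>)"
      unfolding J_def
    proof (rule nn_integral_mono)
      fix x
      have "(r x)\<^sup>2 * P b x \<le> (r x)\<^sup>2 * (P b' x + norm (b - b'))" by (intro mult_left_mono P_close) auto
      then have "ennreal ((r x)\<^sup>2 * P b x) \<le> ennreal ((r x)\<^sup>2 * P b' x + norm (b - b') * (r x)\<^sup>2)"
        by (intro ennreal_leI) (simp add: algebra_simps)
      also have "\<dots> = ennreal ((r x)\<^sup>2 * P b' x) + ennreal (norm (b - b')) * ennreal ((r x)\<^sup>2)"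
        using cond_exp_pos[OF that(2), of x] by (simp add: ennreal_plus ennreal_mult)
      finally show "ennreal ((r x)\<^sup>2 * P b x) \<le> ennreal ((r x)\<^sup>2 * P b' x) + ennreal (norm (b - b')) * ennreal ((r x)\<^sup>2)" .
    qed
    also have "\<dots> = J b' + ennreal (norm (b - b')) * ennreal C"
      unfolding J_def C(1)[symmetric] using r_meas P_meas by (subst nn_integral_add) (auto simp: nn_integral_cmult)
    finally show ?thesis using C(2) by (simp add: ennreal_mult)
  qed
  have l_nonneg: "0 \<le> \<l> b" if "b \<in> pos_cone" for b
  proof -
    have "\<iota> (diag r) * b * \<iota> (diag r) \<in> pos_cone"
      using pos_cone_conj[OF that, of "\<iota> (diag r)"] by (simp add: diag_selfadjoint[OF r])
    moreover have "\<psi> (\<iota> (diag r) * b * \<iota> (diag r)) < \<infinity>" by (simp add: psi_diag_conj[OF r that])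
    ultimately show ?thesis using kms.L_Mpos by (simp add: \<l>_def kms.Mpos_def)
  qed
  have key: "J a \<le> ennreal (\<l> a) + ennreal e \<and> ennreal (\<l> a) \<le> J a + ennreal e" if e: "e > 0" for e
  proof -
    have Q0: "0 \<le> Q" by (simp add: Q_def)
    \<comment> \<open>The summand 1 keeps the divisor positive; the errors of both Lipschitz
      estimates together stay below e.\<close>
    define d where "d = e / (Q + C + 1)"
    have d: "d > 0" "d * (Q + C) \<le> e"
      using e Q0 C(2) by (auto simp: d_def field_simps)
    obtain f where f: "compactly_supported f" "\<iota> f \<in> pos_cone" "norm (a - \<iota> f) < d"
      using pos_cone_approx[OF a d(1)] .
    define n where "n = norm (a - \<iota> f)"
    have n: "0 \<le> n" "norm (\<iota> f - a) = n" by (auto simp: n_def norm_minus_commute)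
    have "n * (Q + C) \<le> d * (Q + C)"
      using f(3) Q0 C(2) by (intro mult_right_mono) (auto simp: n_def)
    then have nQC: "n * Q + n * C \<le> e" using d(2) by (simp add: algebra_simps)
    have Jf: "J (\<iota> f) = ennreal (\<l> (\<iota> f))"
      using psi_diag_conj_iota[OF r f(1,2)] psi_diag_conj[OF r f(2)] by (simp add: J_def \<mu>_def \<l>_def)
    have "J a \<le> ennreal (\<l> (\<iota> f)) + ennreal (n * C)"
      using J_close[OF a f(2)] by (simp add: Jf n_def)
    also have "\<dots> = ennreal (\<l> (\<iota> f) + n * C)"
      using n(1) C(2) l_nonneg[OF f(2)] by simp
    also have "\<dots> \<le> ennreal (\<l> a + e)"
      using L_diag_conj_close[OF r, of "\<iota> f" a] n nQC by (intro ennreal_leI) (simp add: \<l>_def Q_def mult.commute)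
    also have "\<dots> = ennreal (\<l> a) + ennreal e" using l_nonneg[OF a] e by simp
    finally have 1: "J a \<le> ennreal (\<l> a) + ennreal e" .
    have "ennreal (\<l> a) \<le> ennreal (\<l> (\<iota> f) + n * Q)"
      using L_diag_conj_close[OF r, of a "\<iota> f"] by (intro ennreal_leI) (simp add: \<l>_def Q_def n_def mult.commute)
    also have "\<dots> = J (\<iota> f) + ennreal (n * Q)" using n(1) Q0 l_nonneg[OF f(2)] by (simp add: Jf)
    also have "\<dots> \<le> (J a + ennreal (n * C)) + ennreal (n * Q)"
      using J_close[OF f(2) a] by (simp add: n add_right_mono)
    also have "\<dots> = J a + ennreal (n * C + n * Q)" using n(1) Q0 C(2) by (simp add: add.assoc)
    also have "\<dots> \<le> J a + ennreal e" using nQC by (intro add_left_mono ennreal_leI) simp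
    finally show ?thesis using 1 by blast
  qed
  have "J a = ennreal (\<l> a)"
    by (rule antisym; rule ennreal_le_epsilon) (use key in auto)
  then show ?thesis using psi_diag_conj[OF r a] by (simp add: J_def \<mu>_def \<l>_def)
qed

text \<open>The elements h n * a * h n need not increase with n, although the integrals of r^2 * P a
  do. So the upper bound for the weight uses closed sublevel sets, and the lower bound compares each
  compression separately with a.\<close>

theorem psi_eq_integral:
  assumes a: "a \<in> pos_cone"
  shows "\<psi> a = (\<integral>\<^sup>+ x. ennreal (P a x) \<partial>rep.riesz)"
proof -
  obtain r :: "nat \<Rightarrow> 'g \<Rightarrow> real" where r: "\<And>k. compactly_supported (r k)" "\<And>k x. 0 \<le> r k x"
    "\<And>k x. r k x \<le> 1" "\<And>x. incseq (\<lambda>k. r k x)" "\<And>k x. x \<notin> units G \<Longrightarrow> r k x = 0"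
    "\<And>K. compact K \<Longrightarrow> K \<subseteq> units G \<Longrightarrow> \<exists>k. \<forall>x\<in>K. r k x = 1"
    by (rule lc.open_exhaustion[OF open_units]) (rule that, blast+)
  define h where "h = (\<lambda>n. \<iota> (diag (r n)))"
  define J where "J = (\<integral>\<^sup>+ x. ennreal (P a x) \<partial>rep.riesz)"
  have conj: "\<psi> (h n * a * h n) = (\<integral>\<^sup>+ x. ennreal ((r n x)\<^sup>2 * P a x) \<partial>rep.riesz)" for n
    unfolding h_def by (rule psi_diag_conj_integral[OF r(1) a])
  have h_sa: "star (h n) = h n" for n unfolding h_def by (rule diag_selfadjoint[OF r(1)])
  have h_norm: "norm (h n) \<le> 1" for n
    unfolding h_def using r(1,2,3) by (intro diag_norm_le) (auto simp: abs_le_iff intro: order_trans[of _ 0])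
  have lim: "(\<lambda>n. h n * a * h n) \<longlonglongrightarrow> a"
    unfolding h_def by (rule diag_approximate_unit[OF r(1,2,3,4,6)])
  have "\<psi> a \<le> J"
  proof (cases "J = \<infinity>")
    case False
    have "\<psi> (h n * a * h n) \<le> J" for n
      unfolding conj J_def
    proof (intro nn_integral_mono ennreal_leI)
      fix x
      have "(r n x)\<^sup>2 \<le> 1" using r(2,3) by (simp add: power_le_one)
      then show "(r n x)\<^sup>2 * P a x \<le> P a x"
        using cond_exp_pos[OF a, of x] by (simp add: mult_left_le_one_le)
    qed
    moreover have "J = ennreal (enn2real J)" using False by (simp add: less_top)
    moreover have "h n * a * h n \<in> pos_cone" for n using pos_cone_conj[OF a, of "h n"] by (simp add: h_sa)
    ultimately have "h n * a * h n \<in> {a \<in> pos_cone. \<psi> a \<le> ennreal (enn2real J)}" for n by simp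
    then have "a \<in> {a \<in> pos_cone. \<psi> a \<le> ennreal (enn2real J)}"
      by (intro closed_sequentially[OF kms.psi_closed _ lim]) auto
    then show ?thesis using \<open>J = ennreal (enn2real J)\<close> by simp
  qed simp
  moreover have "J \<le> \<psi> a"
  proof -
    \<comment> \<open>The supremum is attained, because every unit lies in a compact set on which
      some r n equals 1.\<close>
    have "(SUP n. ennreal ((r n x)\<^sup>2 * P a x)) = ennreal (P a x)" for x
    proof (cases "x \<in> units G")
      case True
      then obtain n where n: "r n x = 1" using r(6)[of "{x}"] by auto
      show ?thesis
      proof (rule antisym)
        show "(SUP n. ennreal ((r n x)\<^sup>2 * P a x)) \<le> ennreal (P a x)"
        proof (rule SUP_least, rule ennreal_leI)
          fix m
          have "(r m x)\<^sup>2 \<le> 1" using r(2,3) by (simp add: power_le_one)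
          then show "(r m x)\<^sup>2 * P a x \<le> P a x"
            using cond_exp_pos[OF a, of x] by (simp add: mult_left_le_one_le)
        qed
        show "ennreal (P a x) \<le> (SUP n. ennreal ((r n x)\<^sup>2 * P a x))"
          using n by (intro SUP_upper2[of n]) auto
      qed
    qed (simp add: cond_exp_outside)
    then have "J = (\<integral>\<^sup>+ x. (SUP n. ennreal ((r n x)\<^sup>2 * P a x)) \<partial>rep.riesz)" by (simp add: J_def)
    also have "\<dots> = (SUP n. \<integral>\<^sup>+ x. ennreal ((r n x)\<^sup>2 * P a x) \<partial>rep.riesz)"
    proof (rule nn_integral_monotone_convergence_SUP)
      show "incseq (\<lambda>n x. ennreal ((r n x)\<^sup>2 * P a x))"
        using incseqD[OF r(4)] r(2) cond_exp_pos[OF a]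
        by (intro incseq_SucI le_funI ennreal_leI mult_right_mono power_mono) auto
      fix n
      have "r n \<in> borel_measurable rep.riesz"
        using borel_measurable_continuous_onI[OF compactly_supported_continuous[OF r(1)]]
        by (simp add: measurable_cong_sets[OF rep.sets_riesz refl])
      then show "(\<lambda>x. ennreal ((r n x)\<^sup>2 * P a x)) \<in> borel_measurable rep.riesz"
        using P_measurable[of a] by measurable
    qed
    also have "\<dots> \<le> \<psi> a"
    proof (rule SUP_least)
      fix n
      show "(\<integral>\<^sup>+ x. ennreal ((r n x)\<^sup>2 * P a x) \<partial>rep.riesz) \<le> \<psi> a"
      proof (cases "\<psi> a < \<infinity>")
        case True
        obtain b where b: "a = star b * b" using a by (auto simp: pos_cone_def)
        then have bN: "b \<in> \<N> \<psi>" using True by (simp add: weight_null_def)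
        have "h n \<in> kms.Mpos" "\<And>t. gauge_action \<iota> c t (h n) = h n"
          unfolding h_def using diag_Mpos[OF r(1,2)] diag_fixed[OF r(1)] by auto
        \<comment> \<open>Right multiplication by the fixed contraction h n does not increase the
          seminorm; squared, this says that compressing a does not increase its weight.\<close>
        then have "kms.q (b * h n) \<le> norm (h n) * kms.q b" by (rule kms.fixed_right_mult_le[OF _ _ bN])
        also have "\<dots> \<le> kms.q b" using h_norm[of n] by (simp add: mult_left_le_one_le)
        finally have "ennreal ((kms.q (b * h n))\<^sup>2) \<le> ennreal ((kms.q b)\<^sup>2)"
          by (intro ennreal_leI power_mono) auto
        moreover have "b * h n \<in> \<N> \<psi>" unfolding h_def by (intro kms.N_left_mult diag_N r(1))
        ultimately have "\<psi> (star (b * h n) * (b * h n)) \<le> \<psi> (star b * b)"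
          using bN by (simp add: kms.psi_eq_q)
        moreover have "star (b * h n) * (b * h n) = h n * a * h n" by (simp add: b star_mult h_sa mult.assoc)
        ultimately have "\<psi> (h n * a * h n) \<le> \<psi> a" by (simp only: b)
        then show ?thesis by (simp only: conj)
      next
        case False
        then have "\<psi> a = top" by (simp add: less_top[symmetric])
        then show ?thesis by simp
      qed
    qed
    finally show ?thesis .
  qed
  ultimately show ?thesis by (simp add: J_def antisym)
qed

lemma regular_measure_exists:
  "\<exists>m. regular_borel_measure G m \<and> (\<forall>a\<in>pos_cone. \<psi> a = measure_weight G \<iota> m a)"
proof -
  define m where "m = restrict_space rep.riesz (units G)"
  have ub: "units G \<in> sets borel" using open_units by (rule borel_open)
  have m_sets: "sets m = sets (restrict_space borel (units G))"
    unfolding m_def by (rule sets_restrict_space_cong) simp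
  have m_iff: "B \<in> sets m \<longleftrightarrow> B \<in> sets borel \<and> B \<subseteq> units G" for B
    unfolding m_sets using ub by (subst sets_restrict_space_iff) auto
  have m_eq: "emeasure m B = emeasure rep.riesz B" if "B \<subseteq> units G" for B
    unfolding m_def using ub that by (intro emeasure_restrict_space) auto
  have integral: "measure_weight G \<iota> m a = (\<integral>\<^sup>+ x. ennreal (P a x) \<partial>rep.riesz)" for a
    unfolding measure_weight_def m_def using ub
    by (subst nn_integral_restrict_space)
      (auto intro!: nn_integral_cong simp: indicator_def cond_exp_outside)
  have weight_eq: "\<psi> a = measure_weight G \<iota> m a" if "a \<in> pos_cone" for a
    unfolding integral by (rule psi_eq_integral[OF that])
  have "regular_borel_measure G m"
    unfolding regular_borel_measure_def
  proof (intro conjI ballI allI impI)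
    show "sets m = sets (restrict_space borel (units G))" by (rule m_sets)
    \<comment> \<open>A vanishing measure would make every integral, and hence the weight, zero on
      the positive cone, against properness.\<close>
    show "emeasure m (units G) \<noteq> 0"
    proof
      assume "emeasure m (units G) = 0"
      then have "units G \<in> null_sets m" by (auto simp: null_sets_def m_iff ub)
      moreover have "space m = units G" by (simp add: m_def space_restrict_space)
      ultimately have "AE x in m. ennreal (P a x) = 0" for a by (intro AE_I'[of "units G"]) auto
      then have "measure_weight G \<iota> m a = (\<integral>\<^sup>+ x. 0 \<partial>m)" for a
        unfolding measure_weight_def by (rule nn_integral_cong_AE)
      then have "measure_weight G \<iota> m a = 0" for a by simp
      then show False using kms.proper weight_eq unfolding proper_weight_def by metis
    qed
    show "emeasure m K < \<infinity>" if "K \<subseteq> units G \<and> compact K" for K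
      using that rep.riesz_compact_finite[of K] by (simp add: m_eq)
    fix B assume B: "B \<in> sets m"
    have Bb: "B \<in> sets borel" "B \<subseteq> units G" using B m_iff by auto
    have op: "openin (top_of_set (units G)) U \<longleftrightarrow> open U \<and> U \<subseteq> units G" for U
      using open_units by (rule openin_open_eq)
    show "emeasure m B = (INF U\<in>{U. openin (top_of_set (units G)) U \<and> B \<subseteq> U}. emeasure m U)"
    proof (rule antisym)
      show "emeasure m B \<le> (INF U\<in>{U. openin (top_of_set (units G)) U \<and> B \<subseteq> U}. emeasure m U)"
        using m_iff op by (intro INF_greatest emeasure_mono) auto
      \<comment> \<open>The unit space is open, so intersecting an open V with it gives an
        admissible relatively open set of no larger measure.\<close>
      have "(INF U\<in>{U. openin (top_of_set (units G)) U \<and> B \<subseteq> U}. emeasure m U) \<le> emeasure rep.riesz V"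
        if V: "open V" "B \<subseteq> V" for V
      proof (rule INF_lower2[of "V \<inter> units G"])
        show "V \<inter> units G \<in> {U. openin (top_of_set (units G)) U \<and> B \<subseteq> U}"
          using V Bb open_units by (auto simp: op)
        show "emeasure m (V \<inter> units G) \<le> emeasure rep.riesz V"
          using V by (subst m_eq) (auto intro!: emeasure_mono)
      qed
      then show "(INF U\<in>{U. openin (top_of_set (units G)) U \<and> B \<subseteq> U}. emeasure m U) \<le> emeasure m B"
        unfolding m_eq[OF Bb(2)] rep.riesz_outer_regular[OF Bb(1)] by (intro INF_greatest) auto
    qed
    show "emeasure m B = (SUP K\<in>{K. compact K \<and> K \<subseteq> B}. emeasure m K)"
      unfolding m_eq[OF Bb(2)] rep.riesz_inner_regular[OF Bb(1)]
      using Bb(2) by (intro SUP_cong refl m_eq[symmetric]) auto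
  qed
  then show ?thesis using weight_eq by blast
qed

end

theorem theorem2p2:
  fixes G :: "'g :: {second_countable_topology, t2_space} groupoid"
    and \<iota> :: "('g \<Rightarrow> complex) \<Rightarrow> 'a :: cstar_algebra"
    and c\<^sub>0 c :: "'g \<Rightarrow> real"
    and \<beta> :: real
    and \<psi> :: "'a \<Rightarrow> ennreal"
  assumes "etale_groupoid G"
    and "reduced_cstar G \<iota>"
    and "cont_hom G c\<^sub>0"
    and "cont_hom G c"
    and "\<forall>x\<in>units G. {g. rng G g = x \<and> src G g = x} \<inter> {g. c\<^sub>0 g = 0} = {x}"
    and "open {g. c\<^sub>0 g = 0}"
    and "KMS_weight (gauge_action \<iota> c) \<beta> \<psi>"
    and "weight_invariant \<psi> (gauge_action \<iota> c\<^sub>0)"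
  shows "\<exists>m. regular_borel_measure G m \<and> (\<forall>a\<in>pos_cone. \<psi> a = measure_weight G \<iota> m a)"
proof -
  interpret etale_groupoid G by fact
  interpret groupoid_KMS G \<iota> c\<^sub>0 c \<beta> \<psi>
    by unfold_locales (use assms in blast)+
  show ?thesis by (rule regular_measure_exists)
qed

end
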